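(* Let $X$ be a (projective) variety over an algebraically closed field $k$ with a faithful action of a finite group $G$, where $\mathrm{char}(k)\nmid |G|$. Let $Y=X/G$ be the quotient variety and $\pi:X\to Y$ the quotient map. Let $V_0$ (trivial), $V_1,\dots,V_r$ be the irreducible representations of $G$ over $k$ up to isomorphism. Then, as $\mathcal{O}_Y[G]$-modules, $$\pi_*\mathcal{O}_X=\mathcal{O}_Y\oplus(\mathcal{O}(V_1)\otimes\mathcal{E}_{V_1})\oplus\cdots\oplus(\mathcal{O}(V_r)\otimes\mathcal{E}_{V_r}),$$ where the $\mathcal{E}_{V_i}$ are $\mathcal{O}_Y$-modules (with trivial $G$-action) with $\mathrm{rank}\,\mathcal{E}_{V_i}=\dim V_i$.
   Context: A variety is an integral separated scheme of finite type over $k$; all varieties are projective. The $G$-action on $X$ gives $\pi_*\mathcal{O}_X$ the structure of an $\mathcal{O}_Y[G]$-module, i.e. an $\mathcal{O}_Y$-module with an $\mathcal{O}_Y$-linear $G$-action. For a representation $V$ of $G$ over $k$, $\mathcal{O}(V):=\mathcal{O}_Y\otimes_k V$ with the induced $G$-action. Rank means the dimension of the generic stalk over the function field of $Y$. *)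

theory Defs
  imports
    "HOL-Analysis.Abstract_Topology"
    "HOL-Algebra.Ideal"
    "HOL-Algebra.RingHom"
    "HOL-Algebra.Free_Abelian_Groups"
    "HOL-Computational_Algebra.Polynomial"
    "HOL-Library.Poly_Mapping"
    "Jordan_Normal_Form.VS_Connect"
begin

hide_const (open) Multiset.mult Polynomial.smult Modules.module Ring_Hom.ring_hom

section \<open>Presheaves, stalks, sheaves\<close>

text \<open>
  The sections over an open set form a record extending \<^typ>\<open>'m ring\<close>, so that the same
  notions serve for sheaves of rings and for sheaves of modules (a HOL-Algebra module is a ring
  record with a scalar multiplication; its \<^term>\<open>mult\<close> and \<^term>\<open>one\<close> carry no meaning).
  Only open sets matter as arguments of \<open>sec\<close> and \<open>res\<close>; \<open>res F U V\<close> restricts from \<open>U\<close> to \<open>V\<close>.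
\<close>

record ('x, 'm, 'z) sheaf_data =
  base :: "'x topology"
  sec :: "'x set \<Rightarrow> ('m, 'z) ring_scheme"
  res :: "'x set \<Rightarrow> 'x set \<Rightarrow> 'm \<Rightarrow> 'm"

abbreviation points :: "('x, 'm, 'z, 'w) sheaf_data_scheme \<Rightarrow> 'x set" where
  "points F \<equiv> topspace (base F)"

abbreviation sects :: "('x, 'm, 'z, 'w) sheaf_data_scheme \<Rightarrow> 'x set \<Rightarrow> 'm set" where
  "sects F U \<equiv> carrier (sec F U)"

definition is_presheaf :: "('x, 'm, 'z, 'w) sheaf_data_scheme \<Rightarrow> bool" where
  "is_presheaf F \<longleftrightarrow>
     (\<forall>U V. openin (base F) U \<and> openin (base F) V \<and> V \<subseteq> U \<longrightarrow> res F U V \<in> sects F U \<rightarrow> sects F V) \<and>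
     (\<forall>U. openin (base F) U \<longrightarrow> (\<forall>s\<in>sects F U. res F U U s = s)) \<and>
     (\<forall>U V W. openin (base F) U \<and> openin (base F) V \<and> openin (base F) W \<and> W \<subseteq> V \<and> V \<subseteq> U \<longrightarrow>
        (\<forall>s\<in>sects F U. res F V W (res F U V s) = res F U W s))"

definition is_sheaf :: "('x, 'm, 'z, 'w) sheaf_data_scheme \<Rightarrow> bool" where
  "is_sheaf F \<longleftrightarrow> is_presheaf F \<and>
     (\<forall>\<U> s. (\<forall>U\<in>\<U>. openin (base F) U \<and> s U \<in> sects F U) \<and>
        (\<forall>U\<in>\<U>. \<forall>V\<in>\<U>. res F U (U \<inter> V) (s U) = res F V (U \<inter> V) (s V)) \<longrightarrow>
        (\<exists>!t. t \<in> sects F (\<Union>\<U>) \<and> (\<forall>U\<in>\<U>. res F (\<Union>\<U>) U t = s U)))"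

definition germ ::
  "('x, 'm, 'z, 'w) sheaf_data_scheme \<Rightarrow> 'x \<Rightarrow> 'x set \<Rightarrow> 'm \<Rightarrow> ('x set \<times> 'm) set" where
  "germ F x U s = {(V, t). openin (base F) V \<and> x \<in> V \<and> t \<in> sects F V \<and>
     (\<exists>W. openin (base F) W \<and> x \<in> W \<and> W \<subseteq> U \<inter> V \<and> res F U W s = res F V W t)}"

definition stalk :: "('x, 'm, 'z, 'w) sheaf_data_scheme \<Rightarrow> 'x \<Rightarrow> ('x set \<times> 'm) set set" where
  "stalk F x = {germ F x U s | U s. openin (base F) U \<and> x \<in> U \<and> s \<in> sects F U}"

definition stalk_op1 ::
  "('x, 'm, 'z, 'w) sheaf_data_scheme \<Rightarrow> 'x \<Rightarrow> ('x set \<Rightarrow> 'm \<Rightarrow> 'm)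
    \<Rightarrow> ('x set \<times> 'm) set \<Rightarrow> ('x set \<times> 'm) set" where
  "stalk_op1 F x f A = (THE B. \<exists>U s. openin (base F) U \<and> x \<in> U \<and> s \<in> sects F U \<and>
     A = germ F x U s \<and> B = germ F x U (f U s))"

definition stalk_op2 ::
  "('x, 'a, 'z1, 'w1) sheaf_data_scheme \<Rightarrow> ('x, 'm, 'z2, 'w2) sheaf_data_scheme \<Rightarrow> 'x
    \<Rightarrow> ('x set \<Rightarrow> 'a \<Rightarrow> 'm \<Rightarrow> 'm)
    \<Rightarrow> ('x set \<times> 'a) set \<Rightarrow> ('x set \<times> 'm) set \<Rightarrow> ('x set \<times> 'm) set" where
  "stalk_op2 R F x f A B = (THE C. \<exists>U r s. openin (base F) U \<and> x \<in> U \<and>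
     r \<in> sects R U \<and> s \<in> sects F U \<and>
     A = germ R x U r \<and> B = germ F x U s \<and> C = germ F x U (f U r s))"

definition stalk_ring ::
  "('x, 'a, 'z, 'w) sheaf_data_scheme \<Rightarrow> 'x \<Rightarrow> ('x set \<times> 'a) set ring" where
  "stalk_ring F x =
     \<lparr>carrier = stalk F x,
      mult = stalk_op2 F F x (\<lambda>U. mult (sec F U)),
      one = germ F x (points F) (one (sec F (points F))),
      ring.zero = germ F x (points F) (ring.zero (sec F (points F))),
      add = stalk_op2 F F x (\<lambda>U. add (sec F U))\<rparr>"


section \<open>Locally ringed spaces and their morphisms\<close>

type_synonym ('x, 'a) ringed_space = "('x, 'a, unit) sheaf_data"

text \<open>
  A space over \<open>k\<close>: a morphism to \<open>Spec k\<close> is the same thing as a ring homomorphism from \<open>k\<close>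
  to the ring of global sections, here \<open>kmap\<close>.
\<close>
record ('x, 'a, 'k) kspace = "('x, 'a, unit) sheaf_data" +
  kmap :: "'k \<Rightarrow> 'a"

definition sheaf_of_rings :: "('x, 'a, unit, 'w) sheaf_data_scheme \<Rightarrow> bool" where
  "sheaf_of_rings X \<longleftrightarrow> is_sheaf X \<and>
     (\<forall>U. openin (base X) U \<longrightarrow> cring (sec X U)) \<and>
     (\<forall>U V. openin (base X) U \<and> openin (base X) V \<and> V \<subseteq> U \<longrightarrow>
        res X U V \<in> ring_hom (sec X U) (sec X V))"

definition local_ring :: "('a, 'z) ring_scheme \<Rightarrow> bool" where
  "local_ring R \<longleftrightarrow> cring R \<and> (\<exists>!M. maximalideal M R)"

definition locally_ringed_space :: "('x, 'a, unit, 'w) sheaf_data_scheme \<Rightarrow> bool" where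
  "locally_ringed_space X \<longleftrightarrow> sheaf_of_rings X \<and> (\<forall>x\<in>points X. local_ring (stalk_ring X x))"

text \<open>A morphism \<open>X \<rightarrow> Z\<close>; \<open>co f V\<close> is the map from sections over \<open>V\<close> to sections over \<open>f\<^sup>-\<^sup>1 V\<close>.\<close>
record ('x, 'a, 'y, 'b) mor =
  pt :: "'x \<Rightarrow> 'y"
  co :: "'y set \<Rightarrow> 'b \<Rightarrow> 'a"

definition preim ::
  "('x, 'a, 'z, 'w) sheaf_data_scheme \<Rightarrow> ('x, 'a, 'y, 'b) mor \<Rightarrow> 'y set \<Rightarrow> 'x set" where
  "preim X f V = {x \<in> points X. pt f x \<in> V}"

definition stalk_map ::
  "('x, 'a, unit, 'w1) sheaf_data_scheme \<Rightarrow> ('y, 'b, unit, 'w2) sheaf_data_scheme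
    \<Rightarrow> ('x, 'a, 'y, 'b) mor \<Rightarrow> 'x \<Rightarrow> ('y set \<times> 'b) set \<Rightarrow> ('x set \<times> 'a) set" where
  "stalk_map X Z f x A = (THE B. \<exists>V t. openin (base Z) V \<and> pt f x \<in> V \<and> t \<in> sects Z V \<and>
     A = germ Z (pt f x) V t \<and> B = germ X x (preim X f V) (co f V t))"

definition local_hom ::
  "('a, 'z1) ring_scheme \<Rightarrow> ('b, 'z2) ring_scheme \<Rightarrow> ('a \<Rightarrow> 'b) \<Rightarrow> bool" where
  "local_hom R S h \<longleftrightarrow> h \<in> ring_hom R S \<and> (\<forall>a\<in>carrier R. h a \<in> Units S \<longrightarrow> a \<in> Units R)"

definition lrs_mor ::
  "('x, 'a, unit, 'w1) sheaf_data_scheme \<Rightarrow> ('y, 'b, unit, 'w2) sheaf_data_scheme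
    \<Rightarrow> ('x, 'a, 'y, 'b) mor \<Rightarrow> bool" where
  "lrs_mor X Z f \<longleftrightarrow>
     continuous_map (base X) (base Z) (pt f) \<and>
     (\<forall>V. openin (base Z) V \<longrightarrow> co f V \<in> ring_hom (sec Z V) (sec X (preim X f V))) \<and>
     (\<forall>V W. openin (base Z) V \<and> openin (base Z) W \<and> W \<subseteq> V \<longrightarrow>
        (\<forall>t\<in>sects Z V. co f W (res Z V W t) = res X (preim X f V) (preim X f W) (co f V t))) \<and>
     (\<forall>x\<in>points X. local_hom (stalk_ring Z (pt f x)) (stalk_ring X x) (stalk_map X Z f x))"

definition lrs_iso ::
  "('x, 'a, unit, 'w1) sheaf_data_scheme \<Rightarrow> ('y, 'b, unit, 'w2) sheaf_data_scheme
    \<Rightarrow> ('x, 'a, 'y, 'b) mor \<Rightarrow> bool" where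
  "lrs_iso X Z f \<longleftrightarrow> lrs_mor X Z f \<and> homeomorphic_map (base X) (base Z) (pt f) \<and>
     (\<forall>V. openin (base Z) V \<longrightarrow> bij_betw (co f V) (sects Z V) (sects X (preim X f V)))"

definition kmor ::
  "('x, 'a, 'k) kspace \<Rightarrow> ('y, 'b, 'k) kspace \<Rightarrow> ('x, 'a, 'y, 'b) mor \<Rightarrow> bool" where
  "kmor X Z f \<longleftrightarrow> lrs_mor X Z f \<and> (\<forall>c. co f (points Z) (kmap Z c) = kmap X c)"

definition mor_id :: "('x, 'a, 'x, 'a) mor" where
  "mor_id = \<lparr>pt = (\<lambda>x. x), co = (\<lambda>V s. s)\<rparr>"

definition mor_comp ::
  "('y, 'b, 'z, 'w) sheaf_data_scheme \<Rightarrow> ('y, 'b, 'u, 'c) mor \<Rightarrow> ('x, 'a, 'y, 'b) mor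
    \<Rightarrow> ('x, 'a, 'u, 'c) mor" where
  "mor_comp Y f g = \<lparr>pt = pt f \<circ> pt g, co = (\<lambda>V. co g (preim Y f V) \<circ> co f V)\<rparr>"

text \<open>Equality of morphisms, disregarding junk values outside the points and sections.\<close>
definition mor_eq ::
  "('x, 'a, 'z1, 'w1) sheaf_data_scheme \<Rightarrow> ('y, 'b, 'z2, 'w2) sheaf_data_scheme
    \<Rightarrow> ('x, 'a, 'y, 'b) mor \<Rightarrow> ('x, 'a, 'y, 'b) mor \<Rightarrow> bool" where
  "mor_eq X Z f f' \<longleftrightarrow> (\<forall>x\<in>points X. pt f x = pt f' x) \<and>
     (\<forall>V. openin (base Z) V \<longrightarrow> (\<forall>t\<in>sects Z V. co f V t = co f' V t))"

definition open_sub :: "('x, 'a, 'z, 'w) sheaf_data_scheme \<Rightarrow> 'x set \<Rightarrow> ('x, 'a, 'z) sheaf_data" where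
  "open_sub X U = \<lparr>base = subtopology (base X) U, sec = sec X, res = res X\<rparr>"


section \<open>Spec and Proj\<close>

text \<open>The class of the fraction \<open>a/b\<close> in the localization of \<open>R\<close> at the multiplicative set \<open>T\<close>.\<close>
definition loc_frac :: "('a, 'z) ring_scheme \<Rightarrow> 'a set \<Rightarrow> 'a \<Rightarrow> 'a \<Rightarrow> ('a \<times> 'a) set" where
  "loc_frac R T a b = {(c, d). c \<in> carrier R \<and> d \<in> T \<and>
     (\<exists>u\<in>T. u \<otimes>\<^bsub>R\<^esub> (a \<otimes>\<^bsub>R\<^esub> d) = u \<otimes>\<^bsub>R\<^esub> (c \<otimes>\<^bsub>R\<^esub> b))}"

definition frac_add ::
  "('a, 'z) ring_scheme \<Rightarrow> 'a set \<Rightarrow> ('a \<times> 'a) set \<Rightarrow> ('a \<times> 'a) set \<Rightarrow> ('a \<times> 'a) set" where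
  "frac_add R T A B = (THE C. \<exists>(a, b)\<in>A. \<exists>(c, d)\<in>B.
     C = loc_frac R T (a \<otimes>\<^bsub>R\<^esub> d \<oplus>\<^bsub>R\<^esub> c \<otimes>\<^bsub>R\<^esub> b) (b \<otimes>\<^bsub>R\<^esub> d))"

definition frac_mult ::
  "('a, 'z) ring_scheme \<Rightarrow> 'a set \<Rightarrow> ('a \<times> 'a) set \<Rightarrow> ('a \<times> 'a) set \<Rightarrow> ('a \<times> 'a) set" where
  "frac_mult R T A B = (THE C. \<exists>(a, b)\<in>A. \<exists>(c, d)\<in>B.
     C = loc_frac R T (a \<otimes>\<^bsub>R\<^esub> c) (b \<otimes>\<^bsub>R\<^esub> d))"

text \<open>
  Common construction of the structure sheaves of Spec and Proj: \<open>T\<close> is a space of prime ideals,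
  \<open>den P\<close> the multiplicative set to localize at, and \<open>Q\<close> the set of admissible pairs
  (numerator, denominator). Sections over \<open>U\<close> are the functions that assign to each \<open>P \<in> U\<close> an
  admissible fraction at \<open>P\<close> and are locally given by a single fraction.
\<close>
definition frac_sheaf ::
  "('a, 'z) ring_scheme \<Rightarrow> ('a \<times> 'a) set \<Rightarrow> ('a set \<Rightarrow> 'a set) \<Rightarrow> 'a set topology
    \<Rightarrow> ('a set, 'a set \<Rightarrow> ('a \<times> 'a) set) ringed_space" where
  "frac_sheaf R Q den T =
     \<lparr>base = T,
      sec = (\<lambda>U.
        \<lparr>carrier = {s \<in> \<Pi>\<^sub>E P\<in>U. {loc_frac R (den P) a b | a b. (a, b) \<in> Q \<and> b \<in> den P}.
           \<forall>P\<in>U. \<exists>V a b. openin T V \<and> P \<in> V \<and> V \<subseteq> U \<and> (a, b) \<in> Q \<and>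
             (\<forall>P'\<in>V. b \<in> den P' \<and> s P' = loc_frac R (den P') a b)},
         mult = (\<lambda>s t. \<lambda>P\<in>U. frac_mult R (den P) (s P) (t P)),
         one = (\<lambda>P\<in>U. loc_frac R (den P) \<one>\<^bsub>R\<^esub> \<one>\<^bsub>R\<^esub>),
         ring.zero = (\<lambda>P\<in>U. loc_frac R (den P) \<zero>\<^bsub>R\<^esub> \<one>\<^bsub>R\<^esub>),
         add = (\<lambda>s t. \<lambda>P\<in>U. frac_add R (den P) (s P) (t P))\<rparr>),
      res = (\<lambda>U V s. restrict s V)\<rparr>"

text \<open>The closed sets are the loci \<open>{P. S \<subseteq> P}\<close> for subsets \<open>S\<close> of \<open>H\<close>.\<close>
definition zariski :: "'a set set \<Rightarrow> 'a set \<Rightarrow> 'a set topology" where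
  "zariski pts H = topology (\<lambda>U. \<exists>S\<subseteq>H. U = {P \<in> pts. \<not> S \<subseteq> P})"

definition Spec :: "('a, 'z) ring_scheme \<Rightarrow> ('a set, 'a set \<Rightarrow> ('a \<times> 'a) set) ringed_space" where
  "Spec R = frac_sheaf R (carrier R \<times> carrier R) (\<lambda>P. carrier R - P)
     (zariski {P. primeideal P R} (carrier R))"

text \<open>\<open>gr d\<close> is the homogeneous part of degree \<open>d\<close> of the graded ring \<open>S\<close>.\<close>
definition Proj ::
  "('a, 'z) ring_scheme \<Rightarrow> (nat \<Rightarrow> 'a set) \<Rightarrow> ('a set, 'a set \<Rightarrow> ('a \<times> 'a) set) ringed_space" where
  "Proj S gr = frac_sheaf S (\<Union>d. gr d \<times> gr d) (\<lambda>P. (\<Union>d. gr d) - P)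
     (zariski {P. primeideal P S \<and> P = genideal S (P \<inter> (\<Union>d. gr d)) \<and> (\<exists>d>0. \<not> gr d \<subseteq> P)}
       (\<Union>d. gr d))"

text \<open>
  Polynomials in the variables \<open>x\<^sub>0, x\<^sub>1, \<dots>\<close>, a monomial being its finitely supported vector of
  exponents; \<open>k[x\<^sub>0, \<dots>, x\<^sub>n]\<close> consists of those involving only the first \<open>n + 1\<close> variables.
\<close>
type_synonym 'k mpol = "(nat \<Rightarrow>\<^sub>0 nat) \<Rightarrow>\<^sub>0 'k"

definition poly_ring_in :: "nat \<Rightarrow> 'k::field mpol ring" where
  "poly_ring_in n = \<lparr>carrier = {p. \<forall>m\<in>Poly_Mapping.keys p. Poly_Mapping.keys m \<subseteq> {..n}},
     mult = (*), one = 1, ring.zero = 0, add = (+)\<rparr>"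

definition homog_part :: "nat \<Rightarrow> nat \<Rightarrow> 'k::field mpol set" where
  "homog_part n d = {p \<in> carrier (poly_ring_in n).
     \<forall>m\<in>Poly_Mapping.keys p. (\<Sum>i\<le>n. Poly_Mapping.lookup m i) = d}"

definition proj_space ::
  "nat \<Rightarrow> ('k::field mpol set, 'k mpol set \<Rightarrow> ('k mpol \<times> 'k mpol) set, 'k) kspace" where
  "proj_space n = (let Z = Proj (poly_ring_in n) (homog_part n) in
     \<lparr>base = base Z, sec = sec Z, res = res Z,
      kmap = (\<lambda>c. \<lambda>P\<in>topspace (base Z).
        loc_frac (poly_ring_in n) ((\<Union>d. homog_part n d) - P) (Poly_Mapping.single 0 c) 1)\<rparr>)"


section \<open>Projective varieties\<close>

text \<open>
  An affine open set \<open>U\<close> is isomorphic to the spectrum of its own ring of sections, so letting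
  \<open>R\<close> range over rings on the type \<open>'a\<close> of sections is no restriction.
\<close>
definition scheme :: "('x, 'a, unit, 'w) sheaf_data_scheme \<Rightarrow> bool" where
  "scheme X \<longleftrightarrow> locally_ringed_space X \<and>
     (\<forall>x\<in>points X. \<exists>U (R :: 'a ring) f. openin (base X) U \<and> x \<in> U \<and> cring R \<and>
        lrs_iso (open_sub X U) (Spec R) f)"

definition kscheme :: "('x, 'a, 'k::field) kspace \<Rightarrow> bool" where
  "kscheme X \<longleftrightarrow> scheme X \<and> kmap X \<in> ring_hom class_ring (sec X (points X))"

definition integral_scheme :: "('x, 'a, unit, 'w) sheaf_data_scheme \<Rightarrow> bool" where
  "integral_scheme X \<longleftrightarrow> scheme X \<and> points X \<noteq> {} \<and>
     (\<forall>U. openin (base X) U \<and> U \<noteq> {} \<longrightarrow> domain (sec X U))"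

text \<open>The last condition is surjectivity of the map of sheaves from \<open>O\<^sub>Z\<close> to the direct image of \<open>O\<^sub>X\<close>.\<close>
definition closed_immersion ::
  "('x, 'a, unit, 'w1) sheaf_data_scheme \<Rightarrow> ('y, 'b, unit, 'w2) sheaf_data_scheme
    \<Rightarrow> ('x, 'a, 'y, 'b) mor \<Rightarrow> bool" where
  "closed_immersion X Z f \<longleftrightarrow> lrs_mor X Z f \<and>
     embedding_map (base X) (base Z) (pt f) \<and> closedin (base Z) (pt f ` points X) \<and>
     (\<forall>V. openin (base Z) V \<longrightarrow> (\<forall>s\<in>sects X (preim X f V). \<forall>z\<in>V.
        \<exists>W. openin (base Z) W \<and> z \<in> W \<and> W \<subseteq> V \<and>
          (\<exists>t\<in>sects Z W. co f W t = res X (preim X f V) (preim X f W) s)))"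

text \<open>
  A closed subscheme of projective space is automatically separated and of finite type
  over \<open>k\<close>, so that these two conditions need not be listed for a projective variety.
\<close>
definition projective_variety :: "('x, 'a, 'k::field) kspace \<Rightarrow> bool" where
  "projective_variety X \<longleftrightarrow> kscheme X \<and> integral_scheme X \<and>
     (\<exists>n f. kmor X (proj_space n) f \<and> closed_immersion X (proj_space n) f)"


section \<open>Group actions and quotients\<close>

definition scheme_action ::
  "('g, 'h) monoid_scheme \<Rightarrow> ('x, 'a, 'k) kspace \<Rightarrow> ('g \<Rightarrow> ('x, 'a, 'x, 'a) mor) \<Rightarrow> bool" where
  "scheme_action G X \<rho> \<longleftrightarrow> (\<forall>g\<in>carrier G. kmor X X (\<rho> g)) \<and>
     mor_eq X X (\<rho> \<one>\<^bsub>G\<^esub>) mor_id \<and>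
     (\<forall>g\<in>carrier G. \<forall>h\<in>carrier G. mor_eq X X (\<rho> (g \<otimes>\<^bsub>G\<^esub> h)) (mor_comp X (\<rho> g) (\<rho> h)))"

definition faithful_action ::
  "('g, 'h) monoid_scheme \<Rightarrow> ('x, 'a, 'k) kspace \<Rightarrow> ('g \<Rightarrow> ('x, 'a, 'x, 'a) mor) \<Rightarrow> bool" where
  "faithful_action G X \<rho> \<longleftrightarrow> scheme_action G X \<rho> \<and>
     (\<forall>g\<in>carrier G. mor_eq X X (\<rho> g) mor_id \<longrightarrow> g = \<one>\<^bsub>G\<^esub>)"

text \<open>
  \<open>Y = X/G\<close> with quotient map \<open>p\<close>: topologically \<open>Y\<close> is the orbit space, and the structure
  sheaf of \<open>Y\<close> is the sheaf of invariants of the direct image of the structure sheaf of \<open>X\<close>.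
\<close>
definition quotient_by ::
  "('g, 'h) monoid_scheme \<Rightarrow> ('x, 'a, 'k) kspace \<Rightarrow> ('g \<Rightarrow> ('x, 'a, 'x, 'a) mor)
    \<Rightarrow> ('y, 'b, 'k) kspace \<Rightarrow> ('x, 'a, 'y, 'b) mor \<Rightarrow> bool" where
  "quotient_by G X \<rho> Y p \<longleftrightarrow> kmor X Y p \<and>
     (\<forall>g\<in>carrier G. mor_eq X Y (mor_comp X p (\<rho> g)) p) \<and>
     quotient_map (base X) (base Y) (pt p) \<and>
     (\<forall>x\<in>points X. \<forall>x'\<in>points X. pt p x = pt p x' \<longleftrightarrow> (\<exists>g\<in>carrier G. x' = pt (\<rho> g) x)) \<and>
     (\<forall>V. openin (base Y) V \<longrightarrow>
        bij_betw (co p V) (sects Y V)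
          {s \<in> sects X (preim X p V). \<forall>g\<in>carrier G. co (\<rho> g) (preim X p V) s = s})"


section \<open>Modules with a group action over a ringed space\<close>

type_synonym ('x, 'a, 'm) mod_sheaf = "('x, 'm, ('a, 'm, unit) module_ext) sheaf_data"

record ('x, 'a, 'm, 'g) gmod_sheaf = "('x, 'm, ('a, 'm, unit) module_ext) sheaf_data" +
  gact :: "'g \<Rightarrow> 'x set \<Rightarrow> 'm \<Rightarrow> 'm"

definition O_module ::
  "('y, 'b, unit, 'w1) sheaf_data_scheme
    \<Rightarrow> ('y, 'm, ('b, 'm, unit) module_ext, 'w2) sheaf_data_scheme \<Rightarrow> bool" where
  "O_module Y E \<longleftrightarrow> base E = base Y \<and> is_sheaf E \<and>
     (\<forall>U. openin (base Y) U \<longrightarrow> Module.module (sec Y U) (sec E U)) \<and>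
     (\<forall>U V. openin (base Y) U \<and> openin (base Y) V \<and> V \<subseteq> U \<longrightarrow>
        (\<forall>s\<in>sects E U. \<forall>t\<in>sects E U.
           res E U V (s \<oplus>\<^bsub>sec E U\<^esub> t) = res E U V s \<oplus>\<^bsub>sec E V\<^esub> res E U V t) \<and>
        (\<forall>a\<in>sects Y U. \<forall>s\<in>sects E U.
           res E U V (a \<odot>\<^bsub>sec E U\<^esub> s) = res Y U V a \<odot>\<^bsub>sec E V\<^esub> res E U V s))"

definition stalk_module ::
  "('y, 'b, unit, 'w1) sheaf_data_scheme
    \<Rightarrow> ('y, 'm, ('b, 'm, unit) module_ext, 'w2) sheaf_data_scheme \<Rightarrow> 'y
    \<Rightarrow> (('y set \<times> 'b) set, ('y set \<times> 'm) set) Module.module" where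
  "stalk_module Y E x =
     \<lparr>carrier = stalk E x, mult = undefined, one = undefined,
      ring.zero = germ E x (points E) (ring.zero (sec E (points E))),
      add = stalk_op2 E E x (\<lambda>U. add (sec E U)),
      smult = stalk_op2 Y E x (\<lambda>U. smult (sec E U))\<rparr>"

definition gen_point :: "('x, 'a, 'z, 'w) sheaf_data_scheme \<Rightarrow> 'x" where
  "gen_point X = (THE x. x \<in> points X \<and> base X closure_of {x} = points X)"

definition function_field ::
  "('x, 'a, unit, 'w) sheaf_data_scheme \<Rightarrow> ('x set \<times> 'a) set ring" where
  "function_field X = stalk_ring X (gen_point X)"

definition has_rank ::
  "('y, 'b, unit, 'w1) sheaf_data_scheme
    \<Rightarrow> ('y, 'm, ('b, 'm, unit) module_ext, 'w2) sheaf_data_scheme \<Rightarrow> nat \<Rightarrow> bool" where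
  "has_rank Y E d \<longleftrightarrow>
     vectorspace (function_field Y) (stalk_module Y E (gen_point Y)) \<and>
     vectorspace.fin_dim (function_field Y) (stalk_module Y E (gen_point Y)) \<and>
     vectorspace.dim (function_field Y) (stalk_module Y E (gen_point Y)) = d"

definition with_smult ::
  "('m, 'z) ring_scheme \<Rightarrow> ('a \<Rightarrow> 'm \<Rightarrow> 'm) \<Rightarrow> ('a, 'm) Module.module" where
  "with_smult M f = \<lparr>carrier = carrier M, mult = mult M, one = one M, ring.zero = ring.zero M, add = add M,
     smult = f\<rparr>"

definition trivial_gmod ::
  "('y, 'm, ('b, 'm, unit) module_ext, 'w) sheaf_data_scheme \<Rightarrow> ('y, 'b, 'm, 'g) gmod_sheaf" where
  "trivial_gmod E = \<lparr>base = base E, sec = sec E, res = res E, gact = (\<lambda>g U s. s)\<rparr>"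

definition structure_gmod ::
  "('y, 'b, unit, 'w) sheaf_data_scheme \<Rightarrow> ('y, 'b, 'b, 'g) gmod_sheaf" where
  "structure_gmod Y = \<lparr>base = base Y, sec = (\<lambda>U. with_smult (sec Y U) (mult (sec Y U))),
     res = res Y, gact = (\<lambda>g U s. s)\<rparr>"

text \<open>
  The direct image of the structure sheaf of \<open>X\<close> under \<open>p\<close>; the left action of \<open>g\<close> on functions
  is pullback along the inverse of \<open>g\<close>.
\<close>
definition direct_image_gmod ::
  "('g, 'h) monoid_scheme \<Rightarrow> ('x, 'a, 'k) kspace \<Rightarrow> ('g \<Rightarrow> ('x, 'a, 'x, 'a) mor)
    \<Rightarrow> ('y, 'b, 'k) kspace \<Rightarrow> ('x, 'a, 'y, 'b) mor \<Rightarrow> ('y, 'b, 'a, 'g) gmod_sheaf" where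
  "direct_image_gmod G X \<rho> Y p =
     \<lparr>base = base Y,
      sec = (\<lambda>V. with_smult (sec X (preim X p V))
               (\<lambda>b s. co p V b \<otimes>\<^bsub>sec X (preim X p V)\<^esub> s)),
      res = (\<lambda>V W. res X (preim X p V) (preim X p W)),
      gact = (\<lambda>g V. co (\<rho> (m_inv G g)) (preim X p V))\<rparr>"

definition gmod_iso ::
  "('g, 'h) monoid_scheme \<Rightarrow> ('y, 'b, unit, 'w) sheaf_data_scheme
    \<Rightarrow> ('y, 'b, 'm, 'g) gmod_sheaf \<Rightarrow> ('y, 'b, 'n, 'g) gmod_sheaf \<Rightarrow> bool" where
  "gmod_iso G Y M N \<longleftrightarrow> (\<exists>\<phi>.
     (\<forall>U. openin (base Y) U \<longrightarrow>
        \<phi> U \<in> module_hom (sec Y U) (sec M U) (sec N U) \<and> bij_betw (\<phi> U) (sects M U) (sects N U) \<and>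
        (\<forall>g\<in>carrier G. \<forall>s\<in>sects M U. \<phi> U (gact M g U s) = gact N g U (\<phi> U s))) \<and>
     (\<forall>U V. openin (base Y) U \<and> openin (base Y) V \<and> V \<subseteq> U \<longrightarrow>
        (\<forall>s\<in>sects M U. \<phi> V (res M U V s) = res N U V (\<phi> U s))))"

definition gmod_sum2 ::
  "('y, 'b, 'm, 'g) gmod_sheaf \<Rightarrow> ('y, 'b, 'n, 'g) gmod_sheaf \<Rightarrow> ('y, 'b, 'm \<times> 'n, 'g) gmod_sheaf" where
  "gmod_sum2 M N =
     \<lparr>base = base M,
      sec = (\<lambda>U.
        \<lparr>carrier = sects M U \<times> sects N U, mult = undefined, one = undefined,
         ring.zero = (\<zero>\<^bsub>sec M U\<^esub>, \<zero>\<^bsub>sec N U\<^esub>),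
         add = (\<lambda>(m, n) (m', n'). (m \<oplus>\<^bsub>sec M U\<^esub> m', n \<oplus>\<^bsub>sec N U\<^esub> n')),
         smult = (\<lambda>b (m, n). (b \<odot>\<^bsub>sec M U\<^esub> m, b \<odot>\<^bsub>sec N U\<^esub> n))\<rparr>),
      res = (\<lambda>U V (m, n). (res M U V m, res N U V n)),
      gact = (\<lambda>g U (m, n). (gact M g U m, gact N g U n))\<rparr>"

text \<open>Only for a finite index set \<open>I\<close>.\<close>
definition gmod_sum ::
  "('y, 'b, unit, 'w) sheaf_data_scheme \<Rightarrow> 'i set \<Rightarrow> ('i \<Rightarrow> ('y, 'b, 'm, 'g) gmod_sheaf)
    \<Rightarrow> ('y, 'b, 'i \<Rightarrow> 'm, 'g) gmod_sheaf" where
  "gmod_sum Y I M =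
     \<lparr>base = base Y,
      sec = (\<lambda>U.
        \<lparr>carrier = (\<Pi>\<^sub>E i\<in>I. sects (M i) U), mult = undefined, one = undefined,
         ring.zero = (\<lambda>i\<in>I. \<zero>\<^bsub>sec (M i) U\<^esub>),
         add = (\<lambda>s t. \<lambda>i\<in>I. s i \<oplus>\<^bsub>sec (M i) U\<^esub> t i),
         smult = (\<lambda>b s. \<lambda>i\<in>I. b \<odot>\<^bsub>sec (M i) U\<^esub> s i)\<rparr>),
      res = (\<lambda>U V s. \<lambda>i\<in>I. res (M i) U V (s i)),
      gact = (\<lambda>g U s. \<lambda>i\<in>I. gact (M i) g U (s i))\<rparr>"


section \<open>Tensor products\<close>

text \<open>
  The tensor product of two modules, as a quotient of the free abelian group on pairs; its
  elements are the cosets of the subgroup generated by the bilinearity relations.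
\<close>
definition tensor_rels ::
  "('r, 'z0) ring_scheme \<Rightarrow> ('r, 'm, 'z1) module_scheme \<Rightarrow> ('r, 'n, 'z2) module_scheme
    \<Rightarrow> ('m \<times> 'n \<Rightarrow>\<^sub>0 int) set" where
  "tensor_rels R M N =
     {frag_of (m \<oplus>\<^bsub>M\<^esub> m', n) - frag_of (m, n) - frag_of (m', n) | m m' n.
        m \<in> carrier M \<and> m' \<in> carrier M \<and> n \<in> carrier N} \<union>
     {frag_of (m, n \<oplus>\<^bsub>N\<^esub> n') - frag_of (m, n) - frag_of (m, n') | m n n'.
        m \<in> carrier M \<and> n \<in> carrier N \<and> n' \<in> carrier N} \<union>
     {frag_of (r \<odot>\<^bsub>M\<^esub> m, n) - frag_of (m, r \<odot>\<^bsub>N\<^esub> n) | r m n.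
        r \<in> carrier R \<and> m \<in> carrier M \<and> n \<in> carrier N}"

definition tensor_class ::
  "('r, 'z0) ring_scheme \<Rightarrow> ('r, 'm, 'z1) module_scheme \<Rightarrow> ('r, 'n, 'z2) module_scheme
    \<Rightarrow> ('m \<times> 'n \<Rightarrow>\<^sub>0 int) \<Rightarrow> ('m \<times> 'n \<Rightarrow>\<^sub>0 int) set" where
  "tensor_class R M N f =
     generate (free_Abelian_group (carrier M \<times> carrier N)) (tensor_rels R M N)
       #>\<^bsub>free_Abelian_group (carrier M \<times> carrier N)\<^esub> f"

text \<open>The map \<open>\<alpha> \<otimes> \<beta>\<close> into the tensor product of \<open>M'\<close> and \<open>N'\<close>, computed on representatives.\<close>
definition tensor_map ::
  "('r, 'z0) ring_scheme \<Rightarrow> ('r, 'm2, 'z1) module_scheme \<Rightarrow> ('r, 'n2, 'z2) module_scheme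
    \<Rightarrow> ('m1 \<Rightarrow> 'm2) \<Rightarrow> ('n1 \<Rightarrow> 'n2) \<Rightarrow> ('m1 \<times> 'n1 \<Rightarrow>\<^sub>0 int) set \<Rightarrow> ('m2 \<times> 'n2 \<Rightarrow>\<^sub>0 int) set" where
  "tensor_map R M' N' \<alpha> \<beta> A =
     the_elem ((\<lambda>f. tensor_class R M' N' (frag_extend (\<lambda>(m, n). frag_of (\<alpha> m, \<beta> n)) f)) ` A)"

definition tensor ::
  "('r, 'z0) ring_scheme \<Rightarrow> ('r, 'm, 'z1) module_scheme \<Rightarrow> ('r, 'n, 'z2) module_scheme
    \<Rightarrow> ('r, ('m \<times> 'n \<Rightarrow>\<^sub>0 int) set) Module.module" where
  "tensor R M N =
     \<lparr>carrier = tensor_class R M N ` carrier (free_Abelian_group (carrier M \<times> carrier N)),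
      mult = undefined, one = undefined,
      ring.zero = tensor_class R M N 0,
      add = (\<lambda>A B. the_elem {tensor_class R M N (f + g) | f g. f \<in> A \<and> g \<in> B}),
      smult = (\<lambda>r. tensor_map R M N (\<lambda>m. r \<odot>\<^bsub>M\<^esub> m) (\<lambda>n. n))\<rparr>"

definition gmod_sheafify ::
  "('y, 'b, unit, 'w) sheaf_data_scheme \<Rightarrow> ('y, 'b, 'm, 'g) gmod_sheaf
    \<Rightarrow> ('y, 'b, 'y \<Rightarrow> ('y set \<times> 'm) set, 'g) gmod_sheaf" where
  "gmod_sheafify Y P =
     \<lparr>base = base Y,
      sec = (\<lambda>U.
        \<lparr>carrier = {s \<in> \<Pi>\<^sub>E x\<in>U. stalk P x.
           \<forall>x\<in>U. \<exists>V t. openin (base Y) V \<and> x \<in> V \<and> V \<subseteq> U \<and> t \<in> sects P V \<and>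
             (\<forall>x'\<in>V. s x' = germ P x' V t)},
         mult = undefined, one = undefined,
         ring.zero = (\<lambda>x\<in>U. \<zero>\<^bsub>stalk_module Y P x\<^esub>),
         add = (\<lambda>s t. \<lambda>x\<in>U. s x \<oplus>\<^bsub>stalk_module Y P x\<^esub> t x),
         smult = (\<lambda>b s. \<lambda>x\<in>U. germ Y x U b \<odot>\<^bsub>stalk_module Y P x\<^esub> s x)\<rparr>),
      res = (\<lambda>U V s. restrict s V),
      gact = (\<lambda>g U s. \<lambda>x\<in>U. stalk_op1 P x (gact P g) (s x))\<rparr>"

definition gmod_tensor ::
  "('y, 'b, unit, 'w) sheaf_data_scheme \<Rightarrow> ('y, 'b, 'm, 'g) gmod_sheaf \<Rightarrow> ('y, 'b, 'n, 'g) gmod_sheaf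
    \<Rightarrow> ('y, 'b, 'y \<Rightarrow> ('y set \<times> ('m \<times> 'n \<Rightarrow>\<^sub>0 int) set) set, 'g) gmod_sheaf" where
  "gmod_tensor Y M N = gmod_sheafify Y
     \<lparr>base = base Y,
      sec = (\<lambda>U. tensor (sec Y U) (sec M U) (sec N U)),
      res = (\<lambda>U V. tensor_map (sec Y V) (sec M V) (sec N V) (res M U V) (res N U V)),
      gact = (\<lambda>g U. tensor_map (sec Y U) (sec M U) (sec N U) (gact M g U) (gact N g U))\<rparr>"


section \<open>Representations\<close>

record ('k, 'v, 'g) rep = "('k, 'v) Module.module" +
  rho :: "'g \<Rightarrow> 'v \<Rightarrow> 'v"

definition representation :: "('g, 'h) monoid_scheme \<Rightarrow> ('k::field, 'v, 'g) rep \<Rightarrow> bool" where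
  "representation G V \<longleftrightarrow> vectorspace class_ring V \<and> vectorspace.fin_dim class_ring V \<and>
     (\<forall>g\<in>carrier G. rho V g \<in> module_hom class_ring V V) \<and>
     (\<forall>v\<in>carrier V. rho V \<one>\<^bsub>G\<^esub> v = v) \<and>
     (\<forall>g\<in>carrier G. \<forall>h\<in>carrier G. \<forall>v\<in>carrier V. rho V (g \<otimes>\<^bsub>G\<^esub> h) v = rho V g (rho V h v))"

definition irreducible_rep :: "('g, 'h) monoid_scheme \<Rightarrow> ('k::field, 'v, 'g) rep \<Rightarrow> bool" where
  "irreducible_rep G V \<longleftrightarrow> representation G V \<and> carrier V \<noteq> {\<zero>\<^bsub>V\<^esub>} \<and>
     (\<forall>W. VectorSpace.subspace class_ring W V \<and> (\<forall>g\<in>carrier G. rho V g ` W \<subseteq> W) \<longrightarrow>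
        W = {\<zero>\<^bsub>V\<^esub>} \<or> W = carrier V)"

definition rep_iso ::
  "('g, 'h) monoid_scheme \<Rightarrow> ('k::field, 'v, 'g) rep \<Rightarrow> ('k, 'w, 'g) rep \<Rightarrow> bool" where
  "rep_iso G V W \<longleftrightarrow> (\<exists>T \<in> module_hom class_ring V W. bij_betw T (carrier V) (carrier W) \<and>
     (\<forall>g\<in>carrier G. \<forall>v\<in>carrier V. T (rho V g v) = rho W g (T v)))"

definition trivial_rep :: "('g, 'h) monoid_scheme \<Rightarrow> ('k::field, 'v, 'g) rep \<Rightarrow> bool" where
  "trivial_rep G V \<longleftrightarrow> representation G V \<and> vectorspace.dim class_ring V = 1 \<and>
     (\<forall>g\<in>carrier G. \<forall>v\<in>carrier V. rho V g v = v)"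

text \<open>
  \<open>V 0\<close> is trivial and \<open>V 0, \<dots>, V r\<close> are the irreducible representations up to isomorphism.
  Completeness of the list is tested on representations \<open>W\<close> living on the type \<open>nat \<Rightarrow> 'k\<close>;
  every finite-dimensional representation is isomorphic to one of those (on some \<open>k\<^sup>n\<close>).
\<close>
definition irreducible_reps ::
  "('g, 'h) monoid_scheme \<Rightarrow> nat \<Rightarrow> (nat \<Rightarrow> ('k::field, 'v, 'g) rep) \<Rightarrow> bool" where
  "irreducible_reps G r V \<longleftrightarrow> trivial_rep G (V 0) \<and>
     (\<forall>i\<le>r. irreducible_rep G (V i)) \<and>
     (\<forall>i\<le>r. \<forall>j\<le>r. rep_iso G (V i) (V j) \<longrightarrow> i = j) \<and>
     (\<forall>W :: ('k, nat \<Rightarrow> 'k, 'g) rep. irreducible_rep G W \<longrightarrow> (\<exists>i\<le>r. rep_iso G W (V i)))"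

definition ksections :: "('y, 'b, 'k) kspace \<Rightarrow> 'y set \<Rightarrow> ('k, 'b) Module.module" where
  "ksections Y U = with_smult (sec Y U)
     (\<lambda>c b. res Y (points Y) U (kmap Y c) \<otimes>\<^bsub>sec Y U\<^esub> b)"

text \<open>
  \<open>O(V)\<close>, the tensor product over \<open>k\<close> of the structure sheaf with \<open>V\<close>. No sheafification is
  needed since \<open>V\<close> is finite-dimensional: \<open>U \<mapsto> O(U) \<otimes> V\<close> is a finite direct sum of copies of
  the structure sheaf.
\<close>
definition rep_sheaf ::
  "('y, 'b, 'k::field) kspace \<Rightarrow> ('k, 'v, 'g) rep \<Rightarrow> ('y, 'b, ('b \<times> 'v \<Rightarrow>\<^sub>0 int) set, 'g) gmod_sheaf" where
  "rep_sheaf Y V =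
     \<lparr>base = base Y,
      sec = (\<lambda>U. with_smult (tensor class_ring (ksections Y U) V)
        (\<lambda>b. tensor_map class_ring (ksections Y U) V (\<lambda>f. b \<otimes>\<^bsub>sec Y U\<^esub> f) (\<lambda>v. v))),
      res = (\<lambda>U W. tensor_map class_ring (ksections Y W) V (res Y U W) (\<lambda>v. v)),
      gact = (\<lambda>g U. tensor_map class_ring (ksections Y U) V (\<lambda>f. f) (rho V g))\<rparr>"

end

theory Submission
 imports Defs "Jordan_Normal_Form.Char_Poly"
begin

hide_const (open) Multiset.mult Polynomial.smult Modules.module Ring_Hom.ring_hom

syntax "_subindex" :: "logic => index" ("(\<open>unbreakable\<close>\<^sub>_)" [1000] 1000)
translations (index) "\<^sub>x" => (index) "\<^bsub>x\<^esub>"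

text \<open>
 The sheaf belonging to a representation \<open>V\<close> is \<open>E\<^sub>V = Hom\<^sub>G(V, \<pi>\<^sub>* O\<^sub>X)\<close>. Since the order of \<open>G\<close> is invertible in \<open>k\<close>,
 the matrix coefficients of the irreducible representations give idempotents of \<open>k[G]\<close> that split the sections of
 \<open>\<pi>\<^sub>* O\<^sub>X\<close> over every open set into isotypic parts, compatibly with restriction and with multiplication by \<open>O\<^sub>Y\<close>. The
 part of the trivial representation is \<open>O\<^sub>Y\<close>, and evaluation \<open>v \<otimes> f \<mapsto> f(v)\<close> identifies \<open>O(V) \<otimes> E\<^sub>V\<close> with the part of
 \<open>V\<close>, already before sheafification.

 The generic stalk \<open>L\<close> of \<open>\<pi>\<^sub>* O\<^sub>X\<close> is a field, because the norm of a nonzero section is a nonzero rational function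
 on \<open>Y\<close>, and the function field \<open>K\<close> of \<open>Y\<close> is its fixed field under \<open>G\<close>. As \<open>X\<close> is separated, \<open>G\<close> acts faithfully on
 \<open>L\<close>. By Galois descent the equivariant maps then span \<open>Hom\<^sub>k(V, L)\<close> over \<open>L\<close>, and a basis consisting of such maps is a
 \<open>K\<close>-basis of \<open>Hom\<^sub>G(V, L)\<close>, which is the generic stalk of \<open>E\<^sub>V\<close>.
\<close>

text \<open>Matrix coefficients are used in place of characters because they give matrix units
  \<open>E_ba\<close> of the group algebra for each \<open>V i\<close>. A section \<open>s\<close>
  of the part of \<open>V i\<close> is then the sum over \<open>a\<close> of \<open>E_aa s\<close>,
  the value at the basis vector \<open>v_a\<close> of the equivariant map taking each
  \<open>v_b\<close> to \<open>E_ba s\<close>; so evaluation has an explicit inverse over every open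
  set. Completeness of the idempotents is proved inside the regular representation through minimal
  invariant subspaces, which avoids complements and a count of dimensions. For the rank, the degree
  of \<open>L\<close> over \<open>K\<close> is never computed: the functions
  \<open>x \<sigma>_g(y)\<close> of \<open>g\<close> generate a ring of functions on
  \<open>G\<close> that separates 1 from every other element and so contains the delta function at
  1. Faithfulness on \<open>L\<close> is where geometry enters. Exchanging the two origins of a line
  with doubled origin fixes every rational function, so such automorphisms must be excluded.
  Separatedness is used through the embedding in projective space: a point is determined by the
  homogeneous forms vanishing at it, and an automorphism fixing all rational functions preserves
  these.\<close>

section \<open>Bases as indexed families, with coordinates\<close>

text \<open>A basis indexed by \<open>0, \<dots>, n - 1\<close>.\<close>
definition frame ::
 "('r, 'z) ring_scheme => ('r, 'm, 'w) module_scheme => nat => (nat => 'm) => bool" where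
 "frame R M n b \<longleftrightarrow> b : {..<n} \<rightarrow> carrier M &
   (ALL m:carrier M. EX! c. c : {..<n} \<rightarrow>\<^sub>E carrier R & m = (\<Oplus>\<^sub>M j\<in>{..<n}. c j \<odot>\<^sub>M b j))"

definition coords ::
 "('r, 'z) ring_scheme => ('r, 'm, 'w) module_scheme => nat => (nat => 'm) => 'm => nat => 'r" where
 "coords R M n b m = (THE c. c : {..<n} \<rightarrow>\<^sub>E carrier R & m = (\<Oplus>\<^sub>M j\<in>{..<n}. c j \<odot>\<^sub>M b j))"

lemma frame_closed: "frame R M n b ==> j < n ==> b j : carrier M"
 unfolding frame_def by auto

lemma frame_expand:
 assumes "frame R M n b" "m : carrier M"
 shows "coords R M n b m : {..<n} \<rightarrow>\<^sub>E carrier R" (is "PROP ?P1")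
  and "m = (\<Oplus>\<^sub>M j\<in>{..<n}. coords R M n b m j \<odot>\<^sub>M b j)" (is "PROP ?P2")
proof -
 have "EX! c. c : {..<n} \<rightarrow>\<^sub>E carrier R & m = (\<Oplus>\<^sub>M j\<in>{..<n}. c j \<odot>\<^sub>M b j)"
  using assms unfolding frame_def by blast
 from theI'[OF this] show "PROP ?P1"
  "PROP ?P2"
  unfolding coords_def by auto
qed

lemma coords_closed: "frame R M n b ==> m : carrier M ==> j < n ==> coords R M n b m j : carrier R"
 using frame_expand(1)[of R M n b m] by auto

context module
begin

lemma smult_sum_closed [intro, simp]:
 "c : S \<rightarrow> carrier R ==> b : S \<rightarrow> carrier M ==> (\<Oplus>\<^sub>M j\<in>S. c j \<odot>\<^sub>M b j) : carrier M"
 by (rule finsum_closed) auto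

lemma finsum_restrict_coeff:
 assumes "c : S \<rightarrow> carrier R" "b : S \<rightarrow> carrier M"
 shows "(\<Oplus>\<^sub>M j\<in>S. restrict c S j \<odot>\<^sub>M b j) = (\<Oplus>\<^sub>M j\<in>S. c j \<odot>\<^sub>M b j)"
 using assms by (intro finsum_cong') auto

text \<open>The family \<open>c\<close> may be arbitrary outside the index range, so the
  coefficients produced by a computation can be read off directly; the description in
  \<open>coords\<close> sees only the restriction of \<open>c\<close>.\<close>

lemma coords_unique:
 assumes "frame R M n b" "c : {..<n} \<rightarrow> carrier R" "m = (\<Oplus>\<^sub>M j\<in>{..<n}. c j \<odot>\<^sub>M b j)" "j < n"
 shows "coords R M n b m j = c j"
proof -
 have b: "b : {..<n} \<rightarrow> carrier M" using assms(1) unfolding frame_def by auto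
 have m: "m : carrier M" using assms b by auto
 have ex: "EX! c. c : {..<n} \<rightarrow>\<^sub>E carrier R & m = (\<Oplus>\<^sub>M j\<in>{..<n}. c j \<odot>\<^sub>M b j)"
  using assms(1) m unfolding frame_def by blast
 have "coords R M n b m = restrict c {..<n}"
  unfolding coords_def
  by (rule the1_equality[OF ex]) (use assms b finsum_restrict_coeff[OF assms(2) b] in auto)
 with assms(4) show ?thesis by simp
qed

lemma finsum_add_coeff:
 assumes "c : S \<rightarrow> carrier R" "d : S \<rightarrow> carrier R" "b : S \<rightarrow> carrier M"
 shows "(\<Oplus>\<^sub>M j\<in>S. (c j \<oplus>\<^sub>R d j) \<odot>\<^sub>M b j) =
  (\<Oplus>\<^sub>M j\<in>S. c j \<odot>\<^sub>M b j) \<oplus>\<^sub>M (\<Oplus>\<^sub>M j\<in>S. d j \<odot>\<^sub>M b j)"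
proof -
 have "(\<Oplus>\<^sub>M j\<in>S. (c j \<oplus>\<^sub>R d j) \<odot>\<^sub>M b j) = (\<Oplus>\<^sub>M j\<in>S. c j \<odot>\<^sub>M b j \<oplus>\<^sub>M d j \<odot>\<^sub>M b j)"
  using assms by (intro finsum_cong') (auto simp: Pi_iff smult_l_distr)
 also have "\<dots> = (\<Oplus>\<^sub>M j\<in>S. c j \<odot>\<^sub>M b j) \<oplus>\<^sub>M (\<Oplus>\<^sub>M j\<in>S. d j \<odot>\<^sub>M b j)"
  using assms by (intro finsum_addf) auto
 finally show ?thesis .
qed

lemma finsum_smult_coeff:
 assumes "c : S \<rightarrow> carrier R" "b : S \<rightarrow> carrier M" "r : carrier R"
 shows "(\<Oplus>\<^sub>M j\<in>S. (r \<otimes>\<^sub>R c j) \<odot>\<^sub>M b j) = r \<odot>\<^sub>M (\<Oplus>\<^sub>M j\<in>S. c j \<odot>\<^sub>M b j)"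
proof (cases "finite S")
 case True
 have "(\<Oplus>\<^sub>M j\<in>S. (r \<otimes>\<^sub>R c j) \<odot>\<^sub>M b j) = (\<Oplus>\<^sub>M j\<in>S. r \<odot>\<^sub>M (c j \<odot>\<^sub>M b j))"
  using assms by (intro finsum_cong') (auto simp: Pi_iff smult_assoc1)
 also have "\<dots> = r \<odot>\<^sub>M (\<Oplus>\<^sub>M j\<in>S. c j \<odot>\<^sub>M b j)"
  using assms True by (intro finsum_smult[symmetric]) auto
 finally show ?thesis .
\<comment> \<open>A sum over an infinite index set is zero by convention, and a multiple of zero is
  zero.\<close>
qed (use assms in \<open>simp add: finsum_infinite\<close>)

lemma coords_add:
 assumes "frame R M n b" "x : carrier M" "y : carrier M" "j < n"
 shows "coords R M n b (x \<oplus>\<^sub>M y) j = coords R M n b x j \<oplus>\<^sub>R coords R M n b y j"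
 using finsum_add_coeff[of "coords R M n b x" "{..<n}" "coords R M n b y" b]
  frame_expand[OF assms(1,2)] frame_expand[OF assms(1,3)] assms
 by (intro coords_unique[where c = "%j. coords R M n b x j \<oplus>\<^sub>R coords R M n b y j"])
  (auto simp: PiE_iff frame_def)

lemma coords_smult:
 assumes "frame R M n b" "x : carrier M" "r : carrier R" "j < n"
 shows "coords R M n b (r \<odot>\<^sub>M x) j = r \<otimes>\<^sub>R coords R M n b x j"
 using finsum_smult_coeff[of "coords R M n b x" "{..<n}" b r]
  frame_expand[OF assms(1,2)] assms
 by (intro coords_unique[where c = "%j. r \<otimes>\<^sub>R coords R M n b x j"])
  (auto simp: PiE_iff frame_def)

lemma finsum_delta:
 assumes "finite S" "i : S" "b : S \<rightarrow> carrier M"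
 shows "(\<Oplus>\<^sub>M j\<in>S. (if j = i then \<one>\<^sub>R else \<zero>\<^sub>R) \<odot>\<^sub>M b j) = b i"
proof -
 have "(\<Oplus>\<^sub>M j\<in>S. (if j = i then \<one>\<^sub>R else \<zero>\<^sub>R) \<odot>\<^sub>M b j) = (\<Oplus>\<^sub>M j\<in>S. if i = j then b j else \<zero>\<^sub>M)"
  using assms by (intro finsum_cong') (auto simp: Pi_iff)
 also have "\<dots> = b i" using assms by (intro add.finprod_singleton) auto
 finally show ?thesis .
qed

lemma coords_frame:
 assumes "frame R M n b" "i < n" "j < n"
 shows "coords R M n b (b i) j = (if j = i then \<one>\<^sub>R else \<zero>\<^sub>R)"
 using assms finsum_delta[of "{..<n}" i b]
 by (intro coords_unique[where c = "%j. if j = i then \<one>\<^sub>R else \<zero>\<^sub>R"]) (auto simp: frame_def)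

lemma coords_zero_imp:
 assumes "frame R M n b" "x : carrier M" "!!j. j < n ==> coords R M n b x j = \<zero>\<^sub>R"
 shows "x = \<zero>\<^sub>M"
proof -
 have "x = (\<Oplus>\<^sub>M j\<in>{..<n}. coords R M n b x j \<odot>\<^sub>M b j)" using frame_expand(2) assms by metis
 also have "\<dots> = (\<Oplus>\<^sub>M j\<in>{..<n}. \<zero>\<^sub>M)"
  using assms by (intro finsum_cong') (auto simp: frame_def Pi_iff)
 finally show ?thesis by simp
qed

text \<open>Uniqueness of expansions reduces to independence by subtracting two of them; the
  difference is written \<open>d + (-1) c\<close>, the form to which \<open>finsum_add_coeff\<close>
  and \<open>finsum_smult_coeff\<close> apply.\<close>

lemma frameI:
 assumes b: "b : {..<n} \<rightarrow> carrier M"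
  and span: "!!m. m : carrier M ==> EX c : {..<n} \<rightarrow> carrier R. m = (\<Oplus>\<^sub>M j\<in>{..<n}. c j \<odot>\<^sub>M b j)"
  and indep: "!!c j. c : {..<n} \<rightarrow> carrier R ==> (\<Oplus>\<^sub>M j\<in>{..<n}. c j \<odot>\<^sub>M b j) = \<zero>\<^sub>M ==> j < n ==> c j = \<zero>\<^sub>R"
 shows "frame R M n b"
 unfolding frame_def
proof (intro conjI ballI)
 fix m assume m: "m : carrier M"
 then obtain c where c: "c : {..<n} \<rightarrow> carrier R" "m = (\<Oplus>\<^sub>M j\<in>{..<n}. c j \<odot>\<^sub>M b j)"
  using span by blast
 show "EX! c. c : {..<n} \<rightarrow>\<^sub>E carrier R & m = (\<Oplus>\<^sub>M j\<in>{..<n}. c j \<odot>\<^sub>M b j)"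
 proof (rule ex1I[where a = "restrict c {..<n}"])
  show "restrict c {..<n} : {..<n} \<rightarrow>\<^sub>E carrier R & m = (\<Oplus>\<^sub>M j\<in>{..<n}. restrict c {..<n} j \<odot>\<^sub>M b j)"
   using c finsum_restrict_coeff[OF c(1) b] by auto
 next
  fix d assume d: "d : {..<n} \<rightarrow>\<^sub>E carrier R & m = (\<Oplus>\<^sub>M j\<in>{..<n}. d j \<odot>\<^sub>M b j)"
  have d': "d : {..<n} \<rightarrow> carrier R" using d by auto
  have nc: "(%j. (\<ominus>\<^sub>R \<one>\<^sub>R) \<otimes>\<^sub>R c j) : {..<n} \<rightarrow> carrier R" using c by auto
  have "(\<Oplus>\<^sub>M j\<in>{..<n}. (d j \<oplus>\<^sub>R (\<ominus>\<^sub>R \<one>\<^sub>R) \<otimes>\<^sub>R c j) \<odot>\<^sub>M b j) = m \<oplus>\<^sub>M ((\<ominus>\<^sub>R \<one>\<^sub>R) \<odot>\<^sub>M m)"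
   using finsum_add_coeff[OF d' nc b] finsum_smult_coeff[OF c(1) b, of "\<ominus>\<^sub>R \<one>\<^sub>R"] d c by simp
  also have "\<dots> = \<zero>\<^sub>M" using m by (simp add: smult_l_minus r_neg)
  finally have z: "(\<Oplus>\<^sub>M j\<in>{..<n}. (d j \<oplus>\<^sub>R (\<ominus>\<^sub>R \<one>\<^sub>R) \<otimes>\<^sub>R c j) \<odot>\<^sub>M b j) = \<zero>\<^sub>M" .
  have dc: "(%j. d j \<oplus>\<^sub>R (\<ominus>\<^sub>R \<one>\<^sub>R) \<otimes>\<^sub>R c j) : {..<n} \<rightarrow> carrier R" using d' c by auto
  have "d j = c j" if "j < n" for j
  proof -
   have "d j \<oplus>\<^sub>R (\<ominus>\<^sub>R \<one>\<^sub>R) \<otimes>\<^sub>R c j = \<zero>\<^sub>R" using indep[OF dc z that] .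
   moreover have "d j : carrier R" "c j : carrier R" using that d' c by auto
   moreover from this have "(\<ominus>\<^sub>R \<one>\<^sub>R) \<otimes>\<^sub>R c j = \<ominus>\<^sub>R c j" by (simp add: R.l_minus)
   ultimately show ?thesis using R.minus_equality[of "d j" "\<ominus>\<^sub>R c j"] by simp
  qed
  thus "d = restrict c {..<n}" using d by (intro ext) (auto simp: PiE_iff extensional_def)
 qed
qed (rule b)

end

context vectorspace
begin

lemma frame_inj:
 assumes "frame K V n b" shows "inj_on b {..<n}"
proof (rule inj_onI)
 fix i j assume ij: "i : {..<n}" "j : {..<n}" "b i = b j"
 have "coords K V n b (b i) i = \<one>\<^sub>K" "coords K V n b (b j) i = (if i = j then \<one>\<^sub>K else \<zero>\<^sub>K)"
  using coords_frame[OF assms, of i i] coords_frame[OF assms, of j i] ij by auto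
 with ij(3) show "i = j" by (metis one_not_zero)
qed

lemma lincomb_frame:
 assumes "inj_on b {..<n}" "b : {..<n} \<rightarrow> carrier V" "a : b ` {..<n} \<rightarrow> carrier K"
 shows "lincomb a (b ` {..<n}) = (\<Oplus>\<^sub>V j\<in>{..<n}. a (b j) \<odot>\<^sub>V b j)"
 unfolding lincomb_def using assms by (intro finsum_reindex) auto

text \<open>Connects indexed frames with sets that are bases; a coefficient function on the set is
  carried to the indices, and back, along \<open>b\<close>, which is injective by
  \<open>frame_inj\<close>.\<close>

lemma frame_basis:
 assumes f: "frame K V n b" shows "basis (b ` {..<n})"
proof -
 have b: "b : {..<n} \<rightarrow> carrier V" using f by (auto simp: frame_def)
 note inj = frame_inj[OF f]
 have "lin_indpt (b ` {..<n})"
 proof (rule finite_lin_indpt2)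
  fix a assume a: "a : b ` {..<n} \<rightarrow> carrier K" "lincomb a (b ` {..<n}) = \<zero>\<^sub>V"
  show "ALL v:b ` {..<n}. a v = \<zero>\<^sub>K"
  proof safe
   fix j assume j: "j < n"
   have "coords K V n b \<zero>\<^sub>V j = a (b j)"
    using f a(1) lincomb_frame[OF inj b a(1)] a(2) j by (intro coords_unique) auto
   moreover have "coords K V n b \<zero>\<^sub>V j = \<zero>\<^sub>K"
    using coords_smult[OF f, of "\<zero>\<^sub>V" "\<zero>\<^sub>K" j] j coords_closed[OF f, of "\<zero>\<^sub>V" j] by simp
   ultimately show "a (b j) = \<zero>\<^sub>K" by simp
  qed
 qed (use b in auto)
 moreover have "gen_set (b ` {..<n})"
 proof
  show "span (b ` {..<n}) \<subseteq> carrier V" using b by (intro span_is_subset2) auto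
  show "carrier V \<subseteq> span (b ` {..<n})"
  proof
   fix m assume m: "m : carrier V"
   define a where "a v = coords K V n b m (the_inv_into {..<n} b v)" for v
   have ab: "a (b j) = coords K V n b m j" if "j < n" for j
    using the_inv_into_f_f[OF inj] that by (simp add: a_def)
   have a: "a : b ` {..<n} \<rightarrow> carrier K"
    using ab coords_closed[OF f m] by auto
   have "m = (\<Oplus>\<^sub>V j\<in>{..<n}. coords K V n b m j \<odot>\<^sub>V b j)" by (rule frame_expand(2)[OF f m])
   also have "\<dots> = (\<Oplus>\<^sub>V j\<in>{..<n}. a (b j) \<odot>\<^sub>V b j)"
    using ab b a by (intro finsum_cong') (auto simp: Pi_iff)
   also have "\<dots> = lincomb a (b ` {..<n})" using lincomb_frame[OF inj b a] by simp
   finally show "m : span (b ` {..<n})" unfolding span_def using a by blast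
  qed
 qed
 ultimately show ?thesis using b unfolding basis_def by auto
qed

lemma frame_fin_dim: "frame K V n b ==> fin_dim"
 using frame_basis[of n b] unfolding fin_dim_def basis_def by (meson finite_imageI finite_lessThan)

lemma frame_dim: "frame K V n b ==> dim = n"
 using dim_basis[OF _ frame_basis] frame_inj card_image by fastforce

lemma basis_frame:
 assumes B: "finite B" "basis B" shows "EX b. frame K V dim b & b ` {..<dim} = B"
proof -
 have d: "dim = card B" using dim_basis B by auto
 have BV: "B \<subseteq> carrier V" using B by (auto simp: basis_def)
 obtain b where "bij_betw b {0..<card B} B" using ex_bij_betw_nat_finite[OF B(1)] by blast
 hence inj: "inj_on b {..<dim}" and im: "b ` {..<dim} = B"
  unfolding d by (auto simp: bij_betw_def atLeast0LessThan)
 have bV: "b : {..<dim} \<rightarrow> carrier V" using im BV by auto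
 have "frame K V dim b"
 proof (rule frameI[OF bV])
  fix m assume m: "m : carrier V"
  then obtain a where a: "a : B \<rightarrow>\<^sub>E carrier K" "lincomb a B = m"
   using basis_criterion[OF B(1) BV] B(2) by blast
  show "EX c : {..<dim} \<rightarrow> carrier K. m = (\<Oplus>\<^sub>V j\<in>{..<dim}. c j \<odot>\<^sub>V b j)"
   using a im lincomb_frame[OF inj bV, of a] by (intro bexI[where x = "a \<circ> b"]) (auto simp: PiE_iff)
 next
  fix c j assume c: "c : {..<dim} \<rightarrow> carrier K" "(\<Oplus>\<^sub>V j\<in>{..<dim}. c j \<odot>\<^sub>V b j) = \<zero>\<^sub>V" "j < dim"
  define a where "a v = c (the_inv_into {..<dim} b v)" for v
  have ab: "a (b j) = c j" if "j < dim" for j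
   using the_inv_into_f_f[OF inj] that by (simp add: a_def)
  have a: "a : B \<rightarrow> carrier K" using ab c(1) im by force
  have "lincomb a B = (\<Oplus>\<^sub>V j\<in>{..<dim}. a (b j) \<odot>\<^sub>V b j)" using lincomb_frame[OF inj bV] a im by simp
  also have "\<dots> = (\<Oplus>\<^sub>V j\<in>{..<dim}. c j \<odot>\<^sub>V b j)"
   using ab bV c by (intro finsum_cong') (auto simp: Pi_iff)
  finally have "lincomb a B = \<zero>\<^sub>V" using c(2) by simp
  moreover have "\<not> lin_dep B" using B(2) by (auto simp: basis_def)
  ultimately have "a (b j) = \<zero>\<^sub>K"
   using a B(1) BV im c(3) unfolding lin_dep_def by blast
  thus "c j = \<zero>\<^sub>K" using ab c(3) by simp
 qed
 thus ?thesis using im by blast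
qed

lemma frame_exists: "fin_dim ==> EX b. frame K V dim b"
 using finite_basis_exists basis_frame by blast

end

section \<open>Modules over a group algebra\<close>

locale kG_module = G: group G + Module.module class_ring M
 for G :: "('g, 'h) monoid_scheme" (structure) and M :: "('k::field, 'm, 'w) module_scheme"
  and act :: "'g => 'm => 'm" +
 assumes fin: "finite (carrier G)"
  and act_hom: "g : carrier G ==> act g : module_hom class_ring M M"
  and act_one: "m : carrier M ==> act \<one> m = m"
  and act_mult: "g : carrier G ==> h : carrier G ==> m : carrier M ==> act (g \<otimes> h) m = act g (act h m)"

text \<open>The product of the group algebra, whose elements are written as functions on
  \<open>G\<close>.\<close>

definition conv :: "('g, 'h) monoid_scheme => ('g => 'k::field) => ('g => 'k) => 'g => 'k" where
 "conv G x y g = (\<Sum>h\<in>carrier G. x h * y (inv\<^bsub>G\<^esub> h \<otimes>\<^sub>G g))"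

text \<open>The action of the element \<open>\<Sum>g. x g \<cdot> g\<close> of the group algebra.\<close>
definition galg_act ::
 "('g, 'h) monoid_scheme => ('k::field, 'm, 'w) module_scheme => ('g => 'm => 'm) => ('g => 'k) => 'm => 'm" where
 "galg_act G M act x m = (\<Oplus>\<^sub>M g\<in>carrier G. x g \<odot>\<^sub>M act g m)"

lemma (in abelian_monoid) finsum_finsum_swap:
 assumes "finite A" "finite B" "!!a b. a : A ==> b : B ==> f a b : carrier G"
 shows "(\<Oplus>a\<in>A. \<Oplus>b\<in>B. f a b) = (\<Oplus>b\<in>B. \<Oplus>a\<in>A. f a b)"
 using assms add.finprod_finprod_swap[of A B f] by auto

text \<open>Additivity already forces \<open>T\<close> to preserve zero, so the lemma serves
  semilinear maps such as \<open>\<alpha> g\<close> and evaluations as well as module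
  homomorphisms.\<close>

lemma mod_hom_finsum:
 assumes "abelian_group M" "abelian_group N" "T : carrier M \<rightarrow> carrier N"
  "!!x y. x : carrier M ==> y : carrier M ==> T (x \<oplus>\<^sub>M y) = T x \<oplus>\<^sub>N T y"
  "f : S \<rightarrow> carrier M" "finite S"
 shows "T (\<Oplus>\<^sub>M s\<in>S. f s) = (\<Oplus>\<^sub>N s\<in>S. T (f s))"
proof -
 interpret M: abelian_group M by fact
 interpret N: abelian_group N by fact
 have T0: "T \<zero>\<^sub>M = \<zero>\<^sub>N"
  using assms(4)[of "\<zero>\<^sub>M" "\<zero>\<^sub>M"] assms(3) N.r_neg1[of "T \<zero>\<^sub>M" "T \<zero>\<^sub>M"] N.l_neg[of "T \<zero>\<^sub>M"]
  by (metis M.l_zero M.zero_closed PiE)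
 show ?thesis
  using assms(6,5)
 proof (induction S rule: finite_induct)
  case (insert s S)
  have "T (\<Oplus>\<^sub>M s\<in>insert s S. f s) = T (f s \<oplus>\<^sub>M (\<Oplus>\<^sub>M s\<in>S. f s))"
   using insert by (subst M.finsum_insert) auto
  also have "\<dots> = T (f s) \<oplus>\<^sub>N T (\<Oplus>\<^sub>M s\<in>S. f s)"
   using insert by (intro assms(4)) auto
  also have "\<dots> = T (f s) \<oplus>\<^sub>N (\<Oplus>\<^sub>N s\<in>S. T (f s))" using insert by simp
  also have "\<dots> = (\<Oplus>\<^sub>N s\<in>insert s S. T (f s))"
   using insert assms(3) by (subst N.finsum_insert) auto
  finally show ?case .
 qed (simp add: T0)
qed

context kG_module
begin

lemma act_closed [simp, intro]: "g : carrier G ==> m : carrier M ==> act g m : carrier M"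
 using act_hom[of g] by (auto simp: module_hom_def)

lemma act_add: "g : carrier G ==> x : carrier M ==> y : carrier M ==> act g (x \<oplus>\<^sub>M y) = act g x \<oplus>\<^sub>M act g y"
 using act_hom[of g] by (auto simp: module_hom_def)

lemma act_smult: "g : carrier G ==> x : carrier M ==> act g (c \<odot>\<^sub>M x) = c \<odot>\<^sub>M act g x"
 using act_hom[of g] by (auto simp: module_hom_def)

lemma smult_closed' [simp, intro]: "x : carrier M ==> c \<odot>\<^sub>M x : carrier M"
 using smult_closed by simp

lemma smult_smult: "x : carrier M ==> c \<odot>\<^sub>M (d \<odot>\<^sub>M x) = (c * d) \<odot>\<^sub>M x"
 using smult_assoc1[of c d x] by simp

lemma smult_zero_left [simp]: "x : carrier M ==> 0 \<odot>\<^sub>M x = \<zero>\<^sub>M"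
 using smult_l_null[of x] by simp

lemma smult_one_left [simp]: "x : carrier M ==> 1 \<odot>\<^sub>M x = x"
 using smult_one[of x] by simp

lemma smult_sum_left:
 "finite S ==> x : carrier M ==> (\<Sum>s\<in>S. c s) \<odot>\<^sub>M x = (\<Oplus>\<^sub>M s\<in>S. c s \<odot>\<^sub>M x)"
proof (induction S rule: finite_induct)
 case (insert s S)
 thus ?case using smult_l_distr[of "c s" "sum c S" x] by (subst finsum_insert) auto
qed simp

lemma act_finsum:
 "g : carrier G ==> finite S ==> f : S \<rightarrow> carrier M ==> act g (\<Oplus>\<^sub>M s\<in>S. f s) = (\<Oplus>\<^sub>M s\<in>S. act g (f s))"
 by (intro mod_hom_finsum) (auto simp: act_add intro: abelian_group_axioms)

abbreviation ga :: "('g => 'k) => 'm => 'm" where "ga \<equiv> galg_act G M act"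

lemma ga_closed [simp, intro]: "m : carrier M ==> ga x m : carrier M"
 unfolding galg_act_def by (intro finsum_closed) auto

lemma ga_cong: "m : carrier M ==> (!!g. g : carrier G ==> x g = y g) ==> ga x m = ga y m"
 unfolding galg_act_def by (intro finsum_cong') auto

lemma ga_add_left: "m : carrier M ==> ga (%g. x g + y g) m = ga x m \<oplus>\<^sub>M ga y m"
proof -
 assume m: "m : carrier M"
 have "ga (%g. x g + y g) m = (\<Oplus>\<^sub>M g\<in>carrier G. x g \<odot>\<^sub>M act g m \<oplus>\<^sub>M y g \<odot>\<^sub>M act g m)"
  unfolding galg_act_def using m smult_l_distr by (intro finsum_cong') auto
 also have "\<dots> = ga x m \<oplus>\<^sub>M ga y m"
  unfolding galg_act_def using m by (intro finsum_addf) auto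
 finally show ?thesis .
qed

lemma ga_scale_left: "m : carrier M ==> ga (%g. c * x g) m = c \<odot>\<^sub>M ga x m"
proof -
 assume m: "m : carrier M"
 have "ga (%g. c * x g) m = (\<Oplus>\<^sub>M g\<in>carrier G. c \<odot>\<^sub>M (x g \<odot>\<^sub>M act g m))"
  unfolding galg_act_def using m by (intro finsum_cong') (auto simp: smult_smult)
 also have "\<dots> = c \<odot>\<^sub>M ga x m"
  unfolding galg_act_def using m fin by (intro finsum_smult[symmetric]) auto
 finally show ?thesis .
qed

lemma ga_zero_left: "m : carrier M ==> ga (%g. 0) m = \<zero>\<^sub>M"
 using ga_scale_left[of m 0 "%g. 0"] by simp

lemma ga_sum_left:
 "finite S ==> m : carrier M ==> ga (%g. \<Sum>s\<in>S. x s g) m = (\<Oplus>\<^sub>M s\<in>S. ga (x s) m)"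
proof (induction S rule: finite_induct)
 case (insert s S)
 thus ?case using ga_add_left[of m "x s" "%g. \<Sum>s\<in>S. x s g"] by (subst finsum_insert) auto
qed (simp add: ga_zero_left)

lemma ga_add:
 assumes "m : carrier M" "m' : carrier M"
 shows "ga x (m \<oplus>\<^sub>M m') = ga x m \<oplus>\<^sub>M ga x m'"
proof -
 have "ga x (m \<oplus>\<^sub>M m') = (\<Oplus>\<^sub>M g\<in>carrier G. x g \<odot>\<^sub>M act g m \<oplus>\<^sub>M x g \<odot>\<^sub>M act g m')"
  unfolding galg_act_def using assms smult_r_distr by (intro finsum_cong') (auto simp: act_add)
 also have "\<dots> = ga x m \<oplus>\<^sub>M ga x m'"
  unfolding galg_act_def using assms by (intro finsum_addf) auto
 finally show ?thesis .
qed

lemma ga_smult: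
 assumes "m : carrier M"
 shows "ga x (c \<odot>\<^sub>M m) = c \<odot>\<^sub>M ga x m"
proof -
 have "ga x (c \<odot>\<^sub>M m) = (\<Oplus>\<^sub>M g\<in>carrier G. c \<odot>\<^sub>M (x g \<odot>\<^sub>M act g m))"
  unfolding galg_act_def using assms by (intro finsum_cong') (auto simp: act_smult smult_smult mult.commute)
 also have "\<dots> = c \<odot>\<^sub>M ga x m"
  unfolding galg_act_def using assms fin by (intro finsum_smult[symmetric]) auto
 finally show ?thesis .
qed

lemma ga_finsum:
 "finite S ==> f : S \<rightarrow> carrier M ==> ga x (\<Oplus>\<^sub>M s\<in>S. f s) = (\<Oplus>\<^sub>M s\<in>S. ga x (f s))"
 by (intro mod_hom_finsum) (auto simp: ga_add intro: abelian_group_axioms)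

lemma ga_zero [simp]: "ga x \<zero>\<^sub>M = \<zero>\<^sub>M"
 using ga_finsum[of "{}"] by simp

lemma ga_delta:
 assumes "m : carrier M" "h : carrier G"
 shows "ga (%g. if g = h then 1 else 0) m = act h m"
 unfolding galg_act_def
 using finsum_delta[of "carrier G" h "%g. act g m"] fin assms by (simp cong: if_cong)

text \<open>Makes \<open>ga\<close> an action of the group algebra: \<open>act h\<close> is pulled
  into the inner sum, which is then reindexed by the left translation
  \<open>g \<mapsto> h \<otimes> g\<close>.\<close>

lemma ga_conv:
 assumes m: "m : carrier M"
 shows "ga x (ga y m) = ga (conv G x y) m"
proof -
 have "ga x (ga y m) = (\<Oplus>\<^sub>M h\<in>carrier G. \<Oplus>\<^sub>M g\<in>carrier G. (x h * y (inv h \<otimes> g)) \<odot>\<^sub>M act g m)"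
  unfolding galg_act_def[of _ _ _ x]
 proof (intro finsum_cong')
  fix h assume h: "h : carrier G"
  have "x h \<odot>\<^sub>M act h (ga y m) = x h \<odot>\<^sub>M (\<Oplus>\<^sub>M g\<in>carrier G. y g \<odot>\<^sub>M act (h \<otimes> g) m)"
   unfolding galg_act_def using h m fin
   by (subst act_finsum) (auto intro!: arg_cong[where f = "%t. x h \<odot>\<^sub>M t"] finsum_cong' simp: act_smult act_mult)
  also have "\<dots> = (\<Oplus>\<^sub>M g\<in>carrier G. x h \<odot>\<^sub>M (y g \<odot>\<^sub>M act (h \<otimes> g) m))"
   using h m fin by (intro finsum_smult) auto
  also have "\<dots> = (\<Oplus>\<^sub>M g\<in>carrier G. (x h * y g) \<odot>\<^sub>M act (h \<otimes> g) m)"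
   using h m by (intro finsum_cong') (auto simp: smult_smult)
  also have "\<dots> = (\<Oplus>\<^sub>M g\<in>carrier G. (x h * y (inv h \<otimes> g)) \<odot>\<^sub>M act g m)"
   using h m by (intro finsum_reindex_bij_witness[where i = "%g. inv h \<otimes> g" and j = "%g. h \<otimes> g"])
    (auto simp: G.m_assoc[symmetric])
  finally show "x h \<odot>\<^sub>M act h (ga y m) = (\<Oplus>\<^sub>M g\<in>carrier G. (x h * y (inv h \<otimes> g)) \<odot>\<^sub>M act g m)" .
 qed (use m in \<open>auto intro!: finsum_closed\<close>)
 also have "\<dots> = (\<Oplus>\<^sub>M g\<in>carrier G. \<Oplus>\<^sub>M h\<in>carrier G. (x h * y (inv h \<otimes> g)) \<odot>\<^sub>M act g m)"
  using m fin by (intro finsum_finsum_swap) auto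
 also have "\<dots> = ga (conv G x y) m"
  unfolding galg_act_def conv_def using m fin by (intro finsum_cong') (auto simp: smult_sum_left)
 finally show ?thesis .
qed

end

definition kG_hom where
 "kG_hom G M a N b = {f : module_hom class_ring M N. ALL g:carrier G. ALL m:carrier M. f (a g m) = b g (f m)}"

text \<open>The source of all compatibilities of the isotypic projections: whatever is equivariant,
  be it restriction or multiplication by a function on the quotient, commutes with every element of
  the group algebra.\<close>

lemma kG_hom_ga:
 assumes "kG_module G M a" "kG_module G N b" "f : kG_hom G M a N b" "m : carrier M"
 shows "f (galg_act G M a x m) = galg_act G N b x (f m)"
proof -
 interpret M: kG_module G M a by fact
 interpret N: kG_module G N b by fact
 have f: "f : carrier M \<rightarrow> carrier N" "!!x y. x : carrier M ==> y : carrier M ==> f (x \<oplus>\<^sub>M y) = f x \<oplus>\<^sub>N f y"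
  "!!c x. x : carrier M ==> f (c \<odot>\<^sub>M x) = c \<odot>\<^sub>N f x"
  "!!g m. g : carrier G ==> m : carrier M ==> f (a g m) = b g (f m)"
  using assms(3) by (auto simp: kG_hom_def module_hom_def)
 have "f (galg_act G M a x m) = (\<Oplus>\<^sub>N g\<in>carrier G. f (x g \<odot>\<^sub>M a g m))"
  unfolding galg_act_def
  using assms(4) f M.fin by (intro mod_hom_finsum M.abelian_group_axioms N.abelian_group_axioms) auto
 also have "\<dots> = galg_act G N b x (f m)"
  unfolding galg_act_def using f assms(4) by (intro N.finsum_cong') (auto simp: Pi_iff)
 finally show ?thesis .
qed

lemma representation_kG_module:
 assumes "group G" "finite (carrier G)" "representation G V"
 shows "kG_module G V (rho V)"
proof -
 interpret group G by fact
 interpret V: vectorspace class_ring V using assms(3) by (simp add: representation_def)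
 show ?thesis by unfold_locales (use assms in \<open>auto simp: representation_def\<close>)
qed

section \<open>Schur orthogonality\<close>

text \<open>The characteristic polynomial of the matrix of \<open>T\<close> in a frame has degree
  \<open>n\<close>, and \<open>n > 0\<close> because the space is nonzero; over an algebraically
  closed field it has a root.\<close>

lemma linear_map_eigenvector:
 fixes V :: "('k::alg_closed_field, 'v, 'w) module_scheme"
 assumes "vectorspace class_ring V" "vectorspace.fin_dim class_ring V" "carrier V \<noteq> {\<zero>\<^sub>V}"
  and T: "T : module_hom class_ring V V"
 shows "EX c. EX w:carrier V. w \<noteq> \<zero>\<^sub>V & T w = c \<odot>\<^sub>V w"
proof -
 interpret V: vectorspace class_ring V by fact
 obtain n b where f: "frame class_ring V n b" using V.frame_exists assms(2) by blast
 have b: "b : {..<n} \<rightarrow> carrier V" using f by (auto simp: frame_def)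
 have T': "T : carrier V \<rightarrow> carrier V" "!!x y. x : carrier V ==> y : carrier V ==> T (x \<oplus>\<^sub>V y) = T x \<oplus>\<^sub>V T y"
  "!!c x. x : carrier V ==> T (c \<odot>\<^sub>V x) = c \<odot>\<^sub>V T x"
  using T by (auto simp: module_hom_def)
 define co where "co = coords class_ring V n b"
 have "n \<noteq> 0"
 proof
  assume "n = 0"
  hence "carrier V \<subseteq> {\<zero>\<^sub>V}" using V.coords_zero_imp[OF f] by auto
  thus False using assms(3) by auto
 qed
 define A where "A = mat n n (%(i, j). co (T (b j)) i)"
 have A: "A : carrier_mat n n" by (simp add: A_def)
 have "degree (char_poly A) = n" by (rule degree_monic_char_poly[OF A, THEN conjunct1])
 then obtain c where "poly (char_poly A) c = 0"
  using alg_closed_imp_poly_has_root[of "char_poly A"] \<open>n \<noteq> 0\<close> by auto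
 hence "eigenvalue A c" using eigenvalue_root_char_poly[OF A] by simp
 then obtain x where x: "x : carrier_vec n" "x \<noteq> 0\<^sub>v n" "A *\<^sub>v x = c \<cdot>\<^sub>v x"
  unfolding eigenvalue_def eigenvector_def using A by auto
 define w where "w = (\<Oplus>\<^sub>V j\<in>{..<n}. (x $ j) \<odot>\<^sub>V b j)"
 have w: "w : carrier V" unfolding w_def using b by auto
 have cw: "co w i = x $ i" if "i < n" for i
  unfolding co_def using that w_def f by (intro V.coords_unique) auto
 have Tb: "T (b j) : carrier V" if "j < n" for j using that b T'(1) by auto
 have "T w = (\<Oplus>\<^sub>V j\<in>{..<n}. T ((x $ j) \<odot>\<^sub>V b j))"
  unfolding w_def using b T' by (intro mod_hom_finsum V.abelian_group_axioms) auto
 also have "\<dots> = (\<Oplus>\<^sub>V j\<in>{..<n}. (x $ j) \<odot>\<^sub>V T (b j))"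
  using b T'(3) Tb by (intro V.finsum_cong') (auto simp: Pi_iff)
 also have "\<dots> = (\<Oplus>\<^sub>V j\<in>{..<n}. \<Oplus>\<^sub>V i\<in>{..<n}. (x $ j * co (T (b j)) i) \<odot>\<^sub>V b i)"
 proof (intro V.finsum_cong')
  fix j assume "j : {..<n}" hence j: "j < n" by simp
  show "(x $ j) \<odot>\<^sub>V T (b j) = (\<Oplus>\<^sub>V i\<in>{..<n}. (x $ j * co (T (b j)) i) \<odot>\<^sub>V b i)"
   using V.finsum_smult_coeff[of "co (T (b j))" "{..<n}" b "x $ j"] b
    frame_expand(2)[OF f Tb[OF j]] by (simp add: co_def)
 qed (use b in auto)
 also have "\<dots> = (\<Oplus>\<^sub>V i\<in>{..<n}. \<Oplus>\<^sub>V j\<in>{..<n}. (x $ j * co (T (b j)) i) \<odot>\<^sub>V b i)"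
  using b by (intro V.finsum_finsum_swap) auto
 also have "\<dots> = (\<Oplus>\<^sub>V i\<in>{..<n}. (c * x $ i) \<odot>\<^sub>V b i)"
 proof (intro V.finsum_cong')
  fix i assume "i : {..<n}" hence i: "i < n" by simp
  have bi: "b i : carrier V" using b i by auto
  have "(\<Sum>j<n. x $ j * co (T (b j)) i) = (A *\<^sub>v x) $ i"
   using i x(1) A by (auto simp: A_def scalar_prod_def atLeast0LessThan mult.commute intro!: sum.cong)
  also have "\<dots> = c * x $ i" using i x by simp
  finally have s: "(\<Sum>j<n. x $ j * co (T (b j)) i) = c * x $ i" .
  have "(\<Oplus>\<^sub>V j\<in>S. (x $ j * co (T (b j)) i) \<odot>\<^sub>V b i) = (\<Sum>j\<in>S. x $ j * co (T (b j)) i) \<odot>\<^sub>V b i"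
   if "finite S" for S
   using that
  proof (induction S rule: finite_induct)
   case (insert s S)
   show ?case using insert bi V.smult_l_distr[of "x $ s * co (T (b s)) i" "\<Sum>j\<in>S. x $ j * co (T (b j)) i" "b i"]
    by (subst V.finsum_insert) auto
  qed (use V.smult_l_null[OF bi] in simp)
  from this[of "{..<n}"] s show "(\<Oplus>\<^sub>V j\<in>{..<n}. (x $ j * co (T (b j)) i) \<odot>\<^sub>V b i) = (c * x $ i) \<odot>\<^sub>V b i"
   by simp
 qed (use b in auto)
 also have "\<dots> = c \<odot>\<^sub>V w"
  unfolding w_def using V.finsum_smult_coeff[of "%i. x $ i" "{..<n}" b c] b by simp
 finally have "T w = c \<odot>\<^sub>V w" .
 moreover have "w \<noteq> \<zero>\<^sub>V"
 proof
  assume "w = \<zero>\<^sub>V"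
  hence "co w i = 0" if "i < n" for i
   using V.coords_smult[OF f, of "\<zero>\<^sub>V" 0 i] that by (simp add: co_def)
  hence "x = 0\<^sub>v n" using cw x(1) by (intro eq_vecI) auto
  thus False using x(2) by simp
 qed
 ultimately show ?thesis using w by blast
qed

text \<open>Collects kernel and image of an equivariant map in the form in which irreducibility is
  applied to them.\<close>

lemma kG_hom_subspaces:
 assumes "representation G V" "representation G W" "T : kG_hom G V (rho V) W (rho W)"
 defines "Ke \<equiv> {v : carrier V. T v = \<zero>\<^sub>W}"
 shows "VectorSpace.subspace class_ring Ke V" "!!g. g : carrier G ==> rho V g ` Ke \<subseteq> Ke"
  "VectorSpace.subspace class_ring (T ` carrier V) W" "!!g. g : carrier G ==> rho W g ` (T ` carrier V) \<subseteq> T ` carrier V"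
  "Ke = {\<zero>\<^sub>V} ==> inj_on T (carrier V)"
proof -
 interpret V: vectorspace class_ring V using assms by (simp add: representation_def)
 interpret W: vectorspace class_ring W using assms by (simp add: representation_def)
 interpret linear_map class_ring V W T
  by unfold_locales (use assms(3) in \<open>simp add: kG_hom_def\<close>)
 have Ke: "Ke = kerT" by (auto simp: Ke_def ker_def)
 show "VectorSpace.subspace class_ring Ke V" unfolding Ke by (rule kerT_is_subspace)
 show "VectorSpace.subspace class_ring (T ` carrier V) W" using imT_is_subspace by (simp add: im_def)
 show "inj_on T (carrier V)" if "Ke = {\<zero>\<^sub>V}" using Ke0_imp_inj that Ke by auto
 show "rho V g ` Ke \<subseteq> Ke" if "g : carrier G" for g
 proof safe
  fix v assume v: "v : Ke"
  have "rho W g : module_hom class_ring W W" using assms(2) that by (simp add: representation_def)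
  from module_hom_smult[OF this, of 0 "\<zero>\<^sub>W"] module_hom_closed[OF this]
  have "rho W g \<zero>\<^sub>W = \<zero>\<^sub>W" using W.smult_l_null[of "rho W g \<zero>\<^sub>W"] W.smult_l_null[of "\<zero>\<^sub>W"] by auto
  thus "rho V g v : Ke" using v that assms(1,3)
   by (auto simp: Ke_def kG_hom_def representation_def dest!: bspec module_hom_closed)
 qed
 show "rho W g ` (T ` carrier V) \<subseteq> T ` carrier V" if "g : carrier G" for g
 proof safe
  fix v assume v: "v : carrier V"
  have "rho V g v : carrier V" using assms(1) that v by (auto simp: representation_def dest!: bspec module_hom_closed)
  thus "rho W g (T v) : T ` carrier V" using v that assms(3) by (auto simp: kG_hom_def intro!: rev_image_eqI)
 qed
qed

text \<open>A nonzero value of \<open>T\<close> excludes that the kernel is everything and that the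
  image is zero; irreducibility of source and target leaves the zero kernel and the full
  image.\<close>

lemma schur_iso:
 assumes V: "irreducible_rep G V" and W: "irreducible_rep G W"
  and T: "T : kG_hom G V (rho V) W (rho W)" and nz: "v : carrier V" "T v \<noteq> \<zero>\<^sub>W"
 shows "rep_iso G V W" "inj_on T (carrier V)"
proof -
 note S = kG_hom_subspaces[OF _ _ T]
 have rV: "representation G V" and rW: "representation G W" using V W by (auto simp: irreducible_rep_def)
 interpret W: vectorspace class_ring W using rW by (simp add: representation_def)
 have "{v : carrier V. T v = \<zero>\<^sub>W} = {\<zero>\<^sub>V} \<or> {v : carrier V. T v = \<zero>\<^sub>W} = carrier V"
  using V S(1,2)[OF rV rW] unfolding irreducible_rep_def by blast
 hence inj: "inj_on T (carrier V)" using S(5)[OF rV rW] nz by blast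
 have "T ` carrier V = {\<zero>\<^sub>W} \<or> T ` carrier V = carrier W"
  using W S(3,4)[OF rV rW] unfolding irreducible_rep_def by blast
 hence "bij_betw T (carrier V) (carrier W)" using inj nz by (auto simp: bij_betw_def)
 thus "rep_iso G V W" using T by (auto simp: rep_iso_def kG_hom_def)
 show "inj_on T (carrier V)" by fact
qed

text \<open>For an eigenvalue \<open>c\<close> the equivariant map \<open>T - c\<close> has a
  nonzero vector in its kernel, so by \<open>schur_iso\<close> it vanishes identically.\<close>

lemma schur_scalar:
 fixes V :: "('k::alg_closed_field, 'v, 'g) rep"
 assumes "group G" "finite (carrier G)" and V: "irreducible_rep G V" and T: "T : kG_hom G V (rho V) V (rho V)"
 shows "EX c. ALL v:carrier V. T v = c \<odot>\<^sub>V v"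
proof -
 have rV: "representation G V" using V by (auto simp: irreducible_rep_def)
 interpret V: vectorspace class_ring V using rV by (simp add: representation_def)
 interpret kG: kG_module G V "rho V" using representation_kG_module assms rV by blast
 obtain c w where w: "w : carrier V" "w \<noteq> \<zero>\<^sub>V" "T w = c \<odot>\<^sub>V w"
 proof -
  have "vectorspace.fin_dim class_ring V" "carrier V \<noteq> {\<zero>\<^sub>V}" "T : module_hom class_ring V V"
   using V T by (auto simp: irreducible_rep_def representation_def kG_hom_def)
  from linear_map_eigenvector[OF V.vectorspace_axioms this] that show thesis by blast
 qed
 define S where "S v = T v \<oplus>\<^sub>V (- c) \<odot>\<^sub>V v" for v
 have T': "T : carrier V \<rightarrow> carrier V" "!!x y. x : carrier V ==> y : carrier V ==> T (x \<oplus>\<^sub>V y) = T x \<oplus>\<^sub>V T y"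
  "!!c x. x : carrier V ==> T (c \<odot>\<^sub>V x) = c \<odot>\<^sub>V T x"
  "!!g x. g : carrier G ==> x : carrier V ==> T (rho V g x) = rho V g (T x)"
  using T by (auto simp: kG_hom_def module_hom_def)
 have Tc: "T x : carrier V" if "x : carrier V" for x using that T'(1) by auto
 have neg: "c \<odot>\<^sub>V v \<oplus>\<^sub>V (- c) \<odot>\<^sub>V v = \<zero>\<^sub>V" if "v : carrier V" for v
  using that V.smult_l_distr[of c "- c" v] by simp
 have S_add: "S (x \<oplus>\<^sub>V y) = S x \<oplus>\<^sub>V S y" if "x : carrier V" "y : carrier V" for x y
  using that V.smult_r_distr[of "- c" x y] by (simp add: S_def T'(2) Tc V.a_ac)
 have S_smult: "S (d \<odot>\<^sub>V x) = d \<odot>\<^sub>V S x" if "x : carrier V" for x d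
  using that V.smult_r_distr[of d "T x" "(- c) \<odot>\<^sub>V x"] by (simp add: S_def T'(3) Tc kG.smult_smult mult.commute)
 have S_act: "S (rho V g x) = rho V g (S x)" if "x : carrier V" "g : carrier G" for x g
  using that by (simp add: S_def T'(4) Tc kG.act_add kG.act_smult)
 have S: "S : kG_hom G V (rho V) V (rho V)"
  unfolding kG_hom_def module_hom_def using S_add S_smult S_act Tc by (auto simp: S_def)
 have "S w = \<zero>\<^sub>V" using w neg by (simp add: S_def)
 moreover have "S \<zero>\<^sub>V = \<zero>\<^sub>V" using T'(3)[of "\<zero>\<^sub>V" 0] Tc by (simp add: S_def)
 ultimately have ninj: "\<not> inj_on S (carrier V)"
  using w inj_onD[of S "carrier V" w "\<zero>\<^sub>V"] by auto
 have "T v = c \<odot>\<^sub>V v" if "v : carrier V" for v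
 proof -
  have "S v = \<zero>\<^sub>V" using schur_iso(2)[OF V V S that] ninj by blast
  thus ?thesis unfolding S_def using neg[OF that] that Tc[OF that] V.add.right_cancel[of "(- c) \<odot>\<^sub>V v" "T v" "c \<odot>\<^sub>V v"]
   by simp
 qed
 thus ?thesis by blast
qed

lemma coords_finsum:
 assumes "module class_ring M" "frame class_ring M n b" "finite S" "f : S \<rightarrow> carrier M" "j < n"
 shows "coords class_ring M n b (\<Oplus>\<^sub>M s\<in>S. f s) j = (\<Sum>s\<in>S. coords class_ring M n b (f s) j :: 'k::field)"
proof -
 interpret M: Module.module class_ring M by fact
 show ?thesis using assms(3,4)
 proof (induction S rule: finite_induct)
  case empty
  thus ?case using M.coords_smult[OF assms(2), of "\<zero>\<^sub>M" 0 j] assms(5) by simp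
 next
  case (insert s S)
  thus ?case using M.coords_add[OF assms(2), of "f s" "\<Oplus>\<^sub>M s\<in>S. f s" j] assms(5)
   by (simp add: M.finsum_insert)
 qed
qed

lemma frame_eqI:
 assumes "module R M" "frame R M n b" "x : carrier M" "y : carrier M"
  "!!j. j < n ==> coords R M n b x j = coords R M n b y j"
 shows "x = y"
proof -
 interpret M: Module.module R M by fact
 have "coords R M n b x = coords R M n b y"
  by (rule PiE_ext[OF frame_expand(1)[OF assms(2,3)] frame_expand(1)[OF assms(2,4)]]) (simp add: assms(5))
 hence "(\<Oplus>\<^sub>M j\<in>{..<n}. coords R M n b x j \<odot>\<^sub>M b j) = (\<Oplus>\<^sub>M j\<in>{..<n}. coords R M n b y j \<odot>\<^sub>M b j)"
  by simp
 thus ?thesis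
  by (rule trans[OF trans[OF frame_expand(2)[OF assms(2,3)]] sym[OF frame_expand(2)[OF assms(2,4)]]])
qed

locale irreps = G: group G for G :: "('g, 'h) monoid_scheme" (structure) +
 fixes r :: nat and V :: "nat => ('k::alg_closed_field, 'v, 'g) rep"
 assumes fin: "finite (carrier G)" and char: "\<not> CHAR('k) dvd card (carrier G)"
  and reps: "irreducible_reps G r V"
begin

definition dm :: "nat => nat" where "dm i = vectorspace.dim class_ring (V i)"
definition bas :: "nat => nat => 'v" where "bas i = (SOME b. frame class_ring (V i) (dm i) b)"
abbreviation co :: "nat => 'v => nat => 'k" where "co i \<equiv> coords class_ring (V i) (dm i) (bas i)"
text \<open>The entry in row \<open>a\<close> and column \<open>b\<close> of the matrix of
  \<open>g\<close> in the basis \<open>bas i\<close>.\<close>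

definition mc :: "nat => 'g => nat => nat => 'k" where "mc i g a b = co i (rho (V i) g (bas i b)) a"
text \<open>By Schur orthogonality this element of the group algebra acts on \<open>V i\<close> as
  the matrix unit taking \<open>bas i a\<close> to \<open>bas i b\<close>, and as zero on the other
  \<open>V j\<close>; hence the inverse of \<open>g\<close> and the exchanged indices.\<close>

definition idem :: "nat => nat => nat => 'g => 'k" where
 "idem i b a g = of_nat (dm i) / of_nat (card (carrier G)) * mc i (inv g) a b"

lemma irr: "i \<le> r ==> irreducible_rep G (V i)"
 using reps by (auto simp: irreducible_reps_def)

lemma rep: "i \<le> r ==> representation G (V i)"
 using irr by (auto simp: irreducible_rep_def)

lemma V_kG: "i \<le> r ==> kG_module G (V i) (rho (V i))"
 by (rule representation_kG_module[OF G.group_axioms fin rep])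

lemma V_mod: "i \<le> r ==> module class_ring (V i)"
 by (rule kG_module.axioms(2)[OF V_kG])

lemma fr: assumes "i \<le> r" shows "frame class_ring (V i) (dm i) (bas i)"
proof -
 from rep[OF assms] have "vectorspace class_ring (V i)" "vectorspace.fin_dim class_ring (V i)"
  by (auto simp: representation_def)
 hence "EX b. frame class_ring (V i) (dm i) b" unfolding dm_def by (rule vectorspace.frame_exists)
 thus ?thesis unfolding bas_def by (rule someI_ex)
qed

lemma bas_closed: "i \<le> r ==> b < dm i ==> bas i b : carrier (V i)"
 by (rule frame_closed[OF fr])

lemma co_add: "i \<le> r ==> x : carrier (V i) ==> y : carrier (V i) ==> a < dm i ==>
  co i (x \<oplus>\<^sub>(V i) y) a = co i x a + co i y a"
 using module.coords_add[OF V_mod[of i] fr[of i], of x y a] by simp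

lemma co_smult: "i \<le> r ==> x : carrier (V i) ==> a < dm i ==> co i (c \<odot>\<^sub>(V i) x) a = c * co i x a"
 using module.coords_smult[OF V_mod[of i] fr[of i], of x c a] by simp

lemma co_bas: "i \<le> r ==> a < dm i ==> b < dm i ==> co i (bas i b) a = (if a = b then 1 else 0)"
 using module.coords_frame[OF V_mod[of i] fr[of i], of b a] by simp

lemma co_sum: "i \<le> r ==> a < dm i ==> co i (\<Oplus>\<^sub>(V i)b\<in>{..<dm i}. c b \<odot>\<^sub>(V i) bas i b) a = c a"
 using module.coords_unique[OF V_mod[of i] fr[of i], of c _ a] by simp

lemma expand: "i \<le> r ==> x : carrier (V i) ==> x = (\<Oplus>\<^sub>(V i)b\<in>{..<dm i}. co i x b \<odot>\<^sub>(V i) bas i b)"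
 by (rule frame_expand(2)[OF fr])

lemma rho_closed: "i \<le> r ==> g : carrier G ==> x : carrier (V i) ==> rho (V i) g x : carrier (V i)"
 by (rule kG_module.act_closed[OF V_kG])

lemma co_rho:
 assumes "i \<le> r" "g : carrier G" "x : carrier (V i)" "a < dm i"
 shows "co i (rho (V i) g x) a = (\<Sum>b<dm i. mc i g a b * co i x b)"
proof -
 interpret V: kG_module G "V i" "rho (V i)" by (rule V_kG[OF assms(1)])
 have b: "!!b. b < dm i ==> bas i b : carrier (V i)" using bas_closed assms by auto
 have "rho (V i) g x = rho (V i) g (\<Oplus>\<^sub>(V i)b\<in>{..<dm i}. co i x b \<odot>\<^sub>(V i) bas i b)"
  using expand[OF assms(1,3)] by simp
 also have "\<dots> = (\<Oplus>\<^sub>(V i)b\<in>{..<dm i}. rho (V i) g (co i x b \<odot>\<^sub>(V i) bas i b))"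
  using assms b by (intro V.act_finsum) auto
 finally have e: "rho (V i) g x = (\<Oplus>\<^sub>(V i)b\<in>{..<dm i}. rho (V i) g (co i x b \<odot>\<^sub>(V i) bas i b))" .
 have "co i (rho (V i) g x) a = (\<Sum>b<dm i. co i (rho (V i) g (co i x b \<odot>\<^sub>(V i) bas i b)) a)"
  unfolding e using assms b by (intro coords_finsum[OF V_mod fr]) auto
 also have "\<dots> = (\<Sum>b<dm i. mc i g a b * co i x b)"
  using assms b by (intro sum.cong) (auto simp: V.act_smult co_smult mc_def)
 finally show ?thesis .
qed


lemma mc_mult:
 assumes "i \<le> r" "g : carrier G" "h : carrier G" "a < dm i" "c < dm i"
 shows "mc i (g \<otimes> h) a c = (\<Sum>b<dm i. mc i g a b * mc i h b c)"
 using co_rho[OF assms(1,2) rho_closed[OF assms(1,3) bas_closed[OF assms(1,5)]] assms(4)]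
  kG_module.act_mult[OF V_kG[OF assms(1)] assms(2,3) bas_closed[OF assms(1,5)]] by (simp add: mc_def)

lemma mc_one:
 assumes "i \<le> r" "a < dm i" "c < dm i"
 shows "mc i \<one> a c = (if a = c then 1 else 0)"
 using kG_module.act_one[OF V_kG[OF assms(1)] bas_closed[OF assms(1,3)]] co_bas[OF assms] by (simp add: mc_def)

lemma card_nz: "of_nat (card (carrier G)) \<noteq> (0::'k)"
 using char of_nat_eq_0_iff_char_dvd by blast

lemma dm_pos: "i \<le> r ==> 0 < dm i"
proof (rule ccontr)
 assume i: "i \<le> r" "\<not> 0 < dm i"
 interpret V: Module.module class_ring "V i" by (rule V_mod[OF i(1)])
 have "carrier (V i) \<subseteq> {\<zero>\<^sub>(V i)}" using V.coords_zero_imp[OF fr] i by auto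
 thus False using irr[OF i(1)] by (auto simp: irreducible_rep_def)
qed

text \<open>Schur's lemma for matrices. The hypothesis says that \<open>t\<close>, read as a map
  from \<open>V j\<close> to \<open>V i\<close>, is equivariant; it is therefore scalar if
  \<open>i = j\<close>, and zero otherwise since distinct indices belong to non-isomorphic
  representations.\<close>

lemma intertwiner:
 assumes i: "i \<le> r" "j \<le> r"
  and t: "!!h a d. h : carrier G ==> a < dm i ==> d < dm j ==>
   (\<Sum>a'<dm i. mc i h a a' * t a' d) = (\<Sum>d'<dm j. t a d' * mc j h d' d)"
 shows "EX c. ALL a<dm i. ALL d<dm j. t a d = (if i = j & a = d then c else 0)"
proof -
 interpret Vi: kG_module G "V i" "rho (V i)" by (rule V_kG[OF i(1)])
 interpret Vj: kG_module G "V j" "rho (V j)" by (rule V_kG[OF i(2)])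
 define T where "T v = (\<Oplus>\<^sub>(V i)a\<in>{..<dm i}. (\<Sum>d<dm j. t a d * co j v d) \<odot>\<^sub>(V i) bas i a)" for v
 have bi: "bas i : {..<dm i} \<rightarrow> carrier (V i)" using bas_closed i by auto
 have Tc: "T v : carrier (V i)" for v unfolding T_def using bi by auto
 have coT: "co i (T v) a = (\<Sum>d<dm j. t a d * co j v d)" if "a < dm i" for v a
  unfolding T_def using co_sum that i by simp
 have eqI: "x = y" if "x : carrier (V i)" "y : carrier (V i)" "!!a. a < dm i ==> co i x a = co i y a" for x y
  by (rule frame_eqI[OF V_mod[OF i(1)] fr[OF i(1)] that])
 have T: "T : kG_hom G (V j) (rho (V j)) (V i) (rho (V i))"
  unfolding kG_hom_def module_hom_def
 proof (intro CollectI conjI ballI allI impI; (elim conjE)?)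
  fix x y assume "x : carrier (V j)" "y : carrier (V j)"
  thus "T (x \<oplus>\<^sub>(V j) y) = T x \<oplus>\<^sub>(V i) T y"
   using i by (intro eqI) (simp_all add: Tc co_add coT sum.distrib distrib_left)
 next
  fix c x assume "x : carrier (V j)"
  thus "T (c \<odot>\<^sub>(V j) x) = c \<odot>\<^sub>(V i) T x"
   using i by (intro eqI) (simp_all add: Tc co_smult coT sum_distrib_left mult.left_commute)
 next
  fix g x assume g: "g : carrier G" "x : carrier (V j)"
  show "T (rho (V j) g x) = rho (V i) g (T x)"
  proof (rule eqI)
   fix a assume a: "a < dm i"
   have "co i (T (rho (V j) g x)) a = (\<Sum>d<dm j. t a d * (\<Sum>e<dm j. mc j g d e * co j x e))"
    using a g i by (simp add: coT co_rho)
   also have "\<dots> = (\<Sum>d<dm j. \<Sum>e<dm j. t a d * mc j g d e * co j x e)"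
    by (simp add: sum_distrib_left mult_ac)
   also have "\<dots> = (\<Sum>e<dm j. \<Sum>d<dm j. t a d * mc j g d e * co j x e)" by (rule sum.swap)
   also have "\<dots> = (\<Sum>e<dm j. (\<Sum>a'<dm i. mc i g a a' * t a' e) * co j x e)"
    using t[OF g(1) a] by (simp add: sum_distrib_right)
   also have "\<dots> = (\<Sum>e<dm j. \<Sum>a'<dm i. mc i g a a' * t a' e * co j x e)"
    by (simp add: sum_distrib_right)
   also have "\<dots> = (\<Sum>a'<dm i. \<Sum>e<dm j. mc i g a a' * t a' e * co j x e)" by (rule sum.swap)
   also have "\<dots> = (\<Sum>a'<dm i. mc i g a a' * co i (T x) a')"
    by (simp add: coT sum_distrib_left mult_ac)
   also have "\<dots> = co i (rho (V i) g (T x)) a" using a g i Tc by (simp add: co_rho)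
   finally show "co i (T (rho (V j) g x)) a = co i (rho (V i) g (T x)) a" .
  qed (use g i Tc rho_closed in auto)
 qed (use Tc in auto)
 have Tb: "co i (T (bas j d)) a = t a d" if "a < dm i" "d < dm j" for a d
 proof -
  have "co i (T (bas j d)) a = (\<Sum>e<dm j. if e = d then t a e else 0)"
   unfolding coT[OF that(1)] by (intro sum.cong refl) (use that i in \<open>simp add: co_bas\<close>)
  thus ?thesis using that by simp
 qed
 have co0: "co i \<zero>\<^sub>(V i) a = 0" if "a < dm i" for a
  using co_smult[of i "\<zero>\<^sub>(V i)" a 0] i that by simp
 show ?thesis
 proof (cases "i = j")
  case True
  obtain c where c: "ALL v:carrier (V i). T v = c \<odot>\<^sub>(V i) v"
   using schur_scalar[OF G.group_axioms fin irr[OF i(1)]] T True by blast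
  have "t a d = (if a = d then c else 0)" if "a < dm i" "d < dm j" for a d
   using Tb[OF that] c that True i bas_closed[of i d] by (auto simp: co_smult co_bas split: if_splits)
  thus ?thesis using True by auto
 next
  case False
  have "\<not> rep_iso G (V j) (V i)" using reps False i by (auto simp: irreducible_reps_def)
  hence "T v = \<zero>\<^sub>(V i)" if "v : carrier (V j)" for v
   using schur_iso(1)[OF irr[OF i(2)] irr[OF i(1)] T that] by blast
  hence "t a d = 0" if "a < dm i" "d < dm j" for a d
   using Tb[OF that] that i bas_closed[of j d] co0 by simp
  thus ?thesis using False by auto
 qed
qed

text \<open>For fixed \<open>b\<close> and \<open>c\<close>, the sum over \<open>g\<close> of
  \<open>g E_bc g^-1\<close> is equivariant, hence a scalar \<open>l\<close> or zero; its trace is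
  \<open>dim * l\<close>. The dimension is kept as a factor on the left, so that it is never divided
  by in \<open>k\<close>.\<close>

lemma orthogonality:
 assumes i: "i \<le> r" "j \<le> r" and ab: "a < dm i" "b < dm i" and cd: "c < dm j" "d < dm j"
 shows "of_nat (dm i) * (\<Sum>g\<in>carrier G. mc i g a b * mc j (inv g) c d) =
  (if i = j & a = d & b = c then of_nat (card (carrier G)) else 0)"
proof -
 define t where "t a d = (\<Sum>g\<in>carrier G. mc i g a b * mc j (inv g) c d)" for a d
 have tw: "(\<Sum>a'<dm i. mc i h a a' * t a' d) = (\<Sum>d'<dm j. t a d' * mc j h d' d)"
  if h: "h : carrier G" "a < dm i" "d < dm j" for h a d
 proof -
  have "(\<Sum>a'<dm i. mc i h a a' * t a' d) = (\<Sum>a'<dm i. \<Sum>g\<in>carrier G. mc i h a a' * mc i g a' b * mc j (inv g) c d)"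
   by (simp add: t_def sum_distrib_left mult_ac)
  also have "\<dots> = (\<Sum>g\<in>carrier G. \<Sum>a'<dm i. mc i h a a' * mc i g a' b * mc j (inv g) c d)" by (rule sum.swap)
  also have "\<dots> = (\<Sum>g\<in>carrier G. mc i (h \<otimes> g) a b * mc j (inv g) c d)"
   using h i ab by (intro sum.cong) (auto simp: mc_mult sum_distrib_right)
  \<comment> \<open>Substitute \<open>inv h \<otimes> g\<close> for \<open>g\<close>.\<close>
  also have "\<dots> = (\<Sum>g\<in>carrier G. mc i g a b * mc j (inv g \<otimes> h) c d)"
   using h by (intro sum.reindex_bij_witness[where i = "%g. inv h \<otimes> g" and j = "%g. h \<otimes> g"])
    (auto simp: G.m_assoc[symmetric] G.inv_mult_group, simp add: G.m_assoc)
  also have "\<dots> = (\<Sum>g\<in>carrier G. \<Sum>d'<dm j. mc i g a b * mc j (inv g) c d' * mc j h d' d)"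
   using h i cd by (intro sum.cong) (auto simp: mc_mult sum_distrib_left mult_ac)
  also have "\<dots> = (\<Sum>d'<dm j. \<Sum>g\<in>carrier G. mc i g a b * mc j (inv g) c d' * mc j h d' d)" by (rule sum.swap)
  also have "\<dots> = (\<Sum>d'<dm j. t a d' * mc j h d' d)" by (simp add: t_def sum_distrib_right)
  finally show ?thesis .
 qed
 obtain l where l: "!!a d. a < dm i ==> d < dm j ==> t a d = (if i = j & a = d then l else 0)"
  using intertwiner[OF i tw] by blast
 show ?thesis
 proof (cases "i = j")
  case True
  \<comment> \<open>The trace of \<open>t\<close> determines the scalar, because cyclically each
    summand contains the matrix of \<open>inv g \<otimes> g\<close>.\<close>
  have "of_nat (dm i) * l = (\<Sum>a<dm i. t a a)" using l True by simp
  also have "\<dots> = (\<Sum>g\<in>carrier G. \<Sum>a<dm i. mc i (inv g) c a * mc i g a b)"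
   unfolding t_def True by (subst sum.swap) (simp add: mult.commute)
  also have "\<dots> = (\<Sum>g\<in>carrier G. mc i (inv g \<otimes> g) c b)"
   using ab cd True by (intro sum.cong refl mc_mult[OF i(1), symmetric]) auto
  also have "\<dots> = (if b = c then of_nat (card (carrier G)) else 0)"
   using mc_one[OF i(1), of c b] ab cd True by simp
  finally show ?thesis using l[OF ab(1) cd(2)] True unfolding t_def by auto
 next
  case False
  thus ?thesis using l[OF ab(1) cd(2)] unfolding t_def by simp
 qed
qed

lemma orthogonality':
 assumes i: "i \<le> r" "j \<le> r" and ab: "a < dm i" "b < dm i" and cd: "c < dm j" "d < dm j"
 shows "(\<Sum>g\<in>carrier G. idem i b a g * mc j g c d) = (if i = j & a = d & b = c then 1 else 0)"
proof -
 have "(\<Sum>g\<in>carrier G. idem i b a g * mc j g c d) =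
  of_nat (dm i) * (\<Sum>g\<in>carrier G. mc i (inv g) a b * mc j g c d) / of_nat (card (carrier G))"
  by (simp add: idem_def sum_distrib_left mult_ac sum_divide_distrib)
 also have "(\<Sum>g\<in>carrier G. mc i (inv g) a b * mc j g c d) = (\<Sum>g\<in>carrier G. mc i g a b * mc j (inv g) c d)"
  by (intro sum.reindex_bij_witness[where i = "%g. inv g" and j = "%g. inv g"]) auto
 finally show ?thesis using orthogonality[OF assms] card_nz by auto
qed

lemma idem_bas:
 assumes i: "i \<le> r" "j \<le> r" and ab: "a < dm i" "b < dm i" and d: "d < dm j"
 shows "galg_act G (V j) (rho (V j)) (idem i b a) (bas j d) = (if i = j & a = d then bas j b else \<zero>\<^sub>(V j))"
proof -
 interpret V: kG_module G "V j" "rho (V j)" by (rule V_kG[OF i(2)])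
 note bd = bas_closed[OF i(2) d]
 show ?thesis
 proof (rule frame_eqI[OF V_mod[OF i(2)] fr[OF i(2)]])
  fix c assume c: "c < dm j"
  have "co j (galg_act G (V j) (rho (V j)) (idem i b a) (bas j d)) c =
    (\<Sum>g\<in>carrier G. co j (idem i b a g \<odot>\<^sub>(V j) rho (V j) g (bas j d)) c)"
   unfolding galg_act_def using i c fin bd by (intro coords_finsum[OF V_mod fr]) auto
  also have "\<dots> = (\<Sum>g\<in>carrier G. idem i b a g * mc j g c d)"
   using i c bd by (intro sum.cong) (auto simp: co_smult mc_def)
  also have "\<dots> = (if i = j & a = d & b = c then 1 else 0)" by (rule orthogonality'[OF i ab c d])
  also have "\<dots> = co j (if i = j & a = d then bas j b else \<zero>\<^sub>(V j)) c"
   using co_bas[of j c b] co_smult[of j "\<zero>\<^sub>(V j)" c 0] i c ab by auto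
  finally show "co j (galg_act G (V j) (rho (V j)) (idem i b a) (bas j d)) c =
   co j (if i = j & a = d then bas j b else \<zero>\<^sub>(V j)) c" .
 qed (use bd bas_closed[of j b] i ab in auto)
qed

text \<open>The multiplication rule of matrix units, \<open>E_ba E_dc = E_bc\<close> if
  \<open>a = d\<close> and zero otherwise; expanding \<open>mc j (inv g \<otimes> h)\<close> reduces
  it to \<open>orthogonality'\<close>.\<close>

lemma conv_idem:
 assumes i: "i \<le> r" "j \<le> r" and ab: "a < dm i" "b < dm i" and cd: "c < dm j" "d < dm j" and g: "g : carrier G"
 shows "conv G (idem i b a) (idem j d c) g = (if i = j & a = d then idem i b c g else 0)"
proof -
 let ?q = "of_nat (dm j) / of_nat (card (carrier G)) :: 'k"
 have "conv G (idem i b a) (idem j d c) g = (\<Sum>h\<in>carrier G. idem i b a h * (?q * mc j (inv g \<otimes> h) c d))"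
  unfolding conv_def idem_def[of j] using g by (intro sum.cong) (auto simp: G.inv_mult_group)
 also have "\<dots> = (\<Sum>h\<in>carrier G. \<Sum>f<dm j. ?q * mc j (inv g) c f * (idem i b a h * mc j h f d))"
  using g i cd by (intro sum.cong) (auto simp: mc_mult sum_distrib_left mult_ac)
 also have "\<dots> = (\<Sum>f<dm j. \<Sum>h\<in>carrier G. ?q * mc j (inv g) c f * (idem i b a h * mc j h f d))" by (rule sum.swap)
 also have "\<dots> = (\<Sum>f<dm j. ?q * mc j (inv g) c f * (if i = j & a = d & b = f then 1 else 0))"
  using orthogonality'[OF i ab _ cd(2)] by (intro sum.cong refl) (simp only: sum_distrib_left[symmetric] lessThan_iff)
 also have "\<dots> = (\<Sum>f<dm j. if f = b then (if i = j & a = d then ?q * mc j (inv g) c f else 0) else 0)"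
  by (intro sum.cong) auto
 also have "\<dots> = (if i = j & a = d then idem i b c g else 0)"
  using ab i by (auto simp: idem_def)
 finally show ?thesis .
qed

text \<open>Convolution with the delta function at \<open>h\<close> is multiplication by the group
  element \<open>h\<close>. On the right it acts on the second index of \<open>idem\<close>, on the
  left on the first; by the second formula the elements \<open>idem i b a\<close> with fixed
  \<open>a\<close> transform like the basis of \<open>V i\<close>.\<close>

lemma conv_idem_delta:
 assumes i: "i \<le> r" and ab: "a < dm i" "b < dm i" and g: "g : carrier G" "h : carrier G"
 shows "conv G (idem i b a) (%x. if x = h then 1 else 0) g = (\<Sum>c<dm i. mc i h a c * idem i b c g)" (is "PROP ?P1")
  and "conv G (%x. if x = h then 1 else 0) (idem i b a) g = (\<Sum>c<dm i. mc i h c b * idem i c a g)" (is "PROP ?P2")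
proof -
 let ?q = "of_nat (dm i) / of_nat (card (carrier G)) :: 'k"
 have "conv G (idem i b a) (%x. if x = h then 1 else 0) g = (\<Sum>x\<in>carrier G. if x = g \<otimes> inv h then idem i b a x else 0)"
  unfolding conv_def
 proof (intro sum.cong refl)
  fix x assume x: "x : carrier G"
  have "inv x \<otimes> g = h \<longleftrightarrow> x = g \<otimes> inv h"
   using x g by (metis G.inv_closed G.inv_solve_left G.inv_solve_right)
  thus "idem i b a x * (if inv x \<otimes> g = h then 1 else 0) = (if x = g \<otimes> inv h then idem i b a x else 0)" by simp
 qed
 also have "\<dots> = idem i b a (g \<otimes> inv h)" using fin g by simp
 also have "\<dots> = ?q * mc i (h \<otimes> inv g) a b" using g by (simp add: idem_def G.inv_mult_group)
 also have "\<dots> = (\<Sum>c<dm i. mc i h a c * idem i b c g)"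
  using i ab g by (simp add: mc_mult idem_def sum_distrib_left mult_ac)
 finally show "PROP ?P1" .
 have "conv G (%x. if x = h then 1 else 0) (idem i b a) g = (\<Sum>x\<in>carrier G. if x = h then idem i b a (inv x \<otimes> g) else 0)"
  unfolding conv_def by (intro sum.cong) auto
 also have "\<dots> = idem i b a (inv h \<otimes> g)" using fin g by simp
 also have "\<dots> = ?q * mc i (inv g \<otimes> h) a b" using g by (simp add: idem_def G.inv_mult_group)
 also have "\<dots> = (\<Sum>c<dm i. mc i h c b * idem i c a g)"
  using i ab g by (simp add: mc_mult idem_def sum_distrib_left mult_ac)
 finally show "PROP ?P2" .
qed

end

section \<open>Irreducible subrepresentations\<close>

text \<open>Independent subsets of \<open>U\<close> have at most \<open>dim\<close> elements; one of
  maximal size spans \<open>U\<close>, since a vector outside its span could be adjoined.\<close>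

lemma (in vectorspace) subspace_basis:
 assumes fd: "fin_dim" and U: "VectorSpace.subspace K U V"
 shows "EX A. finite A & A \<subseteq> U & lin_indpt A & span A = U"
proof -
 have sm: "submodule K U V" using U by simp
 hence UV: "U \<subseteq> carrier V" by (simp add: submodule_def)
 let ?P = "%A. A \<subseteq> U & lin_indpt A"
 have "?P {}" by (auto simp: lin_dep_def)
 moreover have "ALL A. ?P A --> card A < Suc dim" using li_le_dim[OF fd] UV by (auto simp: less_Suc_eq_le)
 ultimately obtain A where A: "?P A" "!!B. ?P B ==> card B \<le> card A"
  using ex_has_greatest_nat[of ?P "{}" card "Suc dim"] by blast
 have fA: "finite A" using li_le_dim[OF fd] UV A by blast
 have "span A = U"
 proof
  show "span A \<subseteq> U" using span_is_subset[OF _ sm] A by blast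
  show "U \<subseteq> span A"
  proof
   fix v assume v: "v : U"
   show "v : span A"
   proof (cases "v : A")
    case True
    thus ?thesis using in_own_span[of A] A UV by blast
   next
    case False
    have "\<not> ?P (A \<union> {v})" using A(2)[of "A \<union> {v}"] False fA by auto
    thus ?thesis using lin_dep_iff_in_span[of A v] A(1) UV v False by blast
   qed
  qed
 qed
 thus ?thesis using A fA by blast
qed

text \<open>The exchange lemma extends \<open>A\<close> by at most \<open>card B - card A\<close>
  vectors to a set with the span of \<open>B\<close>; here that leaves no vector to add.\<close>

lemma (in vectorspace) span_eq_of_card:
 assumes "finite A" "finite B" "B \<subseteq> carrier V" "lin_indpt A" "A \<subseteq> span B" "card B \<le> card A"
 shows "span A = span B"
proof -
 obtain C where C: "finite C" "int (card C) \<le> int (card B) - int (card A)" "span (A \<union> C) = span B"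
  using replacement[OF assms(1-5)] by blast
 have "card C = 0" using C(2) assms(6) by linarith
 hence "C = {}" using C(1) by simp
 thus ?thesis using C by simp
qed

text \<open>A minimal nonzero invariant subspace is irreducible.\<close>
lemma irreducible_subrep_exists:
 assumes G: "group G" and W: "VectorSpace.subspace class_ring W Z" "W \<noteq> {\<zero>\<^sub>Z}"
  "!!g. g : carrier G ==> rho Z g ` W \<subseteq> W" and Z: "representation G Z"
 shows "\<exists>U \<subseteq> W. irreducible_rep G (Z\<lparr>carrier := U\<rparr>)"
proof -
 interpret Z: vectorspace class_ring Z using Z by (simp add: representation_def)
 have fd: Z.fin_dim using Z by (simp add: representation_def)
 \<comment> \<open>\<open>St\<close> describes the nonzero invariant subspaces inside
   \<open>W\<close>. Minimality is measured by the size of a basis, hence by a natural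
   number.\<close>
 define St where "St U \<longleftrightarrow> VectorSpace.subspace class_ring U Z & U \<noteq> {\<zero>\<^sub>Z} &
  (ALL g:carrier G. rho Z g ` U \<subseteq> U) & U \<subseteq> W" for U
 define Q where "Q A \<longleftrightarrow> finite A & A \<subseteq> carrier Z & Z.lin_indpt A & St (Z.span A)" for A
 have sub: "U \<subseteq> carrier Z" if "VectorSpace.subspace class_ring U Z" for U
  using Z.is_module[OF that] by (simp add: submodule_def)
 have ex: "EX A. Q A & A \<subseteq> U & Z.span A = U" if "St U" for U
 proof -
  have s: "VectorSpace.subspace class_ring U Z" using that by (simp add: St_def)
  from Z.subspace_basis[OF fd s] obtain A where "finite A" "A \<subseteq> U" "Z.lin_indpt A" "Z.span A = U" by blast
  thus ?thesis using that sub[OF s] by (intro exI[of _ A]) (auto simp: Q_def)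
 qed
 have "St W" using W by (simp add: St_def)
 then obtain A0 where "Q A0" using ex by blast
 from ex_has_least_nat[of Q, OF this, of card]
 obtain A where QA: "Q A" and min: "!!B. Q B ==> card A \<le> card B" by blast
 hence A: "finite A" "A \<subseteq> carrier Z" "Z.lin_indpt A" "St (Z.span A)" by (auto simp: Q_def)
 define U where "U = Z.span A"
 have StU: "St U" using A by (simp add: U_def)
 have smU: "submodule class_ring U Z" using StU Z.is_module by (simp add: St_def)
 interpret U: vectorspace class_ring "Z\<lparr>carrier := U\<rparr>" using Z.subspace_is_vs StU by (simp add: St_def)
 have AU: "A \<subseteq> U" unfolding U_def by (rule Z.in_own_span[OF A(2)])
 have fdU: "U.fin_dim"
  unfolding U.fin_dim_def using A AU Z.span_li_not_depend(1)[OF AU smU] by (auto simp: U_def)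
 have inv: "rho Z g u : U" if "g : carrier G" "u : U" for g u using that StU by (auto simp: St_def)
 have UZ: "U \<subseteq> carrier Z" using sub StU by (simp add: St_def)
 have rep: "representation G (Z\<lparr>carrier := U\<rparr>)"
  unfolding representation_def
 proof (intro conjI ballI)
  show "vectorspace class_ring (Z\<lparr>carrier := U\<rparr>)" by unfold_locales
  show "vectorspace.fin_dim class_ring (Z\<lparr>carrier := U\<rparr>)" by (rule fdU)
  fix g assume g: "g : carrier G"
  have "rho Z g : module_hom class_ring Z Z" using Z g by (simp add: representation_def)
  thus "rho (Z\<lparr>carrier := U\<rparr>) g : module_hom class_ring (Z\<lparr>carrier := U\<rparr>) (Z\<lparr>carrier := U\<rparr>)"
   using UZ inv[OF g] unfolding module_hom_def by (auto simp: subset_iff)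
 qed (use Z UZ in \<open>auto simp: representation_def subset_iff\<close>)
 have "irreducible_rep G (Z\<lparr>carrier := U\<rparr>)"
  unfolding irreducible_rep_def
 proof (intro conjI allI impI)
  show "carrier (Z\<lparr>carrier := U\<rparr>) \<noteq> {\<zero>\<^sub>(Z\<lparr>carrier := U\<rparr>)}" using StU by (simp add: St_def)
  fix U' assume U': "VectorSpace.subspace class_ring U' (Z\<lparr>carrier := U\<rparr>) &
   (ALL g:carrier G. rho (Z\<lparr>carrier := U\<rparr>) g ` U' \<subseteq> U')"
  have smU': "submodule class_ring U' (Z\<lparr>carrier := U\<rparr>)" using U' U.is_module by blast
  hence U'U: "U' \<subseteq> U" by (simp add: submodule_def)
  have "submodule class_ring U' Z"
   using smU' U'U UZ Z.module_axioms by (auto simp: submodule_def)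
  hence sU': "VectorSpace.subspace class_ring U' Z" using Z.vectorspace_axioms by (simp add: VectorSpace.subspace_def)
  show "U' = {\<zero>\<^sub>(Z\<lparr>carrier := U\<rparr>)} \<or> U' = carrier (Z\<lparr>carrier := U\<rparr>)"
  proof (cases "U' = {\<zero>\<^sub>Z}")
   case False
   hence "St U'" using sU' U' U'U StU by (auto simp: St_def)
   then obtain B where B: "Q B" "B \<subseteq> U'" "Z.span B = U'" using ex by blast
   \<comment> \<open>By minimality the basis \<open>B\<close> of the smaller subspace has at least
     as many elements as \<open>A\<close>, so both span the same space.\<close>
   have "B \<subseteq> Z.span A" using B(2) U'U by (simp add: U_def)
   hence "Z.span B = Z.span A"
    using Z.span_eq_of_card[of B A] B(1) A min[OF B(1)] by (simp add: Q_def)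
   thus ?thesis using B by (simp add: U_def)
  qed simp
 qed (rule rep)
 thus ?thesis using StU unfolding St_def by blast
qed

text \<open>The regular representation, realised on functions of \<open>nat\<close> through an enumeration \<open>\<gamma>\<close> of the group.\<close>
definition reg_rep :: "('g, 'h) monoid_scheme => (nat => 'g) => ('k::field, nat => 'k, 'g) rep" where
 "reg_rep G \<gamma> = \<lparr>carrier = {z. \<forall>j\<ge>card (carrier G). z j = 0}, mult = undefined, one = undefined,
   ring.zero = (%_. 0), add = (%x y j. x j + y j), smult = (%c x j. c * x j),
   rho = (%g z j. if j < card (carrier G)
    then z (the_inv_into {..<card (carrier G)} \<gamma> (inv\<^bsub>G\<^esub> g \<otimes>\<^sub>G \<gamma> j)) else 0)\<rparr>"

context
 fixes G :: "('g, 'h) monoid_scheme" (structure) and \<gamma> :: "nat => 'g"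
 assumes G: "group G" and fin: "finite (carrier G)" and \<gamma>: "bij_betw \<gamma> {..<card (carrier G)} (carrier G)"
begin

interpretation G: group G by (rule G)

abbreviation (input) Zr :: "('k::field, nat => 'k, 'g) rep" where "Zr \<equiv> reg_rep G \<gamma>"
abbreviation (input) ix where "ix \<equiv> the_inv_into {..<card (carrier G)} \<gamma>"

lemma ix_bound: "g : carrier G ==> ix g < card (carrier G)"
 using bij_betw_apply[OF bij_betw_the_inv_into[OF \<gamma>]] by auto

lemma gamma_ix: "g : carrier G ==> \<gamma> (ix g) = g"
 by (rule f_the_inv_into_f_bij_betw[OF \<gamma>])

lemma ix_gamma: "j < card (carrier G) ==> ix (\<gamma> j) = j"
 using the_inv_into_f_f[of \<gamma> "{..<card (carrier G)}" j] \<gamma> by (auto simp: bij_betw_def)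

lemma gamma_closed: "j < card (carrier G) ==> \<gamma> j : carrier G"
 using \<gamma> by (auto simp: bij_betw_def)

lemma reg_module: "module class_ring (Zr :: ('k::field, nat => 'k, 'g) rep)"
proof (rule module_criteria)
 show "cring (class_ring :: 'k ring)" ..
 show "ALL v:carrier Zr. EX neg_v:carrier Zr. v \<oplus>\<^sub>Zr neg_v = \<zero>\<^sub>(Zr :: ('k, nat => 'k, 'g) rep)"
 proof
  fix v :: "nat => 'k" assume "v : carrier Zr"
  thus "EX neg_v:carrier Zr. v \<oplus>\<^sub>Zr neg_v = \<zero>\<^sub>(Zr :: ('k, nat => 'k, 'g) rep)"
   by (intro bexI[where x = "%j. - v j"]) (auto simp: reg_rep_def)
 qed
qed (auto simp: reg_rep_def algebra_simps)

lemma reg_kG_module: "kG_module G (Zr :: ('k::field, nat => 'k, 'g) rep) (rho Zr)"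
proof -
 interpret Z: Module.module class_ring "Zr :: ('k, nat => 'k, 'g) rep" by (rule reg_module)
 show ?thesis
 proof (unfold_locales, goal_cases)
  case (2 g) thus ?case by (auto simp: module_hom_def reg_rep_def)
 next
  case (3 m) thus ?case
   by (intro ext) (auto simp: reg_rep_def ix_gamma gamma_closed not_less)
 next
  case (4 g h m)
  show ?case
  proof
   fix j
   have "inv (g \<otimes> h) \<otimes> \<gamma> j = inv h \<otimes> (inv g \<otimes> \<gamma> j)" if "j < card (carrier G)"
    using 4 gamma_closed[OF that] by (simp add: G.inv_mult_group G.m_assoc)
   thus "rho (Zr :: ('k, nat => 'k, 'g) rep) (g \<otimes> h) m j = rho Zr g (rho Zr h m) j"
    using 4 gamma_closed[of j] by (auto simp: reg_rep_def gamma_ix ix_bound)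
  qed
 qed (rule fin)
qed

lemma reg_finsum:
 "finite S ==> f : S \<rightarrow> carrier (Zr :: ('k::field, nat => 'k, 'g) rep) ==>
  finsum (Zr :: ('k, nat => 'k, 'g) rep) f S j = (\<Sum>s\<in>S. f s j)"
proof (induction S rule: finite_induct)
 case empty
 interpret Z: Module.module class_ring "Zr :: ('k, nat => 'k, 'g) rep" by (rule reg_module)
 show ?case by (simp, simp add: reg_rep_def)
next
 case (insert s S)
 interpret Z: Module.module class_ring "Zr :: ('k, nat => 'k, 'g) rep" by (rule reg_module)
 have "finsum Zr f (insert s S) = f s \<oplus>\<^sub>Zr finsum Zr f S" using insert by (intro Z.finsum_insert) auto
 thus ?case using insert by (simp, simp add: reg_rep_def)
qed

text \<open>The delta functions at the indices below \<open>card (carrier G)\<close> form a frame.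
  The underlying type \<open>nat => 'k\<close> is the one on which \<open>irreducible_reps\<close>
  tests completeness, so every irreducible subspace of this representation is isomorphic to some
  \<open>V i\<close>.\<close>

lemma reg_rep: "representation G (Zr :: ('k::field, nat => 'k, 'g) rep)"
proof -
 interpret Z: kG_module G "Zr :: ('k, nat => 'k, 'g) rep" "rho Zr" by (rule reg_kG_module)
 interpret Z: vectorspace class_ring "Zr :: ('k, nat => 'k, 'g) rep"
  by (simp add: vectorspace_def Z.module_axioms class_field)
 let ?n = "card (carrier G)"
 let ?b = "%i j::nat. if j = i then 1 else 0 :: 'k"
 have sum: "(\<Oplus>\<^sub>Zr i\<in>{..<?n}. c i \<odot>\<^sub>Zr ?b i) j = (if j < ?n then c j else 0)" for c j
 proof -
  have "(\<Oplus>\<^sub>Zr i\<in>{..<?n}. c i \<odot>\<^sub>Zr ?b i) j = (\<Sum>i<?n. (c i \<odot>\<^sub>Zr ?b i) j)"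
   by (intro reg_finsum) (auto simp: reg_rep_def)
  also have "\<dots> = (\<Sum>i<?n. if i = j then c i else 0)" by (intro sum.cong) (auto simp: reg_rep_def)
  finally show ?thesis by simp
 qed
 have "frame class_ring (Zr :: ('k, nat => 'k, 'g) rep) ?n ?b"
 proof (rule Z.frameI)
  show "?b : {..<?n} \<rightarrow> carrier Zr" by (auto simp: reg_rep_def)
 next
  fix m assume m: "m : carrier (Zr :: ('k, nat => 'k, 'g) rep)"
  have "m = (\<Oplus>\<^sub>Zr i\<in>{..<?n}. m i \<odot>\<^sub>Zr ?b i)"
   using m by (intro ext, subst sum) (auto simp: reg_rep_def not_less)
  thus "EX c : {..<?n} \<rightarrow> carrier class_ring. m = (\<Oplus>\<^sub>Zr i\<in>{..<?n}. c i \<odot>\<^sub>Zr ?b i)" by auto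
 next
  fix c :: "nat => 'k" and j assume "(\<Oplus>\<^sub>Zr i\<in>{..<?n}. c i \<odot>\<^sub>Zr ?b i) = \<zero>\<^sub>Zr" "j < ?n"
  thus "c j = \<zero>\<^sub>class_ring" using sum[of c j] by (simp add: reg_rep_def)
 qed
 hence "Z.fin_dim" by (rule Z.frame_fin_dim)
 thus ?thesis
  unfolding representation_def using Z.vectorspace_axioms Z.act_hom Z.act_one Z.act_mult by auto
qed

text \<open>The regular representation loses nothing: applying \<open>x\<close> to the delta
  function at the identity returns \<open>x\<close> itself, listed along
  \<open>\<gamma>\<close>.\<close>

lemma reg_galg_act:
 fixes x :: "'g => 'k::field"
 assumes "j < card (carrier G)"
 shows "galg_act G Zr (rho Zr) x (%i. if i = ix \<one> then 1 else 0) j = x (\<gamma> j)"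
proof -
 have "galg_act G Zr (rho Zr) x (%i. if i = ix \<one> then 1 else 0) j =
  (\<Sum>g\<in>carrier G. (x g \<odot>\<^sub>Zr rho Zr g (%i. if i = ix \<one> then 1 else 0)) j)"
  unfolding galg_act_def by (intro reg_finsum fin) (auto simp: reg_rep_def)
 also have "\<dots> = (\<Sum>g\<in>carrier G. if g = \<gamma> j then x g else 0)"
 proof (intro sum.cong refl)
  fix g assume g: "g : carrier G"
  have gj: "\<gamma> j : carrier G" using gamma_closed assms by blast
  have "ix (inv g \<otimes> \<gamma> j) = ix \<one> \<longleftrightarrow> inv g \<otimes> \<gamma> j = \<one>"
  proof
   assume e: "ix (inv g \<otimes> \<gamma> j) = ix \<one>"
   show "inv g \<otimes> \<gamma> j = \<one>" using arg_cong[OF e, of \<gamma>] by (simp add: gamma_ix g gj)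
  qed simp
  also have "\<dots> \<longleftrightarrow> g = \<gamma> j"
   using g gj by (metis G.inv_closed G.inv_equality G.inv_inv G.l_inv)
  finally show "(x g \<odot>\<^sub>Zr rho Zr g (%i. if i = ix \<one> then 1 else 0)) j = (if g = \<gamma> j then x g else 0)"
   using assms by (simp add: reg_rep_def)
 qed
 also have "\<dots> = x (\<gamma> j)" using fin gamma_closed[OF assms] by simp
 finally show ?thesis .
qed

end

section \<open>Completeness of the matrix units\<close>

context irreps
begin

text \<open>The left ideal of \<open>k[G]\<close> killed by all \<open>idem i b a\<close> contains no irreducible submodule, so it is zero.\<close>
lemma idem_complete:
 assumes g: "g : carrier G"
 shows "(\<Sum>i\<le>r. \<Sum>a<dm i. idem i a a g) = (if g = \<one> then 1 else 0)"
proof -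
 obtain \<gamma> where "bij_betw \<gamma> {0..<card (carrier G)} (carrier G)" using ex_bij_betw_nat_finite[OF fin] by blast
 hence \<gamma>: "bij_betw \<gamma> {..<card (carrier G)} (carrier G)" by (simp add: atLeast0LessThan)
 define Z :: "('k, nat => 'k, 'g) rep" where "Z = reg_rep G \<gamma>"
 have rep: "representation G Z" unfolding Z_def by (rule reg_rep[OF G.group_axioms fin \<gamma>])
 interpret Z: kG_module G Z "rho Z" unfolding Z_def by (rule reg_kG_module[OF G.group_axioms fin \<gamma>])
 interpret Zv: vectorspace class_ring Z using rep by (simp add: representation_def)
 \<comment> \<open>Everything killed by all matrix units. It is invariant because
   \<open>idem i b a\<close> times \<open>h\<close> is a combination of the
   \<open>idem i b c\<close>.\<close>
 define W where "W = {z : carrier Z. \<forall>i\<le>r. ALL a<dm i. ALL b<dm i. Z.ga (idem i b a) z = \<zero>\<^sub>Z}"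
 have "VectorSpace.subspace class_ring W Z"
  unfolding VectorSpace.subspace_def submodule_def
  using Zv.vectorspace_axioms Z.module_axioms by (auto simp: W_def Z.ga_add Z.ga_smult)
 moreover have "rho Z h ` W \<subseteq> W" if h: "h : carrier G" for h
 proof safe
  fix z assume z: "z : W"
  hence zc: "z : carrier Z" by (simp add: W_def)
  have "Z.ga (idem i b a) (rho Z h z) = \<zero>\<^sub>Z" if i: "i \<le> r" "a < dm i" "b < dm i" for i a b
  proof -
   have "Z.ga (idem i b a) (rho Z h z) = Z.ga (conv G (idem i b a) (%x. if x = h then 1 else 0)) z"
    using zc h by (simp add: Z.ga_conv[symmetric] Z.ga_delta)
   also have "\<dots> = Z.ga (%g. \<Sum>c<dm i. mc i h a c * idem i b c g) z"
    using i h zc by (intro Z.ga_cong conv_idem_delta) auto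
   also have "\<dots> = (\<Oplus>\<^sub>Z c\<in>{..<dm i}. \<zero>\<^sub>Z)"
    unfolding Z.ga_sum_left[OF finite_lessThan zc]
    using z i by (intro Z.finsum_cong') (auto simp: Z.ga_scale_left[OF zc] W_def)
   finally show ?thesis by simp
  qed
  thus "rho Z h z : W" using zc h by (simp add: W_def)
 qed
 \<comment> \<open>An irreducible subspace of \<open>W\<close> would be isomorphic to some
   \<open>V i\<close>, where \<open>idem i 0 0\<close> fixes \<open>bas i 0\<close>, although it
   kills \<open>W\<close>.\<close>
 moreover have False if U: "U \<subseteq> W" "irreducible_rep G (Z\<lparr>carrier := U\<rparr>)" for U
 proof -
  let ?U = "Z\<lparr>carrier := U\<rparr>"
  have rU: "representation G ?U" using U by (simp add: irreducible_rep_def)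
  interpret U: kG_module G ?U "rho ?U" by (rule representation_kG_module[OF G.group_axioms fin rU])
  obtain i where i: "i \<le> r" "rep_iso G ?U (V i)" using reps U by (auto simp: irreducible_reps_def)
  interpret V: kG_module G "V i" "rho (V i)" by (rule V_kG[OF i(1)])
  obtain T where T: "T : kG_hom G ?U (rho ?U) (V i) (rho (V i))" "bij_betw T (carrier ?U) (carrier (V i))"
   using i(2) by (auto simp: rep_iso_def kG_hom_def)
  have d: "0 < dm i" by (rule dm_pos[OF i(1)])
  have "bas i 0 : T ` carrier ?U" using T(2) bas_closed[OF i(1) d] by (simp add: bij_betw_def)
  then obtain u where u: "u : carrier ?U" "T u = bas i 0" by (elim imageE) simp
  have "id : kG_hom G ?U (rho ?U) Z (rho Z)"
   using U by (auto simp: kG_hom_def module_hom_def W_def)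
  from kG_hom_ga[OF U.kG_module_axioms Z.kG_module_axioms this u(1)]
  have "U.ga (idem i 0 0) u = Z.ga (idem i 0 0) u" by simp
  also have "\<dots> = \<zero>\<^sub>?U" using u U i d by (auto simp: W_def)
  finally have "T \<zero>\<^sub>?U = V.ga (idem i 0 0) (bas i 0)"
   using kG_hom_ga[OF U.kG_module_axioms V.kG_module_axioms T(1) u(1)] u(2) by metis
  also have "\<dots> = bas i 0" using idem_bas[OF i(1) i(1) d d d] by simp
  finally have "T \<zero>\<^sub>?U = bas i 0" .
  moreover have "T \<zero>\<^sub>?U = \<zero>\<^sub>(V i)"
   using mod_hom_finsum[of ?U "V i" T "%_. \<zero>\<^sub>?U" "{}"] T(1) U.abelian_group_axioms V.abelian_group_axioms
   by (auto simp: kG_hom_def module_hom_def)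
  ultimately have "co i (bas i 0) 0 = co i (0 \<odot>\<^sub>(V i) bas i 0) 0"
   using bas_closed[OF i(1) d] by simp
  thus False using co_bas[OF i(1) d d] co_smult[OF i(1) bas_closed[OF i(1) d] d, of 0] by simp
 qed
 ultimately have W0: "W = {\<zero>\<^sub>Z}"
  using irreducible_subrep_exists[OF G.group_axioms _ _ _ rep, of W] by blast
 \<comment> \<open>The defect of the asserted identity. Each \<open>idem j d c\<close> annihilates
   it from the left, so \<open>x\<close> applied to \<open>z0\<close> lies in \<open>W\<close>,
   which is zero, and \<open>z0\<close> recovers all coefficients of \<open>x\<close>.\<close>
 define x :: "'g => 'k" where "x h = (if h = \<one> then 1 else 0) - (\<Sum>i\<le>r. \<Sum>a<dm i. idem i a a h)" for h
 let ?ix = "the_inv_into {..<card (carrier G)} \<gamma>"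
 define z0 :: "nat => 'k" where "z0 = (%i. if i = ?ix \<one> then 1 else 0)"
 have z0: "z0 : carrier Z"
  using ix_bound[OF G.group_axioms fin \<gamma> G.one_closed] by (auto simp: z0_def Z_def reg_rep_def)
 have "Z.ga (idem j d c) (Z.ga x z0) = \<zero>\<^sub>Z" if j: "j \<le> r" "c < dm j" "d < dm j" for j c d
 proof -
  have "conv G (idem j d c) x h = 0" if h: "h : carrier G" for h
  proof -
   have "conv G (idem j d c) x h = conv G (idem j d c) (%h. if h = \<one> then 1 else 0) h
     - (\<Sum>i\<le>r. \<Sum>a<dm i. conv G (idem j d c) (idem i a a) h)"
   proof -
    have "(\<Sum>k\<in>carrier G. \<Sum>i\<le>r. \<Sum>a<dm i. idem j d c k * idem i a a (inv k \<otimes> h)) =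
     (\<Sum>i\<le>r. \<Sum>a<dm i. \<Sum>k\<in>carrier G. idem j d c k * idem i a a (inv k \<otimes> h))"
     by (subst sum.swap, intro sum.cong refl, rule sum.swap)
    thus ?thesis
     unfolding conv_def x_def by (simp only: right_diff_distrib sum_subtractf sum_distrib_left)
   qed
   also have "conv G (idem j d c) (%h. if h = \<one> then 1 else 0) h = (\<Sum>a<dm j. mc j \<one> c a * idem j d a h)"
    using j h by (intro conv_idem_delta) auto
   also have "\<dots> = (\<Sum>a<dm j. if a = c then idem j d a h else 0)"
    using j by (intro sum.cong) (auto simp: mc_one)
   also have "\<dots> = idem j d c h" using j by simp
   also have "(\<Sum>i\<le>r. \<Sum>a<dm i. conv G (idem j d c) (idem i a a) h) =
     (\<Sum>i\<le>r. if i = j then idem j d c h else 0)"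
   proof (intro sum.cong refl)
    fix i assume i: "i : {..r}"
    have "(\<Sum>a<dm i. conv G (idem j d c) (idem i a a) h) = (\<Sum>a<dm i. if a = c then (if i = j then idem j d a h else 0) else 0)"
     using j i h by (intro sum.cong) (auto simp: conv_idem)
    thus "(\<Sum>a<dm i. conv G (idem j d c) (idem i a a) h) = (if i = j then idem j d c h else 0)"
     using j by simp
   qed
   also have "\<dots> = idem j d c h" using j by simp
   finally show ?thesis by simp
  qed
  hence "Z.ga (conv G (idem j d c) x) z0 = Z.ga (%_. 0) z0" using z0 by (intro Z.ga_cong) auto
  thus ?thesis using z0 by (simp add: Z.ga_conv Z.ga_zero_left)
 qed
 hence "Z.ga x z0 : W" using z0 by (auto simp: W_def)
 hence "Z.ga x z0 = \<zero>\<^sub>Z" using W0 by blast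
 moreover have "Z.ga x z0 (?ix g) = x (\<gamma> (?ix g))"
  unfolding Z_def z0_def
  by (rule reg_galg_act[OF G.group_axioms fin \<gamma> ix_bound[OF G.group_axioms fin \<gamma> g]])
 ultimately have "x g = 0"
  using gamma_ix[OF G.group_axioms fin \<gamma> g] by (simp add: Z_def reg_rep_def)
 thus ?thesis by (simp add: x_def)
qed

end

section \<open>Isotypic projections of a module\<close>

locale irreps_module = irreps G r V + M: kG_module G M act
 for G :: "('g, 'h) monoid_scheme" (structure) and r :: nat and V :: "nat => ('k::alg_closed_field, 'v, 'g) rep"
  and M :: "('k, 'm, 'w) module_scheme" and act :: "'g => 'm => 'm"
begin

abbreviation E :: "nat => nat => nat => 'm => 'm" where "E i b a \<equiv> M.ga (idem i b a)"

lemma E_E: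
 assumes "i \<le> r" "j \<le> r" "a < dm i" "b < dm i" "c < dm j" "d < dm j" "m : carrier M"
 shows "E i b a (E j d c m) = (if i = j & a = d then E i b c m else \<zero>\<^sub>M)"
proof -
 have "E i b a (E j d c m) = M.ga (conv G (idem i b a) (idem j d c)) m" using assms by (simp add: M.ga_conv)
 also have "\<dots> = M.ga (%g. if i = j & a = d then idem i b c g else 0) m"
  using assms by (intro M.ga_cong conv_idem) auto
 also have "\<dots> = (if i = j & a = d then E i b c m else \<zero>\<^sub>M)"
 proof (cases "i = j & a = d")
  case False
  hence e: "(%g. if i = j & a = d then idem i b c g else 0) = (%g. 0)" by auto
  show ?thesis unfolding e using False by (simp only: M.ga_zero_left[OF assms(7)] if_False)
 qed simp
 finally show ?thesis .
qed

lemma act_E: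
 assumes "i \<le> r" "a < dm i" "b < dm i" "h : carrier G" "m : carrier M"
 shows "act h (E i b a m) = (\<Oplus>\<^sub>M c\<in>{..<dm i}. mc i h c b \<odot>\<^sub>M E i c a m)"
proof -
 have "act h (E i b a m) = M.ga (conv G (%x. if x = h then 1 else 0) (idem i b a)) m"
  using assms by (simp add: M.ga_conv[symmetric] M.ga_delta)
 also have "\<dots> = M.ga (%g. \<Sum>c<dm i. mc i h c b * idem i c a g) m"
  using assms by (intro M.ga_cong conv_idem_delta) auto
 also have "\<dots> = (\<Oplus>\<^sub>M c\<in>{..<dm i}. mc i h c b \<odot>\<^sub>M E i c a m)"
  unfolding M.ga_sum_left[OF finite_lessThan assms(5)]
  using assms by (intro M.finsum_cong') (auto simp: M.ga_scale_left)
 finally show ?thesis .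
qed

text \<open>The central idempotent of \<open>V i\<close>, as the sum of the diagonal matrix units;
  it projects onto the isotypic part.\<close>

definition proj :: "nat => 'm => 'm" where
 "proj i = M.ga (%g. \<Sum>a<dm i. idem i a a g)"

lemma proj_closed [simp]: "m : carrier M ==> proj i m : carrier M"
 by (simp add: proj_def)

lemma proj_sum: "m : carrier M ==> proj i m = (\<Oplus>\<^sub>M a\<in>{..<dm i}. E i a a m)"
 unfolding proj_def by (rule M.ga_sum_left) auto

lemma sum_proj:
 assumes "m : carrier M"
 shows "(\<Oplus>\<^sub>M i\<in>{..r}. proj i m) = m"
proof -
 have "(\<Oplus>\<^sub>M i\<in>{..r}. proj i m) = M.ga (%g. \<Sum>i\<le>r. \<Sum>a<dm i. idem i a a g) m"
  unfolding proj_def using assms by (subst M.ga_sum_left) auto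
 also have "\<dots> = M.ga (%g. if g = \<one> then 1 else 0) m"
  using assms idem_complete by (intro M.ga_cong) auto
 finally show ?thesis using assms by (simp add: M.ga_delta M.act_one)
qed

lemma E_proj:
 assumes "i \<le> r" "j \<le> r" "a < dm i" "b < dm i" "m : carrier M"
 shows "E i b a (proj j m) = (if i = j then E i b a m else \<zero>\<^sub>M)"
proof -
 have "E i b a (proj j m) = (\<Oplus>\<^sub>M c\<in>{..<dm j}. E i b a (E j c c m))"
  unfolding proj_sum[OF assms(5)] using assms by (intro M.ga_finsum) auto
 also have "\<dots> = (\<Oplus>\<^sub>M c\<in>{..<dm j}. if i = j then (if a = c then E i b c m else \<zero>\<^sub>M) else \<zero>\<^sub>M)"
  using assms by (intro M.finsum_cong') (auto simp: E_E)
 also have "\<dots> = (if i = j then E i b a m else \<zero>\<^sub>M)"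
  using M.add.finprod_singleton[of a "{..<dm i}" "%c. E i b c m"] assms by auto
 finally show ?thesis .
qed

lemma proj_proj:
 assumes "i \<le> r" "j \<le> r" "m : carrier M"
 shows "proj i (proj j m) = (if i = j then proj i m else \<zero>\<^sub>M)"
proof -
 have "proj i (proj j m) = (\<Oplus>\<^sub>M a\<in>{..<dm i}. if i = j then E i a a m else \<zero>\<^sub>M)"
  unfolding proj_sum[OF proj_closed[OF assms(3)]]
  using assms by (intro M.finsum_cong') (auto simp: E_proj)
 thus ?thesis using assms by (auto simp: proj_sum)
qed

text \<open>Centrality of the idempotent: multiplying by \<open>h\<close> on the left acts on first
  indices, on the right on second ones, and both lead to the double sum of \<open>mc i h c a\<close>
  times \<open>E i c a m\<close>.\<close>

lemma proj_act:
 assumes "i \<le> r" "h : carrier G" "m : carrier M"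
 shows "proj i (act h m) = act h (proj i m)"
proof -
 have "act h (proj i m) = (\<Oplus>\<^sub>M a\<in>{..<dm i}. act h (E i a a m))"
  unfolding proj_sum[OF assms(3)] using assms by (intro M.act_finsum) auto
 also have "\<dots> = (\<Oplus>\<^sub>M a\<in>{..<dm i}. \<Oplus>\<^sub>M c\<in>{..<dm i}. mc i h c a \<odot>\<^sub>M E i c a m)"
  using assms by (intro M.finsum_cong') (auto simp: act_E intro!: M.finsum_closed)
 also have "\<dots> = (\<Oplus>\<^sub>M c\<in>{..<dm i}. \<Oplus>\<^sub>M a\<in>{..<dm i}. mc i h c a \<odot>\<^sub>M E i c a m)"
  using assms by (intro M.finsum_finsum_swap) auto
 also have "\<dots> = (\<Oplus>\<^sub>M c\<in>{..<dm i}. E i c c (act h m))"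
 proof (intro M.finsum_cong')
  fix c assume c: "c : {..<dm i}"
  have "E i c c (act h m) = M.ga (conv G (idem i c c) (%x. if x = h then 1 else 0)) m"
   using assms by (simp add: M.ga_conv[symmetric] M.ga_delta)
  also have "\<dots> = M.ga (%g. \<Sum>a<dm i. mc i h c a * idem i c a g) m"
   using assms c by (intro M.ga_cong conv_idem_delta) auto
  also have "\<dots> = (\<Oplus>\<^sub>M a\<in>{..<dm i}. mc i h c a \<odot>\<^sub>M E i c a m)"
   unfolding M.ga_sum_left[OF finite_lessThan assms(3)]
   using assms by (intro M.finsum_cong') (auto simp: M.ga_scale_left)
  finally show "(\<Oplus>\<^sub>M a\<in>{..<dm i}. mc i h c a \<odot>\<^sub>M E i c a m) = E i c c (act h m)" by simp
 qed (use assms in auto)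
 finally show ?thesis using proj_sum[of "act h m" i] assms by simp
qed

lemma E_hom:
 assumes "i \<le> r" "j \<le> r" "a < dm i" "b < dm i" "d < dm j" and f: "f : kG_hom G (V j) (rho (V j)) M act"
 shows "E i b a (f (bas j d)) = (if i = j & a = d then f (bas j b) else \<zero>\<^sub>M)"
proof -
 interpret Vj: kG_module G "V j" "rho (V j)" by (rule V_kG[OF assms(2)])
 have "f \<zero>\<^sub>(V j) = \<zero>\<^sub>M"
  using mod_hom_finsum[of "V j" M f "%_. \<zero>\<^sub>(V j)" "{}"] f Vj.abelian_group_axioms M.abelian_group_axioms
  by (auto simp: kG_hom_def module_hom_def)
 thus ?thesis
  using kG_hom_ga[OF V_kG[OF assms(2)] M.kG_module_axioms f bas_closed[OF assms(2,5)], of "idem i b a"]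
   idem_bas[OF assms(1-5)] by auto
qed

lemma hom_expand:
 assumes "i \<le> r" "f : kG_hom G (V i) (rho (V i)) M act" "v : carrier (V i)"
 shows "f v = (\<Oplus>\<^sub>M b\<in>{..<dm i}. co i v b \<odot>\<^sub>M f (bas i b))"
proof -
 interpret Vi: kG_module G "V i" "rho (V i)" by (rule V_kG[OF assms(1)])
 have f: "f : carrier (V i) \<rightarrow> carrier M"
  "!!x y. x : carrier (V i) ==> y : carrier (V i) ==> f (x \<oplus>\<^sub>(V i) y) = f x \<oplus>\<^sub>M f y"
  "!!c x. x : carrier (V i) ==> f (c \<odot>\<^sub>(V i) x) = c \<odot>\<^sub>M f x"
  using assms(2) by (auto simp: kG_hom_def module_hom_def)
 have b: "bas i b : carrier (V i)" if "b < dm i" for b using bas_closed assms that by blast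
 hence fb: "f (bas i b) : carrier M" if "b < dm i" for b using f(1) that by blast
 have "f v = f (\<Oplus>\<^sub>(V i)b\<in>{..<dm i}. co i v b \<odot>\<^sub>(V i) bas i b)" using expand[OF assms(1,3)] by simp
 also have "\<dots> = (\<Oplus>\<^sub>M b\<in>{..<dm i}. f (co i v b \<odot>\<^sub>(V i) bas i b))"
  using f b by (intro mod_hom_finsum Vi.abelian_group_axioms M.abelian_group_axioms) auto
 also have "\<dots> = (\<Oplus>\<^sub>M b\<in>{..<dm i}. co i v b \<odot>\<^sub>M f (bas i b))"
  using f(3) b fb by (intro M.finsum_cong') auto
 finally show ?thesis .
qed

text \<open>At a basis vector \<open>bas i b\<close> only the summand \<open>E i b b\<close> of the
  projection survives, and it fixes the value; hence equivariant maps from \<open>V i\<close> land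
  in the isotypic part.\<close>

lemma proj_hom:
 assumes "i \<le> r" "f : kG_hom G (V i) (rho (V i)) M act" "v : carrier (V i)"
 shows "proj i (f v) = f v"
proof -
 have fb: "f (bas i b) : carrier M" if "b < dm i" for b
  using assms(1,2) that bas_closed[OF assms(1) that] by (auto simp: kG_hom_def module_hom_def)
 have "proj i (f (bas i b)) = f (bas i b)" if b: "b < dm i" for b
 proof -
  have "proj i (f (bas i b)) = (\<Oplus>\<^sub>M a\<in>{..<dm i}. if b = a then f (bas i a) else \<zero>\<^sub>M)"
   unfolding proj_sum[OF fb[OF b]] using b assms(1) fb
   by (intro M.finsum_cong') (auto simp: E_hom[OF _ _ _ _ _ assms(2)])
  also have "\<dots> = f (bas i b)" using M.add.finprod_singleton[of b "{..<dm i}" "%a. f (bas i a)"] b fb by auto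
  finally show ?thesis .
 qed
 note pb = this
 have "proj i (f v) = (\<Oplus>\<^sub>M b\<in>{..<dm i}. proj i (co i v b \<odot>\<^sub>M f (bas i b)))"
  unfolding hom_expand[OF assms] proj_def using fb by (intro M.ga_finsum) auto
 also have "\<dots> = (\<Oplus>\<^sub>M b\<in>{..<dm i}. co i v b \<odot>\<^sub>M f (bas i b))"
  using fb pb by (intro M.finsum_cong') (auto simp: proj_def M.ga_smult)
 finally show ?thesis using hom_expand[OF assms] by simp
qed

text \<open>The equivariant map sending the basis vector \<open>bas i b\<close> to \<open>E i b a m\<close>.\<close>
definition hom_of :: "nat => nat => 'm => 'v => 'm" where
 "hom_of i a m = (\<lambda>v\<in>carrier (V i). \<Oplus>\<^sub>M b\<in>{..<dm i}. co i v b \<odot>\<^sub>M E i b a m)"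

lemma hom_of_bas:
 assumes "i \<le> r" "a < dm i" "b < dm i" "m : carrier M"
 shows "hom_of i a m (bas i b) = E i b a m"
proof -
 have "hom_of i a m (bas i b) = (\<Oplus>\<^sub>M b'\<in>{..<dm i}. (if b' = b then \<one>\<^sub>class_ring else \<zero>\<^sub>class_ring) \<odot>\<^sub>M E i b' a m)"
  unfolding hom_of_def using assms bas_closed[OF assms(1,3)]
  by (simp, intro M.finsum_cong') (auto simp: co_bas)
 also have "\<dots> = E i b a m" using assms by (intro M.finsum_delta) auto
 finally show ?thesis .
qed

text \<open>Equivariance is \<open>act_E\<close>: for fixed \<open>a\<close> the vectors
  \<open>E i b a m\<close> transform under \<open>G\<close> like the basis of
  \<open>V i\<close>.\<close>

lemma hom_of_hom:
 assumes i: "i \<le> r" and a: "a < dm i" and m: "m : carrier M"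
 shows "hom_of i a m : kG_hom G (V i) (rho (V i)) M act"
proof -
 interpret Vi: kG_module G "V i" "rho (V i)" by (rule V_kG[OF i])
 have Em: "(%b. E i b a m) : {..<dm i} \<rightarrow> carrier M" using m by auto
 show ?thesis
  unfolding kG_hom_def module_hom_def
 proof (intro CollectI conjI ballI allI impI; (elim conjE)?)
  fix x y assume xy: "x : carrier (V i)" "y : carrier (V i)"
  have "hom_of i a m (x \<oplus>\<^sub>(V i) y) = (\<Oplus>\<^sub>M b\<in>{..<dm i}. (co i x b + co i y b) \<odot>\<^sub>M E i b a m)"
   unfolding hom_of_def using xy i m by (simp, intro M.finsum_cong') (auto simp: co_add)
  also have "\<dots> = hom_of i a m x \<oplus>\<^sub>M hom_of i a m y"
   using M.finsum_add_coeff[of "co i x" "{..<dm i}" "co i y" "%b. E i b a m"] Em xy by (simp add: hom_of_def)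
  finally show "hom_of i a m (x \<oplus>\<^sub>(V i) y) = hom_of i a m x \<oplus>\<^sub>M hom_of i a m y" .
 next
  fix c x assume x: "x : carrier (V i)"
  have "hom_of i a m (c \<odot>\<^sub>(V i) x) = (\<Oplus>\<^sub>M b\<in>{..<dm i}. (c * co i x b) \<odot>\<^sub>M E i b a m)"
   unfolding hom_of_def using x i m by (simp, intro M.finsum_cong') (auto simp: co_smult)
  also have "\<dots> = c \<odot>\<^sub>M hom_of i a m x"
   using M.finsum_smult_coeff[of "co i x" "{..<dm i}" "%b. E i b a m" c] Em x by (simp add: hom_of_def)
  finally show "hom_of i a m (c \<odot>\<^sub>(V i) x) = c \<odot>\<^sub>M hom_of i a m x" .
 next
  fix g x assume g: "g : carrier G" and x: "x : carrier (V i)"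
  have "act g (hom_of i a m x) = (\<Oplus>\<^sub>M b\<in>{..<dm i}. act g (co i x b \<odot>\<^sub>M E i b a m))"
   unfolding hom_of_def using x g m by (simp, intro M.act_finsum) auto
  also have "\<dots> = (\<Oplus>\<^sub>M b\<in>{..<dm i}. \<Oplus>\<^sub>M c\<in>{..<dm i}. (mc i g c b * co i x b) \<odot>\<^sub>M E i c a m)"
  proof (intro M.finsum_cong')
   fix b assume b: "b : {..<dm i}"
   have "act g (co i x b \<odot>\<^sub>M E i b a m) = co i x b \<odot>\<^sub>M (\<Oplus>\<^sub>M c\<in>{..<dm i}. mc i g c b \<odot>\<^sub>M E i c a m)"
    using b i a m g by (simp add: M.act_smult act_E)
   also have "\<dots> = (\<Oplus>\<^sub>M c\<in>{..<dm i}. (co i x b * mc i g c b) \<odot>\<^sub>M E i c a m)"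
    using M.finsum_smult_coeff[of "%c. mc i g c b" "{..<dm i}" "%c. E i c a m" "co i x b"] Em by simp
   finally show "act g (co i x b \<odot>\<^sub>M E i b a m) = (\<Oplus>\<^sub>M c\<in>{..<dm i}. (mc i g c b * co i x b) \<odot>\<^sub>M E i c a m)"
    by (simp add: mult.commute)
  qed (use m in \<open>auto intro!: M.finsum_closed\<close>)
  also have "\<dots> = (\<Oplus>\<^sub>M c\<in>{..<dm i}. \<Oplus>\<^sub>M b\<in>{..<dm i}. (mc i g c b * co i x b) \<odot>\<^sub>M E i c a m)"
   using m by (intro M.finsum_finsum_swap) auto
  also have "\<dots> = (\<Oplus>\<^sub>M c\<in>{..<dm i}. co i (rho (V i) g x) c \<odot>\<^sub>M E i c a m)"
   using m i g x by (intro M.finsum_cong') (auto simp: M.smult_sum_left co_rho)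
  also have "\<dots> = hom_of i a m (rho (V i) g x)" using g x by (simp add: hom_of_def)
  finally show "hom_of i a m (rho (V i) g x) = act g (hom_of i a m x)" by simp
 qed (use m Em in \<open>auto simp: hom_of_def\<close>)
qed

text \<open>Exhibits an isotypic element as a sum of values of equivariant maps at basis vectors,
  which is what the inverse of evaluation is built from.\<close>

lemma proj_eq_sum_hom_of:
 assumes "i \<le> r" "m : carrier M"
 shows "proj i m = (\<Oplus>\<^sub>M a\<in>{..<dm i}. hom_of i a m (bas i a))"
 unfolding proj_sum[OF assms(2)] using assms by (intro M.finsum_cong') (auto simp: hom_of_bas)

end

lemma (in irreps) dm_zero: "dm 0 = 1"
 using reps by (simp add: irreducible_reps_def trivial_rep_def dm_def)

text \<open>So \<open>proj 0\<close> is the average over the group.\<close>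

lemma (in irreps) idem_zero:
 assumes "g : carrier G" shows "idem 0 0 0 g = 1 / of_nat (card (carrier G))"
proof -
 have "rho (V 0) (inv g) (bas 0 0) = bas 0 0"
  using reps bas_closed[of 0 0] assms by (simp add: irreducible_reps_def trivial_rep_def dm_zero)
 thus ?thesis using co_bas[of 0 0 0] by (simp add: idem_def mc_def dm_zero)
qed

context irreps_module
begin

lemma proj_zero_invariant:
 assumes "m : carrier M" "g : carrier G" shows "act g (proj 0 m) = proj 0 m"
proof -
 have p: "proj 0 m = E 0 0 0 m" by (simp add: proj_def dm_zero)
 have "mc 0 g 0 0 = 1"
 proof -
  have "rho (V 0) g (bas 0 0) = bas 0 0"
   using reps bas_closed[of 0 0] assms by (simp add: irreducible_reps_def trivial_rep_def dm_zero)
  thus ?thesis using co_bas[of 0 0 0] by (simp add: mc_def dm_zero)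
 qed
 thus ?thesis using act_E[of 0 0 0 g m] assms unfolding p by (simp add: dm_zero lessThan_Suc)
qed

lemma proj_invariant:
 assumes "m : carrier M" "!!g. g : carrier G ==> act g m = m" shows "proj 0 m = m"
proof -
 have "proj 0 m = E 0 0 0 m" by (simp add: proj_def dm_zero)
 also have "\<dots> = (\<Oplus>\<^sub>M g\<in>carrier G. idem 0 0 0 g \<odot>\<^sub>M m)"
  unfolding galg_act_def using assms by (intro M.finsum_cong') auto
 also have "\<dots> = (\<Sum>g\<in>carrier G. idem 0 0 0 g) \<odot>\<^sub>M m" using assms(1) fin by (simp add: M.smult_sum_left)
 also have "(\<Sum>g\<in>carrier G. idem 0 0 0 g) = 1" using card_nz by (simp add: idem_zero)
 finally show ?thesis using assms(1) by simp
qed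

end

section \<open>Galois descent\<close>

text \<open>\<open>L\<close> stands for the generic stalk with its action \<open>\<alpha>\<close>,
  and \<open>\<kappa>\<close> embeds the base field \<open>k\<close> of \<open>V\<close> into the
  elements fixed by \<open>G\<close>. The representation is over \<open>k\<close>, whereas the maps
  studied have values in \<open>L\<close>.\<close>

locale galois_rep = field L + G: group G + V: kG_module G V "rho V"
 for L :: "('l, 'z) ring_scheme" and G :: "('g, 'h) monoid_scheme" and V :: "('k::field, 'v, 'g) rep" +
 fixes \<alpha> :: "'g => 'l => 'l" and \<kappa> :: "'k => 'l" and n :: nat and b :: "nat => 'v"
 assumes \<alpha>_hom: "g : carrier G ==> \<alpha> g : ring_hom L L"
  and \<alpha>_one: "x : carrier L ==> \<alpha> \<one>\<^sub>G x = x"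
  and \<alpha>_mult: "g : carrier G ==> h : carrier G ==> x : carrier L ==> \<alpha> (g \<otimes>\<^sub>G h) x = \<alpha> g (\<alpha> h x)"
  and \<alpha>_faithful: "g : carrier G ==> (!!x. x : carrier L ==> \<alpha> g x = x) ==> g = \<one>\<^sub>G"
  and \<kappa>_hom: "\<kappa> : ring_hom class_ring L"
  and \<kappa>_inv: "g : carrier G ==> \<alpha> g (\<kappa> c) = \<kappa> c"
  and fr: "frame class_ring V n b"
begin

lemma \<alpha>_closed [simp, intro]: "g : carrier G ==> x : carrier L ==> \<alpha> g x : carrier L"
 using \<alpha>_hom by (auto simp: Ring.ring_hom_def)
lemma \<alpha>_m: "g : carrier G ==> x : carrier L ==> y : carrier L ==> \<alpha> g (x \<otimes>\<^sub>L y) = \<alpha> g x \<otimes>\<^sub>L \<alpha> g y"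
 using \<alpha>_hom by (auto simp: Ring.ring_hom_def)
lemma \<alpha>_a: "g : carrier G ==> x : carrier L ==> y : carrier L ==> \<alpha> g (x \<oplus>\<^sub>L y) = \<alpha> g x \<oplus>\<^sub>L \<alpha> g y"
 using \<alpha>_hom by (auto simp: Ring.ring_hom_def)
lemma \<alpha>_one_el [simp]: "g : carrier G ==> \<alpha> g \<one>\<^sub>L = \<one>\<^sub>L"
 using \<alpha>_hom by (auto simp: Ring.ring_hom_def)
lemma \<alpha>_sum: "g : carrier G ==> finite S ==> f : S \<rightarrow> carrier L ==> \<alpha> g (finsum L f S) = (\<Oplus>\<^sub>L s\<in>S. \<alpha> g (f s))"
 by (intro mod_hom_finsum abelian_group_axioms) (auto simp: \<alpha>_a)
lemma \<kappa>_closed [simp, intro]: "\<kappa> c : carrier L"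
 using \<kappa>_hom by (auto simp: Ring.ring_hom_def)
lemma \<kappa>_add: "\<kappa> (c + d) = \<kappa> c \<oplus>\<^sub>L \<kappa> d"
 using \<kappa>_hom by (auto simp: Ring.ring_hom_def)
lemma \<kappa>_mult: "\<kappa> (c * d) = \<kappa> c \<otimes>\<^sub>L \<kappa> d"
 using \<kappa>_hom by (auto simp: Ring.ring_hom_def)
lemma \<kappa>_one: "\<kappa> 1 = \<one>\<^sub>L"
 using \<kappa>_hom by (auto simp: Ring.ring_hom_def)
lemma \<kappa>_zero: "\<kappa> 0 = \<zero>\<^sub>L"
 using \<kappa>_add[of 0 0] by (metis \<kappa>_closed add.l_cancel_one' add_0)

definition lin :: "('v => 'l) set" where
 "lin = {f : extensional (carrier V). f : carrier V \<rightarrow> carrier L &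
   (ALL x:carrier V. ALL y:carrier V. f (x \<oplus>\<^sub>V y) = f x \<oplus>\<^sub>L f y) &
   (ALL c. ALL x:carrier V. f (c \<odot>\<^sub>V x) = \<kappa> c \<otimes>\<^sub>L f x)}"

definition lin_G :: "('v => 'l) set" where
 "lin_G = {f : lin. ALL g:carrier G. ALL x:carrier V. f (rho V g x) = \<alpha> g (f x)}"

text \<open>The \<open>k\<close>-linear maps from \<open>V\<close> to \<open>L\<close> as a vector
  space over \<open>L\<close>, scalars acting on the values.\<close>

definition H :: "('l, 'v => 'l) Module.module" where
 "H = \<lparr>carrier = lin, mult = undefined, one = undefined, ring.zero = (\<lambda>v\<in>carrier V. \<zero>\<^sub>L),
   add = (%f f'. \<lambda>v\<in>carrier V. f v \<oplus>\<^sub>L f' v), smult = (%l f. \<lambda>v\<in>carrier V. l \<otimes>\<^sub>L f v)\<rparr>"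

lemma lin_closed: "f : lin ==> x : carrier V ==> f x : carrier L"
 by (auto simp: lin_def)

lemma H_carrier [simp]: "carrier H = lin" by (simp add: H_def)

lemma lin_zero: "(\<lambda>v\<in>carrier V. \<zero>\<^sub>L) : lin"
 by (auto simp: lin_def)
lemma lin_add: "f : lin ==> f' : lin ==> (\<lambda>v\<in>carrier V. f v \<oplus>\<^sub>L f' v) : lin"
 by (auto simp: lin_def Pi_iff a_ac r_distr)
lemma lin_smult: "l : carrier L ==> f : lin ==> (\<lambda>v\<in>carrier V. l \<otimes>\<^sub>L f v) : lin"
 by (auto simp: lin_def Pi_iff r_distr m_lcomm)

lemma lin_eqI: "f : lin ==> f' : lin ==> (!!v. v : carrier V ==> f v = f' v) ==> f = f'"
 by (rule extensionalityI[of _ "carrier V"]) (auto simp: lin_def)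

lemma H_module: "module L H"
proof (rule module_criteria)
 show "ALL v:carrier H. EX neg_v:carrier H. v \<oplus>\<^sub>H neg_v = \<zero>\<^sub>H"
 proof
  fix f assume f: "f : carrier H"
  show "EX neg_v:carrier H. f \<oplus>\<^sub>H neg_v = \<zero>\<^sub>H"
   using lin_smult[of "\<ominus>\<^sub>L \<one>\<^sub>L" f] f lin_closed[of f]
   by (intro bexI[where x = "\<lambda>v\<in>carrier V. (\<ominus>\<^sub>L \<one>\<^sub>L) \<otimes>\<^sub>L f v"])
    (auto simp: H_def l_minus r_neg intro!: restrict_ext)
 qed
qed (auto simp: H_def lin_zero lin_add lin_smult lin_closed a_ac m_assoc l_distr r_distr
  intro!: cring_axioms restrict_ext extensionalityI[of _ "carrier V"], auto simp: lin_def)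

lemma H_vectorspace: "vectorspace L H"
 by (simp add: vectorspace_def H_module field_axioms)

interpretation H: vectorspace L H by (rule H_vectorspace)

lemma H_finsum:
 "finite S ==> f : S \<rightarrow> lin ==> v : carrier V ==> finsum H f S v = (\<Oplus>\<^sub>L s\<in>S. f s v)"
proof (induction S rule: finite_induct)
 case empty thus ?case by (simp, simp add: H_def)
next
 case (insert s S)
 have "finsum H f (insert s S) = f s \<oplus>\<^sub>H finsum H f S" using insert by (intro H.finsum_insert) auto
 hence "finsum H f (insert s S) v = (f s \<oplus>\<^sub>H finsum H f S) v" by simp
 also have "\<dots> = f s v \<oplus>\<^sub>L finsum H f S v" using insert(5) by (simp add: H_def)
 also have "\<dots> = f s v \<oplus>\<^sub>L (\<Oplus>\<^sub>L s\<in>S. f s v)" using insert by auto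
 also have "\<dots> = (\<Oplus>\<^sub>L s\<in>insert s S. f s v)" using insert lin_closed by (subst finsum_insert) auto
 finally show ?case .
qed

lemma H_sum_eval:
 assumes "finite S" "f : S \<rightarrow> lin" "c : S \<rightarrow> carrier L" "v : carrier V"
 shows "(\<Oplus>\<^sub>H s\<in>S. c s \<odot>\<^sub>H f s) v = (\<Oplus>\<^sub>L s\<in>S. c s \<otimes>\<^sub>L f s v)"
proof -
 have "(\<Oplus>\<^sub>H s\<in>S. c s \<odot>\<^sub>H f s) v = (\<Oplus>\<^sub>L s\<in>S. (c s \<odot>\<^sub>H f s) v)"
  using assms H.smult_closed by (intro H_finsum) auto
 also have "\<dots> = (\<Oplus>\<^sub>L s\<in>S. c s \<otimes>\<^sub>L f s v)"
  using assms lin_closed by (intro finsum_cong') (auto simp: H_def Pi_iff)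
 finally show ?thesis .
qed

abbreviation co where "co \<equiv> coords class_ring V n b"
definition dual :: "nat => 'v => 'l" where "dual j = (\<lambda>v\<in>carrier V. \<kappa> (co v j))"

lemma dual_lin: assumes j: "j < n" shows "dual j : lin"
proof -
 have "co (x \<oplus>\<^sub>V y) j = co x j + co y j" if "x : carrier V" "y : carrier V" for x y
  using V.coords_add[OF fr that j] by simp
 moreover have "co (c \<odot>\<^sub>V x) j = c * co x j" if "x : carrier V" for c x
  using V.coords_smult[OF fr that _ j, of c] by simp
 ultimately show ?thesis by (auto simp: dual_def lin_def \<kappa>_add \<kappa>_mult)
qed

lemma lin_expand:
 assumes f: "f : lin" and v: "v : carrier V"
 shows "f v = (\<Oplus>\<^sub>L j\<in>{..<n}. f (b j) \<otimes>\<^sub>L dual j v)"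
proof -
 have bc: "b j : carrier V" if "j < n" for j using frame_closed[OF fr that] .
 have "f v = f (\<Oplus>\<^sub>V j\<in>{..<n}. co v j \<odot>\<^sub>V b j)" using frame_expand(2)[OF fr v] by simp
 also have "\<dots> = (\<Oplus>\<^sub>L j\<in>{..<n}. f (co v j \<odot>\<^sub>V b j))"
  using f bc by (intro mod_hom_finsum V.abelian_group_axioms abelian_group_axioms) (auto simp: lin_def)
 also have "\<dots> = (\<Oplus>\<^sub>L j\<in>{..<n}. f (b j) \<otimes>\<^sub>L dual j v)"
  using f bc v lin_closed[OF f bc] by (intro finsum_cong') (auto simp: lin_def dual_def m_comm)
 finally show ?thesis .
qed

text \<open>After extension of scalars the dual basis of \<open>V\<close> becomes a basis over
  \<open>L\<close>; the coefficients of \<open>f\<close> are its values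
  \<open>f (b j)\<close>.\<close>

lemma dual_frame: "frame L H n dual"
proof (rule H.frameI)
 show "dual : {..<n} \<rightarrow> carrier H" using dual_lin by auto
next
 fix f assume f: "f : carrier H"
 have c: "(%j. f (b j)) : {..<n} \<rightarrow> carrier L" using f lin_closed frame_closed[OF fr] by auto
 have "f = (\<Oplus>\<^sub>H j\<in>{..<n}. f (b j) \<odot>\<^sub>H dual j)"
 proof (rule lin_eqI)
  show "(\<Oplus>\<^sub>H j\<in>{..<n}. f (b j) \<odot>\<^sub>H dual j) : lin"
   using H.smult_sum_closed[OF c, of dual] dual_lin by auto
  fix v assume v: "v : carrier V"
  show "f v = (\<Oplus>\<^sub>H j\<in>{..<n}. f (b j) \<odot>\<^sub>H dual j) v"
   using H_sum_eval[OF _ _ c v, of dual] dual_lin lin_expand[OF _ v] f by auto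
 qed (use f in simp)
 thus "EX c : {..<n} \<rightarrow> carrier L. f = (\<Oplus>\<^sub>H j\<in>{..<n}. c j \<odot>\<^sub>H dual j)" by (rule bexI[OF _ c])
next
 fix c j assume c: "c : {..<n} \<rightarrow> carrier L" and z: "(\<Oplus>\<^sub>H j\<in>{..<n}. c j \<odot>\<^sub>H dual j) = \<zero>\<^sub>H" and j: "j < n"
 have bj: "b j : carrier V" by (rule frame_closed[OF fr j])
 have "\<zero>\<^sub>L = (\<Oplus>\<^sub>H j\<in>{..<n}. c j \<odot>\<^sub>H dual j) (b j)" using bj by (simp add: z, simp add: H_def)
 also have "\<dots> = (\<Oplus>\<^sub>L i\<in>{..<n}. c i \<otimes>\<^sub>L dual i (b j))" using H_sum_eval[OF _ _ c bj, of dual] dual_lin by auto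
 also have "\<dots> = (\<Oplus>\<^sub>L i\<in>{..<n}. if j = i then c i else \<zero>\<^sub>L)"
  using c bj j V.coords_frame[OF fr j] by (intro finsum_cong') (auto simp: dual_def \<kappa>_one \<kappa>_zero Pi_iff)
 also have "\<dots> = c j" using c j by (intro add.finprod_singleton) auto
 finally show "c j = \<zero>\<^sub>L" by simp
qed

text \<open>A weighted trace for the action of \<open>g\<close> on maps by
  \<open>\<alpha> g \<circ> f \<circ> rho V (inv g)\<close>. The constant weight 1 produces
  equivariant maps, the delta function at the identity returns \<open>f\<close>, and the weights in
  \<open>Phi\<close> connect the two.\<close>

definition tr :: "('g => 'l) => ('v => 'l) => 'v => 'l" where
 "tr \<phi> f = (\<lambda>v\<in>carrier V. \<Oplus>\<^sub>L g\<in>carrier G. \<phi> g \<otimes>\<^sub>L \<alpha> g (f (rho V (inv\<^bsub>G\<^esub> g) v)))"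

lemma tr_apply: "v : carrier V ==> tr \<phi> f v = (\<Oplus>\<^sub>L g\<in>carrier G. \<phi> g \<otimes>\<^sub>L \<alpha> g (f (rho V (inv\<^bsub>G\<^esub> g) v)))"
 by (simp add: tr_def)

lemma tr_lin:
 assumes "\<phi> : carrier G \<rightarrow> carrier L" "f : lin" shows "tr \<phi> f : lin"
proof -
 have cl: "\<phi> g \<otimes>\<^sub>L \<alpha> g (f (rho V (inv\<^bsub>G\<^esub> g) v)) : carrier L" if "g : carrier G" "v : carrier V" for g v
  using assms that lin_closed by auto
 have "tr \<phi> f (x \<oplus>\<^sub>V y) = tr \<phi> f x \<oplus>\<^sub>L tr \<phi> f y" if xy: "x : carrier V" "y : carrier V" for x y
 proof -
  have "tr \<phi> f (x \<oplus>\<^sub>V y) = (\<Oplus>\<^sub>L g\<in>carrier G. \<phi> g \<otimes>\<^sub>L \<alpha> g (f (rho V (inv\<^bsub>G\<^esub> g) x)) \<oplus>\<^sub>L \<phi> g \<otimes>\<^sub>L \<alpha> g (f (rho V (inv\<^bsub>G\<^esub> g) y)))"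
   unfolding tr_apply[OF V.a_closed[OF xy]] using xy cl assms
   by (intro finsum_cong') (auto simp: V.act_add lin_def \<alpha>_a r_distr Pi_iff)
  thus ?thesis using xy cl by (simp add: tr_def finsum_addf)
 qed
 moreover have "tr \<phi> f (c \<odot>\<^sub>V x) = \<kappa> c \<otimes>\<^sub>L tr \<phi> f x" if x: "x : carrier V" for c x
 proof -
  have "tr \<phi> f (c \<odot>\<^sub>V x) = (\<Oplus>\<^sub>L g\<in>carrier G. \<kappa> c \<otimes>\<^sub>L (\<phi> g \<otimes>\<^sub>L \<alpha> g (f (rho V (inv\<^bsub>G\<^esub> g) x))))"
   unfolding tr_apply[OF V.smult_closed'[OF x]] using x cl assms
   by (intro finsum_cong') (auto simp: V.act_smult lin_def \<alpha>_m \<kappa>_inv m_lcomm Pi_iff)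
  also have "\<dots> = \<kappa> c \<otimes>\<^sub>L tr \<phi> f x" using x cl V.fin by (simp add: tr_def finsum_rdistr)
  finally show ?thesis .
 qed
 ultimately show ?thesis using cl by (auto simp: lin_def tr_def intro!: finsum_closed)
qed

text \<open>The functions \<open>g \<mapsto> \<Sum>\<^sub>j a\<^sub>j \<sigma>\<^sub>g(b\<^sub>j)\<close> on the group; by faithfulness the delta function at the identity is one.\<close>
inductive Phi :: "('g \<Rightarrow> 'l) \<Rightarrow> bool" where
 Phi_base: "x \<in> carrier L \<Longrightarrow> y \<in> carrier L \<Longrightarrow> (\<And>g. g \<in> carrier G \<Longrightarrow> \<phi> g = x \<otimes>\<^bsub>L\<^esub> \<alpha> g y) \<Longrightarrow> Phi \<phi>"
| Phi_add: "Phi \<phi> \<Longrightarrow> Phi \<psi> \<Longrightarrow> (\<And>g. g \<in> carrier G \<Longrightarrow> \<chi> g = \<phi> g \<oplus>\<^bsub>L\<^esub> \<psi> g) \<Longrightarrow> Phi \<chi>"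

lemma Phi_closed: "Phi \<phi> ==> g : carrier G ==> \<phi> g : carrier L"
 by (induction rule: Phi.induct) auto

lemma Phi_mult: "Phi \<phi> ==> Phi \<psi> ==> Phi (%g. \<phi> g \<otimes>\<^sub>L \<psi> g)"
proof (induction rule: Phi.induct)
 case (Phi_base x y \<phi>)
 from Phi_base(4) Phi_base(1-3) show ?case
 proof (induction rule: Phi.induct)
  case (Phi_base x' y' \<psi>)
  thus ?case by (intro Phi.Phi_base[of "x \<otimes>\<^sub>L x'" "y \<otimes>\<^sub>L y'"]) (auto simp: \<alpha>_m m_ac)
 next
  case (Phi_add \<psi>1 \<psi>2 \<psi>)
  have c: "\<phi> g : carrier L" "\<psi>1 g : carrier L" "\<psi>2 g : carrier L" if "g : carrier G" for g
   using Phi_add.prems Phi_closed[OF Phi_add.hyps(1) that] Phi_closed[OF Phi_add.hyps(2) that] that by auto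
  show ?case
  proof (rule Phi.Phi_add[OF Phi_add.IH(1)[OF Phi_add.prems] Phi_add.IH(2)[OF Phi_add.prems]])
   fix g assume g: "g : carrier G"
   show "\<phi> g \<otimes>\<^sub>L \<psi> g = \<phi> g \<otimes>\<^sub>L \<psi>1 g \<oplus>\<^sub>L \<phi> g \<otimes>\<^sub>L \<psi>2 g"
    unfolding Phi_add.hyps(3)[OF g] by (rule r_distr[OF c(2)[OF g] c(3)[OF g] c(1)[OF g]])
  qed
 qed
next
 case (Phi_add \<phi>1 \<phi>2 \<phi>)
 have c: "\<psi> g : carrier L" "\<phi>1 g : carrier L" "\<phi>2 g : carrier L" if "g : carrier G" for g
  using Phi_closed[OF Phi_add.hyps(1) that] Phi_closed[OF Phi_add.hyps(2) that] Phi_closed[OF Phi_add.prems that] by auto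
 show ?case
  by (rule Phi.Phi_add[OF Phi_add.IH(1)[OF Phi_add.prems] Phi_add.IH(2)[OF Phi_add.prems]])
   (simp add: c Phi_add.hyps(3) l_distr)
qed

text \<open>By faithfulness some \<open>c\<close> is moved by \<open>h\<close>, and
  \<open>(\<alpha> g c - \<alpha> h c) / (c - \<alpha> h c)\<close>, as a function of
  \<open>g\<close>, is one at the identity and zero at \<open>h\<close>.\<close>

lemma Phi_separate:
 assumes h: "h : carrier G" "h \<noteq> \<one>\<^sub>G"
 shows "EX \<phi>. Phi \<phi> & \<phi> \<one>\<^sub>G = \<one>\<^sub>L & \<phi> h = \<zero>\<^sub>L"
proof -
 obtain c where c: "c : carrier L" "\<alpha> h c \<noteq> c" using \<alpha>_faithful h by blast
 define u where "u = c \<ominus>\<^sub>L \<alpha> h c"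
 have u: "u : carrier L" "u \<noteq> \<zero>\<^sub>L" using c h minus_equality[of c "\<ominus>\<^sub>L \<alpha> h c"] by (auto simp: u_def a_minus_def)
 hence uU: "u : Units L" using field_Units by auto
 \<comment> \<open>The factor \<open>\<alpha> g 1\<close> equals one; it gives the constant summand
   the shape required by \<open>Phi_base\<close>.\<close>
 define \<phi> where "\<phi> g = inv\<^bsub>L\<^esub> u \<otimes>\<^sub>L \<alpha> g c \<oplus>\<^sub>L (\<ominus>\<^sub>L (inv\<^bsub>L\<^esub> u \<otimes>\<^sub>L \<alpha> h c)) \<otimes>\<^sub>L \<alpha> g \<one>\<^sub>L" for g
 have "Phi \<phi>"
  using c h uU
  by (intro Phi_add[OF Phi_base[of "inv\<^bsub>L\<^esub> u" c] Phi_base[of "\<ominus>\<^sub>L (inv\<^bsub>L\<^esub> u \<otimes>\<^sub>L \<alpha> h c)" "\<one>\<^sub>L"]])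
   (auto simp: \<phi>_def)
 moreover have "\<phi> h = \<zero>\<^sub>L" using c h uU by (simp add: \<phi>_def r_neg)
 moreover have "\<phi> \<one>\<^sub>G = inv\<^bsub>L\<^esub> u \<otimes>\<^sub>L u"
  using c h uU by (simp add: \<phi>_def u_def \<alpha>_one a_minus_def r_distr r_minus)
 hence "\<phi> \<one>\<^sub>G = \<one>\<^sub>L" using uU by simp
 ultimately show ?thesis by blast
qed

text \<open>The product, over the finitely many \<open>h\<close> other than the identity, of
  functions that separate the identity from \<open>h\<close>.\<close>

lemma Phi_delta: "EX \<phi>. Phi \<phi> & (ALL g:carrier G. \<phi> g = (if g = \<one>\<^sub>G then \<one>\<^sub>L else \<zero>\<^sub>L))"
proof -
 have "finite S ==> S \<subseteq> carrier G - {\<one>\<^sub>G} ==> EX \<phi>. Phi \<phi> & \<phi> \<one>\<^sub>G = \<one>\<^sub>L & (ALL h:S. \<phi> h = \<zero>\<^sub>L)" for S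
 proof (induction S rule: finite_induct)
  case empty
  show ?case by (intro exI[of _ "%g. \<one>\<^sub>L"]) (auto intro!: Phi_base[of "\<one>\<^sub>L" "\<one>\<^sub>L"])
 next
  case (insert h S)
  then obtain \<phi> where \<phi>: "Phi \<phi>" "\<phi> \<one>\<^sub>G = \<one>\<^sub>L" "ALL h:S. \<phi> h = \<zero>\<^sub>L" by auto
  obtain \<psi> where \<psi>: "Phi \<psi>" "\<psi> \<one>\<^sub>G = \<one>\<^sub>L" "\<psi> h = \<zero>\<^sub>L" using Phi_separate[of h] insert by auto
  show ?case
   using \<phi> \<psi> insert Phi_closed[OF \<phi>(1)] Phi_closed[OF \<psi>(1)]
   by (intro exI[of _ "%g. \<phi> g \<otimes>\<^sub>L \<psi> g"]) (auto intro!: Phi_mult)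
 qed
 from this[of "carrier G - {\<one>\<^sub>G}"] V.fin obtain \<phi> where
  "Phi \<phi>" "\<phi> \<one>\<^sub>G = \<one>\<^sub>L" "ALL h:carrier G - {\<one>\<^sub>G}. \<phi> h = \<zero>\<^sub>L" by auto
 thus ?thesis by (intro exI[of _ \<phi>]) auto
qed

lemma trace_invariant:
 assumes f: "f : lin" shows "tr (%_. \<one>\<^sub>L) f : lin_G"
proof -
 have "tr (%_. \<one>\<^sub>L) f (rho V h v) = \<alpha> h (tr (%_. \<one>\<^sub>L) f v)" if h: "h : carrier G" and v: "v : carrier V" for h v
 proof -
  have "\<alpha> h (tr (%_. \<one>\<^sub>L) f v) = (\<Oplus>\<^sub>L g\<in>carrier G. \<alpha> h (\<one>\<^sub>L \<otimes>\<^sub>L \<alpha> g (f (rho V (inv\<^bsub>G\<^esub> g) v))))"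
   using h v V.fin lin_closed[OF f] by (simp add: tr_def \<alpha>_sum)
  also have "\<dots> = (\<Oplus>\<^sub>L g\<in>carrier G. \<one>\<^sub>L \<otimes>\<^sub>L \<alpha> g (f (rho V (inv\<^bsub>G\<^esub> g) (rho V h v))))"
   using h v lin_closed[OF f]
   by (intro finsum_reindex_bij_witness[where i = "%g. inv\<^bsub>G\<^esub> h \<otimes>\<^sub>G g" and j = "%g. h \<otimes>\<^sub>G g"])
    (auto simp: G.m_assoc[symmetric] \<alpha>_mult G.inv_mult_group V.act_mult[symmetric], auto simp: G.m_assoc)
  finally show ?thesis using h v by (simp add: tr_def)
 qed
 thus ?thesis using tr_lin[of "%_. \<one>\<^sub>L"] f by (auto simp: lin_G_def)
qed

text \<open>If \<open>\<phi> g\<close> is the sum of the terms \<open>x_j \<alpha> g y_j\<close>,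
  then \<open>tr \<phi> f\<close> is the combination with coefficients \<open>x_j\<close> of the
  unweighted traces of \<open>y_j f\<close>, which are equivariant. For the delta function at the
  identity, \<open>tr \<phi> f = f\<close>.\<close>

lemma lin_span: "H.span lin_G = lin"
proof -
 have GH: "lin_G \<subseteq> carrier H" by (auto simp: lin_G_def)
 have sm: "submodule L (H.span lin_G) H" by (rule H.span_is_submodule[OF GH])
 have "tr \<phi> f : H.span lin_G" if "Phi \<phi>" "f : lin" for \<phi> f
  using that
 proof (induction rule: Phi.induct)
  case (Phi_base x y \<phi>)
  let ?yf = "\<lambda>v\<in>carrier V. y \<otimes>\<^sub>L f v"
  have yf: "?yf : lin" using Phi_base by (intro lin_smult) auto
  have "tr (%_. \<one>\<^sub>L) ?yf : H.span lin_G"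
   using H.in_own_span[OF GH] trace_invariant[OF yf] by blast
  hence "x \<odot>\<^sub>H tr (%_. \<one>\<^sub>L) ?yf : H.span lin_G" using sm Phi_base(1) by (simp add: submodule_def)
  also have "x \<odot>\<^sub>H tr (%_. \<one>\<^sub>L) ?yf = tr \<phi> f"
  proof
   fix v
   show "(x \<odot>\<^sub>H tr (%_. \<one>\<^sub>L) ?yf) v = tr \<phi> f v"
   proof (cases "v : carrier V")
    case True
    have fc: "f (rho V (inv\<^bsub>G\<^esub> g) v) : carrier L" if "g : carrier G" for g
     using lin_closed Phi_base(4) True that by auto
    have "(x \<odot>\<^sub>H tr (%_. \<one>\<^sub>L) ?yf) v = x \<otimes>\<^sub>L (\<Oplus>\<^sub>L g\<in>carrier G. \<one>\<^sub>L \<otimes>\<^sub>L \<alpha> g (?yf (rho V (inv\<^bsub>G\<^esub> g) v)))"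
     using True by (simp add: H_def tr_def)
    also have "\<dots> = (\<Oplus>\<^sub>L g\<in>carrier G. x \<otimes>\<^sub>L (\<one>\<^sub>L \<otimes>\<^sub>L \<alpha> g (?yf (rho V (inv\<^bsub>G\<^esub> g) v))))"
     using True V.fin Phi_base(1,2) fc by (intro finsum_rdistr) auto
    also have "\<dots> = (\<Oplus>\<^sub>L g\<in>carrier G. \<phi> g \<otimes>\<^sub>L \<alpha> g (f (rho V (inv\<^bsub>G\<^esub> g) v)))"
     using True Phi_base(1-3) fc by (intro finsum_cong') (auto simp: \<alpha>_m m_assoc)
    finally show ?thesis using True by (simp add: tr_def)
   qed (simp add: H_def tr_def)
  qed
  finally show ?case .
 next
  case (Phi_add \<phi> \<psi> \<chi>)
  have "tr \<phi> f \<oplus>\<^sub>H tr \<psi> f : H.span lin_G" using sm Phi_add by (simp add: submodule_def)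
  also have "tr \<phi> f \<oplus>\<^sub>H tr \<psi> f = tr \<chi> f"
  proof
   fix v
   show "(tr \<phi> f \<oplus>\<^sub>H tr \<psi> f) v = tr \<chi> f v"
   proof (cases "v : carrier V")
    case True
    have fc: "f (rho V (inv\<^bsub>G\<^esub> g) v) : carrier L" if "g : carrier G" for g
     using lin_closed Phi_add(6) True that by auto
    have "tr \<chi> f v = (\<Oplus>\<^sub>L g\<in>carrier G. \<phi> g \<otimes>\<^sub>L \<alpha> g (f (rho V (inv\<^bsub>G\<^esub> g) v)) \<oplus>\<^sub>L \<psi> g \<otimes>\<^sub>L \<alpha> g (f (rho V (inv\<^bsub>G\<^esub> g) v)))"
     unfolding tr_apply[OF True] using True Phi_add(3) fc Phi_closed[OF Phi_add(1)] Phi_closed[OF Phi_add(2)]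
     by (intro finsum_cong') (auto simp: l_distr Phi_add.hyps)
    thus ?thesis using True fc Phi_closed[OF Phi_add(1)] Phi_closed[OF Phi_add(2)]
     by (simp add: H_def tr_def finsum_addf)
   qed (simp add: H_def tr_def)
  qed
  finally show ?case .
 qed
 note span = this
 obtain \<phi> where \<phi>: "Phi \<phi>" "!!g. g : carrier G ==> \<phi> g = (if g = \<one>\<^sub>G then \<one>\<^sub>L else \<zero>\<^sub>L)" using Phi_delta by blast
 have "tr \<phi> f = f" if f: "f : lin" for f
 proof (rule lin_eqI)
  fix v assume v: "v : carrier V"
  have "tr \<phi> f v = (\<Oplus>\<^sub>L g\<in>carrier G. if \<one>\<^sub>G = g then \<alpha> g (f (rho V (inv\<^bsub>G\<^esub> g) v)) else \<zero>\<^sub>L)"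
   unfolding tr_apply[OF v] using v lin_closed[OF f] by (intro finsum_cong') (auto simp: \<phi>(2))
  also have "\<dots> = \<alpha> \<one>\<^sub>G (f (rho V (inv\<^bsub>G\<^esub> \<one>\<^sub>G) v))"
   using v lin_closed[OF f] V.fin by (intro add.finprod_singleton) auto
  finally show "tr \<phi> f v = f v" using v lin_closed[OF f v] by (simp add: V.act_one \<alpha>_one)
 qed (use f tr_lin Phi_closed[OF \<phi>(1)] in auto)
 hence "lin \<subseteq> H.span lin_G" using span[OF \<phi>(1)] by (metis subsetI)
 thus ?thesis using H.span_is_subset2[OF GH] by simp
qed

text \<open>Each dual basis vector involves finitely many equivariant maps; a minimal generating
  subset of all of these is a basis, of size \<open>n\<close> because \<open>H\<close> has dimension
  \<open>n\<close>.\<close>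

lemma invariant_basis: "EX F. frame L H n F & (ALL j<n. F j : lin_G)"
proof -
 have GH: "lin_G \<subseteq> carrier H" by (auto simp: lin_G_def)
 have fd: H.fin_dim and dim: "H.dim = n" using H.frame_fin_dim H.frame_dim dual_frame by auto
 have "EX A. finite A & A \<subseteq> lin_G & dual j : H.span A" if "j < n" for j
 proof -
  have "dual j : H.span lin_G" using lin_span dual_lin that by simp
  then obtain a A where A: "A \<subseteq> lin_G" "finite A" "dual j = H.lincomb a A" "a : A \<rightarrow> carrier L"
   unfolding H.span_def by auto
  thus ?thesis by (auto simp: H.span_def)
 qed
 then obtain A where A: "!!j. j < n ==> finite (A j) & A j \<subseteq> lin_G & dual j : H.span (A j)" by metis
 define S where "S = (\<Union>j<n. A j)"
 have S: "finite S" "S \<subseteq> lin_G" using A by (auto simp: S_def)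
 have SH: "S \<subseteq> carrier H" using S GH by blast
 have "dual j : H.span S" if j: "j < n" for j
  using A[OF j] H.span_is_monotone[of "A j" S] j by (auto simp: S_def)
 hence "H.span (dual ` {..<n}) \<subseteq> H.span S"
  by (intro H.span_is_subset H.span_is_submodule SH) auto
 hence "H.gen_set S" using H.frame_basis[OF dual_frame] H.span_is_subset2[OF SH] by (auto simp: H.basis_def)
 then obtain B where B: "finite B" "B \<subseteq> S" "minimal B (%A. A \<subseteq> carrier H & H.gen_set A)"
 proof -
  have "S \<subseteq> carrier H & H.gen_set S" using \<open>H.gen_set S\<close> SH by blast
  from minimal_exists[OF S(1), of "%A. A \<subseteq> carrier H & H.gen_set A", OF this]
  obtain B where B: "B \<subseteq> S" "minimal B (%A. A \<subseteq> carrier H & H.gen_set A)" by blast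
  show thesis by (rule that[OF finite_subset[OF B(1) S(1)] B])
 qed
 have "H.basis B" by (rule H.min_gen_is_basis[OF B(3)])
 from H.basis_frame[OF B(1) this] dim obtain F where "frame L H n F" "F ` {..<n} = B" by auto
 thus ?thesis using B S by blast
qed

text \<open>Applying \<open>g\<close> to the expansion of an equivariant map in an equivariant basis
  gives a second expansion with coefficients \<open>\<alpha> g (c j)\<close>; by uniqueness the
  coefficients are fixed by \<open>G\<close>.\<close>

lemma descent:
 "EX F. (ALL j<n. F j : lin_G) & (ALL f:lin_G. EX! c. c : {..<n} \<rightarrow>\<^sub>E {x : carrier L. ALL g:carrier G. \<alpha> g x = x} &
   (ALL v:carrier V. f v = (\<Oplus>\<^sub>L j\<in>{..<n}. c j \<otimes>\<^sub>L F j v)))"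
proof -
 obtain F where F: "frame L H n F" "!!j. j < n ==> F j : lin_G" using invariant_basis by blast
 have FH: "F : {..<n} \<rightarrow> lin" using F(2) by (auto simp: lin_G_def)
 have Fc: "F j v : carrier L" if "j < n" "v : carrier V" for j v using FH lin_closed that by blast
 have eq: "(ALL v:carrier V. f v = (\<Oplus>\<^sub>L j\<in>{..<n}. c j \<otimes>\<^sub>L F j v)) \<longleftrightarrow> f = (\<Oplus>\<^sub>H j\<in>{..<n}. c j \<odot>\<^sub>H F j)"
  if f: "f : lin" and c: "c : {..<n} \<rightarrow> carrier L" for f c
 proof -
  let ?s = "\<Oplus>\<^sub>H j\<in>{..<n}. c j \<odot>\<^sub>H F j"
  have sl: "?s : lin" using H.smult_sum_closed[OF c, of F] FH by simp
  have ev: "?s v = (\<Oplus>\<^sub>L j\<in>{..<n}. c j \<otimes>\<^sub>L F j v)" if "v : carrier V" for v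
   using H_sum_eval[OF _ FH c that] by simp
  show ?thesis
  proof
   assume h: "ALL v:carrier V. f v = (\<Oplus>\<^sub>L j\<in>{..<n}. c j \<otimes>\<^sub>L F j v)"
   show "f = ?s" by (rule lin_eqI[OF f sl]) (simp only: h ev)
  next
   assume e: "f = ?s"
   show "ALL v:carrier V. f v = (\<Oplus>\<^sub>L j\<in>{..<n}. c j \<otimes>\<^sub>L F j v)"
    by (subst e) (blast intro: ev)
  qed
 qed
 show ?thesis
 proof (intro exI[of _ F] conjI ballI)
  fix f assume f: "f : lin_G"
  hence fl: "f : lin" by (simp add: lin_G_def)
  have ex: "EX! c. c : {..<n} \<rightarrow>\<^sub>E carrier L & f = (\<Oplus>\<^sub>H j\<in>{..<n}. c j \<odot>\<^sub>H F j)"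
   using F(1) fl by (simp add: frame_def)
  then obtain c where c: "c : {..<n} \<rightarrow>\<^sub>E carrier L" "f = (\<Oplus>\<^sub>H j\<in>{..<n}. c j \<odot>\<^sub>H F j)" by blast
  have c': "c : {..<n} \<rightarrow> carrier L" using c by auto
  have inv: "\<alpha> g (c j) = c j" if g: "g : carrier G" and j: "j < n" for g j
  proof -
   have gc: "(%j. \<alpha> g (c j)) : {..<n} \<rightarrow> carrier L" using c' g by auto
   have "f v = (\<Oplus>\<^sub>L j\<in>{..<n}. \<alpha> g (c j) \<otimes>\<^sub>L F j v)" if v: "v : carrier V" for v
   proof -
    \<comment> \<open>Since \<open>g\<close> takes \<open>w\<close> to \<open>v\<close>,
      equivariance of \<open>f\<close> and of each \<open>F j\<close> turns the expansion at
      \<open>w\<close> into one at \<open>v\<close>.\<close>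
    let ?w = "rho V (inv\<^bsub>G\<^esub> g) v"
    have w: "?w : carrier V" "rho V g ?w = v" using g v by (auto simp: V.act_mult[symmetric] V.act_one)
    have "f (rho V g ?w) = \<alpha> g (f ?w)" using f g w(1) by (simp add: lin_G_def)
    hence "f v = \<alpha> g (f ?w)" by (simp only: w(2))
    also have "f ?w = (\<Oplus>\<^sub>L j\<in>{..<n}. c j \<otimes>\<^sub>L F j ?w)" using eq[OF fl c', THEN iffD2, OF c(2)] w(1) by (rule bspec)
    also have "\<alpha> g (\<Oplus>\<^sub>L j\<in>{..<n}. c j \<otimes>\<^sub>L F j ?w) = (\<Oplus>\<^sub>L j\<in>{..<n}. \<alpha> g (c j \<otimes>\<^sub>L F j ?w))"
     using g c' Fc w by (intro \<alpha>_sum) auto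
    also have "\<dots> = (\<Oplus>\<^sub>L j\<in>{..<n}. \<alpha> g (c j) \<otimes>\<^sub>L F j v)"
    proof (intro finsum_cong')
     fix j assume j: "j : {..<n}"
     have "F j (rho V g ?w) = \<alpha> g (F j ?w)" using F(2)[of j] j g w(1) by (simp add: lin_G_def)
     hence "F j v = \<alpha> g (F j ?w)" by (simp only: w(2))
     thus "\<alpha> g (c j \<otimes>\<^sub>L F j ?w) = \<alpha> g (c j) \<otimes>\<^sub>L F j v" using g c' Fc w j by (simp add: \<alpha>_m Pi_iff)
    qed (use g c' Fc v in auto)
    finally show ?thesis .
   qed
   hence "f = (\<Oplus>\<^sub>H j\<in>{..<n}. \<alpha> g (c j) \<odot>\<^sub>H F j)" by (intro eq[OF fl gc, THEN iffD1] ballI)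
   from H.coords_unique[OF F(1) gc this j] H.coords_unique[OF F(1) c' c(2) j] show ?thesis by simp
  qed
  show "EX! c. c : {..<n} \<rightarrow>\<^sub>E {x : carrier L. ALL g:carrier G. \<alpha> g x = x} &
   (ALL v:carrier V. f v = (\<Oplus>\<^sub>L j\<in>{..<n}. c j \<otimes>\<^sub>L F j v))"
  proof (rule ex1I[of _ c])
   show "c : {..<n} \<rightarrow>\<^sub>E {x : carrier L. ALL g:carrier G. \<alpha> g x = x} &
    (ALL v:carrier V. f v = (\<Oplus>\<^sub>L j\<in>{..<n}. c j \<otimes>\<^sub>L F j v))"
    using c eq[OF fl c'] inv by (auto simp: PiE_iff)
  next
   fix d assume d: "d : {..<n} \<rightarrow>\<^sub>E {x : carrier L. ALL g:carrier G. \<alpha> g x = x} &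
    (ALL v:carrier V. f v = (\<Oplus>\<^sub>L j\<in>{..<n}. d j \<otimes>\<^sub>L F j v))"
   hence dP: "d : {..<n} \<rightarrow>\<^sub>E carrier L" by (auto simp: PiE_iff)
   hence "f = (\<Oplus>\<^sub>H j\<in>{..<n}. d j \<odot>\<^sub>H F j)" using eq[OF fl, of d] d by auto
   thus "d = c" using ex dP c by blast
  qed
 qed (use F(2) in auto)
qed

end

section \<open>Tensor products\<close>

text \<open>Closure under addition and scaling puts all bilinearity relations inside the free
  abelian group on \<open>carrier M \<times> carrier N\<close>, which is what forming the quotient
  requires.\<close>

locale tensor_product =
 fixes R :: "('r, 'z0) ring_scheme" and M :: "('r, 'm, 'z1) module_scheme" and N :: "('r, 'n, 'z2) module_scheme"
 assumes M_add: "m : carrier M ==> m' : carrier M ==> m \<oplus>\<^sub>M m' : carrier M"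
  and N_add: "y : carrier N ==> y' : carrier N ==> y \<oplus>\<^sub>N y' : carrier N"
  and M_smult: "c : carrier R ==> m : carrier M ==> c \<odot>\<^sub>M m : carrier M"
  and N_smult: "c : carrier R ==> y : carrier N ==> c \<odot>\<^sub>N y : carrier N"
begin

abbreviation T where "T \<equiv> tensor R M N"
abbreviation F where "F \<equiv> free_Abelian_group (carrier M \<times> carrier N)"
abbreviation cls where "cls \<equiv> tensor_class R M N"
abbreviation rels where "rels \<equiv> tensor_rels R M N"
abbreviation H where "H \<equiv> generate F rels"

definition pure :: "'m => 'n => ('m \<times> 'n \<Rightarrow>\<^sub>0 int) set" where "pure m y = cls (frag_of (m, y))"

lemma keys_diff3: "Poly_Mapping.keys (a - b - c) \<subseteq> Poly_Mapping.keys a \<union> Poly_Mapping.keys b \<union> Poly_Mapping.keys (c :: 'x \<Rightarrow>\<^sub>0 int)"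
 using keys_diff[of "a - b" c] keys_diff[of a b] by auto

lemma rels_F: "rels \<subseteq> carrier F"
proof
 fix x assume "x : rels"
 thus "x : carrier F"
  unfolding tensor_rels_def
 proof (elim UnE CollectE exE conjE)
  fix m m' n assume "x = frag_of (m \<oplus>\<^sub>M m', n) - frag_of (m, n) - frag_of (m', n)"
   "m : carrier M" "m' : carrier M" "n : carrier N"
  thus ?thesis using keys_diff3[of "frag_of (m \<oplus>\<^sub>M m', n)" "frag_of (m, n)" "frag_of (m', n)"] M_add by auto
 next
  fix m n n' assume "x = frag_of (m, n \<oplus>\<^sub>N n') - frag_of (m, n) - frag_of (m, n')"
   "m : carrier M" "n : carrier N" "n' : carrier N"
  thus ?thesis using keys_diff3[of "frag_of (m, n \<oplus>\<^sub>N n')" "frag_of (m, n)" "frag_of (m, n')"] N_add by auto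
 next
  fix r m n assume "x = frag_of (r \<odot>\<^sub>M m, n) - frag_of (m, r \<odot>\<^sub>N n)"
   "r : carrier R" "m : carrier M" "n : carrier N"
  thus ?thesis using keys_diff[of "frag_of (r \<odot>\<^sub>M m, n)" "frag_of (m, r \<odot>\<^sub>N n)"] M_smult N_smult by auto
 qed
qed

lemma F_add: "a : carrier F ==> b : carrier F ==> a + b : carrier F"
 using keys_add[of a b] by auto
lemma F_diff: "a : carrier F ==> b : carrier F ==> a - b : carrier F"
 using keys_diff[of a b] by auto
lemma F_neg: "a : carrier F ==> - a : carrier F" by auto
lemma F_zero: "0 : carrier F" by simp

lemma H_subgroup: "subgroup H F"
 by (rule group.generate_is_subgroup[OF group_free_Abelian_group rels_F])

lemma H_F: "H \<subseteq> carrier F" using subgroup.subset[OF H_subgroup] .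
lemma H_zero: "0 : H" using subgroup.one_closed[OF H_subgroup] by simp
lemma H_add: "a : H ==> b : H ==> a + b : H" using subgroup.m_closed[OF H_subgroup] by simp
lemma H_neg: "a : H ==> - a : H"
 using subgroup.m_inv_closed[OF H_subgroup, of a] H_F by (auto simp: subset_iff)
lemma H_diff: "a : H ==> b : H ==> a - b : H" using H_add[of a "- b"] H_neg by simp

lemma cls_iff: "a : carrier F ==> x : cls a \<longleftrightarrow> x - a : H"
 by (auto simp: tensor_class_def r_coset_def intro!: exI[of _ "x - a"] bexI[of _ "x - a"])

lemma cls_eq:
 assumes ab: "a : carrier F" "b : carrier F" shows "cls a = cls b \<longleftrightarrow> a - b : H"
proof
 assume "cls a = cls b"
 hence "a : cls b" using cls_iff[OF ab(1), of a] H_zero by simp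
 thus "a - b : H" using cls_iff ab by blast
next
 assume h: "a - b : H"
 show "cls a = cls b"
 proof (rule Set.set_eqI)
  fix x
  have "x - a : H \<longleftrightarrow> x - b : H"
   using H_add[OF _ h, of "x - a"] H_diff[OF _ h, of "x - b"] by auto
  thus "x : cls a \<longleftrightarrow> x : cls b" using cls_iff ab by blast
 qed
qed

lemma cls_mem: "a : carrier F ==> x : cls a ==> x : carrier F & cls x = cls a"
proof -
 assume a: "a : carrier F" "x : cls a"
 hence h: "x - a : H" using cls_iff by blast
 hence "x : carrier F" using F_add[OF subsetD[OF H_F h] a(1)] by simp
 thus ?thesis using h cls_eq a by blast
qed

lemma cls_self: "a : carrier F ==> a : cls a" using cls_iff H_zero by simp

lemma T_carrier: "carrier T = cls ` carrier F" by (simp add: tensor_def)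

lemma T_zero: "\<zero>\<^sub>T = cls 0" by (simp add: tensor_def)

text \<open>Independence of representatives: the set below \<open>the_elem\<close> in the addition
  of \<open>tensor\<close> has exactly one element.\<close>

lemma T_add: "a : carrier F ==> b : carrier F ==> cls a \<oplus>\<^sub>T cls b = cls (a + b)"
proof -
 assume ab: "a : carrier F" "b : carrier F"
 have "cls (f + g) = cls (a + b)" if "f : cls a" "g : cls b" for f g
 proof -
  have "f - a + (g - b) : H" using H_add that cls_iff ab by blast
  hence "(f + g) - (a + b) : H" by (simp add: algebra_simps)
  thus ?thesis using cls_eq[of "f + g" "a + b"] F_add cls_mem that ab by blast
 qed
 hence "{cls (f + g) | f g. f : cls a & g : cls b} = {cls (a + b)}"
  using cls_self ab by blast
 thus ?thesis by (simp add: tensor_def)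
qed

lemma T_abelian: "abelian_group T"
proof (rule abelian_groupI)
 fix x y assume "x : carrier T" "y : carrier T"
 thus "x \<oplus>\<^sub>T y : carrier T" "x \<oplus>\<^sub>T y = y \<oplus>\<^sub>T x"
  using F_add by (auto simp: T_carrier T_add add.commute simp del: carrier_free_Abelian_group_iff)
next
 fix x y z assume "x : carrier T" "y : carrier T" "z : carrier T"
 thus "x \<oplus>\<^sub>T y \<oplus>\<^sub>T z = x \<oplus>\<^sub>T (y \<oplus>\<^sub>T z)"
  using F_add by (auto simp: T_carrier T_add add.assoc simp del: carrier_free_Abelian_group_iff)
next
 fix x assume "x : carrier T"
 then obtain a where a: "a : carrier F" "x = cls a" by (auto simp: T_carrier)
 show "\<zero>\<^sub>T \<oplus>\<^sub>T x = x" using a T_add[OF F_zero a(1)] by (simp add: T_zero)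
 show "EX y:carrier T. y \<oplus>\<^sub>T x = \<zero>\<^sub>T"
  using a T_add[OF F_neg[OF a(1)] a(1)] F_neg[OF a(1)]
  by (intro bexI[of _ "cls (- a)"]) (auto simp: T_zero T_carrier simp del: carrier_free_Abelian_group_iff)
qed (use F_zero in \<open>auto simp: T_zero T_carrier simp del: carrier_free_Abelian_group_iff\<close>)

interpretation T: abelian_group T by (rule T_abelian)

lemma frag_F: "m : carrier M ==> y : carrier N ==> frag_of (m, y) : carrier F" by simp

lemma pure_closed: "m : carrier M ==> y : carrier N ==> pure m y : carrier T"
 using frag_F by (auto simp: pure_def T_carrier simp del: carrier_free_Abelian_group_iff)

lemma rels_H: "x : rels ==> x : H" by (rule generate.incl)

lemma rels_left: "m : carrier M ==> m' : carrier M ==> y : carrier N ==>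
  frag_of (m \<oplus>\<^sub>M m', y) - frag_of (m, y) - frag_of (m', y) : H"
 by (intro rels_H) (unfold tensor_rels_def, blast)
lemma rels_right: "m : carrier M ==> y : carrier N ==> y' : carrier N ==>
  frag_of (m, y \<oplus>\<^sub>N y') - frag_of (m, y) - frag_of (m, y') : H"
 by (intro rels_H) (unfold tensor_rels_def, blast)

lemma pure_add_left:
 assumes "m : carrier M" "m' : carrier M" "y : carrier N"
 shows "pure (m \<oplus>\<^sub>M m') y = pure m y \<oplus>\<^sub>T pure m' y"
proof -
 have "frag_of (m \<oplus>\<^sub>M m', y) - frag_of (m, y) - frag_of (m', y) : H"
  using assms by (intro rels_left)
 hence "frag_of (m \<oplus>\<^sub>M m', y) - (frag_of (m, y) + frag_of (m', y)) : H" by (simp add: algebra_simps)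
 thus ?thesis
  unfolding pure_def T_add[OF frag_F[OF assms(1,3)] frag_F[OF assms(2,3)]]
  using cls_eq[OF frag_F[OF M_add[OF assms(1,2)] assms(3)] F_add[OF frag_F[OF assms(1,3)] frag_F[OF assms(2,3)]]] by blast
qed

lemma pure_add_right:
 assumes "m : carrier M" "y : carrier N" "y' : carrier N"
 shows "pure m (y \<oplus>\<^sub>N y') = pure m y \<oplus>\<^sub>T pure m y'"
proof -
 have "frag_of (m, y \<oplus>\<^sub>N y') - frag_of (m, y) - frag_of (m, y') : H"
  using assms by (intro rels_right)
 hence "frag_of (m, y \<oplus>\<^sub>N y') - (frag_of (m, y) + frag_of (m, y')) : H" by (simp add: algebra_simps)
 thus ?thesis
  unfolding pure_def T_add[OF frag_F[OF assms(1,2)] frag_F[OF assms(1,3)]]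
  using cls_eq[OF frag_F[OF assms(1) N_add[OF assms(2,3)]] F_add[OF frag_F[OF assms(1,2)] frag_F[OF assms(1,3)]]] by blast
qed

lemma pure_balanced:
 assumes "c : carrier R" "m : carrier M" "y : carrier N"
 shows "pure (c \<odot>\<^sub>M m) y = pure m (c \<odot>\<^sub>N y)"
proof -
 have "frag_of (c \<odot>\<^sub>M m, y) - frag_of (m, c \<odot>\<^sub>N y) : H"
  using assms by (intro rels_H) (unfold tensor_rels_def, blast)
 thus ?thesis
  unfolding pure_def
  using cls_eq[OF frag_F[OF M_smult[OF assms(1,2)] assms(3)] frag_F[OF assms(2) N_smult[OF assms(1,3)]]] by blast
qed

lemma cls_minus: "a : carrier F ==> b : carrier F ==> cls (a - b) = cls a \<ominus>\<^sub>T cls b"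
proof -
 assume ab: "a : carrier F" "b : carrier F"
 have c: "cls a : carrier T" "cls b : carrier T" "cls (a - b) : carrier T"
  using ab F_diff[OF ab] by (auto simp: T_carrier simp del: carrier_free_Abelian_group_iff)
 have "cls (a - b) \<oplus>\<^sub>T cls b = cls a" using T_add[OF F_diff[OF ab] ab(2)] by simp
 hence "cls a \<ominus>\<^sub>T cls b = (cls (a - b) \<oplus>\<^sub>T cls b) \<ominus>\<^sub>T cls b" by simp
 also have "\<dots> = cls (a - b)" using c by (simp add: a_minus_def T.a_assoc T.r_neg)
 finally show ?thesis by simp
qed

text \<open>Closure under differences instead of sums covers negatives as well and matches
  \<open>free_Abelian_group_induct\<close>.\<close>

lemma tensor_induct [consumes 1, case_names zero pure minus]:
 assumes x: "x : carrier T" and z: "P \<zero>\<^sub>T"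
  and p: "!!m y. m : carrier M ==> y : carrier N ==> P (pure m y)"
  and d: "!!x y. x : carrier T ==> y : carrier T ==> P x ==> P y ==> P (x \<ominus>\<^sub>T y)"
 shows "P x"
proof -
 obtain a where a: "a : carrier F" "x = cls a" using x by (auto simp: T_carrier)
 have "Poly_Mapping.keys a \<subseteq> carrier M \<times> carrier N" using a by simp
 hence "P (cls a)"
 proof (rule free_Abelian_group_induct)
  fix u w assume 2: "Poly_Mapping.keys u \<subseteq> carrier M \<times> carrier N" "Poly_Mapping.keys w \<subseteq> carrier M \<times> carrier N"
   "P (cls u)" "P (cls w)"
  hence uw: "u : carrier F" "w : carrier F" by auto
  have "cls u : carrier T" "cls w : carrier T" using uw by (auto simp: T_carrier simp del: carrier_free_Abelian_group_iff)
  thus "P (cls (u - w))" using d 2 cls_minus[OF uw] by simp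
 qed (use z p in \<open>auto simp: T_zero pure_def\<close>)
 thus ?thesis using a by simp
qed

text \<open>The universal property: the extension of \<open>\<beta>\<close> to the free abelian
  group has a kernel that contains the relations, hence the subgroup they generate.\<close>

lemma tensor_lift:
 fixes A :: "('a, 'z3) ring_scheme"
 assumes A: "abelian_group A"
  and cl: "!!m y. m : carrier M ==> y : carrier N ==> \<beta> m y : carrier A"
  and l: "!!m m' y. m : carrier M ==> m' : carrier M ==> y : carrier N ==> \<beta> (m \<oplus>\<^sub>M m') y = \<beta> m y \<oplus>\<^sub>A \<beta> m' y"
  and rr: "!!m y y'. m : carrier M ==> y : carrier N ==> y' : carrier N ==> \<beta> m (y \<oplus>\<^sub>N y') = \<beta> m y \<oplus>\<^sub>A \<beta> m y'"
  and b: "!!c m y. c : carrier R ==> m : carrier M ==> y : carrier N ==> \<beta> (c \<odot>\<^sub>M m) y = \<beta> m (c \<odot>\<^sub>N y)"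
 shows "EX \<mu>. \<mu> : carrier T \<rightarrow> carrier A &
  (ALL x:carrier T. ALL y:carrier T. \<mu> (x \<oplus>\<^sub>T y) = \<mu> x \<oplus>\<^sub>A \<mu> y) &
  (ALL m:carrier M. ALL y:carrier N. \<mu> (pure m y) = \<beta> m y)"
proof -
 interpret A: abelian_group A by fact
 have "(%(m, y). \<beta> m y) ` (carrier M \<times> carrier N) \<subseteq> carrier (add_monoid A)" using cl by auto
 from comm_group.free_Abelian_group_universal[OF A.a_comm_group this]
 obtain h where h: "h : hom F (add_monoid A)" "!!x. x : carrier M \<times> carrier N ==> h (frag_of x) = (%(m, y). \<beta> m y) x"
  by blast
 have hf: "h (frag_of (m, y)) = \<beta> m y" if "m : carrier M" "y : carrier N" for m y using h(2)[of "(m, y)"] that by simp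
 have hc: "h a : carrier A" if "a : carrier F" for a using h(1) that unfolding hom_def by auto
 have ha: "h (a + b) = h a \<oplus>\<^sub>A h b" if "a : carrier F" "b : carrier F" for a b
  using h(1) that unfolding hom_def by auto
 have hd: "h (a - b) = h a \<ominus>\<^sub>A h b" if ab: "a : carrier F" "b : carrier F" for a b
 proof -
  have "h a = h (a - b) \<oplus>\<^sub>A h b" using ha[OF F_diff[OF ab] ab(2)] by simp
  thus ?thesis using hc[OF F_diff[OF ab]] hc[OF ab(2)] by (simp add: a_minus_def A.a_assoc A.r_neg)
 qed
 have h0: "h 0 = \<zero>\<^sub>A" using hd[OF F_zero F_zero] hc[OF F_zero] by (simp add: a_minus_def A.r_neg)
 have sub: "x \<ominus>\<^sub>A y = \<zero>\<^sub>A" if "x : carrier A" "x = y" for x y using that by (simp add: a_minus_def A.r_neg)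
 have sub2: "x \<oplus>\<^sub>A y \<ominus>\<^sub>A x \<ominus>\<^sub>A y = \<zero>\<^sub>A" if "x : carrier A" "y : carrier A" for x y
  using that by (simp add: a_minus_def A.a_comm[of x y] A.a_assoc A.r_neg)
 have rels0: "h x = \<zero>\<^sub>A" if x: "x : rels" for x
  using x unfolding tensor_rels_def
 proof (elim UnE CollectE exE conjE)
  fix m m' n assume x: "x = frag_of (m \<oplus>\<^sub>M m', n) - frag_of (m, n) - frag_of (m', n)"
   and c: "m : carrier M" "m' : carrier M" "n : carrier N"
  have "h x = h (frag_of (m \<oplus>\<^sub>M m', n)) \<ominus>\<^sub>A h (frag_of (m, n)) \<ominus>\<^sub>A h (frag_of (m', n))"
   unfolding x using c by (simp only: hd F_diff frag_F M_add)
  thus ?thesis using c by (simp add: hf M_add l sub2 cl)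
 next
  fix m n n' assume x: "x = frag_of (m, n \<oplus>\<^sub>N n') - frag_of (m, n) - frag_of (m, n')"
   and c: "m : carrier M" "n : carrier N" "n' : carrier N"
  have "h x = h (frag_of (m, n \<oplus>\<^sub>N n')) \<ominus>\<^sub>A h (frag_of (m, n)) \<ominus>\<^sub>A h (frag_of (m, n'))"
   unfolding x using c by (simp only: hd F_diff frag_F N_add)
  thus ?thesis using c by (simp add: hf N_add rr sub2 cl)
 next
  fix c m n assume x: "x = frag_of (c \<odot>\<^sub>M m, n) - frag_of (m, c \<odot>\<^sub>N n)"
   and c: "c : carrier R" "m : carrier M" "n : carrier N"
  have "h x = h (frag_of (c \<odot>\<^sub>M m, n)) \<ominus>\<^sub>A h (frag_of (m, c \<odot>\<^sub>N n))"
   unfolding x using c by (simp only: hd frag_F M_smult N_smult)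
  thus ?thesis using c by (simp add: hf M_smult N_smult b sub cl)
 qed
 have "subgroup {x : carrier F. h x = \<zero>\<^sub>A} F"
 proof (rule group.subgroupI[OF group_free_Abelian_group])
  fix a assume "a : {x : carrier F. h x = \<zero>\<^sub>A}"
  hence a: "a : carrier F" "h a = \<zero>\<^sub>A" by auto
  have "h (- a) = \<zero>\<^sub>A" using hd[OF F_zero a(1)] h0 a(2) by (simp add: a_minus_def)
  thus "inv\<^bsub>F\<^esub> a : {x : carrier F. h x = \<zero>\<^sub>A}" using a(1) by simp
 next
  fix a b assume "a : {x : carrier F. h x = \<zero>\<^sub>A}" "b : {x : carrier F. h x = \<zero>\<^sub>A}"
  hence "a : carrier F" "h a = \<zero>\<^sub>A" "b : carrier F" "h b = \<zero>\<^sub>A" by auto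
  thus "a \<otimes>\<^sub>F b : {x : carrier F. h x = \<zero>\<^sub>A}" using ha[of a b] F_add[of a b] by simp
 qed (use F_zero h0 in \<open>auto simp del: carrier_free_Abelian_group_iff\<close>)
 hence "H \<subseteq> {x : carrier F. h x = \<zero>\<^sub>A}"
  using group.generate_subgroup_incl[OF group_free_Abelian_group, of rels "{x : carrier F. h x = \<zero>\<^sub>A}"]
   rels0 rels_F by blast
 hence H0: "h x = \<zero>\<^sub>A" if "x : H" for x using that by blast
 \<comment> \<open>An element of the tensor product is a coset, so the induced map is evaluated at a
   chosen representative.\<close>
 define \<mu> where "\<mu> X = h (SOME x. x : X)" for X
 have \<mu>: "\<mu> (cls a) = h a" if a: "a : carrier F" for a
 proof -
  have s: "(SOME x. x : cls a) : cls a" using cls_self[OF a] by (rule someI)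
  define x where "x = (SOME x. x : cls a)"
  have x: "x : carrier F" "x - a : H" using cls_mem[OF a] s cls_iff[OF a] unfolding x_def by auto
  have "h x = h (x - a) \<oplus>\<^sub>A h a" using ha[OF F_diff[OF x(1) a] a] by simp
  thus ?thesis using H0[OF x(2)] hc[OF a] by (simp add: \<mu>_def x_def)
 qed
 show ?thesis
 proof (intro exI[of _ \<mu>] conjI ballI)
  show "\<mu> : carrier T \<rightarrow> carrier A" using \<mu> hc by (auto simp: T_carrier simp del: carrier_free_Abelian_group_iff)
 next
  fix x y assume "x : carrier T" "y : carrier T"
  then obtain a b where ab: "a : carrier F" "b : carrier F" "x = cls a" "y = cls b" by (auto simp: T_carrier)
  thus "\<mu> (x \<oplus>\<^sub>T y) = \<mu> x \<oplus>\<^sub>A \<mu> y"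
   using T_add[OF ab(1,2)] \<mu>[OF F_add[OF ab(1,2)]] \<mu>[OF ab(1)] \<mu>[OF ab(2)] ha[OF ab(1,2)] by simp
 next
  fix m y assume "m : carrier M" "y : carrier N"
  thus "\<mu> (pure m y) = \<beta> m y" using \<mu>[OF frag_F, of m y] hf by (simp add: pure_def)
 qed
qed

lemma tensor_ext:
 assumes A: "abelian_group A" and c: "\<mu> : carrier T \<rightarrow> carrier A" "\<nu> : carrier T \<rightarrow> carrier A"
  and a: "!!x y. x : carrier T ==> y : carrier T ==> \<mu> (x \<oplus>\<^sub>T y) = \<mu> x \<oplus>\<^sub>A \<mu> y"
   "!!x y. x : carrier T ==> y : carrier T ==> \<nu> (x \<oplus>\<^sub>T y) = \<nu> x \<oplus>\<^sub>A \<nu> y"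
  and p: "!!m y. m : carrier M ==> y : carrier N ==> \<mu> (pure m y) = \<nu> (pure m y)"
  and x: "x : carrier T"
 shows "\<mu> x = \<nu> x"
proof -
 interpret A: abelian_group A by fact
 have f_minus: "f (x \<ominus>\<^sub>T y) = f x \<ominus>\<^sub>A f y" if xy: "x : carrier T" "y : carrier T" and f: "f : carrier T \<rightarrow> carrier A"
  "!!x y. x : carrier T ==> y : carrier T ==> f (x \<oplus>\<^sub>T y) = f x \<oplus>\<^sub>A f y" for f x y
 proof -
  have xm: "x \<ominus>\<^sub>T y : carrier T" using xy by simp
  have "(x \<ominus>\<^sub>T y) \<oplus>\<^sub>T y = x" using xy by (simp add: a_minus_def T.a_assoc T.l_neg)
  hence "f x = f (x \<ominus>\<^sub>T y) \<oplus>\<^sub>A f y" using f(2)[OF xm xy(2)] by simp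
  moreover have "f (x \<ominus>\<^sub>T y) : carrier A" "f y : carrier A" using f(1) xm xy by auto
  ultimately show ?thesis by (simp add: a_minus_def A.a_assoc A.r_neg)
 qed
 have f_zero: "f \<zero>\<^sub>T = \<zero>\<^sub>A" if f: "f : carrier T \<rightarrow> carrier A"
  "!!x y. x : carrier T ==> y : carrier T ==> f (x \<oplus>\<^sub>T y) = f x \<oplus>\<^sub>A f y" for f
 proof -
  have "f \<zero>\<^sub>T : carrier A" using f(1) by auto
  moreover have "\<zero>\<^sub>T \<ominus>\<^sub>T \<zero>\<^sub>T = \<zero>\<^sub>T" by (rule T.r_neg[OF T.zero_closed, folded a_minus_def])
  ultimately have "f \<zero>\<^sub>T = f \<zero>\<^sub>T \<ominus>\<^sub>A f \<zero>\<^sub>T" using f_minus[OF T.zero_closed T.zero_closed f] by (simp only:)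
  thus ?thesis using \<open>f \<zero>\<^bsub>T\<^esub> \<in> carrier A\<close> by (simp add: a_minus_def A.r_neg)
 qed
 show ?thesis using x
 proof (induction rule: tensor_induct)
  case zero show ?case using f_zero[OF c(1) a(1)] f_zero[OF c(2) a(2)] by simp
 next
  case (pure m y) thus ?case by (rule p)
 next
  case (minus x y) thus ?case using f_minus[OF minus(1,2) c(1) a(1)] f_minus[OF minus(1,2) c(2) a(2)] by simp
 qed
qed

end

lemma frag_extend_pair_keys:
 assumes "!!m y. m : A ==> y : B ==> f m : A' & g y : B'" "Poly_Mapping.keys c \<subseteq> A \<times> B"
 shows "Poly_Mapping.keys (frag_extend (%(m, y). frag_of (f m, g y)) c) \<subseteq> A' \<times> B'"
 using assms(2)
proof (rule free_Abelian_group_induct)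
 let ?e = "frag_extend (%(m, y). frag_of (f m, g y))"
 fix x y assume "Poly_Mapping.keys (?e x) \<subseteq> A' \<times> B'" "Poly_Mapping.keys (?e y) \<subseteq> A' \<times> B'"
 thus "Poly_Mapping.keys (?e (x - y)) \<subseteq> A' \<times> B'"
  unfolding frag_extend_diff using keys_diff[of "?e x" "?e y"] by blast
qed (use assms(1) in auto)

text \<open>Balancedness is asked of the images inside the target tensor product, with no map
  between the two rings in the statement. This covers operations over one ring as well as
  restriction, where \<open>R\<close> and \<open>R'\<close> differ.\<close>

lemma tensor_map_props:
 assumes T1: "tensor_product R M N" and T2: "tensor_product R' M' N'"
  and cl: "\<alpha> : carrier M \<rightarrow> carrier M'" "\<beta> : carrier N \<rightarrow> carrier N'"
  and \<alpha>: "!!m m'. m : carrier M ==> m' : carrier M ==> \<alpha> (m \<oplus>\<^sub>M m') = \<alpha> m \<oplus>\<^sub>M' \<alpha> m'"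
  and \<beta>: "!!y y'. y : carrier N ==> y' : carrier N ==> \<beta> (y \<oplus>\<^sub>N y') = \<beta> y \<oplus>\<^sub>N' \<beta> y'"
  and b: "!!c m y. c : carrier R ==> m : carrier M ==> y : carrier N ==>
   tensor_product.pure R' M' N' (\<alpha> (c \<odot>\<^sub>M m)) (\<beta> y) = tensor_product.pure R' M' N' (\<alpha> m) (\<beta> (c \<odot>\<^sub>N y))"
 shows "tensor_map R' M' N' \<alpha> \<beta> : carrier (tensor R M N) \<rightarrow> carrier (tensor R' M' N')" (is "PROP ?P1")
  and "x : carrier (tensor R M N) ==> y : carrier (tensor R M N) ==>
   tensor_map R' M' N' \<alpha> \<beta> (x \<oplus>\<^sub>(tensor R M N) y) =
   tensor_map R' M' N' \<alpha> \<beta> x \<oplus>\<^sub>(tensor R' M' N') tensor_map R' M' N' \<alpha> \<beta> y"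
  and "m : carrier M ==> n : carrier N ==>
   tensor_map R' M' N' \<alpha> \<beta> (tensor_product.pure R M N m n) = tensor_product.pure R' M' N' (\<alpha> m) (\<beta> n)"
proof -
 interpret T1: tensor_product R M N by fact
 interpret T2: tensor_product R' M' N' by fact
 let ?e = "frag_extend (%(m, n). frag_of (\<alpha> m, \<beta> n))"
 have eF: "?e f : carrier T2.F" if "f : carrier T1.F" for f
  using frag_extend_pair_keys[of "carrier M" "carrier N" \<alpha> "carrier M'" \<beta> "carrier N'" f] cl that by auto
 have e: "?e (frag_of (m, n)) = frag_of (\<alpha> m, \<beta> n)" for m n by simp
 have c: "!!m. m : carrier M ==> \<alpha> m : carrier M'" "!!n. n : carrier N ==> \<beta> n : carrier N'" using cl by auto
 have relsH: "?e x : T2.H" if x: "x : T1.rels" for x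
  using x unfolding tensor_rels_def[of R M N]
 proof (elim UnE CollectE exE conjE)
  fix m m' n assume x: "x = frag_of (m \<oplus>\<^sub>M m', n) - frag_of (m, n) - frag_of (m', n)"
   "m : carrier M" "m' : carrier M" "n : carrier N"
  have "?e x = frag_of (\<alpha> m \<oplus>\<^sub>M' \<alpha> m', \<beta> n) - frag_of (\<alpha> m, \<beta> n) - frag_of (\<alpha> m', \<beta> n)"
   by (simp only: x(1) frag_extend_diff e \<alpha>[OF x(2,3)])
  thus ?thesis using T2.rels_left[OF c(1)[OF x(2)] c(1)[OF x(3)] c(2)[OF x(4)]] by simp
 next
  fix m n n' assume x: "x = frag_of (m, n \<oplus>\<^sub>N n') - frag_of (m, n) - frag_of (m, n')"
   "m : carrier M" "n : carrier N" "n' : carrier N"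
  have "?e x = frag_of (\<alpha> m, \<beta> n \<oplus>\<^sub>N' \<beta> n') - frag_of (\<alpha> m, \<beta> n) - frag_of (\<alpha> m, \<beta> n')"
   by (simp only: x(1) frag_extend_diff e \<beta>[OF x(3,4)])
  thus ?thesis using T2.rels_right[OF c(1)[OF x(2)] c(2)[OF x(3)] c(2)[OF x(4)]] by simp
 next
  fix r m n assume x: "x = frag_of (r \<odot>\<^sub>M m, n) - frag_of (m, r \<odot>\<^sub>N n)"
   "r : carrier R" "m : carrier M" "n : carrier N"
  have "?e x = frag_of (\<alpha> (r \<odot>\<^sub>M m), \<beta> n) - frag_of (\<alpha> m, \<beta> (r \<odot>\<^sub>N n))"
   by (simp only: x(1) frag_extend_diff e)
  moreover have "frag_of (\<alpha> (r \<odot>\<^sub>M m), \<beta> n) - frag_of (\<alpha> m, \<beta> (r \<odot>\<^sub>N n)) : T2.H"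
   by (rule T2.cls_eq[OF T2.frag_F[OF c(1)[OF T1.M_smult[OF x(2,3)]] c(2)[OF x(4)]]
     T2.frag_F[OF c(1)[OF x(3)] c(2)[OF T1.N_smult[OF x(2,4)]]], THEN iffD1, OF b[OF x(2-4), unfolded T2.pure_def]])
  ultimately show ?thesis by simp
 qed
 \<comment> \<open>Induction over \<open>generate\<close> extends the inclusion from the relations
   to the whole subgroup, so the map descends to cosets.\<close>
 have HH: "?e x : T2.H" if "x : T1.H" for x
  using that
 proof (induction rule: generate.induct)
  case one thus ?case using T2.H_zero by simp
 next
  case (incl h) thus ?case by (rule relsH)
 next
  case (inv h)
  have "h : carrier T1.F" using T1.rels_F inv by blast
  thus ?case using T2.H_neg[OF relsH[OF inv]] by (simp add: frag_extend_minus)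
 next
  case (eng h1 h2) thus ?case using T2.H_add by (simp add: frag_extend_add)
 qed
 have tm: "tensor_map R' M' N' \<alpha> \<beta> (T1.cls a) = T2.cls (?e a)" if a: "a : carrier T1.F" for a
 proof -
  have "T2.cls (?e f) = T2.cls (?e a)" if f: "f : T1.cls a" for f
  proof -
   have "f - a : T1.H" "f : carrier T1.F" using f T1.cls_iff[OF a] T1.cls_mem[OF a] by auto
   thus ?thesis using HH[of "f - a"] T2.cls_eq[OF eF eF[OF a]] by (simp add: frag_extend_diff del: carrier_free_Abelian_group_iff)
  qed
  hence "(%f. T2.cls (?e f)) ` T1.cls a = {T2.cls (?e a)}" using T1.cls_self[OF a] by blast
  thus ?thesis by (simp add: tensor_map_def)
 qed
 show "PROP ?P1"
  using tm eF by (auto simp: T1.T_carrier T2.T_carrier simp del: carrier_free_Abelian_group_iff)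
 show "tensor_map R' M' N' \<alpha> \<beta> (x \<oplus>\<^sub>(tensor R M N) y) =
   tensor_map R' M' N' \<alpha> \<beta> x \<oplus>\<^sub>(tensor R' M' N') tensor_map R' M' N' \<alpha> \<beta> y"
  if xy: "x : carrier (tensor R M N)" "y : carrier (tensor R M N)"
 proof -
  obtain a b where ab: "a : carrier T1.F" "b : carrier T1.F" "x = T1.cls a" "y = T1.cls b"
   using xy by (auto simp: T1.T_carrier)
  show ?thesis
   unfolding ab(3,4) T1.T_add[OF ab(1,2)] tm[OF ab(1)] tm[OF ab(2)] tm[OF T1.F_add[OF ab(1,2)]]
    T2.T_add[OF eF[OF ab(1)] eF[OF ab(2)]] by (simp add: frag_extend_add)
 qed
 show "tensor_map R' M' N' \<alpha> \<beta> (tensor_product.pure R M N m n) = tensor_product.pure R' M' N' (\<alpha> m) (\<beta> n)"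
  if "m : carrier M" "n : carrier N"
  unfolding T1.pure_def T2.pure_def using tm[OF T1.frag_F[OF that]] by simp
qed

section \<open>Stalks\<close>

locale presheaf =
 fixes F :: "('x, 'm, 'z, 'w) sheaf_data_scheme"
 assumes is_presheaf: "is_presheaf F"
begin

abbreviation op :: "'x set => bool" where "op \<equiv> openin (base F)"

lemma res_closed:
 assumes "op U" "op V" "V \<subseteq> U" "s : sects F U" shows "res F U V s : sects F V"
proof -
 have "res F U V : sects F U \<rightarrow> sects F V"
  by (rule is_presheaf[unfolded is_presheaf_def, THEN conjunct1, rule_format]) (simp add: assms)
 thus ?thesis using assms(4) by (rule funcset_mem)
qed

lemma res_id: "op U ==> s : sects F U ==> res F U U s = s"
 by (rule is_presheaf[unfolded is_presheaf_def, THEN conjunct2, THEN conjunct1, rule_format])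

lemma res_res:
 assumes "op U" "op V" "op W" "W \<subseteq> V" "V \<subseteq> U" "s : sects F U"
 shows "res F V W (res F U V s) = res F U W s"
 by (rule is_presheaf[unfolded is_presheaf_def, THEN conjunct2, THEN conjunct2, rule_format]) (simp_all add: assms)

lemma op_Int: "op U ==> op V ==> op (U \<inter> V)" by (rule openin_Int)

lemma op_points: "op (points F)" by simp

lemma op_sub: "op U ==> U \<subseteq> points F" by (rule openin_subset)

lemma germ_mem: "op U ==> x : U ==> s : sects F U ==> (U, s) : germ F x U s"
 unfolding germ_def by auto

text \<open>A germ is the set of all pairs that agree with a given one near \<open>x\<close>; the
  inclusion is transitivity of this relation, on the intersection of two neighbourhoods.\<close>

lemma germ_subset:
 assumes U: "op U" "x : U" "s : sects F U" and V: "op V" "x : V" "t : sects F V"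
  and W: "op W" "x : W" "W \<subseteq> U \<inter> V" "res F U W s = res F V W t"
 shows "germ F x U s \<subseteq> germ F x V t"
proof
 fix p assume "p : germ F x U s"
 then obtain V' t' W' where p: "p = (V', t')" "op V'" "x : V'" "t' : sects F V'"
  "op W'" "x : W'" "W' \<subseteq> U \<inter> V'" "res F U W' s = res F V' W' t'"
  unfolding germ_def by auto
 let ?W = "W \<inter> W'"
 have o: "op ?W" using op_Int W p by blast
 have "res F V ?W t = res F W ?W (res F V W t)" using V W o by (intro res_res[symmetric]) auto
 also have "\<dots> = res F U ?W s" using U W o by (simp add: W(4)[symmetric] res_res)
 also have "\<dots> = res F W' ?W (res F U W' s)" using U p o by (intro res_res[symmetric]) auto
 also have "\<dots> = res F V' ?W t'" using p o by (simp add: res_res)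
 finally have "res F V ?W t = res F V' ?W t'" .
 thus "p : germ F x V t"
  unfolding germ_def p(1) using p(2-7) W o by (auto intro!: exI[of _ ?W])
qed

lemma germ_eq:
 assumes U: "op U" "x : U" "s : sects F U" and V: "op V" "x : V" "t : sects F V"
 shows "germ F x U s = germ F x V t \<longleftrightarrow> (EX W. op W & x : W & W \<subseteq> U \<inter> V & res F U W s = res F V W t)"
proof
 assume "germ F x U s = germ F x V t"
 hence "(V, t) : germ F x U s" using germ_mem[OF V] by simp
 thus "EX W. op W & x : W & W \<subseteq> U \<inter> V & res F U W s = res F V W t" unfolding germ_def by blast
next
 assume "EX W. op W & x : W & W \<subseteq> U \<inter> V & res F U W s = res F V W t"
 then obtain W where W: "op W" "x : W" "W \<subseteq> U \<inter> V" "res F U W s = res F V W t" by blast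
 show "germ F x U s = germ F x V t"
  using germ_subset[OF U V W] germ_subset[OF V U W(1,2) _ W(4)[symmetric]] W(3) by blast
qed

lemma germ_res:
 assumes "op U" "op W" "x : W" "W \<subseteq> U" "s : sects F U"
 shows "germ F x W (res F U W s) = germ F x U s"
proof -
 have "res F W W (res F U W s) = res F U W s" using assms by (intro res_id res_closed) auto
 thus ?thesis using assms res_closed by (subst germ_eq) auto
qed

lemma germ_stalk: "op U ==> x : U ==> s : sects F U ==> germ F x U s : stalk F x"
 unfolding stalk_def by blast

lemma stalkE:
 assumes "A : stalk F x"
 obtains U s where "op U" "x : U" "s : sects F U" "A = germ F x U s"
 using assms unfolding stalk_def by blast

text \<open>Compatibility with restriction makes the result independent of the representative, so
  the definite description in \<open>stalk_op1\<close> has a value.\<close>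

lemma stalk_op1_germ:
 assumes cl: "!!U s. op U ==> s : sects F U ==> f U s : sects F U"
  and cp: "!!U W s. op U ==> op W ==> W \<subseteq> U ==> s : sects F U ==> res F U W (f U s) = f W (res F U W s)"
  and U: "op U" "x : U" "s : sects F U"
 shows "stalk_op1 F x f (germ F x U s) = germ F x U (f U s)"
 unfolding stalk_op1_def
proof (rule the_equality)
 show "EX Ua sa. op Ua & x : Ua & sa : sects F Ua & germ F x U s = germ F x Ua sa &
   germ F x U (f U s) = germ F x Ua (f Ua sa)" using U by blast
next
 fix B assume "EX Ua sa. op Ua & x : Ua & sa : sects F Ua & germ F x U s = germ F x Ua sa & B = germ F x Ua (f Ua sa)"
 then obtain V t where V: "op V" "x : V" "t : sects F V" "germ F x U s = germ F x V t" "B = germ F x V (f V t)" by blast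
 then obtain W where W: "op W" "x : W" "W \<subseteq> U \<inter> V" "res F U W s = res F V W t"
  using germ_eq[OF U V(1-3)] by blast
 have "res F U W (f U s) = res F V W (f V t)" using W U V by (simp add: cp)
 hence "germ F x U (f U s) = germ F x V (f V t)"
  using W by (subst germ_eq[OF U(1,2) cl[OF U(1,3)] V(1,2) cl[OF V(1,3)]]) blast
 thus "B = germ F x U (f U s)" using V by simp
qed

end

text \<open>Two representatives of the first germ agree on \<open>W1\<close>, two of the second on
  \<open>W2\<close>; the intersection serves both and makes the description in
  \<open>stalk_op2\<close> unique.\<close>

lemma stalk_op2_germ:
 assumes R: "presheaf R" and F: "presheaf F" and b: "base R = base F"
  and cl: "!!U r s. openin (base F) U ==> r : sects R U ==> s : sects F U ==> f U r s : sects F U"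
  and cp: "!!U W r s. openin (base F) U ==> openin (base F) W ==> W \<subseteq> U ==> r : sects R U ==> s : sects F U ==>
   res F U W (f U r s) = f W (res R U W r) (res F U W s)"
  and U: "openin (base F) U" "x : U" "r : sects R U" "s : sects F U"
 shows "stalk_op2 R F x f (germ R x U r) (germ F x U s) = germ F x U (f U r s)"
proof -
 interpret R: presheaf R by fact
 interpret F: presheaf F by fact
 show ?thesis
  unfolding stalk_op2_def
 proof (rule the_equality)
  show "EX Ua ra sa. openin (base F) Ua & x : Ua & ra : sects R Ua & sa : sects F Ua &
   germ R x U r = germ R x Ua ra & germ F x U s = germ F x Ua sa &
   germ F x U (f U r s) = germ F x Ua (f Ua ra sa)" using U by blast
 next
  fix C assume "EX Ua ra sa. openin (base F) Ua & x : Ua & ra : sects R Ua & sa : sects F Ua &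
   germ R x U r = germ R x Ua ra & germ F x U s = germ F x Ua sa & C = germ F x Ua (f Ua ra sa)"
  then obtain V r' s' where V: "openin (base F) V" "x : V" "r' : sects R V" "s' : sects F V"
   "germ R x U r = germ R x V r'" "germ F x U s = germ F x V s'" "C = germ F x V (f V r' s')" by blast
  obtain W1 where W1: "openin (base F) W1" "x : W1" "W1 \<subseteq> U \<inter> V" "res R U W1 r = res R V W1 r'"
   using R.germ_eq[of U x r V r'] U V b by auto
  obtain W2 where W2: "openin (base F) W2" "x : W2" "W2 \<subseteq> U \<inter> V" "res F U W2 s = res F V W2 s'"
   using F.germ_eq[of U x s V s'] U V by auto
  let ?W = "W1 \<inter> W2"
  have W: "openin (base F) ?W" "x : ?W" "?W \<subseteq> U" "?W \<subseteq> V" using W1 W2 by auto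
  have "res R U ?W r = res R W1 ?W (res R U W1 r)"
   using W W1 U by (intro R.res_res[symmetric]) (auto simp: b)
  also have "\<dots> = res R V ?W r'" using W W1 V by (simp add: W1(4) R.res_res b)
  finally have r: "res R U ?W r = res R V ?W r'" .
  have "res F U ?W s = res F W2 ?W (res F U W2 s)"
   using W W2 U by (intro F.res_res[symmetric]) auto
  also have "\<dots> = res F V ?W s'" using W W2 V by (simp add: W2(4) F.res_res)
  finally have s: "res F U ?W s = res F V ?W s'" .
  have "res F U ?W (f U r s) = res F V ?W (f V r' s')" using W U V by (simp add: cp r s)
  hence "germ F x U (f U r s) = germ F x V (f V r' s')"
   using W by (subst F.germ_eq[OF U(1,2) cl[OF U(1,3,4)] V(1,2) cl[OF V(1,3,4)]]) blast
  thus "C = germ F x U (f U r s)" using V by simp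
 qed
qed

lemma common_rep:
 assumes R: "presheaf R" and F: "presheaf F" and b: "base R = base F" and A: "A : stalk R x" "B : stalk F x"
 obtains U r s where "openin (base F) U" "x : U" "r : sects R U" "s : sects F U"
  "A = germ R x U r" "B = germ F x U s"
proof -
 interpret R: presheaf R by fact
 interpret F: presheaf F by fact
 obtain U r where U: "R.op U" "x : U" "r : sects R U" "A = germ R x U r" using A(1) by (rule R.stalkE)
 obtain V s where V: "F.op V" "x : V" "s : sects F V" "B = germ F x V s" using A(2) by (rule F.stalkE)
 show ?thesis
 proof (rule that[of "U \<inter> V" "res R U (U \<inter> V) r" "res F V (U \<inter> V) s"])
  show "openin (base F) (U \<inter> V)" using U V b by auto
  thus "A = germ R x (U \<inter> V) (res R U (U \<inter> V) r)" "B = germ F x (U \<inter> V) (res F V (U \<inter> V) s)"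
   "res R U (U \<inter> V) r : sects R (U \<inter> V)" "res F V (U \<inter> V) s : sects F (U \<inter> V)"
   using U V b by (auto simp: R.germ_res F.germ_res R.res_closed F.res_closed)
 qed (use U V in auto)
qed

section \<open>Stalks of sheaves of rings and of modules\<close>

locale ring_presheaf = presheaf F for F :: "('x, 'a, unit, 'w) sheaf_data_scheme" +
 assumes sec_cring: "op U ==> cring (sec F U)"
  and res_hom: "op U ==> op V ==> V \<subseteq> U ==> res F U V : ring_hom (sec F U) (sec F V)"

lemma sheaf_of_rings_presheaf: "sheaf_of_rings F ==> ring_presheaf F"
 by (simp add: ring_presheaf_def presheaf_def ring_presheaf_axioms_def sheaf_of_rings_def is_sheaf_def)

locale mod_presheaf = R: ring_presheaf R + presheaf F
 for R :: "('x, 'a, unit, 'w1) sheaf_data_scheme" and F :: "('x, 'm, ('a, 'm, unit) module_ext, 'w2) sheaf_data_scheme" +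
 assumes base_eq: "base F = base R"
  and sec_module: "op U ==> Module.module (sec R U) (sec F U)"
  and res_add: "op U ==> op V ==> V \<subseteq> U ==> s : sects F U ==> t : sects F U ==>
   res F U V (s \<oplus>\<^sub>(sec F U) t) = res F U V s \<oplus>\<^sub>(sec F V) res F U V t"
  and res_smult: "op U ==> op V ==> V \<subseteq> U ==> a : sects R U ==> s : sects F U ==>
   res F U V (a \<odot>\<^sub>(sec F U) s) = res R U V a \<odot>\<^sub>(sec F V) res F U V s"

lemma O_module_presheaf: "sheaf_of_rings R ==> O_module R F ==> mod_presheaf R F"
 by (simp add: sheaf_of_rings_presheaf mod_presheaf_def mod_presheaf_axioms_def presheaf_def O_module_def is_sheaf_def)

context ring_presheaf
begin

lemma res_ring: assumes "op U" "op V" "V \<subseteq> U"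
 shows "s : sects F U ==> t : sects F U ==> res F U V (s \<oplus>\<^sub>(sec F U) t) = res F U V s \<oplus>\<^sub>(sec F V) res F U V t" (is "PROP ?P1")
  "s : sects F U ==> t : sects F U ==> res F U V (s \<otimes>\<^sub>(sec F U) t) = res F U V s \<otimes>\<^sub>(sec F V) res F U V t" (is "PROP ?P2")
  "res F U V \<one>\<^sub>(sec F U) = \<one>\<^sub>(sec F V)" (is "PROP ?P3") "res F U V \<zero>\<^sub>(sec F U) = \<zero>\<^sub>(sec F V)" (is "PROP ?P4")
proof -
 interpret U: cring "sec F U" by (rule sec_cring[OF assms(1)])
 interpret V: cring "sec F V" by (rule sec_cring[OF assms(2)])
 interpret h: ring_hom_cring "sec F U" "sec F V" "res F U V"
  by unfold_locales (rule res_hom[OF assms])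
 show "PROP ?P1"
  "PROP ?P2"
  "PROP ?P3" "PROP ?P4"
  by simp_all
qed

lemma sec_closed: assumes "op U"
 shows "s : sects F U ==> t : sects F U ==> s \<oplus>\<^sub>(sec F U) t : sects F U" (is "PROP ?P1")
  "s : sects F U ==> t : sects F U ==> s \<otimes>\<^sub>(sec F U) t : sects F U" (is "PROP ?P2")
  "\<one>\<^sub>(sec F U) : sects F U" "\<zero>\<^sub>(sec F U) : sects F U"
proof -
 interpret U: cring "sec F U" by (rule sec_cring[OF assms(1)])
 show "PROP ?P1" by (rule U.a_closed)
 show "PROP ?P2" by (rule U.m_closed)
 show "\<one>\<^sub>(sec F U) : sects F U" by (rule U.one_closed)
 show "\<zero>\<^sub>(sec F U) : sects F U" by (rule U.zero_closed)
qed

abbreviation (input) SR where "SR x \<equiv> stalk_ring F x"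

lemma stalk_carrier [simp]: "carrier (SR x) = stalk F x" by (simp add: stalk_ring_def)

lemma germ_add: "op U ==> x : U ==> s : sects F U ==> t : sects F U ==>
  germ F x U s \<oplus>\<^sub>(SR x) germ F x U t = germ F x U (s \<oplus>\<^sub>(sec F U) t)"
 unfolding stalk_ring_def using stalk_op2_germ[OF presheaf_axioms presheaf_axioms, of "%U. add (sec F U)" U x s t] sec_closed(1) res_ring(1)
 by simp

lemma germ_mult: "op U ==> x : U ==> s : sects F U ==> t : sects F U ==>
  germ F x U s \<otimes>\<^sub>(SR x) germ F x U t = germ F x U (s \<otimes>\<^sub>(sec F U) t)"
 unfolding stalk_ring_def using stalk_op2_germ[OF presheaf_axioms presheaf_axioms, of "%U. mult (sec F U)" U x s t] sec_closed(2) res_ring(2)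
 by simp

lemma germ_zero: "op U ==> x : U ==> \<zero>\<^sub>(SR x) = germ F x U \<zero>\<^sub>(sec F U)"
 using germ_res[of "points F" U x "\<zero>\<^sub>(sec F (points F))"] sec_closed(4)[OF op_points] op_sub[of U] res_ring(4)[of "points F" U]
 by (simp add: stalk_ring_def)

lemma germ_one: "op U ==> x : U ==> \<one>\<^sub>(SR x) = germ F x U \<one>\<^sub>(sec F U)"
 using germ_res[of "points F" U x "\<one>\<^sub>(sec F (points F))"] sec_closed(3)[OF op_points] op_sub[of U] res_ring(3)[of "points F" U]
 by (simp add: stalk_ring_def)

lemma stalk2:
 assumes "A : stalk F x" "B : stalk F x"
 obtains U s t where "op U" "x : U" "s : sects F U" "t : sects F U" "A = germ F x U s" "B = germ F x U t"
 by (rule common_rep[OF presheaf_axioms presheaf_axioms refl assms]) (rule that)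

lemma stalk3:
 assumes "A : stalk F x" "B : stalk F x" "C : stalk F x"
 obtains U s t u where "op U" "x : U" "s : sects F U" "t : sects F U" "u : sects F U"
  "A = germ F x U s" "B = germ F x U t" "C = germ F x U u"
proof -
 obtain U s t where U: "op U" "x : U" "s : sects F U" "t : sects F U" "A = germ F x U s" "B = germ F x U t"
  using assms(1,2) by (rule stalk2)
 obtain V u where V: "op V" "x : V" "u : sects F V" "C = germ F x V u" using assms(3) by (rule stalkE)
 let ?W = "U \<inter> V"
 have W: "op ?W" "x : ?W" "?W \<subseteq> U" "?W \<subseteq> V" using U V by auto
 show ?thesis
  by (rule that[OF W(1,2) res_closed[OF U(1) W(1,3) U(3)] res_closed[OF U(1) W(1,3) U(4)] res_closed[OF V(1) W(1,4) V(3)]])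
   (use U V W in \<open>simp_all add: germ_res\<close>)
qed

text \<open>Finitely many germs have representatives over one open set, so each ring axiom is
  inherited from the sections there.\<close>

lemma stalk_cring:
 assumes x: "x : points F"
 shows "cring (SR x)"
proof (rule cringI)
 show "abelian_group (SR x)"
 proof (rule abelian_groupI)
  fix A B assume "A : carrier (SR x)" "B : carrier (SR x)"
  hence st: "A : stalk F x" "B : stalk F x" by simp_all
  obtain U s t where U: "op U" "x : U" "s : sects F U" "t : sects F U" "A = germ F x U s" "B = germ F x U t"
   using st by (rule stalk2)
  interpret U: cring "sec F U" by (rule sec_cring[OF U(1)])
  show "A \<oplus>\<^sub>(SR x) B : carrier (SR x)" "A \<oplus>\<^sub>(SR x) B = B \<oplus>\<^sub>(SR x) A"
   using U by (auto simp: germ_add germ_stalk U.a_comm)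
 next
  fix A B C assume "A : carrier (SR x)" "B : carrier (SR x)" "C : carrier (SR x)"
  hence st: "A : stalk F x" "B : stalk F x" "C : stalk F x" by simp_all
  obtain U s t u where U: "op U" "x : U" "s : sects F U" "t : sects F U" "u : sects F U"
   "A = germ F x U s" "B = germ F x U t" "C = germ F x U u"
   using st by (rule stalk3)
  interpret U: cring "sec F U" by (rule sec_cring[OF U(1)])
  show "A \<oplus>\<^sub>(SR x) B \<oplus>\<^sub>(SR x) C = A \<oplus>\<^sub>(SR x) (B \<oplus>\<^sub>(SR x) C)"
   using U by (auto simp: germ_add U.a_assoc)
 next
  fix A assume "A : carrier (SR x)"
  hence st: "A : stalk F x" by simp_all
  obtain U s where U: "op U" "x : U" "s : sects F U" "A = germ F x U s"
   using st by (rule stalkE)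
  interpret U: cring "sec F U" by (rule sec_cring[OF U(1)])
  show "\<zero>\<^sub>(SR x) \<oplus>\<^sub>(SR x) A = A"
   unfolding germ_zero[OF U(1,2)] using U by (simp add: germ_add)
  show "EX B:carrier (SR x). B \<oplus>\<^sub>(SR x) A = \<zero>\<^sub>(SR x)"
   unfolding germ_zero[OF U(1,2)] using U
   by (intro bexI[of _ "germ F x U (\<ominus>\<^sub>(sec F U) s)"]) (simp_all add: germ_add germ_stalk U.l_neg)
 next
  show "\<zero>\<^sub>(SR x) : carrier (SR x)"
   unfolding germ_zero[OF op_points x] using sec_closed(4)[OF op_points] x by (simp add: germ_stalk)
 qed
 show "Group.comm_monoid (SR x)"
 proof (rule comm_monoidI)
  fix A B assume "A : carrier (SR x)" "B : carrier (SR x)"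
  hence st: "A : stalk F x" "B : stalk F x" by simp_all
  obtain U s t where U: "op U" "x : U" "s : sects F U" "t : sects F U" "A = germ F x U s" "B = germ F x U t"
   using st by (rule stalk2)
  interpret U: cring "sec F U" by (rule sec_cring[OF U(1)])
  show "A \<otimes>\<^sub>(SR x) B : carrier (SR x)" "A \<otimes>\<^sub>(SR x) B = B \<otimes>\<^sub>(SR x) A"
   using U by (auto simp: germ_mult germ_stalk U.m_comm)
 next
  fix A B C assume "A : carrier (SR x)" "B : carrier (SR x)" "C : carrier (SR x)"
  hence st: "A : stalk F x" "B : stalk F x" "C : stalk F x" by simp_all
  obtain U s t u where U: "op U" "x : U" "s : sects F U" "t : sects F U" "u : sects F U"
   "A = germ F x U s" "B = germ F x U t" "C = germ F x U u"
   using st by (rule stalk3)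
  interpret U: cring "sec F U" by (rule sec_cring[OF U(1)])
  show "A \<otimes>\<^sub>(SR x) B \<otimes>\<^sub>(SR x) C = A \<otimes>\<^sub>(SR x) (B \<otimes>\<^sub>(SR x) C)"
   using U by (auto simp: germ_mult U.m_assoc)
 next
  fix A assume "A : carrier (SR x)"
  hence st: "A : stalk F x" by simp_all
  obtain U s where U: "op U" "x : U" "s : sects F U" "A = germ F x U s"
   using st by (rule stalkE)
  interpret U: cring "sec F U" by (rule sec_cring[OF U(1)])
  show "\<one>\<^sub>(SR x) \<otimes>\<^sub>(SR x) A = A"
   unfolding germ_one[OF U(1,2)] using U by (simp add: germ_mult)
 next
  show "\<one>\<^sub>(SR x) : carrier (SR x)"
   unfolding germ_one[OF op_points x] using sec_closed(3)[OF op_points] x by (simp add: germ_stalk)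
 qed
 fix A B C assume "A : carrier (SR x)" "B : carrier (SR x)" "C : carrier (SR x)"
 hence st: "A : stalk F x" "B : stalk F x" "C : stalk F x" by simp_all
  obtain U s t u where U: "op U" "x : U" "s : sects F U" "t : sects F U" "u : sects F U"
  "A = germ F x U s" "B = germ F x U t" "C = germ F x U u"
  using st by (rule stalk3)
 interpret U: cring "sec F U" by (rule sec_cring[OF U(1)])
 show "(A \<oplus>\<^sub>(SR x) B) \<otimes>\<^sub>(SR x) C = A \<otimes>\<^sub>(SR x) C \<oplus>\<^sub>(SR x) B \<otimes>\<^sub>(SR x) C"
  using U by (auto simp: germ_mult germ_add U.l_distr)
qed

end

context mod_presheaf
begin

abbreviation (input) SM where "SM x \<equiv> stalk_module R F x"


lemma msec_closed: assumes "op U"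
 shows "s : sects F U ==> t : sects F U ==> s \<oplus>\<^sub>(sec F U) t : sects F U" (is "PROP ?P1")
  "a : sects R U ==> s : sects F U ==> a \<odot>\<^sub>(sec F U) s : sects F U" (is "PROP ?P2") "\<zero>\<^sub>(sec F U) : sects F U"
proof -
 interpret U: Module.module "sec R U" "sec F U" by (rule sec_module[OF assms(1)])
 show "PROP ?P1" by (rule U.a_closed)
 show "PROP ?P2" by (rule U.smult_closed)
 show "\<zero>\<^sub>(sec F U) : sects F U" by (rule U.zero_closed)
qed

lemma res_zero: assumes "op U" "op V" "V \<subseteq> U" shows "res F U V \<zero>\<^sub>(sec F U) = \<zero>\<^sub>(sec F V)"
proof -
 interpret U: Module.module "sec R U" "sec F U" by (rule sec_module[OF assms(1)])
 interpret V: Module.module "sec R V" "sec F V" by (rule sec_module[OF assms(2)])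
 from mod_hom_finsum[OF U.abelian_group_axioms V.abelian_group_axioms, of "res F U V" "%_. \<zero>\<^sub>(sec F U)" "{}"]
 show ?thesis using res_closed[OF assms] res_add[OF assms] by simp
qed

lemma smod_carrier [simp]: "carrier (SM x) = stalk F x" by (simp add: stalk_module_def)

lemma mgerm_add: "op U ==> x : U ==> s : sects F U ==> t : sects F U ==>
  germ F x U s \<oplus>\<^sub>(SM x) germ F x U t = germ F x U (s \<oplus>\<^sub>(sec F U) t)"
 unfolding stalk_module_def using stalk_op2_germ[OF presheaf_axioms presheaf_axioms, of "%U. add (sec F U)" U x s t] msec_closed(1) res_add
 by simp

lemma mgerm_smult: "op U ==> x : U ==> a : sects R U ==> t : sects F U ==>
  germ R x U a \<odot>\<^sub>(SM x) germ F x U t = germ F x U (a \<odot>\<^sub>(sec F U) t)"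
 unfolding stalk_module_def using stalk_op2_germ[OF R.presheaf_axioms presheaf_axioms base_eq[symmetric], of "%U. smult (sec F U)" U x a t] msec_closed(2) res_smult
 by simp

lemma mgerm_zero: "op U ==> x : U ==> \<zero>\<^sub>(SM x) = germ F x U \<zero>\<^sub>(sec F U)"
 using germ_res[of "points F" U x "\<zero>\<^sub>(sec F (points F))"] msec_closed(3)[OF op_points] op_sub[of U] res_zero[of "points F" U]
 by (simp add: stalk_module_def)

lemma mstalk2:
 assumes "A : stalk F x" "B : stalk F x"
 obtains U s t where "op U" "x : U" "s : sects F U" "t : sects F U" "A = germ F x U s" "B = germ F x U t"
 by (rule common_rep[OF presheaf_axioms presheaf_axioms refl assms]) (rule that)

lemma mstalk3:
 assumes "A : stalk F x" "B : stalk F x" "C : stalk F x"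
 obtains U s t u where "op U" "x : U" "s : sects F U" "t : sects F U" "u : sects F U"
  "A = germ F x U s" "B = germ F x U t" "C = germ F x U u"
proof -
 obtain U s t where U: "op U" "x : U" "s : sects F U" "t : sects F U" "A = germ F x U s" "B = germ F x U t"
  using assms(1,2) by (rule mstalk2)
 obtain V u where V: "op V" "x : V" "u : sects F V" "C = germ F x V u" using assms(3) by (rule stalkE)
 let ?W = "U \<inter> V"
 have W: "op ?W" "x : ?W" "?W \<subseteq> U" "?W \<subseteq> V" using U V by auto
 show ?thesis
  by (rule that[OF W(1,2) res_closed[OF U(1) W(1,3) U(3)] res_closed[OF U(1) W(1,3) U(4)] res_closed[OF V(1) W(1,4) V(3)]])
   (use U V W in \<open>simp_all add: germ_res\<close>)
qed

lemma rstalk4: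
 assumes "a : stalk R x" "b : stalk R x" "A : stalk F x" "B : stalk F x"
 obtains U r r' s t where "op U" "x : U" "r : sects R U" "r' : sects R U" "s : sects F U" "t : sects F U"
  "a = germ R x U r" "b = germ R x U r'" "A = germ F x U s" "B = germ F x U t"
proof -
 obtain U s t where U: "op U" "x : U" "s : sects F U" "t : sects F U" "A = germ F x U s" "B = germ F x U t"
  using assms(3,4) by (rule mstalk2)
 obtain V r r' where V: "R.op V" "x : V" "r : sects R V" "r' : sects R V" "a = germ R x V r" "b = germ R x V r'"
  using assms(1,2) by (rule R.stalk2)
 let ?W = "U \<inter> V"
 have W: "op ?W" "x : ?W" "?W \<subseteq> U" "?W \<subseteq> V" "R.op ?W" using U V by (auto simp: base_eq)
 show ?thesis
  by (rule that[OF W(1,2) R.res_closed[OF V(1) W(5,4) V(3)] R.res_closed[OF V(1) W(5,4) V(4)]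
     res_closed[OF U(1) W(1,3) U(3)] res_closed[OF U(1) W(1,3) U(4)]])
   (use U V W in \<open>simp_all add: germ_res R.germ_res\<close>)
qed

lemma stalk_mod:
 assumes x: "x : points F"
 shows "Module.module (stalk_ring R x) (SM x)"
proof (rule module_criteria)
 show "cring (stalk_ring R x)" by (rule R.stalk_cring) (use x base_eq in auto)
 have rc: "carrier (stalk_ring R x) = stalk R x" by simp
 show "\<zero>\<^sub>(SM x) : carrier (SM x)"
  unfolding mgerm_zero[OF op_points x] using msec_closed(3)[OF op_points] x by (simp add: germ_stalk)
 have two: "A \<oplus>\<^sub>(SM x) B : stalk F x & A \<oplus>\<^sub>(SM x) B = B \<oplus>\<^sub>(SM x) A"
  if AB: "A : stalk F x" "B : stalk F x" for A B
 proof -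
  obtain U s t where U: "op U" "x : U" "s : sects F U" "t : sects F U" "A = germ F x U s" "B = germ F x U t"
   using AB by (rule mstalk2)
  interpret U: Module.module "sec R U" "sec F U" by (rule sec_module[OF U(1)])
  show ?thesis using U by (auto simp: mgerm_add germ_stalk U.a_comm)
 qed
 show "ALL v w. v : carrier (SM x) & w : carrier (SM x) -->
   v \<oplus>\<^sub>(SM x) w : carrier (SM x)"
  "ALL v w. v : carrier (SM x) & w : carrier (SM x) -->
   v \<oplus>\<^sub>(SM x) w = w \<oplus>\<^sub>(SM x) v"
  using two by auto
 have one: "A \<oplus>\<^sub>(SM x) \<zero>\<^sub>(SM x) = A & \<one>\<^sub>(stalk_ring R x) \<odot>\<^sub>(SM x) A = A &
   (EX B:stalk F x. A \<oplus>\<^sub>(SM x) B = \<zero>\<^sub>(SM x))" if A: "A : stalk F x" for A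
 proof -
  obtain U s where U: "op U" "x : U" "s : sects F U" "A = germ F x U s" using A by (rule stalkE)
  interpret U: Module.module "sec R U" "sec F U" by (rule sec_module[OF U(1)])
  have RU: "R.op U" using U base_eq by simp
  show ?thesis
   unfolding mgerm_zero[OF U(1,2)] R.germ_one[OF RU U(2)] using U R.sec_closed(3)[OF RU]
   by (auto simp: mgerm_add mgerm_smult U.r_neg intro!: bexI[of _ "germ F x U (\<ominus>\<^sub>(sec F U) s)"] germ_stalk)
 qed
 show "ALL v:carrier (SM x). EX neg_v:carrier (SM x).
   v \<oplus>\<^sub>(SM x) neg_v = \<zero>\<^sub>(SM x)"
  "ALL v:carrier (SM x). v \<oplus>\<^sub>(SM x) \<zero>\<^sub>(SM x) = v"
  "ALL v:carrier (SM x). \<one>\<^sub>(stalk_ring R x) \<odot>\<^sub>(SM x) v = v"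
  using one by auto
 have three: "A \<oplus>\<^sub>(SM x) B \<oplus>\<^sub>(SM x) C = A \<oplus>\<^sub>(SM x) (B \<oplus>\<^sub>(SM x) C)"
  if ABC: "A : stalk F x" "B : stalk F x" "C : stalk F x" for A B C
 proof -
  obtain U s t u where U: "op U" "x : U" "s : sects F U" "t : sects F U" "u : sects F U"
   "A = germ F x U s" "B = germ F x U t" "C = germ F x U u" using ABC by (rule mstalk3)
  interpret U: Module.module "sec R U" "sec F U" by (rule sec_module[OF U(1)])
  show ?thesis using U by (auto simp: mgerm_add U.a_assoc)
 qed
 thus "ALL v w xa. v : carrier (SM x) & w : carrier (SM x) & xa : carrier (SM x) -->
   v \<oplus>\<^sub>(SM x) w \<oplus>\<^sub>(SM x) xa = v \<oplus>\<^sub>(SM x) (w \<oplus>\<^sub>(SM x) xa)"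
  by auto
 have four: "a \<odot>\<^sub>(SM x) A : stalk F x &
   (a \<otimes>\<^sub>(stalk_ring R x) b) \<odot>\<^sub>(SM x) A = a \<odot>\<^sub>(SM x) (b \<odot>\<^sub>(SM x) A) &
   (a \<oplus>\<^sub>(stalk_ring R x) b) \<odot>\<^sub>(SM x) A = (a \<odot>\<^sub>(SM x) A) \<oplus>\<^sub>(SM x) (b \<odot>\<^sub>(SM x) A) &
   a \<odot>\<^sub>(SM x) (A \<oplus>\<^sub>(SM x) B) = (a \<odot>\<^sub>(SM x) A) \<oplus>\<^sub>(SM x) (a \<odot>\<^sub>(SM x) B)"
  if h: "a : stalk R x" "b : stalk R x" "A : stalk F x" "B : stalk F x" for a b A B
 proof -
  obtain U r r' s t where U: "op U" "x : U" "r : sects R U" "r' : sects R U" "s : sects F U" "t : sects F U"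
   "a = germ R x U r" "b = germ R x U r'" "A = germ F x U s" "B = germ F x U t" using h by (rule rstalk4)
  interpret U: Module.module "sec R U" "sec F U" by (rule sec_module[OF U(1)])
  have RU: "R.op U" using U base_eq by simp
  show ?thesis
   using U RU by (simp add: mgerm_add mgerm_smult R.germ_mult R.germ_add germ_stalk U.smult_assoc1 U.smult_l_distr U.smult_r_distr)
 qed
 show "ALL c v. c : carrier (stalk_ring R x) & v : carrier (SM x) -->
   c \<odot>\<^sub>(SM x) v : carrier (SM x)"
  "ALL a b v. a : carrier (stalk_ring R x) & b : carrier (stalk_ring R x) & v : carrier (SM x) -->
   (a \<otimes>\<^sub>(stalk_ring R x) b) \<odot>\<^sub>(SM x) v = a \<odot>\<^sub>(SM x) (b \<odot>\<^sub>(SM x) v)"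
  "ALL a b v. a : carrier (stalk_ring R x) & b : carrier (stalk_ring R x) & v : carrier (SM x) -->
   (a \<oplus>\<^sub>(stalk_ring R x) b) \<odot>\<^sub>(SM x) v = a \<odot>\<^sub>(SM x) v \<oplus>\<^sub>(SM x) b \<odot>\<^sub>(SM x) v"
  "ALL a v w. a : carrier (stalk_ring R x) & v : carrier (SM x) & w : carrier (SM x) -->
   a \<odot>\<^sub>(SM x) (v \<oplus>\<^sub>(SM x) w) = a \<odot>\<^sub>(SM x) v \<oplus>\<^sub>(SM x) a \<odot>\<^sub>(SM x) w"
  unfolding rc smod_carrier using four by blast+
qed

end

section \<open>Sheaf axioms\<close>

locale sheaf = presheaf F for F :: "('x, 'm, 'z, 'w) sheaf_data_scheme" +
 assumes is_sheaf: "is_sheaf F"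
begin

lemma glue1:
 assumes "!!U. U : \<U> ==> op U & s U : sects F U"
  and "!!U V. U : \<U> ==> V : \<U> ==> res F U (U \<inter> V) (s U) = res F V (U \<inter> V) (s V)"
 shows "EX! t. t : sects F (\<Union>\<U>) & (ALL U:\<U>. res F (\<Union>\<U>) U t = s U)"
 by (rule is_sheaf[unfolded is_sheaf_def, THEN conjunct2, rule_format]) (use assms in blast)

text \<open>The uniqueness half of the gluing axiom, for the cover by all open sets on which
  \<open>s\<close> and \<open>t\<close> agree.\<close>

lemma locality:
 assumes U: "op U" "s : sects F U" "t : sects F U"
  and loc: "!!y. y : U ==> EX D. op D & y : D & D \<subseteq> U & res F U D s = res F U D t"
 shows "s = t"
proof -
 define \<U> where "\<U> = {D. op D & D \<subseteq> U & res F U D s = res F U D t}"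
 have un: "\<Union>\<U> = U" using loc by (auto simp: \<U>_def)
 have ex: "EX! r. r : sects F (\<Union>\<U>) & (ALL D:\<U>. res F (\<Union>\<U>) D r = res F U D s)"
 proof (rule glue1)
  fix D assume D: "D : \<U>"
  show "op D & res F U D s : sects F D" using D U res_closed[of U D s] by (auto simp: \<U>_def)
  fix E assume E: "E : \<U>"
  have o: "op (D \<inter> E)" using D E by (auto simp: \<U>_def)
  show "res F D (D \<inter> E) (res F U D s) = res F E (D \<inter> E) (res F U E s)"
   using D E U o by (simp add: \<U>_def res_res)
 qed
 have "ALL D:\<U>. res F U D t = res F U D s" by (auto simp: \<U>_def)
 with ex U show ?thesis unfolding un by blast
qed

text \<open>The data are indexed by points instead of by members of the cover. Different points may
  share an open set, hence the choice \<open>c\<close>; compatibility at such points forces equal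
  sections.\<close>

lemma glue_local:
 assumes U: "op U"
  and sc: "!!x. x : U ==> op (W x) & x : W x & W x \<subseteq> U & s x : sects F (W x)"
  and cp: "!!x y. x : U ==> y : U ==> res F (W x) (W x \<inter> W y) (s x) = res F (W y) (W x \<inter> W y) (s y)"
 shows "EX t:sects F U. ALL x:U. res F U (W x) t = s x"
proof -
 define c where "c D = (SOME x. x : U & W x = D)" for D
 have c: "c (W x) : U & W (c (W x)) = W x" if "x : U" for x
  unfolding c_def by (rule someI[of _ x]) (simp add: that)
 have un: "\<Union>(W ` U) = U" using sc by blast
 have s_c: "s (c (W x)) = s x" if x: "x : U" for x
 proof -
  have e: "W (c (W x)) = W x" and cU: "c (W x) : U" using c[OF x] by auto
  have "res F (W x) (W x) (s (c (W x))) = res F (W x) (W x) (s x)" using cp[OF cU x] by (simp add: e)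
  thus ?thesis using sc[OF x] sc[OF cU] by (simp add: res_id e)
 qed
 have "EX! t. t : sects F (\<Union>(W ` U)) & (ALL D:W ` U. res F (\<Union>(W ` U)) D t = s (c D))"
 proof (rule glue1)
  fix D assume "D : W ` U"
  then obtain x where x: "x : U" "D = W x" by auto
  show "op D & s (c D) : sects F D" using sc[OF x(1)] x s_c by simp
  fix E assume "E : W ` U"
  then obtain y where y: "y : U" "E = W y" by auto
  show "res F D (D \<inter> E) (s (c D)) = res F E (D \<inter> E) (s (c E))"
   using cp[OF x(1) y(1)] x y s_c by simp
 qed
 then obtain t where "t : sects F U" "ALL D:W ` U. res F U D t = s (c D)" unfolding un by blast
 thus ?thesis using s_c by (intro bexI[of _ t]) auto
qed

text \<open>Gluing over the empty cover.\<close>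

lemma sects_empty: "EX! t. t : sects F {}"
 using glue1[of "{}" undefined] by simp

end

section \<open>Localizations and spectra\<close>

locale mult_set = cring R for R :: "('a, 'z) ring_scheme" (structure) and S :: "'a set" +
 assumes S_R: "S \<subseteq> carrier R" and S_one: "\<one> : S" and S_mult: "a : S ==> b : S ==> a \<otimes> b : S"
begin

lemma SR: "a : S ==> a : carrier R" using S_R by blast

lemma frac_self: "a : carrier R ==> b : S ==> (a, b) : loc_frac R S a b"
 using S_one by (auto simp: loc_frac_def)

text \<open>Transitivity of equality of fractions, with multiplier
  \<open>u \<otimes> w \<otimes> b\<close>.\<close>

lemma frac_sub:
 assumes "a : carrier R" "c : carrier R" "b : S" "d : S" and u: "u : S" "u \<otimes> (a \<otimes> d) = u \<otimes> (c \<otimes> b)"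
 shows "loc_frac R S a b \<subseteq> loc_frac R S c d"
proof
 fix p assume "p : loc_frac R S a b"
 then obtain e f w where p: "p = (e, f)" "e : carrier R" "f : S" "w : S" "w \<otimes> (a \<otimes> f) = w \<otimes> (e \<otimes> b)"
  by (auto simp: loc_frac_def)
 note R = assms(1,2) p(2) SR[OF assms(3)] SR[OF assms(4)] SR[OF u(1)] SR[OF p(3)] SR[OF p(4)]
 have "(u \<otimes> w \<otimes> b) \<otimes> (c \<otimes> f) = (w \<otimes> f) \<otimes> (u \<otimes> (c \<otimes> b))" using R by (simp add: m_ac)
 also have "\<dots> = (u \<otimes> d) \<otimes> (w \<otimes> (a \<otimes> f))" unfolding u(2)[symmetric] using R by (simp add: m_ac)
 also have "\<dots> = (u \<otimes> w \<otimes> b) \<otimes> (e \<otimes> d)" unfolding p(5) using R by (simp add: m_ac)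
 finally show "p : loc_frac R S c d"
  using p assms S_mult u by (auto simp: loc_frac_def intro!: bexI[of _ "u \<otimes> w \<otimes> b"])
qed

lemma frac_eq:
 assumes "a : carrier R" "c : carrier R" "b : S" "d : S"
 shows "loc_frac R S a b = loc_frac R S c d \<longleftrightarrow> (EX u:S. u \<otimes> (a \<otimes> d) = u \<otimes> (c \<otimes> b))"
proof
 assume "loc_frac R S a b = loc_frac R S c d"
 hence "(c, d) : loc_frac R S a b" using frac_self assms by simp
 thus "EX u:S. u \<otimes> (a \<otimes> d) = u \<otimes> (c \<otimes> b)" by (auto simp: loc_frac_def)
next
 assume "EX u:S. u \<otimes> (a \<otimes> d) = u \<otimes> (c \<otimes> b)"
 then obtain u where u: "u : S" "u \<otimes> (a \<otimes> d) = u \<otimes> (c \<otimes> b)" by blast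
 show "loc_frac R S a b = loc_frac R S c d"
  using frac_sub[OF assms u] frac_sub[OF assms(2,1,4,3) u(1) u(2)[symmetric]] by blast
qed

lemma frac_mult_frac:
 assumes "a : carrier R" "c : carrier R" "b : S" "d : S"
 shows "frac_mult R S (loc_frac R S a b) (loc_frac R S c d) = loc_frac R S (a \<otimes> c) (b \<otimes> d)"
 unfolding frac_mult_def
proof (rule the_equality)
 show "EX (aa, ba):loc_frac R S a b. EX (ca, da):loc_frac R S c d.
   loc_frac R S (a \<otimes> c) (b \<otimes> d) = loc_frac R S (aa \<otimes> ca) (ba \<otimes> da)"
  using frac_self assms by blast
next
 fix C assume "EX (aa, ba):loc_frac R S a b. EX (ca, da):loc_frac R S c d. C = loc_frac R S (aa \<otimes> ca) (ba \<otimes> da)"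
 then obtain a' b' c' d' where p: "(a', b') : loc_frac R S a b" "(c', d') : loc_frac R S c d"
  "C = loc_frac R S (a' \<otimes> c') (b' \<otimes> d')" by auto
 obtain u where u: "a' : carrier R" "b' : S" "u : S" "u \<otimes> (a \<otimes> b') = u \<otimes> (a' \<otimes> b)"
  using p(1) by (auto simp: loc_frac_def)
 obtain w where w: "c' : carrier R" "d' : S" "w : S" "w \<otimes> (c \<otimes> d') = w \<otimes> (c' \<otimes> d)"
  using p(2) by (auto simp: loc_frac_def)
 note R = assms(1,2) SR[OF assms(3)] SR[OF assms(4)] u(1) SR[OF u(2)] SR[OF u(3)] w(1) SR[OF w(2)] SR[OF w(3)]
 have "(u \<otimes> w) \<otimes> ((a' \<otimes> c') \<otimes> (b \<otimes> d)) = (u \<otimes> (a' \<otimes> b)) \<otimes> (w \<otimes> (c' \<otimes> d))" using R by (simp add: m_ac)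
 also have "\<dots> = (u \<otimes> w) \<otimes> ((a \<otimes> c) \<otimes> (b' \<otimes> d'))" unfolding u(4)[symmetric] w(4)[symmetric] using R by (simp add: m_ac)
 finally have "(u \<otimes> w) \<otimes> ((a' \<otimes> c') \<otimes> (b \<otimes> d)) = (u \<otimes> w) \<otimes> ((a \<otimes> c) \<otimes> (b' \<otimes> d'))" .
 hence "EX x:S. x \<otimes> ((a' \<otimes> c') \<otimes> (b \<otimes> d)) = x \<otimes> ((a \<otimes> c) \<otimes> (b' \<otimes> d'))"
  by (rule bexI) (rule S_mult[OF u(3) w(3)])
 thus "C = loc_frac R S (a \<otimes> c) (b \<otimes> d)"
  unfolding p(3) using R assms u w by (subst frac_eq) (auto simp: S_mult)
qed

end

text \<open>Unions of open sets correspond to unions of the defining sets, intersections to sets of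
  products. With \<open>mul\<close> and \<open>H\<close> abstract this serves all elements of a ring
  for \<open>Spec\<close> and the homogeneous ones for \<open>Proj\<close>.\<close>

lemma zariski_open:
 assumes m: "!!P a b. P : pts ==> a : H ==> b : H ==> mul a b : P \<longleftrightarrow> a : P \<or> b : P"
  and H: "!!a b. a : H ==> b : H ==> mul a b : H"
 shows "openin (zariski pts H) U \<longleftrightarrow> (\<exists>S\<subseteq>H. U = {P : pts. \<not> S \<subseteq> P})"
proof -
 have "istopology (%U. \<exists>S\<subseteq>H. U = {P : pts. \<not> S \<subseteq> P})"
  unfolding istopology_def
 proof (intro conjI allI impI)
  fix U U' assume "\<exists>S\<subseteq>H. U = {P : pts. \<not> S \<subseteq> P}" "\<exists>S\<subseteq>H. U' = {P : pts. \<not> S \<subseteq> P}"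
  then obtain S S' where S: "S \<subseteq> H" "U = {P : pts. \<not> S \<subseteq> P}" "S' \<subseteq> H" "U' = {P : pts. \<not> S' \<subseteq> P}" by blast
  let ?T = "{mul a b | a b. a : S & b : S'}"
  have TH: "?T \<subseteq> H" using H S by blast
  have "P : U \<inter> U' \<longleftrightarrow> P : pts & \<not> ?T \<subseteq> P" for P
  proof (cases "P : pts")
   case True
   have "?T \<subseteq> P \<longleftrightarrow> (ALL a:S. ALL b:S'. a : P \<or> b : P)"
   proof
    assume T: "?T \<subseteq> P"
    show "ALL a:S. ALL b:S'. a : P \<or> b : P"
    proof (intro ballI)
     fix a b assume ab: "a : S" "b : S'"
     hence "mul a b : P" using T by blast
     thus "a : P \<or> b : P" using m[OF True] ab S by blast
    qed
   next
    assume A: "ALL a:S. ALL b:S'. a : P \<or> b : P"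
    show "?T \<subseteq> P"
    proof
     fix x assume "x : ?T"
     then obtain a b where ab: "x = mul a b" "a : S" "b : S'" by blast
     thus "x : P" using m[OF True, of a b] A S by blast
    qed
   qed
   thus ?thesis using True S by auto
  qed (use S in auto)
  thus "\<exists>S\<subseteq>H. U \<inter> U' = {P : pts. \<not> S \<subseteq> P}" using TH by (intro exI[of _ ?T]) auto
 next
  fix K assume K: "ALL U:K. \<exists>S\<subseteq>H. U = {P : pts. \<not> S \<subseteq> P}"
  then obtain S where S: "!!U. U : K ==> S U \<subseteq> H & U = {P : pts. \<not> S U \<subseteq> P}" by metis
  have "\<Union>K = {P : pts. \<not> (\<Union>U\<in>K. S U) \<subseteq> P}"
  proof (rule Set.set_eqI)
   fix P
   have "P : U \<longleftrightarrow> P : pts & \<not> S U \<subseteq> P" if "U : K" for U using S[OF that] by blast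
   thus "P : \<Union>K \<longleftrightarrow> P : {P : pts. \<not> (\<Union>U\<in>K. S U) \<subseteq> P}" by auto
  qed
  thus "\<exists>S\<subseteq>H. \<Union>K = {P : pts. \<not> S \<subseteq> P}" using S by (intro exI[of _ "\<Union>U\<in>K. S U"]) blast
 qed
 thus ?thesis by (simp add: zariski_def topology_inverse')
qed

text \<open>Sections given by one fraction throughout; by \<open>local_const\<close> every section
  is locally of this form.\<close>

definition const_sec :: "('a, 'z) ring_scheme => ('a set => 'a set) => 'a set set => 'a => 'a => 'a set => ('a \<times> 'a) set" where
 "const_sec R den U a b = (\<lambda>P\<in>U. loc_frac R (den P) a b)"

lemma const_sec_mem:
 assumes "openin T U" "(a, b) : Q" "!!P. P : U ==> b : den P"
 shows "const_sec R den U a b : sects (frac_sheaf R Q den T) U"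
proof -
 have "EX V a' b'. openin T V & P : V & V \<subseteq> U & (a', b') : Q &
   (ALL P':V. b' : den P' & (\<lambda>P\<in>U. loc_frac R (den P) a b) P' = loc_frac R (den P') a' b')" if "P : U" for P
  by (rule exI[of _ U], rule exI[of _ a], rule exI[of _ b]) (use that assms in simp)
 moreover have "(\<lambda>P\<in>U. loc_frac R (den P) a b) : (\<Pi>\<^sub>E P\<in>U. {loc_frac R (den P) a b | a b. (a, b) : Q & b : den P})"
  unfolding restrict_PiE_iff using assms by blast
 ultimately show ?thesis by (simp add: frac_sheaf_def const_sec_def)
qed

lemma const_sec_res:
 "W \<subseteq> U ==> res (frac_sheaf R Q den T) U W (const_sec R den U a b) = const_sec R den W a b"
 by (auto simp: frac_sheaf_def const_sec_def fun_eq_iff)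

lemma const_sec_mult:
 assumes "!!P. P : U ==> mult_set R (den P)" "a : carrier R" "c : carrier R"
  "!!P. P : U ==> b : den P" "!!P. P : U ==> d : den P"
 shows "const_sec R den U a b \<otimes>\<^sub>(sec (frac_sheaf R Q den T) U) const_sec R den U c d =
  const_sec R den U (a \<otimes>\<^sub>R c) (b \<otimes>\<^sub>R d)"
 using mult_set.frac_mult_frac[OF assms(1) assms(2,3)] assms(4,5)
 by (auto simp: frac_sheaf_def const_sec_def intro!: restrict_ext)

lemma const_sec_eq:
 assumes "!!P. P : U ==> mult_set R (den P)" "a : carrier R" "c : carrier R"
  "!!P. P : U ==> b : den P" "!!P. P : U ==> d : den P"
 shows "const_sec R den U a b = const_sec R den U c d \<longleftrightarrow>
  (ALL P:U. EX u:den P. u \<otimes>\<^sub>R (a \<otimes>\<^sub>R d) = u \<otimes>\<^sub>R (c \<otimes>\<^sub>R b))"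
proof -
 have "const_sec R den U a b = const_sec R den U c d \<longleftrightarrow> (ALL P:U. loc_frac R (den P) a b = loc_frac R (den P) c d)"
  by (auto simp: const_sec_def fun_eq_iff restrict_def)
 also have "\<dots> \<longleftrightarrow> (ALL P:U. EX u:den P. u \<otimes>\<^sub>R (a \<otimes>\<^sub>R d) = u \<otimes>\<^sub>R (c \<otimes>\<^sub>R b))"
  using mult_set.frac_eq[OF assms(1) assms(2,3) assms(4,5)] by (intro ball_cong) auto
 finally show ?thesis .
qed

lemma const_sec_one: "\<one>\<^sub>(sec (frac_sheaf R Q den T) U) = const_sec R den U \<one>\<^sub>R \<one>\<^sub>R"
 by (simp add: frac_sheaf_def const_sec_def)

lemma local_const:
 assumes "s : sects (frac_sheaf R Q den T) U" "P : U"
 shows "EX V a b. openin T V & P : V & V \<subseteq> U & (a, b) : Q & (ALL P:V. b : den P) &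
  res (frac_sheaf R Q den T) U V s = const_sec R den V a b"
proof -
 obtain V a b where V: "openin T V" "P : V" "V \<subseteq> U" "(a, b) : Q" "ALL P':V. b : den P' & s P' = loc_frac R (den P') a b"
  using assms by (auto simp: frac_sheaf_def)
 have "restrict s V = const_sec R den V a b" using V by (auto simp: const_sec_def intro!: restrict_ext)
 thus ?thesis using V by (intro exI[of _ V] exI[of _ a] exI[of _ b]) (auto simp: frac_sheaf_def)
qed

lemma prime_mult_set:
 assumes "primeideal P R" shows "mult_set R (carrier R - P)"
proof -
 interpret primeideal P R by fact
 show ?thesis
 proof unfold_locales
  show "\<one>\<^sub>R : carrier R - P" using I_notcarr one_imp_carrier by auto
 qed (use I_prime in auto)
qed

lemma spec_open:
 assumes "cring R"
 shows "openin (base (Spec R)) U \<longleftrightarrow> (\<exists>S\<subseteq>carrier R. U = {P. primeideal P R & \<not> S \<subseteq> P})"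
proof -
 interpret cring R by fact
 have "mult R a b : P \<longleftrightarrow> a : P \<or> b : P" if "P : {P. primeideal P R}" "a : carrier R" "b : carrier R" for P a b
 proof -
  interpret P: primeideal P R using that by simp
  show ?thesis using P.I_prime[OF that(2,3)] P.I_l_closed P.I_r_closed that by blast
 qed
 from zariski_open[where pts = "{P. primeideal P R}" and H = "carrier R" and mul = "mult R", OF this]
 show ?thesis by (simp add: Spec_def frac_sheaf_def)
qed

section \<open>Integral schemes\<close>

locale ring_sheaf = ring_presheaf F + sheaf F for F :: "('x, 'a, unit, 'w) sheaf_data_scheme"

lemma sheaf_of_rings_ring_sheaf: "sheaf_of_rings F ==> ring_sheaf F"
 using sheaf_of_rings_presheaf[of F]
 by (auto simp: ring_sheaf_def sheaf_def sheaf_axioms_def ring_presheaf_def sheaf_of_rings_def)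

context ring_sheaf
begin

lemma sec_empty: "s : sects F {} ==> t : sects F {} ==> s = t"
 using sects_empty by blast

text \<open>Produces the idempotent that a domain of sections cannot contain, so that nonempty open
  sets of an integral scheme must meet.\<close>

lemma zero_one_glue:
 assumes U: "op U" and V: "op V" and d: "U \<inter> V = {}"
 shows "EX e : sects F (U \<union> V). res F (U \<union> V) U e = \<one>\<^sub>(sec F U) & res F (U \<union> V) V e = \<zero>\<^sub>(sec F V)"
proof -
 have o: "op (U \<union> V)" "op {}" using U V by auto
 define W where "W x = (if x : U then U else V)" for x
 define s where "s x = (if x : U then \<one>\<^sub>(sec F U) else \<zero>\<^sub>(sec F V))" for x
 have sW: "op (W x) & x : W x & W x \<subseteq> U \<union> V & s x : sects F (W x)" if "x : U \<union> V" for x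
  using that U V sec_closed(3)[OF U] sec_closed(4)[OF V] by (auto simp: W_def s_def)
 have "res F (W x) (W x \<inter> W y) (s x) = res F (W y) (W x \<inter> W y) (s y)" if xy: "x : U \<union> V" "y : U \<union> V" for x y
 proof (cases "x : U \<longleftrightarrow> y : U")
  case True thus ?thesis by (simp add: W_def s_def)
 next
  case False
  hence e: "W x \<inter> W y = {}" using d by (auto simp: W_def)
  \<comment> \<open>On the empty overlap all sections coincide.\<close>
  show ?thesis unfolding e by (rule sec_empty) (use sW[OF xy(1)] sW[OF xy(2)] o(2) in \<open>auto intro!: res_closed\<close>)
 qed
 from glue_local[where W = W and s = s, OF o(1) sW this]
 obtain e where e: "e : sects F (U \<union> V)" "ALL x:U \<union> V. res F (U \<union> V) (W x) e = s x" by blast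
 have "res F (U \<union> V) U e = \<one>\<^sub>(sec F U)"
 proof (cases "U = {}")
  case True
  show ?thesis unfolding True by (rule sec_empty) (use e o sec_closed(3)[OF o(2)] True in \<open>auto intro!: res_closed\<close>)
 next
  case False
  then obtain x where "x : U" by blast
  thus ?thesis using e(2) by (auto simp: W_def s_def dest!: bspec[where x = x])
 qed
 moreover have "res F (U \<union> V) V e = \<zero>\<^sub>(sec F V)"
 proof (cases "V = {}")
  case True
  show ?thesis unfolding True by (rule sec_empty) (use e o sec_closed(4)[OF o(2)] True in \<open>auto intro!: res_closed\<close>)
 next
  case False
  then obtain x where "x : V" by blast
  moreover have "x ~: U" using d \<open>x \<in> V\<close> by blast
  ultimately show ?thesis using e(2) by (auto simp: W_def s_def dest!: bspec[where x = x])
 qed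
 ultimately show ?thesis using e(1) by blast
qed

end

text \<open>
 A point \<open>y\<close> of an integral scheme has an affine neighbourhood \<open>Spec R\<close>. The elements of \<open>R\<close> that vanish in
 all localizations form a prime ideal contained in every other one, which is the generic point.
\<close>
lemma integral_chart:
 fixes X :: "('x, 'a, unit, 'w) sheaf_data_scheme"
 assumes X: "integral_scheme X" and y: "y : points X"
 shows "EX C \<eta>. openin (base X) C & y : C & \<eta> : C &
  (ALL U. openin (base X) U --> U \<inter> C \<noteq> {} --> \<eta> : U) &
  (ALL \<eta>':C. (ALL U. openin (base X) U --> U \<inter> C \<noteq> {} --> \<eta>' : U) --> \<eta>' = \<eta>) &
  (ALL U z s. openin (base X) U & U \<subseteq> C & z : U & s : sects X U -->
    (EX D. openin (base X) D & z : D & D \<subseteq> U & (res X U D s = \<zero>\<^sub>(sec X D) \<or>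
     (EX D' t. openin (base X) D' & D' \<noteq> {} & D' \<subseteq> D & t : sects X D' &
      t \<otimes>\<^sub>(sec X D') res X U D' s = \<one>\<^sub>(sec X D')))))"
proof -
 have sch: "scheme X" and dom: "!!U. openin (base X) U ==> U \<noteq> {} ==> domain (sec X U)"
  using X by (auto simp: integral_scheme_def)
 interpret X: ring_sheaf X
  by (rule sheaf_of_rings_ring_sheaf) (use sch in \<open>simp add: scheme_def locally_ringed_space_def\<close>)
 obtain C and R :: "'a ring" and f where C: "X.op C" "y : C" and R: "cring R" and iso: "lrs_iso (open_sub X C) (Spec R) f"
  using sch y unfolding scheme_def by blast
 interpret R: cring R by fact
 let ?S = "Spec R"
 let ?f = "pt f"
 let ?den = "%P. carrier R - P"
 let ?pre = "preim (open_sub X C) f"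
 note so = spec_open[OF R]
 have CX: "C \<subseteq> points X" using X.op_sub C by blast
 have tC: "topspace (subtopology (base X) C) = C" using CX by auto
 have hom: "homeomorphic_map (subtopology (base X) C) (base ?S) ?f" using iso by (simp add: lrs_iso_def open_sub_def)
 have prime_open: "openin (base ?S) {P. primeideal P R & \<not> S \<subseteq> P}" if "S \<subseteq> carrier R" for S using that so by blast
 have all_open: "openin (base ?S) {P. primeideal P R}"
 proof -
  have "{P. primeideal P R} = {P. primeideal P R & \<not> carrier R \<subseteq> P}"
  proof (intro Collect_cong iffI conjI notI)
   fix P assume P: "primeideal P R" "carrier R \<subseteq> P"
   interpret primeideal P R by fact
   show False using I_notcarr P(2) a_subset by blast
  qed auto
  thus ?thesis using prime_open[of "carrier R"] by simp
 qed
 have tS: "topspace (base ?S) = {P. primeideal P R}"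
 proof
  show "topspace (base ?S) \<subseteq> {P. primeideal P R}" using so[of "topspace (base ?S)"] openin_topspace[of "base ?S"] by blast
 qed (rule openin_subset[OF all_open])
 have inj: "inj_on ?f C" and im: "?f ` C = {P. primeideal P R}"
  using hom CX by (auto simp: homeomorphic_eq_everything_map tC tS Int_absorb1)
 have fprime: "primeideal (?f x) R" if "x : C" for x using im that by blast
 have pre: "?pre V = {x : C. ?f x : V}" for V using CX by (auto simp: preim_def open_sub_def)
 have pre_open: "X.op (?pre V)" if "openin (base ?S) V" for V
 proof -
  have "continuous_map (subtopology (base X) C) (base ?S) ?f" using hom by (simp add: homeomorphic_eq_everything_map)
  from openin_continuous_map_preimage[OF this that]
  have "openin (subtopology (base X) C) {x : C. ?f x : V}" unfolding tC .
  thus ?thesis unfolding pre using C(1) by (simp add: openin_open_subtopology)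
 qed
 have im_open: "openin (base ?S) (?f ` U)" "?pre (?f ` U) = U" if U: "X.op U" "U \<subseteq> C" for U
 proof -
  have "openin (subtopology (base X) C) U" using U C(1) by (simp add: openin_open_subtopology)
  thus "openin (base ?S) (?f ` U)" using hom by (simp add: homeomorphic_eq_everything_map open_map_def)
  show "?pre (?f ` U) = U" unfolding pre using U inj by (auto simp: inj_on_def)
 qed
 have co: "co f V : ring_hom (sec ?S V) (sec X (?pre V))" and cobij: "bij_betw (co f V) (sects ?S V) (sects X (?pre V))"
  if "openin (base ?S) V" for V
  using iso that by (auto simp: lrs_iso_def lrs_mor_def open_sub_def preim_def)
 have cores: "co f W (res ?S V W t) = res X (?pre V) (?pre W) (co f V t)"
  if "openin (base ?S) V" "openin (base ?S) W" "W \<subseteq> V" "t : sects ?S V" for V W t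
  using iso that by (auto simp: lrs_iso_def lrs_mor_def open_sub_def preim_def)
 have ms: "mult_set R (?den P)" if "primeideal P R" for P using prime_mult_set that by blast
 have opr: "primeideal P R" if "openin (base ?S) V" "P : V" for V P using openin_subset[OF that(1)] that(2) tS by blast
 define \<sigma> where "\<sigma> V = const_sec R ?den V" for V
 \<comment> \<open>Restates \<open>Spec R\<close> over its own base, so that the lemmas on
   \<open>frac_sheaf\<close> apply without unfolding the Zariski topology.\<close>
 have Sdef: "?S = frac_sheaf R (carrier R \<times> carrier R) ?den (base ?S)"
  by (simp add: Spec_def frac_sheaf_def)
 have \<sigma>_mem: "\<sigma> V a b : sects ?S V" if "openin (base ?S) V" "a : carrier R" "b : carrier R" "!!P. P : V ==> b ~: P" for V a b
  unfolding \<sigma>_def by (subst Sdef, rule const_sec_mem) (use that in auto)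
 have \<sigma>_mult: "\<sigma> V a b \<otimes>\<^sub>(sec ?S V) \<sigma> V c d = \<sigma> V (a \<otimes>\<^sub>R c) (b \<otimes>\<^sub>R d)"
  if "openin (base ?S) V" "a : carrier R" "c : carrier R" "b : carrier R" "d : carrier R"
   "!!P. P : V ==> b ~: P" "!!P. P : V ==> d ~: P" for V a b c d
  unfolding \<sigma>_def by (subst Sdef, rule const_sec_mult) (use that ms opr in auto)
 have \<sigma>_res: "res ?S V W (\<sigma> V a b) = \<sigma> W a b" if "W \<subseteq> V" for V W a b
  unfolding \<sigma>_def by (subst Sdef, rule const_sec_res[OF that])
 have \<sigma>_eq: "\<sigma> V a b = \<sigma> V c d \<longleftrightarrow> (ALL P:V. EX u:?den P. u \<otimes>\<^sub>R (a \<otimes>\<^sub>R d) = u \<otimes>\<^sub>R (c \<otimes>\<^sub>R b))"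
  if "openin (base ?S) V" "a : carrier R" "c : carrier R" "b : carrier R" "d : carrier R"
   "!!P. P : V ==> b ~: P" "!!P. P : V ==> d ~: P" for V a b c d
  unfolding \<sigma>_def by (rule const_sec_eq) (use that ms opr in auto)
 have \<sigma>_one: "\<one>\<^sub>(sec ?S V) = \<sigma> V \<one>\<^sub>R \<one>\<^sub>R" for V
  unfolding \<sigma>_def by (subst Sdef, rule const_sec_one)
 have one_nP: "\<one>\<^sub>R ~: P" if "primeideal P R" for P
 proof -
  interpret primeideal P R by fact
  show ?thesis using I_notcarr one_imp_carrier by auto
 qed
 have zero_P: "\<zero>\<^sub>R : P" if "primeideal P R" for P
 proof -
  interpret primeideal P R by fact
  show ?thesis by simp
 qed
 \<comment> \<open>Equality of sections of \<open>Spec R\<close> is tested at each prime separately,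
   so \<open>a\<close> lies in \<open>N\<close> exactly when the fraction \<open>a/1\<close> is the
   zero section over the whole chart.\<close>
 define N where "N = {a : carrier R. ALL P. primeideal P R --> (EX u:?den P. u \<otimes>\<^sub>R a = \<zero>\<^sub>R)}"
 have N_sub: "N \<subseteq> P" if P: "primeideal P R" for P
 proof
  fix a assume a: "a : N"
  interpret P: primeideal P R by fact
  obtain u where u: "u : carrier R" "u ~: P" "u \<otimes>\<^sub>R a = \<zero>\<^sub>R" using a P by (auto simp: N_def)
  hence "u \<otimes>\<^sub>R a : P" using zero_P[OF P] by simp
  moreover have "a : carrier R" using a by (simp add: N_def)
  ultimately show "a : P" using P.I_prime[of u a] u by blast
 qed
 have NR: "N \<subseteq> carrier R" by (auto simp: N_def)
 \<comment> \<open>Zero is recognised by absorption: \<open>0/1\<close> times the preimage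
   \<open>t\<close> of zero is again \<open>0/1\<close>, so the image of \<open>0/1\<close> is a
   multiple of zero. The argument uses products of fractions in place of sums.\<close>
 have zero_sec: "co f V (\<sigma> V \<zero>\<^sub>R \<one>\<^sub>R) = \<zero>\<^sub>(sec X (?pre V))" if V: "openin (base ?S) V" for V
 proof -
  interpret XV: cring "sec X (?pre V)" by (rule X.sec_cring[OF pre_open[OF V]])
  let ?z = "\<sigma> V \<zero>\<^sub>R \<one>\<^sub>R"
  have z: "?z : sects ?S V" using V one_nP opr[OF V] by (intro \<sigma>_mem) auto
  have "\<zero>\<^sub>(sec X (?pre V)) : co f V ` sects ?S V" using cobij[OF V] by (simp add: bij_betw_def)
  then obtain t where t: "t : sects ?S V" "co f V t = \<zero>\<^sub>(sec X (?pre V))" by auto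
  have "?z \<otimes>\<^sub>(sec ?S V) t = ?z"
  proof -
   have "(?z \<otimes>\<^sub>(sec ?S V) t) P = ?z P" if P: "P : V" for P
   proof -
    obtain a b where ab: "a : carrier R" "b : ?den P" "t P = loc_frac R (?den P) a b"
     using t(1) P by (subst (asm) Sdef) (auto simp: frac_sheaf_def PiE_iff)
    interpret m: mult_set R "?den P" by (rule ms[OF opr[OF V P]])
    have "(?z \<otimes>\<^sub>(sec ?S V) t) P = frac_mult R (?den P) (?z P) (t P)"
     using P by (subst Sdef) (simp add: frac_sheaf_def)
    also have "\<dots> = loc_frac R (?den P) (\<zero>\<^sub>R \<otimes>\<^sub>R a) (\<one>\<^sub>R \<otimes>\<^sub>R b)"
     unfolding ab(3) using P ab m.S_one by (simp add: \<sigma>_def const_sec_def m.frac_mult_frac)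
    also have "\<dots> = loc_frac R (?den P) \<zero>\<^sub>R \<one>\<^sub>R"
     using ab m.S_one by (subst m.frac_eq) auto
    finally show ?thesis using P by (simp add: \<sigma>_def const_sec_def)
   qed
   moreover have "?z \<otimes>\<^sub>(sec ?S V) t : extensional V" by (subst Sdef) (simp add: frac_sheaf_def)
   moreover have "?z : extensional V" by (simp add: \<sigma>_def const_sec_def)
   ultimately show ?thesis by (intro extensionalityI) auto
  qed
  hence "co f V ?z = co f V ?z \<otimes>\<^sub>(sec X (?pre V)) co f V t" using ring_hom_mult[OF co[OF V] z t(1)] by simp
  moreover have "co f V ?z : sects X (?pre V)" using ring_hom_closed[OF co[OF V] z] .
  ultimately show ?thesis using t(2) by simp
 qed
 have fy: "primeideal (?f y) R" using fprime C by blast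
 have N_prime: "primeideal N R"
 proof (rule primeidealI)
  show "ideal N R"
  proof (rule idealI)
   show "subgroup N (add_monoid R)"
   proof (rule subgroup.intro)
    show "N \<subseteq> carrier (add_monoid R)" using NR by simp
    show "\<one>\<^sub>(add_monoid R) : N" using one_nP by (auto simp: N_def intro!: bexI[of _ "\<one>\<^sub>R"])
    fix a assume a: "a : N"
    hence "(\<ominus>\<^sub>R a) : N"
     by (auto simp: N_def R.r_minus)
    thus "inv\<^bsub>add_monoid R\<^esub> a : N" by (simp add: a_inv_def)
    fix b assume b: "b : N"
    have "EX u:?den P. u \<otimes>\<^sub>R (a \<oplus>\<^sub>R b) = \<zero>\<^sub>R" if P: "primeideal P R" for P
    proof -
     interpret m: mult_set R "?den P" by (rule ms[OF P])
     obtain u w where uw: "u : ?den P" "u \<otimes>\<^sub>R a = \<zero>\<^sub>R" "w : ?den P" "w \<otimes>\<^sub>R b = \<zero>\<^sub>R"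
      using a b P unfolding N_def by blast
     have c: "u : carrier R" "w : carrier R" "a : carrier R" "b : carrier R" using uw a b NR by auto
     have "(u \<otimes>\<^sub>R w) \<otimes>\<^sub>R (a \<oplus>\<^sub>R b) = w \<otimes>\<^sub>R (u \<otimes>\<^sub>R a) \<oplus>\<^sub>R u \<otimes>\<^sub>R (w \<otimes>\<^sub>R b)"
      using c by (simp add: R.r_distr R.m_ac)
     hence "(u \<otimes>\<^sub>R w) \<otimes>\<^sub>R (a \<oplus>\<^sub>R b) = \<zero>\<^sub>R" using c uw by simp
     thus ?thesis using m.S_mult[OF uw(1,3)] by blast
    qed
    thus "a \<otimes>\<^sub>(add_monoid R) b : N" using a b by (auto simp: N_def)
   qed
   fix a x assume a: "a : N" and x: "x : carrier R"
   have "EX u:?den P. u \<otimes>\<^sub>R (x \<otimes>\<^sub>R a) = \<zero>\<^sub>R" if P: "primeideal P R" for P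
   proof -
    obtain u where u: "u : ?den P" "u \<otimes>\<^sub>R a = \<zero>\<^sub>R" using a P unfolding N_def by blast
    have "u \<otimes>\<^sub>R (x \<otimes>\<^sub>R a) = x \<otimes>\<^sub>R (u \<otimes>\<^sub>R a)" using u(1) x a NR by (intro R.m_lcomm) auto
    thus ?thesis using u x by auto
   qed
   hence "x \<otimes>\<^sub>R a : N" using a x by (auto simp: N_def)
   thus "x \<otimes>\<^sub>R a : N" "a \<otimes>\<^sub>R x : N" using a x NR R.m_comm[of a x] by auto
  qed (rule R.ring_axioms)
  show "carrier R \<noteq> N"
  proof
   assume "carrier R = N"
   hence "\<one>\<^sub>R : N" by auto
   thus False using N_sub[OF fy] one_nP[OF fy] by blast
  qed
  \<comment> \<open>Primality comes from integrality: \<open>a/1\<close> and \<open>b/1\<close> are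
    sections over the whole chart with product zero in a domain, and a section \<open>c/1\<close>
    vanishes only for \<open>c\<close> in \<open>N\<close>.\<close>
  fix a b assume ab: "a : carrier R" "b : carrier R" "a \<otimes>\<^sub>R b : N"
  let ?V = "{P. primeideal P R}"
  have preV: "?pre ?V = C" unfolding pre using fprime by auto
  interpret D: domain "sec X C" by (rule dom) (use C in auto)
  have s: "\<sigma> ?V c \<one>\<^sub>R : sects ?S ?V" if "c : carrier R" for c using that one_nP by (intro \<sigma>_mem all_open) auto
  have "\<sigma> ?V (a \<otimes>\<^sub>R b) \<one>\<^sub>R = \<sigma> ?V \<zero>\<^sub>R \<one>\<^sub>R"
   using ab one_nP by (subst \<sigma>_eq[OF all_open]) (auto simp: N_def)
  hence "\<sigma> ?V a \<one>\<^sub>R \<otimes>\<^sub>(sec ?S ?V) \<sigma> ?V b \<one>\<^sub>R = \<sigma> ?V \<zero>\<^sub>R \<one>\<^sub>R"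
   using ab one_nP by (subst \<sigma>_mult[OF all_open]) auto
  hence "co f ?V (\<sigma> ?V a \<one>\<^sub>R) \<otimes>\<^sub>(sec X C) co f ?V (\<sigma> ?V b \<one>\<^sub>R) = \<zero>\<^sub>(sec X C)"
   using ring_hom_mult[OF co[OF all_open] s[OF ab(1)] s[OF ab(2)]] zero_sec[OF all_open] by (simp add: preV)
  moreover have "co f ?V (\<sigma> ?V c \<one>\<^sub>R) : sects X C" if "c : carrier R" for c
   using ring_hom_closed[OF co[OF all_open] s[OF that]] by (simp add: preV)
  ultimately have "co f ?V (\<sigma> ?V a \<one>\<^sub>R) = \<zero>\<^sub>(sec X C) \<or> co f ?V (\<sigma> ?V b \<one>\<^sub>R) = \<zero>\<^sub>(sec X C)"
   using ab D.integral by blast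
  moreover have "c : N" if c: "c : carrier R" "co f ?V (\<sigma> ?V c \<one>\<^sub>R) = \<zero>\<^sub>(sec X C)" for c
  proof -
   have "co f ?V (\<sigma> ?V c \<one>\<^sub>R) = co f ?V (\<sigma> ?V \<zero>\<^sub>R \<one>\<^sub>R)" using c zero_sec[OF all_open] by (simp add: preV)
   hence "\<sigma> ?V c \<one>\<^sub>R = \<sigma> ?V \<zero>\<^sub>R \<one>\<^sub>R"
    by (rule inj_onD[OF bij_betw_imp_inj_on[OF cobij[OF all_open]]]) (use s c in auto)
   thus ?thesis using c one_nP by (subst (asm) \<sigma>_eq[OF all_open]) (auto simp: N_def)
  qed
  ultimately show "a : N \<or> b : N" using ab by blast
 qed (rule R)
 \<comment> \<open>A set of elements not contained in some prime is not contained in the smaller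
   prime \<open>N\<close> either.\<close>
 have N_V: "N : V" if V: "openin (base ?S) V" "V \<noteq> {}" for V
 proof -
  obtain S where S: "V = {P. primeideal P R & \<not> S \<subseteq> P}" using so V(1) by blast
  thus ?thesis using V(2) N_sub N_prime by auto
 qed
 obtain \<eta> where \<eta>: "\<eta> : C" "?f \<eta> = N" using im N_prime by (metis (no_types, lifting) imageE mem_Collect_eq)
 have gen: "\<eta> : U" if U: "X.op U" "U \<inter> C \<noteq> {}" for U
 proof -
  have o: "X.op (U \<inter> C)" using U C by blast
  have "N : ?f ` (U \<inter> C)" using im_open(1)[OF o] U by (intro N_V) auto
  thus ?thesis using \<eta> inj by (auto simp: inj_on_def)
 qed
 have uniq: "\<eta>' = \<eta>" if \<eta>': "\<eta>' : C" "ALL U. X.op U --> U \<inter> C \<noteq> {} --> \<eta>' : U" for \<eta>'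
 proof (rule ccontr)
  assume "\<eta>' \<noteq> \<eta>"
  hence "?f \<eta>' \<noteq> N" using \<eta> \<eta>' inj by (auto simp: inj_on_def)
  then obtain a where a: "a : ?f \<eta>'" "a ~: N" using N_sub[OF fprime[OF \<eta>'(1)]] by blast
  interpret P: primeideal "?f \<eta>'" R by (rule fprime[OF \<eta>'(1)])
  have aR: "a : carrier R" using a by simp
  \<comment> \<open>An element \<open>a\<close> of the larger prime outside \<open>N\<close> gives
    an open set that contains \<eta> and misses \<open>\<eta>'\<close>.\<close>
  let ?V = "{P. primeideal P R & \<not> {a} \<subseteq> P}"
  have V: "openin (base ?S) ?V" using aR by (intro prime_open) auto
  have "\<eta> : ?pre ?V" unfolding pre using \<eta> N_prime a by auto
  moreover have "?pre ?V \<inter> C \<noteq> {}" using calculation unfolding pre by blast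
  ultimately have "\<eta>' : ?pre ?V" using \<eta>'(2) pre_open[OF V] by blast
  thus False unfolding pre using a by auto
 qed
 have loc: "EX D. X.op D & z : D & D \<subseteq> U & (res X U D s = \<zero>\<^sub>(sec X D) \<or>
     (EX D' t. X.op D' & D' \<noteq> {} & D' \<subseteq> D & t : sects X D' & t \<otimes>\<^sub>(sec X D') res X U D' s = \<one>\<^sub>(sec X D')))"
  if U: "X.op U" "U \<subseteq> C" "z : U" "s : sects X U" for U z s
 proof -
  let ?V = "?f ` U"
  have V: "openin (base ?S) ?V" "?pre ?V = U" using im_open U by auto
  have "s : co f ?V ` sects ?S ?V" using cobij[OF V(1)] U V(2) by (simp add: bij_betw_def)
  then obtain t where t: "t : sects ?S ?V" "s = co f ?V t" by auto
  define T where "T = base ?S"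
  note Sd = Sdef[folded T_def]
  have "?f z : ?V" using U by blast
  from local_const[OF t(1)[unfolded Sd] this, folded Sd]
  have "EX W a b. openin (base ?S) W & ?f z : W & W \<subseteq> ?V & (a, b) : carrier R \<times> carrier R &
   (ALL P:W. b : ?den P) & res ?S ?V W t = const_sec R ?den W a b" unfolding T_def .
  then obtain W a b where "openin (base ?S) W" "?f z : W" "W \<subseteq> ?V" "(a, b) : carrier R \<times> carrier R"
   "ALL P:W. b : ?den P" "res ?S ?V W t = const_sec R ?den W a b" by (elim exE conjE) (rule that)
  hence W: "openin (base ?S) W" "?f z : W" "W \<subseteq> ?V" "a : carrier R" "b : carrier R"
   "!!P. P : W ==> b ~: P" "res ?S ?V W t = \<sigma> W a b" by (simp_all only: \<sigma>_def mem_Sigma_iff Diff_iff simp_thms)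
  let ?D = "?pre W"
  have D: "X.op ?D" "z : ?D" "?D \<subseteq> U" using pre_open[OF W(1)] W U V(2) unfolding pre by auto
  have sD: "res X U ?D s = co f W (\<sigma> W a b)" using cores[OF V(1) W(1,3) t(1)] V(2) t(2) W(7) by simp
  show ?thesis
  \<comment> \<open>Near \<open>z\<close> the section is a fraction \<open>a/b\<close>. It is zero
    if \<open>a\<close> lies in \<open>N\<close>; otherwise it is invertible where \<open>a\<close>
    does not vanish, an open set that is nonempty because it contains the generic point.\<close>
  proof (cases "a : N")
   case True
   have "\<sigma> W a b = \<sigma> W \<zero>\<^sub>R \<one>\<^sub>R"
    using W True one_nP opr[OF W(1)] by (subst \<sigma>_eq[OF W(1)]) (auto simp: N_def)
   hence "res X U ?D s = \<zero>\<^sub>(sec X ?D)" using sD zero_sec[OF W(1)] by simp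
   thus ?thesis using D by blast
  next
   case False
   let ?W' = "W \<inter> {P. primeideal P R & \<not> {a} \<subseteq> P}"
   have W': "openin (base ?S) ?W'" using W by (intro openin_Int prime_open) auto
   have na: "!!P. P : ?W' ==> a ~: P" "!!P. P : ?W' ==> b ~: P" using W by auto
   let ?D' = "?pre ?W'"
   have "N : W" by (rule N_V[OF W(1)]) (use W in auto)
   hence "\<eta> : ?D'" unfolding pre using \<eta> False N_prime by auto
   hence D': "X.op ?D'" "?D' \<noteq> {}" "?D' \<subseteq> ?D" using pre_open[OF W'] unfolding pre by auto
   let ?t = "\<sigma> ?W' b a"
   have tm: "?t : sects ?S ?W'" "\<sigma> ?W' a b : sects ?S ?W'" "\<sigma> W a b : sects ?S W"
    by (simp_all only: \<sigma>_mem[OF W' W(5,4) na(1)] \<sigma>_mem[OF W' W(4,5) na(2)] \<sigma>_mem[OF W(1,4,5,6)])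
   have ab_nP: "a \<otimes>\<^sub>R b ~: P" if "P : ?W'" for P
   proof -
    interpret primeideal P R using that by simp
    show ?thesis using I_prime[OF W(4,5)] na that by blast
   qed
   have "?t \<otimes>\<^sub>(sec ?S ?W') \<sigma> ?W' a b = \<sigma> ?W' (b \<otimes>\<^sub>R a) (a \<otimes>\<^sub>R b)"
    by (rule \<sigma>_mult[OF W' W(5,4,4,5) na])
   also have "\<dots> = \<sigma> ?W' \<one>\<^sub>R \<one>\<^sub>R"
   proof (rule iffD2[OF \<sigma>_eq[OF W']], goal_cases)
    case 7
    show ?case
    proof
     fix P assume "P : ?W'"
     hence "\<one>\<^sub>R : ?den P" using one_nP by blast
     thus "EX u:?den P. u \<otimes>\<^sub>R (b \<otimes>\<^sub>R a \<otimes>\<^sub>R \<one>\<^sub>R) = u \<otimes>\<^sub>R (\<one>\<^sub>R \<otimes>\<^sub>R (a \<otimes>\<^sub>R b))"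
      using W(4,5) R.m_comm[OF W(4,5)] by (intro bexI[of _ "\<one>\<^sub>R"]) auto
    qed
   next
    case (5 P) thus ?case by (rule ab_nP)
   next
    case (6 P) thus ?case using one_nP by blast
   qed (use W(4,5) in auto)
   also have "\<dots> = \<one>\<^sub>(sec ?S ?W')" by (rule \<sigma>_one[symmetric])
   finally have prod: "co f ?W' ?t \<otimes>\<^sub>(sec X ?D') co f ?W' (\<sigma> ?W' a b) = \<one>\<^sub>(sec X ?D')"
    using ring_hom_mult[OF co[OF W'] tm(1,2)] ring_hom_one[OF co[OF W']] by simp
   have "res X U ?D' s = res X ?D ?D' (res X U ?D s)" using X.res_res[OF U(1) D(1) D'(1,3) D(3) U(4)] by simp
   also have "\<dots> = co f ?W' (\<sigma> ?W' a b)" unfolding sD using cores[OF W(1) W' _ tm(3)] \<sigma>_res[of ?W' W a b] by simp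
   finally have "co f ?W' ?t \<otimes>\<^sub>(sec X ?D') res X U ?D' s = \<one>\<^sub>(sec X ?D')" using prod by simp
   moreover have "co f ?W' ?t : sects X ?D'" using ring_hom_closed[OF co[OF W'] tm(1)] .
   ultimately show ?thesis using D D' by blast
  qed
 qed
 show ?thesis
 proof (intro exI[of _ C] exI[of _ \<eta>] conjI)
  show "ALL U. X.op U --> U \<inter> C \<noteq> {} --> \<eta> : U" using gen by simp
  show "ALL \<eta>':C. (ALL U. X.op U --> U \<inter> C \<noteq> {} --> \<eta>' : U) --> \<eta>' = \<eta>" using uniq by simp
  show "ALL U z s. X.op U & U \<subseteq> C & z : U & s : sects X U -->
    (EX D. X.op D & z : D & D \<subseteq> U & (res X U D s = \<zero>\<^sub>(sec X D) \<or>
     (EX D' t. X.op D' & D' \<noteq> {} & D' \<subseteq> D & t : sects X D' &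
      t \<otimes>\<^sub>(sec X D') res X U D' s = \<one>\<^sub>(sec X D'))))"
   by (intro allI impI, elim conjE) (rule loc)
 qed (rule C \<eta>(1))+
qed

section \<open>Sections and the generic point of an integral scheme\<close>

locale integral = ring_sheaf F for F :: "('x, 'a, unit, 'w) sheaf_data_scheme" +
 assumes integral: "integral_scheme F"

lemma integral_schemeI: "integral_scheme F ==> integral F"
 by (simp add: integral_def integral_axioms_def sheaf_of_rings_ring_sheaf integral_scheme_def scheme_def locally_ringed_space_def)

context integral
begin

lemma dom: "op U ==> U \<noteq> {} ==> domain (sec F U)"
 using integral by (simp add: integral_scheme_def)

text \<open>Disjoint nonempty open sets would carry an idempotent section other than zero and one on
  their union, whose sections form a domain.\<close>

lemma irreducible:
 assumes U: "op U" "U \<noteq> {}" and V: "op V" "V \<noteq> {}" shows "U \<inter> V \<noteq> {}"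
proof
 assume d: "U \<inter> V = {}"
 obtain e where e: "e : sects F (U \<union> V)" "res F (U \<union> V) U e = \<one>\<^sub>(sec F U)" "res F (U \<union> V) V e = \<zero>\<^sub>(sec F V)"
  using zero_one_glue[OF U(1) V(1) d] by blast
 have o: "op (U \<union> V)" using U V by auto
 interpret D: domain "sec F (U \<union> V)" using U o by (intro dom) auto
 interpret DU: domain "sec F U" using U by (intro dom) auto
 interpret DV: domain "sec F V" using V by (intro dom) auto
 have "e \<otimes>\<^sub>(sec F (U \<union> V)) e = e"
 proof (rule locality[OF o])
  fix y assume "y : U \<union> V"
  thus "EX D. op D & y : D & D \<subseteq> U \<union> V & res F (U \<union> V) D (e \<otimes>\<^sub>(sec F (U \<union> V)) e) = res F (U \<union> V) D e"
  proof
   assume "y : U"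
   thus ?thesis using U e res_ring(2)[OF o U(1) _ e(1) e(1)] by (intro exI[of _ U]) auto
  next
   assume "y : V"
   thus ?thesis using V e res_ring(2)[OF o V(1) _ e(1) e(1)] by (intro exI[of _ V]) auto
  qed
 qed (use e in auto)
 hence "e \<otimes>\<^sub>(sec F (U \<union> V)) (e \<ominus>\<^sub>(sec F (U \<union> V)) \<one>\<^sub>(sec F (U \<union> V))) = \<zero>\<^sub>(sec F (U \<union> V))"
  using e(1) by (simp add: a_minus_def D.r_distr D.r_minus D.r_neg)
 hence "e = \<zero>\<^sub>(sec F (U \<union> V)) \<or> e \<ominus>\<^sub>(sec F (U \<union> V)) \<one>\<^sub>(sec F (U \<union> V)) = \<zero>\<^sub>(sec F (U \<union> V))"
  using e(1) by (intro D.integral) auto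
 thus False
 proof
  assume "e = \<zero>\<^sub>(sec F (U \<union> V))"
  hence "\<one>\<^sub>(sec F U) = \<zero>\<^sub>(sec F U)" using e(2) res_ring(4)[OF o U(1)] by simp
  thus False by simp
 next
  assume "e \<ominus>\<^sub>(sec F (U \<union> V)) \<one>\<^sub>(sec F (U \<union> V)) = \<zero>\<^sub>(sec F (U \<union> V))"
  hence "e = \<one>\<^sub>(sec F (U \<union> V))" using e(1) D.minus_equality[of e "\<ominus>\<^sub>(sec F (U \<union> V)) \<one>\<^sub>(sec F (U \<union> V))"] by (simp add: a_minus_def)
  hence "\<one>\<^sub>(sec F V) = \<zero>\<^sub>(sec F V)" using e(3) res_ring(3)[OF o V(1)] by simp
  thus False by simp
 qed
qed

text \<open>The alternative in \<open>integral_chart\<close>, freed from the chart by restricting to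
  its intersection with \<open>U\<close>.\<close>

lemma local_unit:
 assumes U: "op U" "y : U" "s : sects F U"
 shows "EX D. op D & y : D & D \<subseteq> U & (res F U D s = \<zero>\<^sub>(sec F D) \<or>
   (EX D' t. op D' & D' \<noteq> {} & D' \<subseteq> D & t : sects F D' & t \<otimes>\<^sub>(sec F D') res F U D' s = \<one>\<^sub>(sec F D')))"
proof -
 have "y : points F" using U op_sub by blast
 from integral_chart[OF integral this] obtain C \<eta> where C: "op C" "y : C" and
  loc: "!!U z s. op U & U \<subseteq> C & z : U & s : sects F U ==>
    (EX D. op D & z : D & D \<subseteq> U & (res F U D s = \<zero>\<^sub>(sec F D) \<or>
     (EX D' t. op D' & D' \<noteq> {} & D' \<subseteq> D & t : sects F D' & t \<otimes>\<^sub>(sec F D') res F U D' s = \<one>\<^sub>(sec F D'))))"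
  by metis
 have o: "op (U \<inter> C)" using U C by blast
 have rr: "res F (U \<inter> C) D (res F U (U \<inter> C) s) = res F U D s" if "op D" "D \<subseteq> U \<inter> C" for D
  using res_res[OF U(1) o that(1,2) _ U(3)] by simp
 from loc[of "U \<inter> C" y "res F U (U \<inter> C) s"] o U C res_closed[OF U(1) o _ U(3)]
 obtain D where D: "op D" "y : D" "D \<subseteq> U \<inter> C" and
  or: "res F (U \<inter> C) D (res F U (U \<inter> C) s) = \<zero>\<^sub>(sec F D) \<or>
   (EX D' t. op D' & D' \<noteq> {} & D' \<subseteq> D & t : sects F D' & t \<otimes>\<^sub>(sec F D') res F (U \<inter> C) D' (res F U (U \<inter> C) s) = \<one>\<^sub>(sec F D'))"
  by auto
 from or have "res F U D s = \<zero>\<^sub>(sec F D) \<or>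
   (EX D' t. op D' & D' \<noteq> {} & D' \<subseteq> D & t : sects F D' & t \<otimes>\<^sub>(sec F D') res F U D' s = \<one>\<^sub>(sec F D'))"
 proof (elim disjE exE conjE)
  fix D' t assume h: "op D'" "D' \<noteq> {}" "D' \<subseteq> D" "t : sects F D'"
   "t \<otimes>\<^sub>(sec F D') res F (U \<inter> C) D' (res F U (U \<inter> C) s) = \<one>\<^sub>(sec F D')"
  have "D' \<subseteq> U \<inter> C" using h(3) D(3) by blast
  thus ?thesis using h rr[OF h(1)] by auto
 qed (use rr[OF D(1,3)] in simp)
 thus ?thesis using D by blast
qed

text \<open>Near each point either \<open>s\<close> vanishes or it is invertible on a nonempty open
  set. The latter set would meet \<open>W\<close>, where \<open>s\<close> is zero, and a unit would
  be zero there; so \<open>s\<close> vanishes locally everywhere.\<close>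

lemma res_inj_zero:
 assumes U: "op U" "s : sects F U" and W: "op W" "W \<noteq> {}" "W \<subseteq> U" "res F U W s = \<zero>\<^sub>(sec F W)"
 shows "s = \<zero>\<^sub>(sec F U)"
proof (rule locality[OF U(1,2) sec_closed(4)[OF U(1)]])
 fix y assume y: "y : U"
 obtain D where D: "op D" "y : D" "D \<subseteq> U" and or: "res F U D s = \<zero>\<^sub>(sec F D) \<or>
   (EX D' t. op D' & D' \<noteq> {} & D' \<subseteq> D & t : sects F D' & t \<otimes>\<^sub>(sec F D') res F U D' s = \<one>\<^sub>(sec F D'))"
  using local_unit[OF U(1) y U(2)] by blast
 have "res F U D s = \<zero>\<^sub>(sec F D)"
  using or
 proof (elim disjE exE conjE)
  fix D' t assume h: "op D'" "D' \<noteq> {}" "D' \<subseteq> D" "t : sects F D'" "t \<otimes>\<^sub>(sec F D') res F U D' s = \<one>\<^sub>(sec F D')"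
  let ?E = "D' \<inter> W"
  have E: "op ?E" "?E \<noteq> {}" "?E \<subseteq> D'" "?E \<subseteq> W" "?E \<subseteq> U" using h W D irreducible[OF h(1,2) W(1,2)] by auto
  interpret DE: domain "sec F ?E" by (rule dom[OF E(1,2)])
  have D'U: "D' \<subseteq> U" using h(3) D(3) by blast
  have "\<one>\<^sub>(sec F ?E) = res F D' ?E (t \<otimes>\<^sub>(sec F D') res F U D' s)" using h(5) res_ring(3)[OF h(1) E(1,3)] by simp
  also have "\<dots> = res F D' ?E t \<otimes>\<^sub>(sec F ?E) res F D' ?E (res F U D' s)"
   by (rule res_ring(2)[OF h(1) E(1,3) h(4) res_closed[OF U(1) h(1) D'U U(2)]])
  also have "res F D' ?E (res F U D' s) = res F W ?E (res F U W s)"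
   using res_res[OF U(1) h(1) E(1,3) D'U U(2)] res_res[OF U(1) W(1) E(1,4) W(3) U(2)] by simp
  also have "\<dots> = \<zero>\<^sub>(sec F ?E)" using W(4) res_ring(4)[OF W(1) E(1,4)] by simp
  finally have "\<one>\<^sub>(sec F ?E) = \<zero>\<^sub>(sec F ?E)" using res_closed[OF h(1) E(1,3) h(4)] by simp
  thus ?thesis by simp
 qed
 thus "EX D. op D & y : D & D \<subseteq> U & res F U D s = res F U D \<zero>\<^sub>(sec F U)"
  using D res_ring(4)[OF U(1) D(1,3)] by (intro exI[of _ D]) simp
qed

lemma res_inj:
 assumes U: "op U" "s : sects F U" "t : sects F U" and W: "op W" "W \<noteq> {}" "W \<subseteq> U" "res F U W s = res F U W t"
 shows "s = t"
proof -
 interpret U: cring "sec F U" by (rule sec_cring[OF U(1)])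
 interpret W: cring "sec F W" by (rule sec_cring[OF W(1)])
 interpret h: ring_hom_cring "sec F U" "sec F W" "res F U W" by unfold_locales (rule res_hom[OF U(1) W(1,3)])
 have "res F U W (s \<ominus>\<^sub>(sec F U) t) = \<zero>\<^sub>(sec F W)"
  using U W(4) res_closed[OF U(1) W(1,3)] by (simp add: a_minus_def W.r_neg)
 hence "s \<ominus>\<^sub>(sec F U) t = \<zero>\<^sub>(sec F U)" using res_inj_zero[OF U(1) _ W(1-3)] U by simp
 thus ?thesis using U(2,3) U.minus_equality[of s "\<ominus>\<^sub>(sec F U) t"] by (simp add: a_minus_def)
qed

text \<open>If \<open>s\<close> were nowhere invertible, the first alternative of
  \<open>local_unit\<close> would hold near every point and \<open>s\<close> would be zero.\<close>

lemma nonzero_unit: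
 assumes U: "op U" "s : sects F U" "s \<noteq> \<zero>\<^sub>(sec F U)"
 shows "EX D t. op D & D \<noteq> {} & D \<subseteq> U & t : sects F D & t \<otimes>\<^sub>(sec F D) res F U D s = \<one>\<^sub>(sec F D)"
proof (rule ccontr)
 assume n: "\<not> ?thesis"
 have "s = \<zero>\<^sub>(sec F U)"
 proof (rule locality[OF U(1,2) sec_closed(4)[OF U(1)]])
  fix y assume y: "y : U"
  obtain D where D: "op D" "y : D" "D \<subseteq> U" and or: "res F U D s = \<zero>\<^sub>(sec F D) \<or>
   (EX D' t. op D' & D' \<noteq> {} & D' \<subseteq> D & t : sects F D' & t \<otimes>\<^sub>(sec F D') res F U D' s = \<one>\<^sub>(sec F D'))"
   using local_unit[OF U(1) y U(2)] by blast
  hence "res F U D s = \<zero>\<^sub>(sec F D)" using n by (meson order_trans)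
  thus "EX D. op D & y : D & D \<subseteq> U & res F U D s = res F U D \<zero>\<^sub>(sec F U)"
   using D res_ring(4)[OF U(1) D(1,3)] by (intro exI[of _ D]) simp
 qed
 thus False using U(3) by simp
qed

text \<open>The generic point of one chart lies in every nonempty open set, since each such set
  meets the chart; its uniqueness within the chart gives the description in \<open>gen_point\<close>
  a value.\<close>

lemma gen_point: "gen_point F : points F" "!!U. op U ==> U \<noteq> {} ==> gen_point F : U"
proof -
 have "points F \<noteq> {}" using integral unfolding integral_scheme_def by blast
 then obtain y where y: "y : points F" by blast
 from integral_chart[OF integral y] obtain C \<eta> where C: "op C" "y : C" "\<eta> : C" and
  gen: "!!U. op U ==> U \<inter> C \<noteq> {} ==> \<eta> : U" and
  uniq: "!!\<eta>'. \<eta>' : C ==> (!!U. op U ==> U \<inter> C \<noteq> {} ==> \<eta>' : U) ==> \<eta>' = \<eta>"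
  by metis
 have CF: "C \<subseteq> points F" using op_sub C by blast
 have cl: "base F closure_of {x} = points F \<longleftrightarrow> (ALL U. op U --> U \<noteq> {} --> x : U)" if "x : points F" for x
 proof
  assume e: "base F closure_of {x} = points F"
  show "ALL U. op U --> U \<noteq> {} --> x : U"
  proof (intro allI impI)
   fix U assume U: "op U" "U \<noteq> {}"
   then obtain z where z: "z : U" by blast
   hence "z : base F closure_of {x}" using e U op_sub by blast
   thus "x : U" using z U by (auto simp: in_closure_of)
  qed
 next
  assume "ALL U. op U --> U \<noteq> {} --> x : U"
  thus "base F closure_of {x} = points F" by (auto simp: in_closure_of)
 qed
 have all: "\<eta> : U" if "op U" "U \<noteq> {}" for U using gen[OF that(1)] irreducible[OF that C(1)] C by blast
 have "gen_point F = \<eta>"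
  unfolding gen_point_def
 proof (rule the_equality)
  show "\<eta> : points F & base F closure_of {\<eta>} = points F" using cl[of \<eta>] all C CF by auto
 next
  fix x assume x: "x : points F & base F closure_of {x} = points F"
  hence "!!U. op U ==> U \<noteq> {} ==> x : U" using cl by blast
  thus "x = \<eta>" using C by (intro uniq) auto
 qed
 thus "gen_point F : points F" "!!U. op U ==> U \<noteq> {} ==> gen_point F : U" using C CF all by auto
qed

end

section \<open>Projective varieties are separated\<close>

lemma frac_sheaf_presheaf: "presheaf (frac_sheaf R Q den T)"
proof -
 have r: "restrict s V : sects (frac_sheaf R Q den T) V"
  if o: "openin T U" "openin T V" "V \<subseteq> U" and s: "s : sects (frac_sheaf R Q den T) U" for U V s
 proof -
  have "restrict s V : (\<Pi>\<^sub>E P\<in>V. {loc_frac R (den P) a b | a b. (a, b) : Q & b : den P})"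
   using s o(3) unfolding restrict_PiE_iff by (auto simp: frac_sheaf_def PiE_iff)
  moreover have "EX V' a b. openin T V' & P : V' & V' \<subseteq> V & (a, b) : Q &
   (ALL P':V'. b : den P' & restrict s V P' = loc_frac R (den P') a b)" if P: "P : V" for P
  proof -
   have "P : U" using P o by blast
   then obtain W a b where W: "openin T W" "P : W" "W \<subseteq> U" "(a, b) : Q"
    "ALL P':W. b : den P' & s P' = loc_frac R (den P') a b"
    using s by (simp add: frac_sheaf_def) blast
   thus ?thesis using o P by (intro exI[of _ "W \<inter> V"] exI[of _ a] exI[of _ b]) auto
  qed
  ultimately show ?thesis by (simp add: frac_sheaf_def)
 qed
 have id: "restrict s U = s" if "s : sects (frac_sheaf R Q den T) U" for U s
  using that by (auto simp: frac_sheaf_def PiE_iff extensional_restrict)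
 have e: "base (frac_sheaf R Q den T) = T" "!!U V s. res (frac_sheaf R Q den T) U V s = restrict s V"
  by (simp_all add: frac_sheaf_def)
 show ?thesis
  unfolding presheaf_def is_presheaf_def e(1)
 proof (intro conjI allI impI ballI)
  fix U V assume "openin T U & openin T V & V \<subseteq> U"
  thus "res (frac_sheaf R Q den T) U V : sects (frac_sheaf R Q den T) U \<rightarrow> sects (frac_sheaf R Q den T) V"
   using r[of U V] by (intro funcsetI) (simp add: e)
 next
  fix U V W s
  assume "openin T U & openin T V & openin T W & W \<subseteq> V & V \<subseteq> U" "s : sects (frac_sheaf R Q den T) U"
  thus "res (frac_sheaf R Q den T) V W (res (frac_sheaf R Q den T) U V s) = res (frac_sheaf R Q den T) U W s"
   by (simp add: e restrict_restrict Int_absorb1)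
 qed (simp add: e id)
qed

lemma frac_sheaf_at:
 "s : sects (frac_sheaf R Q den T) U ==> P : U ==>
  EX a b. s P = loc_frac R (den P) a b & (a, b) : Q & b : den P"
 by (auto simp: frac_sheaf_def PiE_iff)

text \<open>Supplies the multiplication of germs on projective space; a common neighbourhood is the
  intersection of those on which \<open>s\<close> and \<open>t\<close> are single fractions.\<close>

lemma frac_sheaf_mult_closed:
 assumes ms: "!!P. P : topspace T ==> mult_set R (den P)" and Q: "Q \<subseteq> carrier R \<times> carrier R"
  and Qm: "!!a b c d. (a, b) : Q ==> (c, d) : Q ==> (a \<otimes>\<^sub>R c, b \<otimes>\<^sub>R d) : Q"
  and U: "openin T U" and s: "s : sects (frac_sheaf R Q den T) U" and t: "t : sects (frac_sheaf R Q den T) U"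
 shows "s \<otimes>\<^sub>(sec (frac_sheaf R Q den T) U) t : sects (frac_sheaf R Q den T) U"
proof -
 have m: "mult_set R (den P)" if "P : U" for P using ms openin_subset[OF U] that by blast
 have fm: "frac_mult R (den P) (loc_frac R (den P) a b) (loc_frac R (den P) c d) = loc_frac R (den P) (a \<otimes>\<^sub>R c) (b \<otimes>\<^sub>R d) &
   b \<otimes>\<^sub>R d : den P"
  if "P : U" "(a, b) : Q" "b : den P" "(c, d) : Q" "d : den P" for P a b c d
  using mult_set.frac_mult_frac[OF m[OF that(1)], of a c b d] mult_set.S_mult[OF m[OF that(1)]] that Q by auto
 define w where "w = (\<lambda>P\<in>U. frac_mult R (den P) (s P) (t P))"
 have "w : (\<Pi>\<^sub>E P\<in>U. {loc_frac R (den P) a b | a b. (a, b) : Q & b : den P})"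
  unfolding w_def restrict_PiE_iff
 proof
  fix P assume P: "P : U"
  obtain a b where ab: "s P = loc_frac R (den P) a b" "(a, b) : Q" "b : den P"
   using s P by (auto simp: frac_sheaf_def PiE_iff)
  obtain c d where cd: "t P = loc_frac R (den P) c d" "(c, d) : Q" "d : den P"
   using t P by (auto simp: frac_sheaf_def PiE_iff)
  show "frac_mult R (den P) (s P) (t P) : {loc_frac R (den P) a b | a b. (a, b) : Q & b : den P}"
   unfolding ab(1) cd(1) using fm[OF P ab(2,3) cd(2,3)] Qm[OF ab(2) cd(2)] by auto
 qed
 moreover have "EX V a b. openin T V & P : V & V \<subseteq> U & (a, b) : Q &
   (ALL P':V. b : den P' & w P' = loc_frac R (den P') a b)" if P: "P : U" for P
 proof -
  obtain V a b where V: "openin T V" "P : V" "V \<subseteq> U" "(a, b) : Q" "ALL P':V. b : den P' & s P' = loc_frac R (den P') a b"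
   using s P by (simp add: frac_sheaf_def) blast
  obtain W c d where W: "openin T W" "P : W" "W \<subseteq> U" "(c, d) : Q" "ALL P':W. d : den P' & t P' = loc_frac R (den P') c d"
   using t P by (simp add: frac_sheaf_def) blast
  have "b \<otimes>\<^sub>R d : den P' & w P' = loc_frac R (den P') (a \<otimes>\<^sub>R c) (b \<otimes>\<^sub>R d)" if P': "P' : V \<inter> W" for P'
  proof -
   have "P' : U" using P' V by blast
   thus ?thesis using fm[OF _ V(4) _ W(4), of P'] P' V W by (simp add: w_def)
  qed
  thus ?thesis using V W Qm[OF V(4) W(4)]
   by (intro exI[of _ "V \<inter> W"] exI[of _ "a \<otimes>\<^sub>R c"] exI[of _ "b \<otimes>\<^sub>R d"]) auto
 qed
 ultimately show ?thesis by (simp add: frac_sheaf_def w_def)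
qed

lemma frac_sheaf_mult_res:
 "V \<subseteq> U ==> res (frac_sheaf R Q den T) U V (s \<otimes>\<^sub>(sec (frac_sheaf R Q den T) U) t) =
  res (frac_sheaf R Q den T) U V s \<otimes>\<^sub>(sec (frac_sheaf R Q den T) V) res (frac_sheaf R Q den T) U V t"
 by (auto simp: frac_sheaf_def fun_eq_iff)

section \<open>Points and open sets of projective space\<close>

context
 fixes n :: nat
begin

abbreviation (input) Rn :: "'k::field mpol ring" where "Rn \<equiv> poly_ring_in n"
abbreviation (input) Hn :: "'k::field mpol set" where "Hn \<equiv> (\<Union>d. homog_part n d)"

lemma poly_ring_mult_closed:
 "p : carrier Rn ==> q : carrier Rn ==> p * q : carrier (Rn :: 'k::field mpol ring)"
proof -
 assume pq: "p : carrier Rn" "q : carrier (Rn :: 'k mpol ring)"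
 have "Poly_Mapping.keys m \<subseteq> {..n}" if mk: "m : Poly_Mapping.keys (p * q)" for m
 proof -
  obtain a b where ab: "m = a + b" "a : Poly_Mapping.keys p" "b : Poly_Mapping.keys q"
   using subsetD[OF keys_mult mk] by blast
  hence "Poly_Mapping.keys a \<subseteq> {..n}" "Poly_Mapping.keys b \<subseteq> {..n}" using pq by (auto simp: poly_ring_in_def)
  thus ?thesis using keys_add[of a b] ab by blast
 qed
 thus ?thesis by (simp add: poly_ring_in_def)
qed

lemma poly_ring_simps [simp]: "mult (Rn :: 'k::field mpol ring) = (*)" "one (Rn :: 'k mpol ring) = 1"
  "add (Rn :: 'k mpol ring) = (+)" "ring.zero (Rn :: 'k mpol ring) = 0"
 by (simp_all add: poly_ring_in_def)

lemma poly_ring_cring: "cring (Rn :: 'k::field mpol ring)"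
proof (rule cringI)
 have add: "p + q : carrier Rn" if "p : carrier Rn" "q : carrier (Rn :: 'k mpol ring)" for p q
  using that keys_add[of p q] by (auto simp: poly_ring_in_def)
 have c: "- p : carrier Rn" if "p : carrier (Rn :: 'k mpol ring)" for p
  using that by (auto simp: poly_ring_in_def)
 have z: "0 : carrier (Rn :: 'k mpol ring)" "1 : carrier (Rn :: 'k mpol ring)" by (simp_all add: poly_ring_in_def)
 show "abelian_group (Rn :: 'k mpol ring)"
 proof (rule abelian_groupI)
  fix p assume p: "p : carrier (Rn :: 'k mpol ring)"
  show "EX q:carrier Rn. q \<oplus>\<^sub>Rn p = \<zero>\<^sub>(Rn :: 'k mpol ring)"
   by (rule bexI[OF _ c[OF p]]) simp
 qed (simp_all add: add z add_ac)
 show "Group.comm_monoid (Rn :: 'k mpol ring)"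
  by (rule comm_monoidI) (simp_all add: poly_ring_mult_closed z mult_ac)
qed (simp add: distrib_right)

lemma homog_carrier: "homog_part n d \<subseteq> carrier (Rn :: 'k::field mpol ring)"
 by (auto simp: homog_part_def)

lemma homog_mult:
 assumes "p : homog_part n d" "q : homog_part n e"
 shows "p * q : (homog_part n (d + e) :: 'k::field mpol set)"
proof -
 have "(\<Sum>i\<le>n. Poly_Mapping.lookup m i) = d + e" if mk: "m : Poly_Mapping.keys (p * q)" for m
 proof -
  obtain a b where ab: "m = a + b" "a : Poly_Mapping.keys p" "b : Poly_Mapping.keys q"
   using subsetD[OF keys_mult mk] by blast
  thus ?thesis using assms by (simp add: homog_part_def lookup_add sum.distrib)
 qed
 thus ?thesis using assms poly_ring_mult_closed[of p q] by (simp add: homog_part_def)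
qed

lemma homog_one: "(1 :: 'k::field mpol) : homog_part n 0"
 by (simp add: homog_part_def poly_ring_in_def)

lemma homog_pow: "p : homog_part n d ==> p ^ e : (homog_part n (d * e) :: 'k::field mpol set)"
proof (induction e)
 case (Suc e)
 thus ?case using homog_mult[of p d "p ^ e" "d * e"] by simp
qed (simp add: homog_one)

abbreviation (input) proj_pts :: "'k::field mpol set set" where
 "proj_pts \<equiv> {P. primeideal P Rn & P = genideal Rn (P \<inter> Hn) & (EX d>0. \<not> homog_part n d \<subseteq> P)}"

lemma prime_mult_iff:
 "primeideal P Rn ==> a : carrier (Rn :: 'k::field mpol ring) ==> b : carrier (Rn :: 'k mpol ring) ==> a * b : P \<longleftrightarrow> a : P \<or> b : P"
proof -
 assume h: "primeideal P Rn" "a : carrier (Rn :: 'k mpol ring)" "b : carrier (Rn :: 'k mpol ring)"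
 interpret primeideal P Rn by fact
 show ?thesis using I_prime[OF h(2,3)] I_l_closed[of b a] I_r_closed[of a b] h by auto
qed

lemma prime_pow_iff:
 "primeideal P Rn ==> a : carrier (Rn :: 'k::field mpol ring) ==> a ^ e : P ==> a : P"
proof (induction e)
 case 0
 interpret primeideal P Rn by fact
 show ?case using one_imp_carrier I_notcarr 0 by auto
next
 case (Suc e)
 have "a ^ e : carrier (Rn :: 'k mpol ring)"
 proof (induction e)
  case 0 show ?case using cring.cring_simprules(6)[OF poly_ring_cring] by simp
 qed (use Suc.prems poly_ring_mult_closed in auto)
 thus ?case using Suc prime_mult_iff[of P a "a ^ e"] by auto
qed

lemma proj_open:
 "openin (base (proj_space n)) U \<longleftrightarrow> (\<exists>S\<subseteq>Hn. U = {P : (proj_pts :: 'k::field mpol set set). \<not> S \<subseteq> P})"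
proof -
 have b: "base (proj_space n :: ('k mpol set, 'k mpol set => ('k mpol \<times> 'k mpol) set, 'k) kspace) = zariski proj_pts Hn"
  by (simp add: proj_space_def Proj_def frac_sheaf_def Let_def)
 show ?thesis
  unfolding b
 proof (rule zariski_open)
  fix P :: "'k mpol set" and a b :: "'k mpol" assume "P : proj_pts" "a : Hn" "b : Hn"
  thus "a * b : P \<longleftrightarrow> a : P \<or> b : P" using homog_carrier by (intro prime_mult_iff) auto
 next
  fix a b :: "'k mpol" assume "a : Hn" "b : Hn"
  thus "a * b : Hn" using homog_mult by blast
 qed
qed

lemma proj_points: "points (proj_space n) = (proj_pts :: 'k::field mpol set set)"
proof
 have "openin (base (proj_space n)) (points (proj_space n :: ('k mpol set, 'k mpol set => ('k mpol \<times> 'k mpol) set, 'k) kspace))" by simp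
 thus "points (proj_space n) \<subseteq> (proj_pts :: 'k mpol set set)" unfolding proj_open by blast
 have "proj_pts = {P : proj_pts. \<not> Hn \<subseteq> (P :: 'k mpol set)}" by blast
 hence "openin (base (proj_space n)) (proj_pts :: 'k mpol set set)" unfolding proj_open by blast
 thus "(proj_pts :: 'k mpol set set) \<subseteq> points (proj_space n)" by (rule openin_subset)
qed

lemma proj_mult_set: "P : proj_pts ==> mult_set Rn (Hn - (P :: 'k::field mpol set))"
proof -
 assume P: "P : proj_pts"
 hence pr: "primeideal P Rn" by blast
 interpret primeideal P Rn by (rule pr)
 show ?thesis
 proof unfold_locales
  have "\<one>\<^sub>Rn ~: P" using one_imp_carrier I_notcarr by auto
  thus "\<one>\<^sub>Rn : Hn - P" using homog_one by auto
  fix a b assume ab: "a : Hn - P" "b : Hn - P"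
  hence c: "a : carrier Rn" "b : carrier Rn" using homog_carrier by auto
  have "a * b : Hn" using ab homog_mult by blast
  thus "a \<otimes>\<^sub>Rn b : Hn - P" using ab prime_mult_iff[OF pr c] by auto
 qed (use homog_carrier in auto)
qed

end

text \<open>
 If homogeneous \<open>h\<close> vanishes at \<open>P\<close> but not at \<open>P'\<close>, choose \<open>q\<close> of positive degree not vanishing at \<open>P\<close>. Then
 \<open>h\<^sup>e/q\<^sup>d\<close> is a nonunit at \<open>P\<close>, although its inverse is regular at \<open>P'\<close>. A morphism that fixes all rational
 functions therefore cannot move a point over \<open>P\<close> to one over \<open>P'\<close>.
\<close>
lemma homogeneous_part_mono:
 fixes X :: "('x, 'a, 'k::field) kspace" and n :: nat
 assumes X: "integral_scheme X"
  and f: "lrs_mor X (proj_space n :: ('k mpol set, 'k mpol set => ('k mpol \<times> 'k mpol) set, 'k) kspace) f" and \<tau>: "lrs_mor X X \<tau>"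
  and triv: "!!V s. openin (base X) V ==> V \<noteq> {} ==> s : sects X V ==>
   EX W. openin (base X) W & W \<noteq> {} & W \<subseteq> V \<inter> preim X \<tau> V & res X V W s = res X (preim X \<tau> V) W (co \<tau> V s)"
  and x: "x : points X" and h: "h : pt f x" "h : homog_part n d"
 shows "h : pt f (pt \<tau> x)"
proof (rule ccontr)
 assume nh: "h ~: pt f (pt \<tau> x)"
 interpret X: integral X by (rule integral_schemeI[OF X])
 let ?Z = "proj_space n :: ('k mpol set, 'k mpol set => ('k mpol \<times> 'k mpol) set, 'k) kspace"
 let ?R = "poly_ring_in n :: 'k mpol ring"
 let ?H = "\<Union>d. homog_part n d :: 'k mpol set"
 let ?den = "%P. ?H - P"
 let ?Q = "\<Union>d. homog_part n d \<times> homog_part n d :: ('k mpol \<times> 'k mpol) set"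
 let ?F = "frac_sheaf ?R ?Q ?den (base ?Z)"
 have FZ: "sec ?Z = sec ?F" "res ?Z = res ?F" "base ?F = base ?Z"
  by (simp_all add: proj_space_def Proj_def frac_sheaf_def Let_def)
 have Zpre: "presheaf ?Z"
  using frac_sheaf_presheaf[of ?R ?Q ?den "base ?Z"] unfolding presheaf_def is_presheaf_def FZ .
 interpret Z: presheaf ?Z by (rule Zpre)
 have cont: "continuous_map (base X) (base ?Z) (pt f)" and fco: "!!V. Z.op V ==> co f V : ring_hom (sec ?Z V) (sec X (preim X f V))"
  and fres: "!!V W t. Z.op V ==> Z.op W ==> W \<subseteq> V ==> t : sects ?Z V ==>
   co f W (res ?Z V W t) = res X (preim X f V) (preim X f W) (co f V t)"
  and floc: "local_hom (stalk_ring ?Z (pt f x)) (stalk_ring X x) (stalk_map X ?Z f x)"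
  using f x by (auto simp: lrs_mor_def)
 have tcont: "continuous_map (base X) (base X) (pt \<tau>)" and tco: "!!V. X.op V ==> co \<tau> V : ring_hom (sec X V) (sec X (preim X \<tau> V))"
  using \<tau> by (auto simp: lrs_mor_def)
 have fop: "X.op (preim X f V)" if "Z.op V" for V
  unfolding preim_def by (rule openin_continuous_map_preimage[OF cont that])
 have top: "X.op (preim X \<tau> V)" if "X.op V" for V
  unfolding preim_def by (rule openin_continuous_map_preimage[OF tcont that])
 let ?x' = "pt \<tau> x"
 have x': "?x' : points X" using continuous_map_image_subset_topspace[OF tcont] x by blast
 let ?P = "pt f x" and ?P' = "pt f ?x'"
 have PZ: "?P : points ?Z" "?P' : points ?Z" using continuous_map_image_subset_topspace[OF cont] x x' by blast+
 note ppts = proj_points[of n, where 'k = 'k]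
 have prime: "primeideal P ?R" if "P : points ?Z" for P using that unfolding ppts by blast
 obtain e q where q: "0 < e" "q : homog_part n e" "q ~: ?P" using PZ(1) unfolding ppts by blast
 \<comment> \<open>The exponents equalise the degrees: \<open>h\<close> has degree \<open>d\<close>
   and \<open>q\<close> has degree \<open>e\<close>, so both powers have degree \<open>d * e\<close>
   and their quotient is admissible.\<close>
 define a where "a = h ^ e"
 define b where "b = q ^ d"
 have aH: "a : homog_part n (d * e)" unfolding a_def by (rule homog_pow[OF h(2)])
 have bH: "b : homog_part n (d * e)" unfolding b_def using homog_pow[OF q(2), of d] by (simp add: mult.commute)
 have aR: "a : carrier ?R" "b : carrier ?R" "h : carrier ?R" "q : carrier ?R"
  using aH bH h q homog_carrier[of n] by blast+
 have D_open: "Z.op {P : points ?Z. c ~: P}" if "c : homog_part n i" for c i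
  unfolding proj_open ppts using that by (intro exI[of _ "{c}"]) auto
 let ?Dq = "{P : points ?Z. q ~: P}" and ?Dh = "{P : points ?Z. h ~: P}"
 have Dq: "Z.op ?Dq" and Dh: "Z.op ?Dh" using D_open q h by blast+
 have bq: "b ~: P" if "P : ?Dq" for P using prime_pow_iff[OF prime aR(4), of P d] that unfolding b_def by blast
 have ah: "a ~: P" if "P : ?Dh" for P using prime_pow_iff[OF prime aR(3), of P e] that unfolding a_def by blast
 have aP: "a : ?P"
 proof -
  interpret primeideal ?P ?R by (rule prime[OF PZ(1)])
  obtain e' where "e = Suc e'" using q(1) by (cases e) auto
  hence "a = h ^ e' \<otimes>\<^sub>?R h" by (simp add: a_def mult.commute)
  moreover have "h ^ e' : carrier ?R" using homog_pow[OF h(2), of e'] homog_carrier[of n] by blast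
  ultimately show ?thesis using I_l_closed[OF h(1)] by simp
 qed
 have ms: "mult_set ?R (?den P)" if "P : points ?Z" for P using proj_mult_set that unfolding ppts by blast
 \<comment> \<open>The fraction \<open>a/b\<close> is regular where \<open>q\<close> does not
   vanish, hence at \<open>P\<close>; its inverse \<open>b/a\<close> is regular where
   \<open>h\<close> does not vanish, hence at \<open>P'\<close>.\<close>
 define t where "t = const_sec ?R ?den ?Dq a b"
 define t' where "t' = const_sec ?R ?den ?Dh b a"
 have tm: "t : sects ?Z ?Dq" unfolding t_def FZ using Dq aH bH bq by (intro const_sec_mem) auto
 have t'm: "t' : sects ?Z ?Dh" unfolding t'_def FZ using Dh aH bH ah by (intro const_sec_mem) auto
 let ?E = "?Dq \<inter> ?Dh"
 have E: "Z.op ?E" by (rule Z.op_Int[OF Dq Dh])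
 have prodE: "res ?Z ?Dq ?E t \<otimes>\<^sub>(sec ?Z ?E) res ?Z ?Dh ?E t' = \<one>\<^sub>(sec ?Z ?E)"
 proof -
  have "res ?Z ?Dq ?E t \<otimes>\<^sub>(sec ?Z ?E) res ?Z ?Dh ?E t' =
   const_sec ?R ?den ?E a b \<otimes>\<^sub>(sec ?F ?E) const_sec ?R ?den ?E b a"
   unfolding t_def t'_def FZ by (simp only: const_sec_res Int_lower1 Int_lower2)
  also have "\<dots> = const_sec ?R ?den ?E (a \<otimes>\<^sub>?R b) (b \<otimes>\<^sub>?R a)"
   by (rule const_sec_mult) (use ms aR aH bH ah bq in auto)
  also have "\<dots> = const_sec ?R ?den ?E \<one>\<^sub>?R \<one>\<^sub>?R"
  proof -
   have c: "a * b : carrier ?R" "(1::'k mpol) : carrier ?R" using poly_ring_mult_closed[OF aR(1,2)] homog_one homog_carrier[of n] by blast+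
   have abH: "b * a : ?H" using homog_mult[OF bH aH] by blast
   have "b * a : ?den P & 1 : ?den P" if P: "P : ?E" for P
   proof -
    have pp: "primeideal P ?R" "P : points ?Z" using prime P by auto
    have "1 : ?den P" using mult_set.S_one[OF ms[OF pp(2)]] by simp
    thus ?thesis using abH prime_mult_iff[OF pp(1) aR(2,1)] ah[of P] bq[of P] P by blast
   qed
   note den = this
   show ?thesis
   proof (rule iffD2[OF const_sec_eq], goal_cases)
    case (1 P) thus ?case using ms by blast
   next
    case (4 P) thus ?case using den by simp
   next
    case (5 P) thus ?case using den by simp
   next
    case 6 show ?case
     by (intro ballI bexI[of _ 1]) (use den in \<open>auto simp: mult.commute\<close>)
   qed (use c in auto)
  qed
  also have "\<dots> = \<one>\<^sub>(sec ?Z ?E)" unfolding FZ by (rule const_sec_one[symmetric])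
  finally show ?thesis .
 qed
 let ?V = "preim X f ?Dq" and ?V' = "preim X f ?Dh"
 define s where "s = co f ?Dq t"
 define s' where "s' = co f ?Dh t'"
 have sm: "s : sects X ?V" unfolding s_def by (rule ring_hom_closed[OF fco[OF Dq] tm])
 have s'm: "s' : sects X ?V'" unfolding s'_def by (rule ring_hom_closed[OF fco[OF Dh] t'm])
 have V: "X.op ?V" "x : ?V" and V': "X.op ?V'" "?x' : ?V'"
  using fop[OF Dq] fop[OF Dh] x x' q nh PZ by (auto simp: preim_def)
 let ?W0 = "preim X f ?E"
 have W0: "X.op ?W0" "?W0 = ?V \<inter> ?V'" using fop[OF E] by (auto simp: preim_def)
 have prod0: "res X ?V ?W0 s \<otimes>\<^sub>(sec X ?W0) res X ?V' ?W0 s' = \<one>\<^sub>(sec X ?W0)"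
 proof -
  have "res X ?V ?W0 s \<otimes>\<^sub>(sec X ?W0) res X ?V' ?W0 s' = co f ?E (res ?Z ?Dq ?E t) \<otimes>\<^sub>(sec X ?W0) co f ?E (res ?Z ?Dh ?E t')"
   unfolding s_def s'_def using fres[OF Dq E _ tm] fres[OF Dh E _ t'm] by simp
  also have "\<dots> = co f ?E (\<one>\<^sub>(sec ?Z ?E))"
   unfolding prodE[symmetric]
   by (rule ring_hom_mult[OF fco[OF E] Z.res_closed[OF Dq E _ tm] Z.res_closed[OF Dh E _ t'm], symmetric]) auto
  also have "\<dots> = \<one>\<^sub>(sec X ?W0)" by (rule ring_hom_one[OF fco[OF E]])
  finally show ?thesis .
 qed
 \<comment> \<open>Pulled back along \<tau>, the function \<open>s'\<close> near the image of
   \<open>x\<close> becomes a function \<open>u\<close> near \<open>x\<close>. By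
   \<open>triv\<close> it agrees with \<open>s'\<close> on a nonempty open set, so it is inverse to
   \<open>s\<close> there.\<close>
 let ?T = "preim X \<tau> ?V'"
 define u where "u = co \<tau> ?V' s'"
 have T: "X.op ?T" "x : ?T" using top[OF V'(1)] V'(2) x by (auto simp: preim_def)
 have um: "u : sects X ?T" unfolding u_def by (rule ring_hom_closed[OF tco[OF V'(1)] s'm])
 obtain W1 where W1: "X.op W1" "W1 \<noteq> {}" "W1 \<subseteq> ?V' \<inter> ?T" "res X ?V' W1 s' = res X ?T W1 u"
  using triv[OF V'(1) _ s'm] V'(2) unfolding u_def by blast
 let ?B = "?V \<inter> ?T"
 have B: "X.op ?B" "x : ?B" "?B \<subseteq> ?V" "?B \<subseteq> ?T" using V T by auto
 let ?W2 = "W1 \<inter> ?B"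
 have W2: "X.op ?W2" "?W2 \<noteq> {}" "?W2 \<subseteq> ?B" "?W2 \<subseteq> W1" "?W2 \<subseteq> ?W0" "?W2 \<subseteq> ?V" "?W2 \<subseteq> ?T" "?W2 \<subseteq> ?V'"
  using W1 B W0 X.irreducible[OF W1(1,2) B(1)] by auto
 interpret XB: cring "sec X ?B" by (rule X.sec_cring[OF B(1)])
 let ?sB = "res X ?V ?B s" and ?uB = "res X ?T ?B u"
 have sB: "?sB : sects X ?B" by (rule X.res_closed[OF V(1) B(1,3) sm])
 have uB: "?uB : sects X ?B" by (rule X.res_closed[OF T(1) B(1,4) um])
 have "res X ?B ?W2 (?sB \<otimes>\<^sub>(sec X ?B) ?uB) = res X ?B ?W2 ?sB \<otimes>\<^sub>(sec X ?W2) res X ?B ?W2 ?uB"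
  by (rule X.res_ring(2)[OF B(1) W2(1,3) sB uB])
 also have "res X ?B ?W2 ?sB = res X ?W0 ?W2 (res X ?V ?W0 s)"
  using X.res_res[OF V(1) B(1) W2(1,3) B(3) sm] X.res_res[OF V(1) W0(1) W2(1,5) _ sm] W0(2) by simp
 also have "res X ?B ?W2 ?uB = res X W1 ?W2 (res X ?T W1 u)"
  using X.res_res[OF T(1) B(1) W2(1,3) B(4) um] X.res_res[OF T(1) W1(1) W2(1,4) _ um] W1(3) by simp
 also have "\<dots> = res X ?W0 ?W2 (res X ?V' ?W0 s')"
  unfolding W1(4)[symmetric]
  using X.res_res[OF V'(1) W1(1) W2(1,4) _ s'm] X.res_res[OF V'(1) W0(1) W2(1,5) _ s'm] W1(3) W0(2) by simp
 also have "res X ?W0 ?W2 (res X ?V ?W0 s) \<otimes>\<^sub>(sec X ?W2) res X ?W0 ?W2 (res X ?V' ?W0 s') =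
   res X ?W0 ?W2 \<one>\<^sub>(sec X ?W0)"
  unfolding prod0[symmetric]
  by (rule X.res_ring(2)[OF W0(1) W2(1,5) X.res_closed[OF V(1) W0(1) _ sm] X.res_closed[OF V'(1) W0(1) _ s'm], symmetric])
   (use W0(2) in auto)
 also have "\<dots> = res X ?B ?W2 \<one>\<^sub>(sec X ?B)" using X.res_ring(3)[OF W0(1) W2(1,5)] X.res_ring(3)[OF B(1) W2(1,3)] by simp
 \<comment> \<open>The identity holds on the nonempty open set \<open>?W2\<close> and extends to the
   neighbourhood \<open>?B\<close> of \<open>x\<close>, since restriction is injective on an
   integral scheme.\<close>
 finally have su: "?sB \<otimes>\<^sub>(sec X ?B) ?uB = \<one>\<^sub>(sec X ?B)"
  by (rule X.res_inj[OF B(1) XB.m_closed[OF sB uB] XB.one_closed W2(1,2,3)])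
 have "germ X x ?V s = germ X x ?B ?sB" using X.germ_res[OF V(1) B(1,2,3) sm] by simp
 hence "germ X x ?V s \<otimes>\<^sub>(stalk_ring X x) germ X x ?B ?uB = \<one>\<^sub>(stalk_ring X x)"
  using X.germ_mult[OF B(1,2) sB uB] su X.germ_one[OF B(1,2)] by simp
 moreover interpret Xx: cring "stalk_ring X x" by (rule X.stalk_cring[OF x])
 have gs: "germ X x ?V s : carrier (stalk_ring X x)" "germ X x ?B ?uB : carrier (stalk_ring X x)"
  using X.germ_stalk[OF V sm] X.germ_stalk[OF B(1,2) uB] by auto
 ultimately have unit: "germ X x ?V s : Units (stalk_ring X x)"
  unfolding Units_def using Xx.m_comm[OF gs] gs by auto
 have PD: "?P : ?Dq" using q PZ by blast
 \<comment> \<open>The map on stalks is a definite description, so its value at the germ of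
   \<open>t\<close> has to be shown independent of the representative.\<close>
 have smap: "stalk_map X ?Z f x (germ ?Z ?P ?Dq t) = germ X x ?V s"
  unfolding stalk_map_def
 proof (rule the_equality)
  show "EX V ta. Z.op V & ?P : V & ta : sects ?Z V & germ ?Z ?P ?Dq t = germ ?Z ?P V ta &
    germ X x ?V s = germ X x (preim X f V) (co f V ta)"
   using Dq PD tm unfolding s_def by blast
 next
  fix A assume "EX V ta. Z.op V & ?P : V & ta : sects ?Z V & germ ?Z ?P ?Dq t = germ ?Z ?P V ta &
    A = germ X x (preim X f V) (co f V ta)"
  then obtain U r where U: "Z.op U" "?P : U" "r : sects ?Z U" "germ ?Z ?P ?Dq t = germ ?Z ?P U r"
   "A = germ X x (preim X f U) (co f U r)" by blast
  obtain W where W: "Z.op W" "?P : W" "W \<subseteq> ?Dq \<inter> U" "res ?Z ?Dq W t = res ?Z U W r"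
   using Z.germ_eq[OF Dq PD tm U(1-3)] U(4) by blast
  have pW: "X.op (preim X f W)" "x : preim X f W" "preim X f W \<subseteq> ?V" "preim X f W \<subseteq> preim X f U"
   using fop[OF W(1)] W x by (auto simp: preim_def)
  have rU: "co f U r : sects X (preim X f U)" by (rule ring_hom_closed[OF fco[OF U(1)] U(3)])
  have "res X ?V (preim X f W) s = res X (preim X f U) (preim X f W) (co f U r)"
   unfolding s_def using fres[OF Dq W(1) _ tm] fres[OF U(1) W(1) _ U(3)] W(3,4) by auto
  hence "germ X x ?V s = germ X x (preim X f U) (co f U r)"
   using X.germ_res[OF V(1) pW(1,2,3) sm] X.germ_res[OF fop[OF U(1)] pW(1,2,4) rU] by simp
  thus "A = germ X x ?V s" using U(5) by simp
 qed
 have gt: "germ ?Z ?P ?Dq t : carrier (stalk_ring ?Z ?P)"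
  using Z.germ_stalk[OF Dq PD tm] by (simp add: stalk_ring_def)
 \<comment> \<open>The map on stalks is local, so \<open>a/b\<close> is invertible already in the
   local ring of projective space at \<open>P\<close>.\<close>
 have "germ ?Z ?P ?Dq t : Units (stalk_ring ?Z ?P)"
  using floc gt unit smap unfolding local_hom_def by auto
 then obtain g where g: "g : stalk ?Z ?P" "g \<otimes>\<^sub>(stalk_ring ?Z ?P) germ ?Z ?P ?Dq t = \<one>\<^sub>(stalk_ring ?Z ?P)"
  unfolding Units_def by (auto simp: stalk_ring_def)
 obtain U r where U: "Z.op U" "?P : U" "r : sects ?Z U" "g = germ ?Z ?P U r" using g(1) by (rule Z.stalkE)
 let ?U = "U \<inter> ?Dq"
 have UU: "Z.op ?U" "?P : ?U" "?U \<subseteq> U" "?U \<subseteq> ?Dq" using U Dq PD Z.op_Int by auto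
 let ?r = "res ?Z U ?U r" and ?t = "res ?Z ?Dq ?U t"
 have rt: "?r : sects ?Z ?U" "?t : sects ?Z ?U" using Z.res_closed[OF U(1) UU(1,3) U(3)] Z.res_closed[OF Dq UU(1,4) tm] by auto
 have Qc: "?Q \<subseteq> carrier ?R \<times> carrier ?R" using homog_carrier[of n] by blast
 have Qm: "(a \<otimes>\<^sub>?R c, b \<otimes>\<^sub>?R d) : ?Q" if cq: "(a, b) : ?Q" "(c, d) : ?Q" for a b c d
 proof -
  obtain i j where "a : homog_part n i" "b : homog_part n i" "c : homog_part n j" "d : homog_part n j" using cq by blast
  hence "a * c : homog_part n (i + j)" "b * d : homog_part n (i + j)" using homog_mult by blast+
  thus ?thesis by auto
 qed
 have mcl: "r \<otimes>\<^sub>(sec ?Z U) t : sects ?Z U" if "Z.op U" "r : sects ?Z U" "t : sects ?Z U" for U r t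
  using frac_sheaf_mult_closed[of "base ?Z" ?R ?den ?Q U r t] ms Qc Qm that unfolding FZ by blast
 have mres: "res ?Z U W (r \<otimes>\<^sub>(sec ?Z U) t) = res ?Z U W r \<otimes>\<^sub>(sec ?Z W) res ?Z U W t" if "W \<subseteq> U" for U W r t
  unfolding FZ by (rule frac_sheaf_mult_res[OF that])
 have "stalk_op2 ?Z ?Z ?P (%U. mult (sec ?Z U)) (germ ?Z ?P ?U ?r) (germ ?Z ?P ?U ?t) =
   germ ?Z ?P ?U (?r \<otimes>\<^sub>(sec ?Z ?U) ?t)"
  by (rule stalk_op2_germ[where f = "%U. mult (sec ?Z U)", OF Zpre Zpre refl mcl mres UU(1,2) rt])
 hence "germ ?Z ?P ?U (?r \<otimes>\<^sub>(sec ?Z ?U) ?t) = germ ?Z ?P (points ?Z) \<one>\<^sub>(sec ?Z (points ?Z))"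
  using g(2) U(4) Z.germ_res[OF U(1) UU(1,2,3) U(3)] Z.germ_res[OF Dq UU(1,2,4) tm] by (simp add: stalk_ring_def)
 hence "(?U, ?r \<otimes>\<^sub>(sec ?Z ?U) ?t) : germ ?Z ?P (points ?Z) \<one>\<^sub>(sec ?Z (points ?Z))"
  using Z.germ_mem[OF UU(1,2) mcl[OF UU(1) rt]] by simp
 then obtain W where W: "?P : W" "W \<subseteq> points ?Z \<inter> ?U"
  "res ?Z (points ?Z) W \<one>\<^sub>(sec ?Z (points ?Z)) = res ?Z ?U W (?r \<otimes>\<^sub>(sec ?Z ?U) ?t)"
  unfolding germ_def by blast
 have WU: "?P : points ?Z" "?P : ?U" using W by auto
 interpret m: mult_set ?R "?den ?P" by (rule ms[OF PZ(1)])
 have l: "(res ?Z (points ?Z) W \<one>\<^sub>(sec ?Z (points ?Z))) ?P = loc_frac ?R (?den ?P) 1 1"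
 proof -
  have WZ: "W \<subseteq> points ?Z" using W(2) by blast
  have "res ?Z (points ?Z) W \<one>\<^sub>(sec ?Z (points ?Z)) = const_sec ?R ?den W \<one>\<^sub>?R \<one>\<^sub>?R"
   unfolding FZ(1,2) const_sec_one by (rule const_sec_res[OF WZ])
  thus ?thesis using W(1) by (simp add: const_sec_def)
 qed
 obtain c c' where c: "r ?P = loc_frac ?R (?den ?P) c c'" "(c, c') : ?Q" "c' : ?den ?P"
  using frac_sheaf_at[OF U(3)[unfolded FZ] U(2)] by (elim exE conjE) (rule that)
 have tP: "t ?P = loc_frac ?R (?den ?P) a b" using PD by (simp add: t_def const_sec_def)
 have cR: "c : carrier ?R" "c' : carrier ?R" using c Qc by auto
 have bden: "b : ?den ?P" using bH bq PD by blast
 have rr: "(res ?Z ?U W (?r \<otimes>\<^sub>(sec ?Z ?U) ?t)) ?P = frac_mult ?R (?den ?P) (r ?P) (t ?P)"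
  unfolding FZ using W(1) WU by (simp add: frac_sheaf_def)
 have fe: "loc_frac ?R (?den ?P) 1 1 = loc_frac ?R (?den ?P) (c \<otimes>\<^sub>?R a) (c' \<otimes>\<^sub>?R b)"
  using W(3) l rr m.frac_mult_frac[OF cR(1) aR(1) c(3) bden] unfolding c(1) tP by simp
 have o1: "(1::'k mpol) : carrier ?R" "1 : ?den ?P" using m.S_one m.SR[OF m.S_one] by simp_all
 have ca: "c \<otimes>\<^sub>?R a : carrier ?R" using poly_ring_mult_closed[OF cR(1) aR(1)] by simp
 have "EX u:?den ?P. u \<otimes>\<^sub>?R (1 \<otimes>\<^sub>?R (c' \<otimes>\<^sub>?R b)) = u \<otimes>\<^sub>?R (c \<otimes>\<^sub>?R a \<otimes>\<^sub>?R 1)"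
  by (rule iffD1[OF m.frac_eq[OF o1(1) ca o1(2) m.S_mult[OF c(3) bden]] fe])
 then obtain w where w0: "w : ?den ?P"
  "w \<otimes>\<^sub>?R (1 \<otimes>\<^sub>?R (c' \<otimes>\<^sub>?R b)) = w \<otimes>\<^sub>?R (c \<otimes>\<^sub>?R a \<otimes>\<^sub>?R 1)" by (rule bexE)
 hence w: "w : ?den ?P" "w * (c' * b) = w * (c * a)" by simp_all
 have wR: "w : carrier ?R" using m.SR[OF w(1)] .
 \<comment> \<open>If \<open>c/c'\<close> is the inverse of \<open>a/b\<close> at \<open>P\<close>,
   then \<open>w c' b = w c a\<close> with \<open>w\<close>, \<open>c'\<close> and \<open>b\<close>
   outside the prime \<open>P\<close>, while \<open>a\<close> lies in it.\<close>
 have "w * (c * a) : ?P"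
  using prime_mult_iff[OF prime[OF PZ(1)] wR poly_ring_mult_closed[OF cR(1) aR(1)]] prime_mult_iff[OF prime[OF PZ(1)] cR(1) aR(1)] aP by blast
 hence "w : ?P \<or> c' : ?P \<or> b : ?P"
  unfolding w(2)[symmetric]
  using prime_mult_iff[OF prime[OF PZ(1)] wR poly_ring_mult_closed[OF cR(2) aR(2)]] prime_mult_iff[OF prime[OF PZ(1)] cR(2) aR(2)] by blast
 thus False using w c bden by blast
qed

section \<open>Sheaves of algebras with a group action\<close>

lemma with_smult_simps [simp]:
 "carrier (with_smult M f) = carrier M" "add (with_smult M f) = add M" "ring.zero (with_smult M f) = ring.zero M"
 "smult (with_smult M f) = f"
 by (simp_all add: with_smult_def)

lemma finsum_with_smult: "finsum (with_smult M f) = finsum M"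
 by (simp add: finsum_def finprod_def fun_eq_iff)

lemma algebra_module:
 assumes R: "cring R" and S: "cring S" and h: "h \<in> ring_hom S R"
 shows "Module.module S (with_smult R (\<lambda>c x. h c \<otimes>\<^bsub>R\<^esub> x))"
proof -
 interpret R: cring R by fact
 interpret S: cring S by fact
 interpret h: ring_hom_cring S R h by unfold_locales fact
 show ?thesis
 proof (rule moduleI)
  show "abelian_group (with_smult R (\<lambda>c x. h c \<otimes>\<^bsub>R\<^esub> x))"
  proof (rule abelian_groupI)
   fix x assume "x \<in> carrier (with_smult R (\<lambda>c x. h c \<otimes>\<^bsub>R\<^esub> x))"
   thus "\<exists>y\<in>carrier (with_smult R (\<lambda>c x. h c \<otimes>\<^bsub>R\<^esub> x)). y \<oplus>\<^bsub>with_smult R (\<lambda>c x. h c \<otimes>\<^bsub>R\<^esub> x)\<^esub> x =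
     \<zero>\<^bsub>with_smult R (\<lambda>c x. h c \<otimes>\<^bsub>R\<^esub> x)\<^esub>"
    by (intro bexI[of _ "\<ominus>\<^bsub>R\<^esub> x"]) (simp_all add: R.l_neg)
  qed (simp_all add: R.a_ac)
 qed (simp_all add: R.l_distr R.r_distr R.m_assoc S.is_cring)
qed

text \<open>Axioms met by the direct image of the structure sheaf of \<open>X\<close>, so that ranks
  and decompositions are treated entirely on \<open>Y\<close>. What survives of the integrality of
  \<open>X\<close> is that sections form domains and that restriction to nonempty open sets is
  injective; \<open>inc\<close> identifies functions on \<open>Y\<close> with the
  invariants.\<close>

locale galois_sheaf = Y: integral Y + A: ring_sheaf A + G: group G
 for Y :: "('y, 'b, 'k::field) kspace" and A :: "('y, 'a) ringed_space" and G :: "('g, 'h) monoid_scheme" (structure) +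
 fixes act :: "'g => 'y set => 'a => 'a" and inc :: "'y set => 'b => 'a"
 assumes base_A: "base A = base Y" and finite_G: "finite (carrier G)"
  and kmap_hom: "kmap Y : ring_hom class_ring (sec Y (points Y))"
  and act_hom: "g : carrier G ==> Y.op U ==> act g U : ring_hom (sec A U) (sec A U)"
  and act_one: "Y.op U ==> s : sects A U ==> act \<one> U s = s"
  and act_mult: "g : carrier G ==> h : carrier G ==> Y.op U ==> s : sects A U ==> act (g \<otimes> h) U s = act g U (act h U s)"
  and act_res: "g : carrier G ==> Y.op U ==> Y.op W ==> W \<subseteq> U ==> s : sects A U ==>
   res A U W (act g U s) = act g W (res A U W s)"
  and inc_hom: "Y.op U ==> inc U : ring_hom (sec Y U) (sec A U)"
  and inc_res: "Y.op U ==> Y.op W ==> W \<subseteq> U ==> b : sects Y U ==> res A U W (inc U b) = inc W (res Y U W b)"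
  and inc_bij: "Y.op U ==> bij_betw (inc U) (sects Y U) {s : sects A U. ALL g:carrier G. act g U s = s}"
  and A_dom: "Y.op U ==> U \<noteq> {} ==> domain (sec A U)"
  and A_inj: "Y.op U ==> s : sects A U ==> t : sects A U ==> Y.op W ==> W \<noteq> {} ==> W \<subseteq> U ==>
   res A U W s = res A U W t ==> s = t"
  and faithful: "g : carrier G ==> (!!U s. Y.op U ==> s : sects A U ==> act g U s = s) ==> g = \<one>"
begin

abbreviation op :: "'y set => bool" where "op \<equiv> openin (base Y)"

lemmas A_res_closed [simp] = A.res_closed[unfolded base_A]
 and A_res_id = A.res_id[unfolded base_A] and A_res_res = A.res_res[unfolded base_A]
 and A_cring = A.sec_cring[unfolded base_A]
 and A_res_ring = A.res_ring[unfolded base_A] and A_locality = A.locality[unfolded base_A]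
 and A_glue1 = A.glue1[unfolded base_A] and A_glue_local = A.glue_local[unfolded base_A]
 and A_sec_closed [simp] = A.sec_closed[unfolded base_A]

lemma act_closed [simp]: "g : carrier G ==> op U ==> s : sects A U ==> act g U s : sects A U"
 using ring_hom_closed[OF act_hom] .

lemma inc_closed [simp]: "op U ==> b : sects Y U ==> inc U b : sects A U"
 using ring_hom_closed[OF inc_hom] .

lemma act_ring:
 assumes "g : carrier G" "op U"
 shows "s : sects A U ==> t : sects A U ==> act g U (s \<oplus>\<^sub>(sec A U) t) = act g U s \<oplus>\<^sub>(sec A U) act g U t" (is "PROP ?P1")
  "s : sects A U ==> t : sects A U ==> act g U (s \<otimes>\<^sub>(sec A U) t) = act g U s \<otimes>\<^sub>(sec A U) act g U t" (is "PROP ?P2")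
  "act g U \<one>\<^sub>(sec A U) = \<one>\<^sub>(sec A U)" (is "PROP ?P3") "act g U \<zero>\<^sub>(sec A U) = \<zero>\<^sub>(sec A U)" (is "PROP ?P4")
proof -
 interpret A: cring "sec A U" by (rule A_cring[OF assms(2)])
 interpret h: ring_hom_cring "sec A U" "sec A U" "act g U" by unfold_locales (rule act_hom[OF assms])
 show "PROP ?P1"
  "PROP ?P2"
  "PROP ?P3" "PROP ?P4" by simp_all
qed

lemma inc_ring:
 assumes "op U"
 shows "s : sects Y U ==> t : sects Y U ==> inc U (s \<oplus>\<^sub>(sec Y U) t) = inc U s \<oplus>\<^sub>(sec A U) inc U t" (is "PROP ?P1")
  "s : sects Y U ==> t : sects Y U ==> inc U (s \<otimes>\<^sub>(sec Y U) t) = inc U s \<otimes>\<^sub>(sec A U) inc U t" (is "PROP ?P2")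
  "inc U \<one>\<^sub>(sec Y U) = \<one>\<^sub>(sec A U)" (is "PROP ?P3") "inc U \<zero>\<^sub>(sec Y U) = \<zero>\<^sub>(sec A U)" (is "PROP ?P4")
proof -
 interpret A: cring "sec A U" by (rule A_cring[OF assms(1)])
 interpret Z: cring "sec Y U" by (rule Y.sec_cring[OF assms(1)])
 interpret h: ring_hom_cring "sec Y U" "sec A U" "inc U" by unfold_locales (rule inc_hom[OF assms])
 show "PROP ?P1"
  "PROP ?P2"
  "PROP ?P3" "PROP ?P4" by simp_all
qed

lemma inc_inv: "op U ==> b : sects Y U ==> g : carrier G ==> act g U (inc U b) = inc U b"
 using bij_betwE[OF inc_bij] by blast

lemma inc_surj:
 assumes "op U" "s : sects A U" "!!g. g : carrier G ==> act g U s = s"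
 obtains b where "b : sects Y U" "s = inc U b"
proof -
 have "s : inc U ` sects Y U" using assms inc_bij[OF assms(1)] by (simp add: bij_betw_def)
 thus ?thesis using that by blast
qed

lemma inc_inj: "op U ==> b : sects Y U ==> b' : sects Y U ==> inc U b = inc U b' ==> b = b'"
 using inj_onD[OF bij_betw_imp_inj_on[OF inc_bij]] by blast

definition kY :: "'y set => 'k => 'b" where "kY U c = res Y (points Y) U (kmap Y c)"
definition \<kappa> :: "'y set => 'k => 'a" where "\<kappa> U c = inc U (kY U c)"

lemma kY_hom: "op U ==> kY U : ring_hom class_ring (sec Y U)"
 using ring_hom_trans[OF kmap_hom Y.res_hom[OF Y.op_points _ Y.op_sub]] unfolding kY_def[abs_def] comp_def by simp

lemma kY_closed [simp]: "op U ==> kY U c : sects Y U"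
 using ring_hom_closed[OF kY_hom] by simp

lemma kY_res: "op U ==> op W ==> W \<subseteq> U ==> res Y U W (kY U c) = kY W c"
 unfolding kY_def using ring_hom_closed[OF kmap_hom, of c] Y.op_sub by (intro Y.res_res) auto

lemma \<kappa>_hom: "op U ==> \<kappa> U : ring_hom class_ring (sec A U)"
 using ring_hom_trans[OF kY_hom inc_hom] unfolding \<kappa>_def[abs_def] comp_def by simp

lemma \<kappa>_closed [simp]: "op U ==> \<kappa> U c : sects A U"
 using ring_hom_closed[OF \<kappa>_hom] by simp

lemma \<kappa>_res: "op U ==> op W ==> W \<subseteq> U ==> res A U W (\<kappa> U c) = \<kappa> W c"
 by (simp add: \<kappa>_def inc_res kY_res)

lemma \<kappa>_inv: "op U ==> g : carrier G ==> act g U (\<kappa> U c) = \<kappa> U c"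
 by (simp add: \<kappa>_def inc_inv)

text \<open>Places the sections over \<open>U\<close> in the setting of \<open>kG_module\<close>,
  with \<open>k\<close> acting through the constants \<open>\<kappa> U\<close>.\<close>

definition MA :: "'y set => ('k, 'a) Module.module" where
 "MA U = with_smult (sec A U) (%c s. \<kappa> U c \<otimes>\<^sub>(sec A U) s)"

lemma MA_simps [simp]: "carrier (MA U) = sects A U" "add (MA U) = add (sec A U)" "ring.zero (MA U) = ring.zero (sec A U)"
 "c \<odot>\<^sub>(MA U) s = \<kappa> U c \<otimes>\<^sub>(sec A U) s" "finsum (MA U) = finsum (sec A U)"
 by (simp_all add: MA_def finsum_with_smult)

lemma class_cring: "cring (class_ring :: 'k ring)"
 by (rule field.axioms(1)[THEN domain.axioms(1)]) (rule class_field)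

lemma MA_kG: assumes U: "op U" shows "kG_module G (MA U) (%g. act g U)"
proof -
 interpret A: cring "sec A U" by (rule A_cring[OF U])
 have "Module.module class_ring (MA U)"
  unfolding MA_def by (rule algebra_module[OF A.is_cring class_cring \<kappa>_hom[OF U]])
 moreover have "act g U : module_hom class_ring (MA U) (MA U)" if "g : carrier G" for g
  using that U by (auto simp: module_hom_def act_ring \<kappa>_inv)
 ultimately show ?thesis
  unfolding kG_module_def kG_module_axioms_def
  using U finite_G act_one act_mult G.is_group by simp
qed

text \<open>With \<open>mult_kG_hom\<close>, this makes restriction and multiplication by functions
  on \<open>Y\<close> commute with the group algebra, by \<open>kG_hom_ga\<close>.\<close>

lemma res_kG_hom:
 assumes "op U" "op W" "W \<subseteq> U"
 shows "res A U W : kG_hom G (MA U) (%g. act g U) (MA W) (%g. act g W)"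
 using assms by (auto simp: kG_hom_def module_hom_def A_res_ring \<kappa>_res act_res)

lemma mult_kG_hom:
 assumes "op U" "b : sects Y U"
 shows "(%s. inc U b \<otimes>\<^sub>(sec A U) s) : kG_hom G (MA U) (%g. act g U) (MA U) (%g. act g U)"
proof -
 interpret A: cring "sec A U" by (rule A_cring[OF assms(1)])
 show ?thesis using assms by (auto simp: kG_hom_def module_hom_def A.r_distr A.m_lcomm act_ring inc_inv)
qed

section \<open>The sheaf of equivariant homomorphisms\<close>

text \<open>The sheaf \<open>E_V\<close>. Sections are extensional functions on the carrier of
  \<open>V\<close>, so that two of them are equal as soon as their values on \<open>V\<close>
  agree.\<close>

definition hom_sheaf :: "('k, 'v, 'g) rep => ('y, 'b, 'v => 'a) mod_sheaf" where
 "hom_sheaf V =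
  \<lparr>base = base Y,
   sec = (%U. \<lparr>carrier = {f : extensional (carrier V). f : kG_hom G V (rho V) (MA U) (%g. act g U)},
    mult = undefined, one = undefined, ring.zero = (\<lambda>v\<in>carrier V. \<zero>\<^sub>(sec A U)),
    add = (%f f'. \<lambda>v\<in>carrier V. f v \<oplus>\<^sub>(sec A U) f' v), smult = (%b f. \<lambda>v\<in>carrier V. inc U b \<otimes>\<^sub>(sec A U) f v)\<rparr>),
   res = (%U W f. \<lambda>v\<in>carrier V. res A U W (f v))\<rparr>"

lemma hom_sheaf_simps [simp]: "base (hom_sheaf V) = base Y"
 "ring.zero (sec (hom_sheaf V) U) = (\<lambda>v\<in>carrier V. \<zero>\<^sub>(sec A U))"
 "add (sec (hom_sheaf V) U) f f' = (\<lambda>v\<in>carrier V. f v \<oplus>\<^sub>(sec A U) f' v)"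
 "smult (sec (hom_sheaf V) U) b f = (\<lambda>v\<in>carrier V. inc U b \<otimes>\<^sub>(sec A U) f v)"
 "res (hom_sheaf V) U W f = (\<lambda>v\<in>carrier V. res A U W (f v))"
 by (simp_all add: hom_sheaf_def)

lemma hom_mem: "f : sects (hom_sheaf V) U \<longleftrightarrow> f : extensional (carrier V) & (ALL v:carrier V. f v : sects A U) &
  (ALL v:carrier V. ALL w:carrier V. f (v \<oplus>\<^sub>V w) = f v \<oplus>\<^sub>(sec A U) f w) &
  (ALL c. ALL v:carrier V. f (c \<odot>\<^sub>V v) = \<kappa> U c \<otimes>\<^sub>(sec A U) f v) &
  (ALL g:carrier G. ALL v:carrier V. f (rho V g v) = act g U (f v))"
 by (auto simp: hom_sheaf_def kG_hom_def module_hom_def)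

lemma hom_memD:
 assumes "f : sects (hom_sheaf V) U"
 shows "f : extensional (carrier V)" "v : carrier V ==> f v : sects A U"
  "v : carrier V ==> w : carrier V ==> f (v \<oplus>\<^sub>V w) = f v \<oplus>\<^sub>(sec A U) f w"
  "v : carrier V ==> f (c \<odot>\<^sub>V v) = \<kappa> U c \<otimes>\<^sub>(sec A U) f v"
  "g : carrier G ==> v : carrier V ==> f (rho V g v) = act g U (f v)"
 using assms unfolding hom_mem by blast+

lemma hom_kG: "f : sects (hom_sheaf V) U ==> f : kG_hom G V (rho V) (MA U) (%g. act g U)"
 by (simp add: hom_sheaf_def)

lemma hom_eqI: "f : sects (hom_sheaf V) U ==> f' : sects (hom_sheaf V) U' ==> (!!v. v : carrier V ==> f v = f' v) ==> f = f'"
 by (rule extensionalityI[OF hom_memD(1) hom_memD(1)])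

context
 fixes V :: "('k, 'v, 'g) rep"
 assumes V: "representation G V"
begin

interpretation V: kG_module G V "rho V"
 by (rule representation_kG_module[OF G.is_group finite_G V])

lemma hom_zero: "op U ==> \<zero>\<^sub>(sec (hom_sheaf V) U) : sects (hom_sheaf V) U"
proof -
 assume U: "op U"
 interpret A: cring "sec A U" by (rule A_cring[OF U])
 show ?thesis unfolding hom_mem using U by (simp add: act_ring)
qed

lemma hom_add:
 assumes U: "op U" and f: "f : sects (hom_sheaf V) U" "f' : sects (hom_sheaf V) U"
 shows "f \<oplus>\<^sub>(sec (hom_sheaf V) U) f' : sects (hom_sheaf V) U"
proof -
 interpret A: cring "sec A U" by (rule A_cring[OF U])
 note d = hom_memD[OF f(1)] hom_memD[OF f(2)]
 show ?thesis unfolding hom_mem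
  using U d(2,7) by (simp add: d(3-5,8-10) act_ring A.a_ac A.r_distr)
qed

lemma hom_smult:
 assumes U: "op U" and b: "b : sects Y U" and f: "f : sects (hom_sheaf V) U"
 shows "b \<odot>\<^sub>(sec (hom_sheaf V) U) f : sects (hom_sheaf V) U"
proof -
 interpret A: cring "sec A U" by (rule A_cring[OF U])
 note d = hom_memD[OF f(1)]
 show ?thesis unfolding hom_mem
  using U d(2) b by (simp add: d(3-5) act_ring A.r_distr A.m_lcomm inc_inv)
qed

lemma hom_res:
 assumes U: "op U" "op W" "W \<subseteq> U" and f: "f : sects (hom_sheaf V) U"
 shows "res (hom_sheaf V) U W f : sects (hom_sheaf V) W"
proof -
 note d = hom_memD[OF f(1)]
 show ?thesis unfolding hom_mem
  using U d(2) by (simp add: d(3-5) A_res_ring act_res \<kappa>_res)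
qed

lemma hom_module: assumes U: "op U" shows "Module.module (sec Y U) (sec (hom_sheaf V) U)"
proof -
 interpret A: cring "sec A U" by (rule A_cring[OF U])
 note c = hom_zero[OF U] hom_add[OF U] hom_smult[OF U]
 have mem: "f v : sects A U" if "f : sects (hom_sheaf V) U" "v : carrier V" for f v using hom_memD(2)[OF that] .
 have one: "inc U \<one>\<^sub>(sec Y U) = \<one>\<^sub>(sec A U)" by (rule inc_ring(3)[OF U])
 show ?thesis
 proof (rule moduleI)
  show "abelian_group (sec (hom_sheaf V) U)"
  proof (rule abelian_groupI)
   fix f assume f: "f : sects (hom_sheaf V) U"
   let ?n = "\<lambda>v\<in>carrier V. \<ominus>\<^sub>(sec A U) f v"
   note d = hom_memD[OF f]
   have neg: "act g U (\<ominus>\<^sub>(sec A U) s) = \<ominus>\<^sub>(sec A U) act g U s" if "g : carrier G" "s : sects A U" for g s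
   proof -
    interpret h: ring_hom_cring "sec A U" "sec A U" "act g U" by unfold_locales (rule act_hom[OF that(1) U])
    show ?thesis using that by simp
   qed
   have "?n : sects (hom_sheaf V) U"
    unfolding hom_mem using U d(2) by (simp add: d(3-5) A.minus_add A.r_minus neg)
   moreover have "?n \<oplus>\<^sub>(sec (hom_sheaf V) U) f = \<zero>\<^sub>(sec (hom_sheaf V) U)"
    using d(2) by (auto simp: A.l_neg fun_eq_iff)
   ultimately show "EX f':sects (hom_sheaf V) U. f' \<oplus>\<^sub>(sec (hom_sheaf V) U) f = \<zero>\<^sub>(sec (hom_sheaf V) U)" by blast
  next
   fix f assume f: "f : sects (hom_sheaf V) U"
   show "\<zero>\<^sub>(sec (hom_sheaf V) U) \<oplus>\<^sub>(sec (hom_sheaf V) U) f = f"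
    by (rule hom_eqI[OF c(2)[OF c(1) f] f]) (use hom_memD(2)[OF f] in simp)
  qed (use c in \<open>auto simp: mem A.a_ac intro!: restrict_ext\<close>)
 next
  fix f assume f: "f : sects (hom_sheaf V) U"
  show "\<one>\<^sub>(sec Y U) \<odot>\<^sub>(sec (hom_sheaf V) U) f = f"
   by (rule hom_eqI[OF c(3)[OF Y.sec_closed(3)[OF U] f] f]) (use hom_memD(2)[OF f] in \<open>simp add: one\<close>)
 qed (use c U Y.sec_cring[OF U] Y.sec_closed[OF U] in
   \<open>auto simp: mem inc_ring A.l_distr A.r_distr A.m_assoc intro!: restrict_ext\<close>)
qed

lemma hom_sheaf_presheaf: "is_presheaf (hom_sheaf V)"
 unfolding is_presheaf_def hom_sheaf_simps(1)
proof (intro conjI allI impI ballI, goal_cases)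
 case (1 U W) thus ?case using hom_res[of U W] by blast
next
 case (2 U f)
 have "res (hom_sheaf V) U U f : sects (hom_sheaf V) U" using 2 by (intro hom_res) auto
 thus ?case using 2 hom_memD(2)[OF 2(2)] by (intro hom_eqI) (auto simp: A_res_id)
next
 case (3 U W Z f)
 thus ?case using hom_memD(2)[OF 3(2)] by (auto simp: A_res_res intro!: restrict_ext)
qed

text \<open>The values are glued separately at each \<open>v\<close>; linearity and equivariance of
  the result hold because they hold on every member of the cover.\<close>

lemma hom_sheaf_sheaf: "is_sheaf (hom_sheaf V)"
 unfolding is_sheaf_def
proof (intro conjI allI impI hom_sheaf_presheaf)
 fix \<U> s
 assume "(ALL U:\<U>. openin (base (hom_sheaf V)) U & s U : sects (hom_sheaf V) U) &
  (ALL U:\<U>. ALL W:\<U>. res (hom_sheaf V) U (U \<inter> W) (s U) = res (hom_sheaf V) W (U \<inter> W) (s W))"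
 hence o: "!!U. U : \<U> ==> op U" and s: "!!U. U : \<U> ==> s U : sects (hom_sheaf V) U"
  and cp: "!!U W. U : \<U> ==> W : \<U> ==> res (hom_sheaf V) U (U \<inter> W) (s U) = res (hom_sheaf V) W (U \<inter> W) (s W)"
  by (simp, blast, blast)
 let ?U = "\<Union>\<U>"
 have oU: "op ?U" using o by blast
 have sub: "!!U. U : \<U> ==> U \<subseteq> ?U" by blast
 have ext: "t = t'" if "t : sects A ?U" "t' : sects A ?U" "!!U. U : \<U> ==> res A ?U U t = res A ?U U t'" for t t'
  using that o by (intro A_locality[OF oU]) blast+
 have glue: "EX t. t : sects A ?U & (ALL U:\<U>. res A ?U U t = s U v)" if v: "v : carrier V" for v
 proof -
  have "EX! t. t : sects A ?U & (ALL U:\<U>. res A ?U U t = s U v)"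
  proof (rule A_glue1)
   fix U W assume UW: "U : \<U>" "W : \<U>"
   show "res A U (U \<inter> W) (s U v) = res A W (U \<inter> W) (s W v)"
    using fun_cong[OF cp[OF UW], of v] v by simp
  qed (use o hom_memD(2)[OF s v] in simp)
  thus ?thesis by blast
 qed
 define t where "t = (\<lambda>v\<in>carrier V. SOME t. t : sects A ?U & (ALL U:\<U>. res A ?U U t = s U v))"
 have t: "t v : sects A ?U" "!!U. U : \<U> ==> res A ?U U (t v) = s U v" if "v : carrier V" for v
  using someI_ex[OF glue[OF that]] that by (simp_all add: t_def)
 interpret AU: cring "sec A ?U" by (rule A_cring[OF oU])
 have "t : sects (hom_sheaf V) ?U"
  unfolding hom_mem
 proof (intro conjI ballI allI)
  show "t : extensional (carrier V)" by (simp add: t_def)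
 next
  fix v w assume v: "v : carrier V" "w : carrier V"
  show "t (v \<oplus>\<^sub>V w) = t v \<oplus>\<^sub>(sec A ?U) t w"
   by (rule ext) (use v t o oU sub hom_memD(3)[OF s] in \<open>simp_all add: A_res_ring\<close>)
 next
  fix c v assume v: "v : carrier V"
  show "t (c \<odot>\<^sub>V v) = \<kappa> ?U c \<otimes>\<^sub>(sec A ?U) t v"
   by (rule ext) (use v t o oU sub hom_memD(4)[OF s] in \<open>simp_all add: A_res_ring \<kappa>_res\<close>)
 next
  fix g v assume v: "g : carrier G" "v : carrier V"
  show "t (rho V g v) = act g ?U (t v)"
   by (rule ext) (use v t o oU sub hom_memD(5)[OF s] in \<open>simp_all add: act_res\<close>)
 qed (use t in simp)
 note tm = this
 have rt: "res (hom_sheaf V) ?U U t = s U" if U: "U : \<U>" for U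
  by (rule hom_eqI[OF hom_res[OF oU o[OF U] sub[OF U] tm] s[OF U]]) (use t(2) U in simp)
 show "EX! t. t : sects (hom_sheaf V) ?U & (ALL U:\<U>. res (hom_sheaf V) ?U U t = s U)"
 proof (rule ex1I[of _ t])
  fix t' assume t': "t' : sects (hom_sheaf V) ?U & (ALL U:\<U>. res (hom_sheaf V) ?U U t' = s U)"
  hence t'm: "t' : sects (hom_sheaf V) ?U" by blast
  show "t' = t"
  proof (rule hom_eqI[OF t'm tm])
   fix v assume v: "v : carrier V"
   show "t' v = t v"
   proof (rule ext[OF hom_memD(2)[OF t'm v] t(1)[OF v]])
    fix U assume U: "U : \<U>"
    have "(res (hom_sheaf V) ?U U t') v = s U v" using t' U by simp
    thus "res A ?U U (t' v) = res A ?U U (t v)" using t(2)[OF v U] v by simp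
   qed
  qed
 qed (use tm rt in blast)
qed

lemma hom_O_module: "O_module Y (hom_sheaf V)"
 unfolding O_module_def
proof (intro conjI allI impI hom_sheaf_sheaf ballI, goal_cases)
 case 1 show ?case by simp
next
 case (2 U) thus ?case by (rule hom_module)
next
 case (3 U W f f')
 thus ?case using hom_memD(2)[OF 3(2)] hom_memD(2)[OF 3(3)] by (auto simp: A_res_ring intro!: restrict_ext)
next
 case (4 U W b f)
 thus ?case using hom_memD(2)[OF 4(3)] by (auto simp: A_res_ring inc_res intro!: restrict_ext)
qed

end

end

section \<open>Ranks\<close>

text \<open>The map on stalks induced by maps \<open>h U\<close> of sections, meant for families
  that commute with restriction.\<close>

definition smap ::
 "('x, 'm, 'z1, 'w1) sheaf_data_scheme => ('x, 'n, 'z2, 'w2) sheaf_data_scheme => 'x => ('x set => 'm => 'n)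
  => ('x set \<times> 'm) set => ('x set \<times> 'n) set" where
 "smap F F' x h A = (THE B. EX U s. openin (base F) U & x : U & s : sects F U &
   A = germ F x U s & B = germ F' x U (h U s))"

lemma smap_germ:
 assumes F: "presheaf F" and F': "presheaf F'" and b: "base F = base F'"
  and cl: "!!U s. openin (base F) U ==> s : sects F U ==> h U s : sects F' U"
  and cp: "!!U W s. openin (base F) U ==> openin (base F) W ==> W \<subseteq> U ==> s : sects F U ==>
   res F' U W (h U s) = h W (res F U W s)"
  and U: "openin (base F) U" "x : U" "s : sects F U"
 shows "smap F F' x h (germ F x U s) = germ F' x U (h U s)"
 unfolding smap_def
proof (rule the_equality)
 interpret F: presheaf F by fact
 interpret F': presheaf F' by fact
 show "EX Ua sa. openin (base F) Ua & x : Ua & sa : sects F Ua & germ F x U s = germ F x Ua sa &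
   germ F' x U (h U s) = germ F' x Ua (h Ua sa)" using U by blast
 fix B assume "EX Ua sa. openin (base F) Ua & x : Ua & sa : sects F Ua & germ F x U s = germ F x Ua sa & B = germ F' x Ua (h Ua sa)"
 then obtain V t where V: "openin (base F) V" "x : V" "t : sects F V" "germ F x U s = germ F x V t" "B = germ F' x V (h V t)" by blast
 then obtain W where W: "openin (base F) W" "x : W" "W \<subseteq> U \<inter> V" "res F U W s = res F V W t"
  using F.germ_eq[OF U V(1-3)] by blast
 have "res F' U W (h U s) = res F' V W (h V t)" using W U V by (simp add: cp)
 hence "germ F' x U (h U s) = germ F' x V (h V t)"
  using W U V cl b by (subst F'.germ_eq) auto
 thus "B = germ F' x U (h U s)" using V by simp
qed

lemma (in presheaf) common_open:
 fixes n :: nat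
 assumes x: "x : points F" and A: "!!j. j < n ==> A j : stalk F x"
 shows "EX U. op U & x : U & (ALL j<n. EX s:sects F U. A j = germ F x U s)"
 using A
proof (induction n)
 case 0 show ?case using x by (intro exI[of _ "points F"]) simp
next
 case (Suc n)
 then obtain U where U: "op U" "x : U" "!!j. j < n ==> EX s:sects F U. A j = germ F x U s" by force
 obtain W t where W: "op W" "x : W" "t : sects F W" "A n = germ F x W t" using Suc.prems[of n] by (auto elim: stalkE)
 let ?D = "U \<inter> W"
 have D: "op ?D" "x : ?D" "?D \<subseteq> U" "?D \<subseteq> W" using U W by auto
 have "EX s:sects F ?D. A j = germ F x ?D s" if jn: "j < Suc n" for j
 proof (cases "j = n")
  case True thus ?thesis using W D by (intro bexI[of _ "res F W ?D t"]) (auto simp: germ_res res_closed)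
 next
  case False
  hence "j < n" using jn by simp
  from U(3)[OF this] obtain s where "s : sects F U" "A j = germ F x U s" by (rule bexE)
  thus ?thesis using U D by (intro bexI[of _ "res F U ?D s"]) (auto simp: germ_res res_closed)
 qed
 thus ?case using D by blast
qed

context ring_presheaf
begin

lemma germ_hom: "op U ==> x : U ==> germ F x U : ring_hom (sec F U) (stalk_ring F x)"
 by (rule ring_hom_memI) (simp_all add: germ_stalk germ_add germ_mult germ_one)

lemma stalk_field:
 assumes x: "x : points F" and nz: "!!U. op U ==> x : U ==> \<one>\<^sub>(sec F U) \<noteq> \<zero>\<^sub>(sec F U)"
  and unit: "!!U s. op U ==> x : U ==> s : sects F U ==> s \<noteq> \<zero>\<^sub>(sec F U) ==>
   EX D t. op D & x : D & D \<subseteq> U & t : sects F D & t \<otimes>\<^sub>(sec F D) res F U D s = \<one>\<^sub>(sec F D)"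
 shows "field (stalk_ring F x)"
proof -
 interpret S: cring "stalk_ring F x" by (rule stalk_cring[OF x])
 show ?thesis
 proof (rule S.cring_fieldI2)
  show "\<zero>\<^sub>(stalk_ring F x) \<noteq> \<one>\<^sub>(stalk_ring F x)"
  proof
   assume "\<zero>\<^sub>(stalk_ring F x) = \<one>\<^sub>(stalk_ring F x)"
   hence "germ F x (points F) \<zero>\<^sub>(sec F (points F)) = germ F x (points F) \<one>\<^sub>(sec F (points F))"
    using germ_zero[OF op_points x] germ_one[OF op_points x] by simp
   then obtain W where W: "op W" "x : W" "W \<subseteq> points F"
    "res F (points F) W \<zero>\<^sub>(sec F (points F)) = res F (points F) W \<one>\<^sub>(sec F (points F))"
    using germ_eq[OF op_points x sec_closed(4)[OF op_points] op_points x sec_closed(3)[OF op_points]] by auto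
   thus False using res_ring(3,4)[OF op_points W(1,3)] nz[OF W(1,2)] by simp
  qed
  fix a assume a: "a : carrier (stalk_ring F x)" "a \<noteq> \<zero>\<^sub>(stalk_ring F x)"
  have "a : stalk F x" using a(1) by simp
  then obtain U s where U: "op U" "x : U" "s : sects F U" "a = germ F x U s" by (rule stalkE)
  have "s \<noteq> \<zero>\<^sub>(sec F U)" using a(2) U germ_zero[OF U(1,2)] by auto
  then obtain D t where D: "op D" "x : D" "D \<subseteq> U" "t : sects F D" "t \<otimes>\<^sub>(sec F D) res F U D s = \<one>\<^sub>(sec F D)"
   using unit[OF U(1-3)] by blast
  interpret D: cring "sec F D" by (rule sec_cring[OF D(1)])
  have rs: "res F U D s : sects F D" using res_closed[OF U(1) D(1,3) U(3)] .
  have "a = germ F x D (res F U D s)" using germ_res[OF U(1) D(1-3) U(3)] U(4) by simp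
  hence "a \<otimes>\<^sub>(stalk_ring F x) germ F x D t = \<one>\<^sub>(stalk_ring F x)"
   using germ_mult[OF D(1,2) rs D(4)] D.m_comm[OF rs D(4)] D(5) germ_one[OF D(1,2)] by simp
  thus "EX b:carrier (stalk_ring F x). a \<otimes>\<^sub>(stalk_ring F x) b = \<one>\<^sub>(stalk_ring F x)"
   using germ_stalk[OF D(1,2,4)] by auto
 qed
qed

end

lemma (in domain) finprod_nonzero:
 "finite S ==> f : S \<rightarrow> carrier R - {\<zero>} ==> finprod R f S : carrier R - {\<zero>}"
proof (induction S rule: finite_induct)
 case (insert x S)
 have f: "f : S \<rightarrow> carrier R" "f x : carrier R" "f x \<noteq> \<zero>" using insert.prems by auto
 have "finprod R f S : carrier R - {\<zero>}" using insert by auto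
 thus ?case using insert f integral[of "f x" "finprod R f S"] by auto
qed simp

section \<open>The generic stalk\<close>

context galois_sheaf
begin

abbreviation (input) \<eta> where "\<eta> \<equiv> gen_point Y"
abbreviation (input) K where "K \<equiv> function_field Y"
abbreviation (input) L where "L \<equiv> stalk_ring A \<eta>"

lemmas gen = Y.gen_point(2)

lemma K_field: "field K"
 unfolding function_field_def
proof (rule Y.stalk_field[OF Y.gen_point(1)])
 fix U assume "op U" "\<eta> : U"
 then interpret domain "sec Y U" by (intro Y.dom) auto
 show "\<one>\<^sub>(sec Y U) \<noteq> \<zero>\<^sub>(sec Y U)" by simp
next
 fix U s assume U: "op U" "\<eta> : U" "s : sects Y U" "s \<noteq> \<zero>\<^sub>(sec Y U)"
 show "EX D t. op D & \<eta> : D & D \<subseteq> U & t : sects Y D & t \<otimes>\<^sub>(sec Y D) res Y U D s = \<one>\<^sub>(sec Y D)"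
  using Y.nonzero_unit[OF U(1,3,4)] gen by blast
qed

text \<open>The norm of a section is invariant, hence a rational function on \<open>Y\<close>.\<close>
lemma A_unit:
 assumes U: "op U" "U \<noteq> {}" and s: "s : sects A U" "s \<noteq> \<zero>\<^sub>(sec A U)"
 shows "EX D t. op D & D \<noteq> {} & D \<subseteq> U & t : sects A D & t \<otimes>\<^sub>(sec A D) res A U D s = \<one>\<^sub>(sec A D)"
proof -
 interpret AU: domain "sec A U" by (rule A_dom[OF U])
 let ?f = "%g. act g U s"
 define N where "N = finprod (sec A U) ?f (carrier G)"
 \<comment> \<open>The norm is \<open>s\<close> times this cofactor, so an inverse of the norm
   yields one of \<open>s\<close>.\<close>
 define Q where "Q = finprod (sec A U) ?f (carrier G - {\<one>})"
 have fc: "?f : S \<rightarrow> sects A U" if "S \<subseteq> carrier G" for S using that U s by auto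
 have "?f g \<noteq> \<zero>\<^sub>(sec A U)" if g: "g : carrier G" for g
 proof
  assume "?f g = \<zero>\<^sub>(sec A U)"
  hence "act (inv g) U (?f g) = \<zero>\<^sub>(sec A U)" using g U act_ring(4) by simp
  thus False using act_mult[of "inv g" g U s] act_one[OF U(1) s(1)] g U s by simp
 qed
 hence Nz: "N : sects A U" "N \<noteq> \<zero>\<^sub>(sec A U)"
  using AU.finprod_nonzero[of "carrier G" ?f] finite_G fc[of "carrier G"] by (auto simp: N_def)
 have Q: "Q : sects A U" unfolding Q_def by (rule AU.finprod_closed[OF fc]) blast
 have "finprod (sec A U) ?f (insert \<one> (carrier G - {\<one>})) = ?f \<one> \<otimes>\<^sub>(sec A U) Q"
  unfolding Q_def by (rule AU.finprod_insert) (use finite_G fc[of "carrier G - {\<one>}"] U s in auto)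
 moreover have "insert \<one> (carrier G - {\<one>}) = carrier G" by auto
 ultimately have NQ: "N = s \<otimes>\<^sub>(sec A U) Q" using act_one[OF U(1) s(1)] by (simp add: N_def)
 have "act h U N = N" if h: "h : carrier G" for h
 proof -
  interpret hh: ring_hom_cring "sec A U" "sec A U" "act h U" by unfold_locales (rule act_hom[OF h U(1)])
  have "act h U N = finprod (sec A U) (act h U \<circ> ?f) (carrier G)"
   unfolding N_def by (rule hh.hom_finprod[OF fc]) blast
  \<comment> \<open>Translation by \<open>h\<close> permutes the factors of the norm.\<close>
  also have "\<dots> = finprod (sec A U) (%g. ?f (h \<otimes> g)) (carrier G)"
   by (rule AU.finprod_cong') (use h U s act_mult in auto)
  also have "\<dots> = finprod (sec A U) ?f ((%g. h \<otimes> g) ` carrier G)"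
   by (rule AU.finprod_reindex[symmetric]) (use h U s in \<open>auto simp: inj_on_def\<close>)
  also have "(%g. h \<otimes> g) ` carrier G = carrier G" by (rule G.surj_const_mult[OF h])
  finally show ?thesis by (simp add: N_def)
 qed
 then obtain b where b: "b : sects Y U" "N = inc U b" using inc_surj[OF U(1) Nz(1)] by blast
 have "b \<noteq> \<zero>\<^sub>(sec Y U)" using Nz b inc_ring(4)[OF U(1)] by auto
 then obtain D t where D: "op D" "D \<noteq> {}" "D \<subseteq> U" "t : sects Y D" "t \<otimes>\<^sub>(sec Y D) res Y U D b = \<one>\<^sub>(sec Y D)"
  using Y.nonzero_unit[OF U(1) b(1)] by blast
 interpret AD: cring "sec A D" by (rule A_cring[OF D(1)])
 have rb: "res Y U D b : sects Y D" using Y.res_closed[OF U(1) D(1,3) b(1)] .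
 have rs: "res A U D s : sects A D" "res A U D Q : sects A D" "inc D t : sects A D" using U D s Q by simp_all
 have "\<one>\<^sub>(sec A D) = inc D t \<otimes>\<^sub>(sec A D) inc D (res Y U D b)"
  using inc_ring(2,3)[OF D(1)] D rb by metis
 also have "inc D (res Y U D b) = res A U D s \<otimes>\<^sub>(sec A D) res A U D Q"
  using inc_res[OF U(1) D(1,3) b(1)] A_res_ring(2)[OF U(1) D(1,3) s(1) Q] NQ b by simp
 finally have "inc D t \<otimes>\<^sub>(sec A D) res A U D Q \<otimes>\<^sub>(sec A D) res A U D s = \<one>\<^sub>(sec A D)"
  using rs by (simp add: AD.m_ac)
 thus ?thesis using D rs by (intro exI[of _ D] exI[of _ "inc D t \<otimes>\<^sub>(sec A D) res A U D Q"]) simp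
qed

lemma L_field: "field L"
proof (rule A.stalk_field, unfold base_A)
 show "\<eta> : points Y" by (rule Y.gen_point(1))
next
 fix U assume "op U" "\<eta> : U"
 then interpret domain "sec A U" by (intro A_dom) auto
 show "\<one>\<^sub>(sec A U) \<noteq> \<zero>\<^sub>(sec A U)" by simp
next
 fix U s assume U: "op U" "\<eta> : U" "s : sects A U" "s \<noteq> \<zero>\<^sub>(sec A U)"
 show "EX D t. op D & \<eta> : D & D \<subseteq> U & t : sects A D & t \<otimes>\<^sub>(sec A D) res A U D s = \<one>\<^sub>(sec A D)"
  using A_unit[OF U(1) _ U(3,4)] U(2) gen by blast
qed

lemmas A_germ_stalk = A.germ_stalk[unfolded base_A] and A_germ_eq = A.germ_eq[unfolded base_A]
 and A_germ_hom = A.germ_hom[unfolded base_A] and A_germ_add = A.germ_add[unfolded base_A]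
 and A_germ_mult = A.germ_mult[unfolded base_A] and A_germ_one = A.germ_one[unfolded base_A]
 and A_stalk_op1_germ = A.stalk_op1_germ[unfolded base_A] and A_stalk2 = A.stalk2[unfolded base_A]
 and A_stalkE = A.stalkE[unfolded base_A] and A_common_open = A.common_open[unfolded base_A]
 and A_germ_res = A.germ_res[unfolded base_A]

text \<open>Equal germs agree on a nonempty open set, where injectivity of restriction applies;
  sections can thus be compared in the generic stalk.\<close>

lemma A_germ_inj:
 assumes "op U" "\<eta> : U" "s : sects A U" "t : sects A U" "germ A \<eta> U s = germ A \<eta> U t"
 shows "s = t"
proof -
 obtain W where "op W" "\<eta> : W" "W \<subseteq> U" "res A U W s = res A U W t"
  using A_germ_eq[OF assms(1-3) assms(1,2,4)] assms(5) by auto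
 thus ?thesis using assms by (intro A_inj[of U s t W]) auto
qed

definition \<alpha> :: "'g => ('y set \<times> 'a) set => ('y set \<times> 'a) set" where "\<alpha> g = stalk_op1 A \<eta> (act g)"
definition \<kappa>L :: "'k => ('y set \<times> 'a) set" where "\<kappa>L c = germ A \<eta> (points Y) (\<kappa> (points Y) c)"
definition \<iota> :: "('y set \<times> 'b) set => ('y set \<times> 'a) set" where "\<iota> = smap Y A \<eta> inc"

lemma \<alpha>_germ: "g : carrier G ==> op U ==> \<eta> : U ==> s : sects A U ==> \<alpha> g (germ A \<eta> U s) = germ A \<eta> U (act g U s)"
 unfolding \<alpha>_def by (rule A_stalk_op1_germ) (simp_all add: act_res)

lemma \<kappa>L_germ: "op U ==> \<eta> : U ==> \<kappa>L c = germ A \<eta> U (\<kappa> U c)"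
 unfolding \<kappa>L_def using A_germ_res[of "points Y" U \<eta> "\<kappa> (points Y) c"] Y.op_sub[of U] \<kappa>_res[of "points Y" U c] by simp

lemma \<iota>_germ: "op U ==> \<eta> : U ==> b : sects Y U ==> \<iota> (germ Y \<eta> U b) = germ A \<eta> U (inc U b)"
 unfolding \<iota>_def
 by (rule smap_germ[OF Y.presheaf_axioms A.presheaf_axioms base_A[symmetric]]) (simp_all add: inc_res)

lemma \<iota>_closed: "a : stalk Y \<eta> ==> \<iota> a : stalk A \<eta>"
 by (erule Y.stalkE) (simp add: \<iota>_germ A_germ_stalk)

lemma \<iota>_inj:
 assumes "a : stalk Y \<eta>" "b : stalk Y \<eta>" "\<iota> a = \<iota> b" shows "a = b"
proof -
 obtain U s t where U: "op U" "\<eta> : U" "s : sects Y U" "t : sects Y U" "a = germ Y \<eta> U s" "b = germ Y \<eta> U t"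
  using assms(1,2) by (rule Y.stalk2)
 have "inc U s = inc U t" by (rule A_germ_inj[of U]) (use U assms(3) in \<open>simp_all add: \<iota>_germ\<close>)
 thus ?thesis using inc_inj[of U s t] U by simp
qed

text \<open>A fixed germ comes from an invariant section, because germs determine sections, and
  invariant sections are functions on \<open>Y\<close>. With \<open>\<iota>_inj\<close> and
  \<open>\<iota>_invariant\<close> this identifies the function field of \<open>Y\<close> with the
  fixed field.\<close>

lemma \<iota>_fixed:
 assumes "c : stalk A \<eta>" "!!g. g : carrier G ==> \<alpha> g c = c" shows "EX a:stalk Y \<eta>. c = \<iota> a"
proof -
 obtain U s where U: "op U" "\<eta> : U" "s : sects A U" "c = germ A \<eta> U s" using assms(1) by (rule A_stalkE)
 have "act g U s = s" if "g : carrier G" for g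
  by (rule A_germ_inj[of U]) (use U assms(2)[OF that] that in \<open>simp_all add: \<alpha>_germ\<close>)
 then obtain b where "b : sects Y U" "s = inc U b" using inc_surj[OF U(1,3)] by blast
 thus ?thesis using U by (intro bexI[of _ "germ Y \<eta> U b"]) (simp_all add: \<iota>_germ Y.germ_stalk)
qed

lemma \<iota>_invariant: "a : stalk Y \<eta> ==> g : carrier G ==> \<alpha> g (\<iota> a) = \<iota> a"
 by (erule Y.stalkE) (simp add: \<iota>_germ \<alpha>_germ inc_inv)

lemma galois_rep_stalk:
 assumes V: "representation G V" and fr: "frame class_ring V n b"
 shows "galois_rep L G V \<alpha> \<kappa>L n b"
proof -
 interpret L: field L by (rule L_field)
 have oP: "op (points Y)" "\<eta> : points Y" by (simp_all add: Y.gen_point(1))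
 have hom: "\<alpha> g : ring_hom L L" if g: "g : carrier G" for g
 proof (rule ring_hom_memI)
  have "\<alpha> g x : stalk A \<eta>" if "x : stalk A \<eta>" for x
   using that by (rule A_stalkE) (simp add: g \<alpha>_germ A_germ_stalk)
  thus "\<alpha> g x : carrier L" if "x : carrier L" for x using that by simp
  fix x y assume "x : carrier L" "y : carrier L"
  hence xy: "x : stalk A \<eta>" "y : stalk A \<eta>" by simp_all
  obtain U s t where U: "op U" "\<eta> : U" "s : sects A U" "t : sects A U" "x = germ A \<eta> U s" "y = germ A \<eta> U t"
   using xy by (rule A_stalk2)
  show "\<alpha> g (x \<otimes>\<^sub>L y) = \<alpha> g x \<otimes>\<^sub>L \<alpha> g y" "\<alpha> g (x \<oplus>\<^sub>L y) = \<alpha> g x \<oplus>\<^sub>L \<alpha> g y"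
   using U g by (simp_all add: A_germ_mult A_germ_add \<alpha>_germ act_ring)
 next
  show "\<alpha> g \<one>\<^sub>L = \<one>\<^sub>L" using oP g by (simp add: A_germ_one[OF oP] \<alpha>_germ act_ring)
 qed
 have one: "\<alpha> \<one> x = x" if "x : carrier L" for x
 proof -
  have "x : stalk A \<eta>" using that by simp
  thus ?thesis by (rule A_stalkE) (simp add: \<alpha>_germ act_one)
 qed
 have mult: "\<alpha> (g \<otimes> h) x = \<alpha> g (\<alpha> h x)" if "g : carrier G" "h : carrier G" "x : carrier L" for g h x
 proof -
  have "x : stalk A \<eta>" using that by simp
  thus ?thesis by (rule A_stalkE) (simp add: that \<alpha>_germ act_mult)
 qed
 have faith: "g = \<one>" if g: "g : carrier G" and f: "!!x. x : carrier L ==> \<alpha> g x = x" for g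
 proof (rule faithful[OF g])
  fix U s assume U: "op U" "s : sects A U"
  show "act g U s = s"
  \<comment> \<open>Over the empty set all sections coincide; elsewhere the generic germ determines
    the section.\<close>
  proof (cases "U = {}")
   case True thus ?thesis using A.sec_empty[of "act g U s" s] act_closed[OF g U] U by simp
  next
   case False
   hence e: "\<eta> : U" using gen U by blast
   show ?thesis
    by (rule A_germ_inj[OF U(1) e]) (use U e g f[of "germ A \<eta> U s"] in \<open>simp_all add: \<alpha>_germ A_germ_stalk\<close>)
  qed
 qed
 have kap: "\<kappa>L : ring_hom class_ring L"
  using ring_hom_trans[OF \<kappa>_hom[OF oP(1)] A_germ_hom[OF oP]] unfolding \<kappa>L_def[abs_def] comp_def .
 have kinv: "\<alpha> g (\<kappa>L c) = \<kappa>L c" if "g : carrier G" for g c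
  using that oP by (simp add: \<kappa>L_def \<alpha>_germ \<kappa>_inv)
 show ?thesis
  unfolding galois_rep_def galois_rep_axioms_def
  using L_field G.is_group representation_kG_module[OF G.is_group finite_G V] hom one mult faith kap kinv fr by blast
qed

context
 fixes V :: "('k, 'v, 'g) rep" and n :: nat and b :: "nat => 'v"
 assumes V: "representation G V" and fr: "frame class_ring V n b"
begin

interpretation L: galois_rep L G V \<alpha> \<kappa>L n b by (rule galois_rep_stalk[OF V fr])
interpretation E: mod_presheaf Y "hom_sheaf V"
proof (rule O_module_presheaf)
 show "sheaf_of_rings Y" using Y.integral by (simp add: integral_scheme_def scheme_def locally_ringed_space_def)
qed (rule hom_O_module[OF V])

abbreviation (input) ES where "ES \<equiv> hom_sheaf V"
abbreviation (input) ME where "ME \<equiv> stalk_module Y (hom_sheaf V) \<eta>"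

definition ev :: "'v => ('y set \<times> ('v => 'a)) set => ('y set \<times> 'a) set" where
 "ev v = smap ES A \<eta> (%U f. f v)"

lemma ev_germ: "v : carrier V ==> op U ==> \<eta> : U ==> f : sects ES U ==> ev v (germ ES \<eta> U f) = germ A \<eta> U (f v)"
 unfolding ev_def
 by (rule smap_germ[where h = "%U f. f v", OF E.presheaf_axioms A.presheaf_axioms])
  (simp_all add: base_A hom_memD(2))

text \<open>The values on a basis are finitely many germs, so they live over one open set
  \<open>U\<close>, and then so does every value. Lifts to \<open>U\<close> are unique by
  \<open>A_germ_inj\<close>, whence the laws for \<open>f\<close> pass to the lift.\<close>

lemma lift_lin_G:
 assumes f: "f : L.lin_G"
 shows "EX x:stalk ES \<eta>. ALL v:carrier V. ev v x = f v"
proof -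
 have fl: "f : L.lin" using f by (simp add: L.lin_G_def)
 have fV: "f v : stalk A \<eta>" if "v : carrier V" for v using L.lin_closed[OF fl that] by simp
 have bV: "b j : carrier V" if "j < n" for j using frame_closed[OF fr that] .
 have e: "\<eta> : points Y" by (rule Y.gen_point(1))
 have fb: "f (b j) : stalk A \<eta>" if "j < n" for j using fV[OF bV[OF that]] .
 have "EX U. op U & \<eta> : U & (ALL j<n. EX s:sects A U. f (b j) = germ A \<eta> U s)"
  by (rule A_common_open[OF e]) (rule fb)
 then obtain U where U: "op U" "\<eta> : U" "ALL j<n. EX s:sects A U. f (b j) = germ A \<eta> U s"
  by (elim exE conjE) (rule that)
 have "ALL j. EX s. j < n --> s : sects A U & f (b j) = germ A \<eta> U s" using U(3) by blast
 from choice[OF this] obtain s where s0: "ALL j. j < n --> s j : sects A U & f (b j) = germ A \<eta> U (s j)" by (rule exE)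
 have s: "s j : sects A U" "f (b j) = germ A \<eta> U (s j)" if "j < n" for j using s0 that by simp_all
 interpret AU: cring "sec A U" by (rule A_cring[OF U(1)])
 interpret h: ring_hom_cring "sec A U" L "germ A \<eta> U"
  by unfold_locales (rule A_germ_hom[OF U(1,2)])
 have ex: "EX t. t : sects A U & germ A \<eta> U t = f v" if v: "v : carrier V" for v
 proof -
  \<comment> \<open>The lift at \<open>v\<close> combines the lifted basis values with the
    coordinates of \<open>v\<close>, regarded as constants over \<open>U\<close>.\<close>
  let ?t = "%j. s j \<otimes>\<^sub>(sec A U) \<kappa> U (coords class_ring V n b v j)"
  have t: "?t : {..<n} \<rightarrow> sects A U" using s U by auto
  have "germ A \<eta> U (\<Oplus>\<^sub>(sec A U)j\<in>{..<n}. ?t j) = (\<Oplus>\<^sub>L j\<in>{..<n}. (germ A \<eta> U \<circ> ?t) j)"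
   by (rule h.hom_finsum[OF t])
  also have "\<dots> = (\<Oplus>\<^sub>L j\<in>{..<n}. f (b j) \<otimes>\<^sub>L L.dual j v)"
  proof (rule L.finsum_cong')
   have e: "(germ A \<eta> U \<circ> ?t) j = f (b j) \<otimes>\<^sub>L L.dual j v" if j: "j < n" for j
    using A_germ_mult[OF U(1,2) s(1)[OF j] \<kappa>_closed[OF U(1)], symmetric] s(2)[OF j] v
    by (simp only: comp_apply L.dual_def restrict_apply' \<kappa>L_germ[OF U(1,2)])
   show "(germ A \<eta> U \<circ> ?t) j = f (b j) \<otimes>\<^sub>L L.dual j v" if "j : {..<n}" for j using e that by simp
   have "f (b j) \<otimes>\<^sub>L L.dual j v : carrier L" if "j < n" for j
    using L.m_closed[OF L.lin_closed[OF fl bV[OF that]] L.lin_closed[OF L.dual_lin[OF that] v]] .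
   thus "(%j. f (b j) \<otimes>\<^sub>L L.dual j v) : {..<n} \<rightarrow> carrier L" by simp
  qed simp
  also have "\<dots> = f v" by (rule L.lin_expand[OF fl v, symmetric])
  finally show ?thesis using AU.finsum_closed[OF t] by blast
 qed
 define t where "t = (\<lambda>v\<in>carrier V. SOME t. t : sects A U & germ A \<eta> U t = f v)"
 have t: "t v : sects A U" "germ A \<eta> U (t v) = f v" if "v : carrier V" for v
  using someI_ex[OF ex[OF that]] that by (simp_all add: t_def)
 note inj = A_germ_inj[OF U(1,2)]
 have "t : sects ES U"
  unfolding hom_mem
 proof (intro conjI ballI allI)
  show "t : extensional (carrier V)" by (simp add: t_def)
 next
  fix v w assume v: "v : carrier V" "w : carrier V"
  have "f (v \<oplus>\<^sub>V w) = f v \<oplus>\<^sub>L f w" using fl v by (simp add: L.lin_def)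
  thus "t (v \<oplus>\<^sub>V w) = t v \<oplus>\<^sub>(sec A U) t w" using v t by (intro inj) simp_all
 next
  fix c v assume v: "v : carrier V"
  have "f (c \<odot>\<^sub>V v) = \<kappa>L c \<otimes>\<^sub>L f v" using fl v by (simp add: L.lin_def)
  thus "t (c \<odot>\<^sub>V v) = \<kappa> U c \<otimes>\<^sub>(sec A U) t v" using v t U by (intro inj) (simp_all add: \<kappa>L_germ[OF U(1,2)])
 next
  fix g v assume v: "g : carrier G" "v : carrier V"
  have "f (rho V g v) = \<alpha> g (f v)" using f v by (simp add: L.lin_G_def)
  moreover have "\<alpha> g (f v) = germ A \<eta> U (act g U (t v))" using \<alpha>_germ[OF v(1) U(1,2) t(1)[OF v(2)]] t(2)[OF v(2)] by simp
  ultimately show "t (rho V g v) = act g U (t v)" using v t U by (intro inj) simp_all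
 qed (use t in simp)
 thus ?thesis using U t by (intro bexI[of _ "germ ES \<eta> U t"]) (simp_all add: ev_germ E.germ_stalk)
qed

lemma ev_lin_G:
 assumes x: "x : stalk ES \<eta>" shows "(\<lambda>v\<in>carrier V. ev v x) : L.lin_G"
proof -
 obtain U f where U: "op U" "\<eta> : U" "f : sects ES U" "x = germ ES \<eta> U f"
  using x by (rule E.stalkE[unfolded hom_sheaf_simps])
 note d = hom_memD[OF U(3)]
 show ?thesis
  unfolding L.lin_G_def L.lin_def
  using U d(2) by (simp add: ev_germ d(3-5) A_germ_stalk A_germ_add A_germ_mult \<alpha>_germ \<kappa>L_germ[OF U(1,2)] L.V.act_closed Pi_def)
qed

lemma ev_closed: "x : stalk ES \<eta> ==> v : carrier V ==> ev v x : stalk A \<eta>"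
 using L.lin_closed[of "\<lambda>v\<in>carrier V. ev v x" v] ev_lin_G[of x] by (simp add: L.lin_G_def)

lemma ev_add: "x : stalk ES \<eta> ==> y : stalk ES \<eta> ==> v : carrier V ==> ev v (x \<oplus>\<^sub>ME y) = ev v x \<oplus>\<^sub>L ev v y"
proof -
 assume h: "x : stalk ES \<eta>" "y : stalk ES \<eta>" "v : carrier V"
 obtain U s t where U: "op U" "\<eta> : U" "s : sects ES U" "t : sects ES U" "x = germ ES \<eta> U s" "y = germ ES \<eta> U t"
  using h(1,2) by (rule E.mstalk2[unfolded hom_sheaf_simps(1)])
 have st: "s \<oplus>\<^sub>(sec ES U) t : sects ES U" by (rule hom_add[OF V U(1,3,4)])
 have "x \<oplus>\<^sub>ME y = germ ES \<eta> U (s \<oplus>\<^sub>(sec ES U) t)" unfolding U(5,6) by (rule E.mgerm_add) (use U in simp_all)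
 hence "ev v (x \<oplus>\<^sub>ME y) = germ A \<eta> U ((s \<oplus>\<^sub>(sec ES U) t) v)" using ev_germ[OF h(3) U(1,2) st] by simp
 thus ?thesis using U h(3) hom_memD(2)[OF U(3) h(3)] hom_memD(2)[OF U(4) h(3)] by (simp add: ev_germ A_germ_add)
qed

lemma ev_smult:
 "a : stalk Y \<eta> ==> x : stalk ES \<eta> ==> v : carrier V ==> ev v (a \<odot>\<^sub>ME x) = \<iota> a \<otimes>\<^sub>L ev v x"
proof -
 assume h: "a : stalk Y \<eta>" "x : stalk ES \<eta>" "v : carrier V"
 obtain U r r' s t where U: "op U" "\<eta> : U" "r : sects Y U" "s : sects ES U" "a = germ Y \<eta> U r" "x = germ ES \<eta> U s"
  using h(1,1,2,2) by (rule E.rstalk4[unfolded hom_sheaf_simps(1)])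
 have st: "r \<odot>\<^sub>(sec ES U) s : sects ES U" by (rule hom_smult[OF V U(1,3,4)])
 have "a \<odot>\<^sub>ME x = germ ES \<eta> U (r \<odot>\<^sub>(sec ES U) s)" unfolding U(5,6) by (rule E.mgerm_smult) (use U in simp_all)
 hence "ev v (a \<odot>\<^sub>ME x) = germ A \<eta> U ((r \<odot>\<^sub>(sec ES U) s) v)" using ev_germ[OF h(3) U(1,2) st] by simp
 thus ?thesis using U h(3) hom_memD(2)[OF U(4) h(3)] by (simp add: ev_germ A_germ_mult \<iota>_germ)
qed

text \<open>Together with \<open>ev_lin_G\<close> and \<open>lift_lin_G\<close>, this identifies the
  generic stalk of \<open>hom_sheaf V\<close> with the equivariant maps from \<open>V\<close> to
  \<open>L\<close>.\<close>

lemma ev_eqI: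
 assumes "x : stalk ES \<eta>" "y : stalk ES \<eta>" "!!v. v : carrier V ==> ev v x = ev v y" shows "x = y"
proof -
 obtain U s t where U: "op U" "\<eta> : U" "s : sects ES U" "t : sects ES U" "x = germ ES \<eta> U s" "y = germ ES \<eta> U t"
  using assms(1,2) by (rule E.mstalk2[unfolded hom_sheaf_simps(1)])
 have "s = t"
 proof (rule hom_eqI[OF U(3,4)])
  fix v assume v: "v : carrier V"
  show "s v = t v"
   by (rule A_germ_inj[OF U(1,2) hom_memD(2)[OF U(3) v] hom_memD(2)[OF U(4) v]])
    (use assms(3)[OF v] U v in \<open>simp add: ev_germ\<close>)
 qed
 thus ?thesis using U by simp
qed

text \<open>Lifts the equivariant basis from \<open>L.descent\<close> to the stalk of the sheaf. Its
  coefficients are fixed by \<open>G\<close>, hence of the form \<open>\<iota> a\<close> for unique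
  rational functions \<open>a\<close> on \<open>Y\<close>.\<close>

lemma hom_sheaf_frame: "EX \<epsilon>. frame K ME n \<epsilon>"
proof -
 have e: "\<eta> : points ES" by (simp add: Y.gen_point(1))
 interpret M: Module.module K ME unfolding function_field_def by (rule E.stalk_mod[OF e])
 obtain F where F0: "ALL j<n. F j : L.lin_G" and
  ex0: "ALL f:L.lin_G. EX! c. c : {..<n} \<rightarrow>\<^sub>E {x : carrier L. ALL g:carrier G. \<alpha> g x = x} &
   (ALL v:carrier V. f v = (\<Oplus>\<^sub>L j\<in>{..<n}. c j \<otimes>\<^sub>L F j v))"
  using L.descent by (elim exE conjE) (rule that)
 have F: "F j : L.lin_G" if "j < n" for j using F0 that by simp
 note ex = bspec[OF ex0]
 have "ALL j. EX x. j < n --> x : stalk ES \<eta> & (ALL v:carrier V. ev v x = F j v)" using lift_lin_G[OF F] by blast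
 from choice[OF this] obtain \<epsilon> where \<epsilon>0: "ALL j. j < n --> \<epsilon> j : stalk ES \<eta> & (ALL v:carrier V. ev v (\<epsilon> j) = F j v)" by (rule exE)
 have \<epsilon>: "\<epsilon> j : stalk ES \<eta>" "v : carrier V ==> ev v (\<epsilon> j) = F j v" if "j < n" for j v using \<epsilon>0 that by simp_all
 let ?X = "{x : carrier L. ALL g:carrier G. \<alpha> g x = x}"
 have KY: "carrier K = stalk Y \<eta>" by (simp add: function_field_def)
 have Fc: "F j v : carrier L" if "j < n" "v : carrier V" for j v
  using L.lin_closed[of "F j" v] F[OF that(1)] that by (simp add: L.lin_G_def)
 have evs: "ev v (\<Oplus>\<^sub>ME j\<in>{..<n}. c j \<odot>\<^sub>ME \<epsilon> j) = (\<Oplus>\<^sub>L j\<in>{..<n}. \<iota> (c j) \<otimes>\<^sub>L F j v)"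
  if c: "c : {..<n} \<rightarrow> stalk Y \<eta>" and v: "v : carrier V" for c v
 proof -
  have cm: "(%j. c j \<odot>\<^sub>ME \<epsilon> j) : {..<n} \<rightarrow> carrier ME"
  proof
   fix j assume "j : {..<n}"
   thus "c j \<odot>\<^sub>ME \<epsilon> j : carrier ME" using c \<epsilon>(1)[of j] KY by (intro M.smult_closed) auto
  qed
  have "ev v (\<Oplus>\<^sub>ME j\<in>{..<n}. c j \<odot>\<^sub>ME \<epsilon> j) = (\<Oplus>\<^sub>L j\<in>{..<n}. ev v (c j \<odot>\<^sub>ME \<epsilon> j))"
   by (rule mod_hom_finsum[OF M.abelian_group_axioms L.abelian_group_axioms _ _ cm])
    (use v in \<open>auto simp: ev_closed ev_add\<close>)
  also have "\<dots> = (\<Oplus>\<^sub>L j\<in>{..<n}. \<iota> (c j) \<otimes>\<^sub>L F j v)"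
  proof (rule L.finsum_cong')
   fix j assume j: "j : {..<n}"
   thus "ev v (c j \<odot>\<^sub>ME \<epsilon> j) = \<iota> (c j) \<otimes>\<^sub>L F j v" using ev_smult[of "c j" "\<epsilon> j" v] c v \<epsilon> by auto
  next
   show "(%j. \<iota> (c j) \<otimes>\<^sub>L F j v) : {..<n} \<rightarrow> carrier L"
   proof
    fix j assume j: "j : {..<n}"
    hence "\<iota> (c j) : carrier L" using \<iota>_closed[of "c j"] c by auto
    thus "\<iota> (c j) \<otimes>\<^sub>L F j v : carrier L" using Fc[of j v] j v by (intro L.m_closed) auto
   qed
  qed simp
  finally show ?thesis .
 qed
 have "frame K ME n \<epsilon>"
  unfolding frame_def
 proof (intro conjI ballI)
  show "\<epsilon> : {..<n} \<rightarrow> carrier ME" using \<epsilon>(1) by auto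
  fix m assume "m : carrier ME"
  hence m: "m : stalk ES \<eta>" by simp
  define f where "f = (\<lambda>v\<in>carrier V. ev v m)"
  have fv: "f v = ev v m" if "v : carrier V" for v using that by (simp add: f_def)
  have fG: "f : L.lin_G" unfolding f_def by (rule ev_lin_G[OF m])
  have char: "m = (\<Oplus>\<^sub>ME j\<in>{..<n}. c j \<odot>\<^sub>ME \<epsilon> j) \<longleftrightarrow>
    (ALL v:carrier V. f v = (\<Oplus>\<^sub>L j\<in>{..<n}. \<iota> (c j) \<otimes>\<^sub>L F j v))" if c: "c : {..<n} \<rightarrow> stalk Y \<eta>" for c
  proof
   assume "m = (\<Oplus>\<^sub>ME j\<in>{..<n}. c j \<odot>\<^sub>ME \<epsilon> j)"
   thus "ALL v:carrier V. f v = (\<Oplus>\<^sub>L j\<in>{..<n}. \<iota> (c j) \<otimes>\<^sub>L F j v)" using evs[OF c] fv by auto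
  next
   assume a: "ALL v:carrier V. f v = (\<Oplus>\<^sub>L j\<in>{..<n}. \<iota> (c j) \<otimes>\<^sub>L F j v)"
   have "(\<Oplus>\<^sub>ME j\<in>{..<n}. c j \<odot>\<^sub>ME \<epsilon> j) : carrier ME"
    by (rule M.smult_sum_closed) (use c \<epsilon>(1) KY in auto)
   thus "m = (\<Oplus>\<^sub>ME j\<in>{..<n}. c j \<odot>\<^sub>ME \<epsilon> j)"
    using m a evs[OF c] fv by (intro ev_eqI) auto
  qed
  define P where "P d \<longleftrightarrow> d : {..<n} \<rightarrow>\<^sub>E ?X & (ALL v:carrier V. f v = (\<Oplus>\<^sub>L j\<in>{..<n}. d j \<otimes>\<^sub>L F j v))" for d
  have "EX! c. P c" unfolding P_def by (rule ex[OF fG])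
  then obtain c' where Pc: "P c'" and Pu: "ALL d. P d --> d = c'" by (rule ex1E)
  have c': "c' : {..<n} \<rightarrow>\<^sub>E ?X" "ALL v:carrier V. f v = (\<Oplus>\<^sub>L j\<in>{..<n}. c' j \<otimes>\<^sub>L F j v)"
   using Pc unfolding P_def by (rule conjunct1, rule conjunct2)
  have c'u: "d = c'" if "d : {..<n} \<rightarrow>\<^sub>E ?X" "ALL v:carrier V. f v = (\<Oplus>\<^sub>L j\<in>{..<n}. d j \<otimes>\<^sub>L F j v)" for d
  proof -
   have "P d" unfolding P_def using that by (rule conjI)
   thus ?thesis using Pu by simp
  qed
  have "EX a:stalk Y \<eta>. c' j = \<iota> a" if "j < n" for j
   using c'(1) that by (intro \<iota>_fixed) (auto simp: PiE_iff)
  hence "ALL j. EX a. j < n --> a : stalk Y \<eta> & c' j = \<iota> a" by blast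
  from choice[OF this] obtain c where c0: "ALL j. j < n --> c j : stalk Y \<eta> & c' j = \<iota> (c j)" by (rule exE)
  have c: "c j : stalk Y \<eta>" "c' j = \<iota> (c j)" if "j < n" for j using c0 that by simp_all
  have sum_cong: "(\<Oplus>\<^sub>L j\<in>{..<n}. d j \<otimes>\<^sub>L F j v) = (\<Oplus>\<^sub>L j\<in>{..<n}. d' j \<otimes>\<^sub>L F j v)"
   if "!!j. j < n ==> d j = d' j" "!!j. j < n ==> d' j : carrier L" "v : carrier V" for d d' v
   by (rule L.finsum_cong') (use that Fc in \<open>auto simp del: A.stalk_carrier\<close>)
  have c'L: "c' j : carrier L" if "j < n" for j using c'(1) that by (auto simp: PiE_iff)
  show "EX! c. c : {..<n} \<rightarrow>\<^sub>E carrier K & m = (\<Oplus>\<^sub>ME j\<in>{..<n}. c j \<odot>\<^sub>ME \<epsilon> j)"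
  proof (rule ex1I[of _ "restrict c {..<n}"])
   have rc: "restrict c {..<n} : {..<n} \<rightarrow> stalk Y \<eta>" using c by auto
   have "f v = (\<Oplus>\<^sub>L j\<in>{..<n}. \<iota> (restrict c {..<n} j) \<otimes>\<^sub>L F j v)" if v: "v : carrier V" for v
    using c'(2) v sum_cong[of "%j. \<iota> (restrict c {..<n} j)" c' v] c c'L by auto
   hence "m = (\<Oplus>\<^sub>ME j\<in>{..<n}. restrict c {..<n} j \<odot>\<^sub>ME \<epsilon> j)" unfolding char[OF rc] by blast
   thus "restrict c {..<n} : {..<n} \<rightarrow>\<^sub>E carrier K & m = (\<Oplus>\<^sub>ME j\<in>{..<n}. restrict c {..<n} j \<odot>\<^sub>ME \<epsilon> j)"
    using c KY by auto
  next
   fix d assume "d : {..<n} \<rightarrow>\<^sub>E carrier K & m = (\<Oplus>\<^sub>ME j\<in>{..<n}. d j \<odot>\<^sub>ME \<epsilon> j)"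
   hence d: "d : {..<n} \<rightarrow>\<^sub>E stalk Y \<eta>" "m = (\<Oplus>\<^sub>ME j\<in>{..<n}. d j \<odot>\<^sub>ME \<epsilon> j)" using KY by auto
   have dY: "d j : stalk Y \<eta>" if "j < n" for j using d(1) that by (auto simp: PiE_iff)
   have "ALL v:carrier V. f v = (\<Oplus>\<^sub>L j\<in>{..<n}. \<iota> (d j) \<otimes>\<^sub>L F j v)"
    using char[of d] d dY by blast
   \<comment> \<open>Uniqueness in \<open>L.descent\<close> concerns extensional families, hence the
     restriction.\<close>
   hence "ALL v:carrier V. f v = (\<Oplus>\<^sub>L j\<in>{..<n}. restrict (%j. \<iota> (d j)) {..<n} j \<otimes>\<^sub>L F j v)"
    using sum_cong[of "%j. restrict (%j. \<iota> (d j)) {..<n} j" "%j. \<iota> (d j)"] \<iota>_closed[OF dY] by auto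
   moreover have "restrict (%j. \<iota> (d j)) {..<n} : {..<n} \<rightarrow>\<^sub>E ?X" using \<iota>_closed[OF dY] \<iota>_invariant[OF dY] by auto
   ultimately have "restrict (%j. \<iota> (d j)) {..<n} = c'" by (intro c'u)
   hence "\<iota> (d j) = \<iota> (c j)" if "j < n" for j using c(2)[OF that] that by (metis lessThan_iff restrict_apply')
   hence "d j = c j" if "j < n" for j using \<iota>_inj[OF dY[OF that] c(1)[OF that]] that by blast
   thus "d = restrict c {..<n}" by (intro extensionalityI[of _ "{..<n}"]) (use d in \<open>auto simp: PiE_iff\<close>)
  qed
 qed
 thus ?thesis by blast
qed

lemma hom_sheaf_rank: "has_rank Y (hom_sheaf V) n"
proof -
 have e: "\<eta> : points ES" by (simp add: Y.gen_point(1))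
 have "vectorspace K ME"
  unfolding vectorspace_def using K_field E.stalk_mod[OF e] by (simp add: function_field_def)
 then interpret S: vectorspace K ME .
 show ?thesis
  unfolding has_rank_def using hom_sheaf_frame S.frame_fin_dim S.frame_dim S.vectorspace_axioms by blast
qed

end

end

section \<open>Sheafification\<close>

text \<open>Sheafification changes nothing if the presheaf is already isomorphic to a sheaf. Of
  \<open>P\<close> only closure properties are assumed; its presheaf axioms and the compatibility of
  its operations with restriction are transported from \<open>A\<close> along the injective maps
  \<open>\<mu> U\<close>.\<close>

lemma gmod_sheafify_iso:
 fixes Y :: "('y, 'b, unit, 'w) sheaf_data_scheme" and A :: "('y, 'b, 'm, 'g) gmod_sheaf" and P :: "('y, 'b, 'n, 'g) gmod_sheaf"
 assumes Y: "ring_presheaf Y" and A: "sheaf A" and bA: "base A = base Y" and bP: "base P = base Y"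
  and A_add: "!!U s t. openin (base Y) U ==> s : sects A U ==> t : sects A U ==> s \<oplus>\<^sub>(sec A U) t : sects A U"
  and A_smult: "!!U b s. openin (base Y) U ==> b : sects Y U ==> s : sects A U ==> b \<odot>\<^sub>(sec A U) s : sects A U"
  and A_gact: "!!U g s. openin (base Y) U ==> g : carrier G ==> s : sects A U ==> gact A g U s : sects A U"
  and A_res_add: "!!U W s t. openin (base Y) U ==> openin (base Y) W ==> W \<subseteq> U ==> s : sects A U ==> t : sects A U ==>
   res A U W (s \<oplus>\<^sub>(sec A U) t) = res A U W s \<oplus>\<^sub>(sec A W) res A U W t"
  and A_res_smult: "!!U W b s. openin (base Y) U ==> openin (base Y) W ==> W \<subseteq> U ==> b : sects Y U ==> s : sects A U ==>
   res A U W (b \<odot>\<^sub>(sec A U) s) = res Y U W b \<odot>\<^sub>(sec A W) res A U W s"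
  and A_res_gact: "!!U W g s. openin (base Y) U ==> openin (base Y) W ==> W \<subseteq> U ==> g : carrier G ==> s : sects A U ==>
   res A U W (gact A g U s) = gact A g W (res A U W s)"
  and P_add: "!!U s t. openin (base Y) U ==> s : sects P U ==> t : sects P U ==> s \<oplus>\<^sub>(sec P U) t : sects P U"
  and P_smult: "!!U b s. openin (base Y) U ==> b : sects Y U ==> s : sects P U ==> b \<odot>\<^sub>(sec P U) s : sects P U"
  and P_gact: "!!U g s. openin (base Y) U ==> g : carrier G ==> s : sects P U ==> gact P g U s : sects P U"
  and P_res: "!!U W s. openin (base Y) U ==> openin (base Y) W ==> W \<subseteq> U ==> s : sects P U ==> res P U W s : sects P W"
  and \<mu>: "!!U. openin (base Y) U ==> bij_betw (\<mu> U) (sects P U) (sects A U)"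
  and \<mu>_add: "!!U s t. openin (base Y) U ==> s : sects P U ==> t : sects P U ==> \<mu> U (s \<oplus>\<^sub>(sec P U) t) = \<mu> U s \<oplus>\<^sub>(sec A U) \<mu> U t"
  and \<mu>_smult: "!!U b s. openin (base Y) U ==> b : sects Y U ==> s : sects P U ==> \<mu> U (b \<odot>\<^sub>(sec P U) s) = b \<odot>\<^sub>(sec A U) \<mu> U s"
  and \<mu>_gact: "!!U g s. openin (base Y) U ==> g : carrier G ==> s : sects P U ==> \<mu> U (gact P g U s) = gact A g U (\<mu> U s)"
  and \<mu>_res: "!!U W s. openin (base Y) U ==> openin (base Y) W ==> W \<subseteq> U ==> s : sects P U ==> \<mu> W (res P U W s) = res A U W (\<mu> U s)"
 shows "gmod_iso G Y A (gmod_sheafify Y P)"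
proof -
 interpret Y: ring_presheaf Y by fact
 interpret A: sheaf A by fact
 let ?op = "openin (base Y)"
 note A_res = A.res_closed[unfolded bA]
 have \<mu>c: "\<mu> U s : sects A U" if "?op U" "s : sects P U" for U s using bij_betwE[OF \<mu>[OF that(1)]] that(2) by blast
 have \<mu>i: "s = t" if "?op U" "s : sects P U" "t : sects P U" "\<mu> U s = \<mu> U t" for U s t
  using inj_onD[OF bij_betw_imp_inj_on[OF \<mu>[OF that(1)]] that(4,2,3)] .
 define \<psi> where "\<psi> U = the_inv_into (sects P U) (\<mu> U)" for U
 have \<psi>: "\<psi> U s : sects P U" "\<mu> U (\<psi> U s) = s" if "?op U" "s : sects A U" for U s
  using bij_betwE[OF bij_betw_the_inv_into[OF \<mu>[OF that(1)]]] f_the_inv_into_f_bij_betw[OF \<mu>[OF that(1)], of s] that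
  by (auto simp: \<psi>_def)
 have \<psi>_eq: "\<psi> U s = p" if "?op U" "s : sects A U" "p : sects P U" "\<mu> U p = s" for U s p
  by (rule \<mu>i[OF that(1) \<psi>(1)[OF that(1,2)] that(3)]) (simp add: \<psi>(2)[OF that(1,2)] that(4))
 \<comment> \<open>Each axiom is checked after applying \<mu>, where it becomes an axiom for
   \<open>A\<close>.\<close>
 have Ppre: "presheaf P"
  unfolding presheaf_def is_presheaf_def bP
 proof (intro conjI allI impI ballI)
  fix U W assume "?op U & ?op W & W \<subseteq> U"
  thus "res P U W : sects P U \<rightarrow> sects P W" by (intro funcsetI) (simp add: P_res)
 next
  fix U s assume U: "?op U" "s : sects P U"
  show "res P U U s = s"
   by (rule \<mu>i[OF U(1) P_res[OF U(1) U(1) subset_refl U(2)] U(2)])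
    (simp add: \<mu>_res U A.res_id[unfolded bA] \<mu>c)
 next
  fix U V W s assume h: "?op U & ?op V & ?op W & W \<subseteq> V & V \<subseteq> U" "s : sects P U"
  hence o: "?op U" "?op V" "?op W" "W \<subseteq> V" "V \<subseteq> U" "W \<subseteq> U" by auto
  show "res P V W (res P U V s) = res P U W s"
   by (rule \<mu>i[OF o(3)]) (simp_all add: P_res \<mu>_res o h(2) \<mu>c A.res_res[unfolded bA])
 qed
 interpret P: presheaf P by (rule Ppre)
 note germ_eq = P.germ_eq[unfolded bP]
 have P_res_add: "res P U W (s \<oplus>\<^sub>(sec P U) t) = res P U W s \<oplus>\<^sub>(sec P W) res P U W t"
  if "?op U" "?op W" "W \<subseteq> U" "s : sects P U" "t : sects P U" for U W s t
  by (rule \<mu>i[OF that(2)]) (simp_all add: that P_res P_add \<mu>_res \<mu>_add A_res_add \<mu>c)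
 have P_res_smult: "res P U W (b \<odot>\<^sub>(sec P U) s) = res Y U W b \<odot>\<^sub>(sec P W) res P U W s"
  if "?op U" "?op W" "W \<subseteq> U" "b : sects Y U" "s : sects P U" for U W b s
  by (rule \<mu>i[OF that(2)]) (simp_all add: that P_res P_smult Y.res_closed \<mu>_res \<mu>_smult A_res_smult \<mu>c)
 have P_res_gact: "res P U W (gact P g U s) = gact P g W (res P U W s)"
  if "?op U" "?op W" "W \<subseteq> U" "g : carrier G" "s : sects P U" for U W g s
  by (rule \<mu>i[OF that(2)]) (simp_all add: that P_res P_gact \<mu>_res \<mu>_gact A_res_gact \<mu>c)
 have \<psi>_add: "\<psi> U (s \<oplus>\<^sub>(sec A U) t) = \<psi> U s \<oplus>\<^sub>(sec P U) \<psi> U t" if "?op U" "s : sects A U" "t : sects A U" for U s t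
  by (rule \<psi>_eq) (simp_all add: that \<psi> A_add P_add \<mu>_add)
 have \<psi>_smult: "\<psi> U (b \<odot>\<^sub>(sec A U) s) = b \<odot>\<^sub>(sec P U) \<psi> U s" if "?op U" "b : sects Y U" "s : sects A U" for U b s
  by (rule \<psi>_eq) (simp_all add: that \<psi> A_smult P_smult \<mu>_smult)
 have \<psi>_gact: "\<psi> U (gact A g U s) = gact P g U (\<psi> U s)" if "?op U" "g : carrier G" "s : sects A U" for U g s
  by (rule \<psi>_eq) (simp_all add: that \<psi> A_gact P_gact \<mu>_gact)
 have \<psi>_res: "\<psi> W (res A U W s) = res P U W (\<psi> U s)" if "?op U" "?op W" "W \<subseteq> U" "s : sects A U" for U W s
  by (rule \<psi>_eq) (simp_all add: that \<psi> A_res P_res \<mu>_res)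
 have g_add: "germ P x U s \<oplus>\<^sub>(stalk_module Y P x) germ P x U t = germ P x U (s \<oplus>\<^sub>(sec P U) t)"
  if "?op U" "x : U" "s : sects P U" "t : sects P U" for x U s t
  using stalk_op2_germ[where f = "%U. add (sec P U)" and R = P and F = P, OF Ppre Ppre refl, unfolded bP, OF P_add P_res_add that]
  by (simp add: stalk_module_def)
 have g_smult: "germ Y x U b \<odot>\<^sub>(stalk_module Y P x) germ P x U s = germ P x U (b \<odot>\<^sub>(sec P U) s)"
  if "?op U" "x : U" "b : sects Y U" "s : sects P U" for x U b s
  using stalk_op2_germ[where f = "%U. smult (sec P U)" and R = Y and F = P, OF Y.presheaf_axioms Ppre bP[symmetric], unfolded bP, OF P_smult P_res_smult that]
  by (simp add: stalk_module_def)
 have g_gact: "stalk_op1 P x (gact P g) (germ P x U s) = germ P x U (gact P g U s)"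
  if g: "g : carrier G" and U: "?op U" "x : U" "s : sects P U" for x g U s
  by (rule P.stalk_op1_germ[unfolded bP]) (simp_all add: g U P_gact P_res_gact)
 define \<phi> where "\<phi> U s = (\<lambda>x\<in>U. germ P x U (\<psi> U s))" for U s
 let ?Q = "gmod_sheafify Y P"
 have \<phi>_mem: "\<phi> U s : sects ?Q U" if U: "?op U" "s : sects A U" for U s
 proof -
  have "germ P x U (\<psi> U s) : stalk P x" if "x : U" for x
   by (rule P.germ_stalk[unfolded bP, OF U(1) that \<psi>(1)[OF U]])
  moreover have "EX V t. ?op V & x : V & V \<subseteq> U & t : sects P V & (ALL x':V. \<phi> U s x' = germ P x' V t)" if "x : U" for x
   using U that \<psi>(1)[OF U] by (intro exI[of _ U] exI[of _ "\<psi> U s"]) (simp add: \<phi>_def)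
  ultimately show ?thesis by (simp add: gmod_sheafify_def \<phi>_def)
 qed
 have germ_A: "EX W. ?op W & x : W & W \<subseteq> U \<inter> V & res A U W (\<mu> U s) = res A V W (\<mu> V t)"
  if h: "?op U" "?op V" "x : U" "x : V" "s : sects P U" "t : sects P V" "germ P x U s = germ P x V t" for x U V s t
 proof -
  obtain W where W: "?op W" "x : W" "W \<subseteq> U \<inter> V" "res P U W s = res P V W t"
   using germ_eq[OF h(1,3,5) h(2,4,6)] h(7) by (elim iffE) blast
  thus ?thesis using \<mu>_res[OF h(1) W(1) _ h(5)] \<mu>_res[OF h(2) W(1) _ h(6)] by (intro exI[of _ W]) auto
 qed
 have inj: "s = t" if U: "?op U" and st: "s : sects A U" "t : sects A U" and e: "\<phi> U s = \<phi> U t" for U s t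
 proof (rule A.locality[unfolded bA, OF U st])
  fix y assume y: "y : U"
  have "germ P y U (\<psi> U s) = germ P y U (\<psi> U t)" using fun_cong[OF e, of y] y by (simp add: \<phi>_def)
  from germ_A[OF U U y y \<psi>(1)[OF U st(1)] \<psi>(1)[OF U st(2)] this]
  show "EX D. ?op D & y : D & D \<subseteq> U & res A U D s = res A U D t" by (simp add: \<psi>(2)[OF U] st)
 qed
 have surj: "EX s:sects A U. \<phi> U s = q" if U: "?op U" and q: "q : sects ?Q U" for U q
 proof -
  have "ALL x. EX V t. x : U --> ?op V & x : V & V \<subseteq> U & t : sects P V & (ALL x':V. q x' = germ P x' V t)"
   using q by (simp add: gmod_sheafify_def)
  then obtain W t where "ALL x. x : U --> ?op (W x) & x : W x & W x \<subseteq> U & t x : sects P (W x) &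
    (ALL x':W x. q x' = germ P x' (W x) (t x))" unfolding choice_iff by (elim exE) (rule that)
  hence W: "?op (W x)" "x : W x" "W x \<subseteq> U" "t x : sects P (W x)" "!!x'. x' : W x ==> q x' = germ P x' (W x) (t x)"
   if "x : U" for x using that by simp_all
  have "EX s:sects A U. ALL x:U. res A U (W x) s = \<mu> (W x) (t x)"
  proof (rule A.glue_local[unfolded bA, OF U])
   fix x assume x: "x : U"
   show "?op (W x) & x : W x & W x \<subseteq> U & \<mu> (W x) (t x) : sects A (W x)" using W[OF x] \<mu>c by simp
   fix y assume y: "y : U"
   let ?I = "W x \<inter> W y"
   have I: "?op ?I" "?I \<subseteq> W x" "?I \<subseteq> W y" using W(1)[OF x] W(1)[OF y] by auto
   note m = \<mu>c[OF W(1,4)[OF x]] \<mu>c[OF W(1,4)[OF y]]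
   \<comment> \<open>Equality of germs at the points of the overlap gives agreement only near each
     point; locality of \<open>A\<close> turns this into agreement on the overlap.\<close>
   show "res A (W x) ?I (\<mu> (W x) (t x)) = res A (W y) ?I (\<mu> (W y) (t y))"
   proof (rule A.locality[unfolded bA, OF I(1) A_res[OF W(1)[OF x] I(1,2) m(1)] A_res[OF W(1)[OF y] I(1,3) m(2)]])
    fix z assume z: "z : ?I"
    have "germ P z (W x) (t x) = germ P z (W y) (t y)" using W(5)[OF x, of z] W(5)[OF y, of z] z by simp
    then obtain D where D: "?op D" "z : D" "D \<subseteq> ?I" "res A (W x) D (\<mu> (W x) (t x)) = res A (W y) D (\<mu> (W y) (t y))"
     using germ_A[OF W(1)[OF x] W(1)[OF y] _ _ W(4)[OF x] W(4)[OF y], of z] z by auto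
    thus "EX D. ?op D & z : D & D \<subseteq> ?I & res A ?I D (res A (W x) ?I (\<mu> (W x) (t x))) =
      res A ?I D (res A (W y) ?I (\<mu> (W y) (t y)))"
     using A.res_res[unfolded bA, OF W(1)[OF x] I(1) D(1,3) I(2) m(1)] A.res_res[unfolded bA, OF W(1)[OF y] I(1) D(1,3) I(3) m(2)]
     by (intro exI[of _ D]) simp
   qed
  qed
  then obtain s where s: "s : sects A U" "!!x. x : U ==> res A U (W x) s = \<mu> (W x) (t x)" by blast
  have "\<phi> U s x = q x" if x: "x : U" for x
  proof -
   have "res P U (W x) (\<psi> U s) = t x"
    using \<psi>_res[OF U W(1)[OF x] W(3)[OF x] s(1)] s(2)[OF x] \<psi>_eq[OF W(1)[OF x] _ W(4)[OF x]] \<mu>c[OF W(1,4)[OF x]] by simp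
   hence "germ P x U (\<psi> U s) = germ P x (W x) (t x)"
    using P.germ_res[unfolded bP, OF U W(1)[OF x] W(2)[OF x] W(3)[OF x] \<psi>(1)[OF U s(1)]] by simp
   thus ?thesis using W(5)[OF x W(2)[OF x]] x by (simp add: \<phi>_def)
  qed
  moreover have "q : extensional U" using q by (simp add: gmod_sheafify_def PiE_iff)
  ultimately have "\<phi> U s = q" by (intro extensionalityI[of _ U]) (simp_all add: \<phi>_def)
  thus ?thesis using s(1) by blast
 qed
 have e: "base ?Q = base Y" "!!U s t. s \<oplus>\<^sub>(sec ?Q U) t = (\<lambda>x\<in>U. s x \<oplus>\<^sub>(stalk_module Y P x) t x)"
  "!!U b s. b \<odot>\<^sub>(sec ?Q U) s = (\<lambda>x\<in>U. germ Y x U b \<odot>\<^sub>(stalk_module Y P x) s x)"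
  "!!U W s. res ?Q U W s = restrict s W" "!!g U s. gact ?Q g U s = (\<lambda>x\<in>U. stalk_op1 P x (gact P g) (s x))"
  by (simp_all add: gmod_sheafify_def)
 show ?thesis
  unfolding gmod_iso_def
 proof (intro exI[of _ \<phi>] conjI allI impI ballI)
  fix U assume U: "?op U"
  show "\<phi> U : module_hom (sec Y U) (sec A U) (sec ?Q U)"
   unfolding module_hom_def
  proof (intro CollectI conjI ballI allI impI funcsetI)
   fix s assume s: "s : sects A U"
   show "\<phi> U s : sects ?Q U" by (rule \<phi>_mem[OF U s])
  next
   fix s t assume "s : sects A U & t : sects A U"
   hence s: "s : sects A U" "t : sects A U" by auto
   show "\<phi> U (s \<oplus>\<^sub>(sec A U) t) = \<phi> U s \<oplus>\<^sub>(sec ?Q U) \<phi> U t"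
    unfolding e(2) by (rule ext) (simp add: \<phi>_def \<psi>_add[OF U s] g_add[OF U] \<psi>(1)[OF U] s)
  next
   fix b s assume "b : sects Y U & s : sects A U"
   hence s: "b : sects Y U" "s : sects A U" by auto
   show "\<phi> U (b \<odot>\<^sub>(sec A U) s) = b \<odot>\<^sub>(sec ?Q U) \<phi> U s"
    unfolding e(3) by (rule ext) (simp add: \<phi>_def \<psi>_smult[OF U s] g_smult[OF U] \<psi>(1)[OF U] s)
  qed
  show "bij_betw (\<phi> U) (sects A U) (sects ?Q U)"
   unfolding bij_betw_def using inj[OF U] surj[OF U] \<phi>_mem[OF U] by (auto simp: inj_on_def image_iff) metis
  fix g s assume s: "g : carrier G" "s : sects A U"
  show "\<phi> U (gact A g U s) = gact ?Q g U (\<phi> U s)"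
   unfolding e(5) by (rule ext) (simp add: \<phi>_def \<psi>_gact[OF U s] g_gact[OF s(1) U] \<psi>(1)[OF U] s)
 next
  fix U W s assume h: "?op U & ?op W & W \<subseteq> U" "s : sects A U"
  hence o: "?op U" "?op W" "W \<subseteq> U" by auto
  have "germ P x W (res P U W (\<psi> U s)) = germ P x U (\<psi> U s)" if "x : W" for x
   by (rule P.germ_res[unfolded bP, OF o(1,2) that o(3) \<psi>(1)[OF o(1) h(2)]])
  thus "\<phi> W (res A U W s) = res ?Q U W (\<phi> U s)"
   unfolding e(4) by (intro ext) (use o in \<open>auto simp: \<phi>_def \<psi>_res[OF o h(2)]\<close>)
 qed
qed

section \<open>Isotypic parts as tensor products\<close>

text \<open>The matrix unit keeps the coordinate of \<open>v\<close> at \<open>bas i a\<close> and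
  moves it to \<open>bas i b\<close>, and \<open>f\<close> commutes with the group algebra.\<close>

lemma (in irreps_module) E_hom_apply:
 assumes "i \<le> r" "a < dm i" "b < dm i" and f: "f : kG_hom G (V i) (rho (V i)) M act" and v: "v : carrier (V i)"
 shows "E i b a (f v) = co i v a \<odot>\<^sub>M f (bas i b)"
proof -
 have fc: "f (bas i d) : carrier M" if "d < dm i" for d
  using f bas_closed[OF assms(1) that] by (auto simp: kG_hom_def module_hom_def)
 have "E i b a (f v) = (\<Oplus>\<^sub>M d\<in>{..<dm i}. E i b a (co i v d \<odot>\<^sub>M f (bas i d)))"
  unfolding hom_expand[OF assms(1) f v] by (rule M.ga_finsum) (use fc in auto)
 also have "\<dots> = (\<Oplus>\<^sub>M d\<in>{..<dm i}. (if d = a then \<one>\<^sub>class_ring else \<zero>\<^sub>class_ring) \<odot>\<^sub>M (co i v d \<odot>\<^sub>M f (bas i b)))"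
  by (rule M.finsum_cong') (use assms fc in \<open>auto simp: M.ga_smult E_hom[OF assms(1,1-3) _ f]\<close>)
 also have "\<dots> = co i v a \<odot>\<^sub>M f (bas i b)"
  by (rule M.finsum_delta) (use assms fc in auto)
 finally show ?thesis .
qed

locale galois_irreps = galois_sheaf Y A G act inc + irreps G r V
 for Y :: "('y, 'b, 'k::alg_closed_field) kspace" and A :: "('y, 'a) ringed_space"
  and G :: "('g, 'h) monoid_scheme" (structure)
  and act :: "'g => 'y set => 'a => 'a" and inc :: "'y set => 'b => 'a"
  and r :: nat and V :: "nat => ('k, 'v, 'g) rep"
begin

lemma MI: "op U ==> irreps_module G r V (MA U) (%g. act g U)"
 unfolding irreps_module_def by (intro conjI irreps_axioms MA_kG)

definition prj :: "nat => 'y set => 'a => 'a" where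
 "prj i U = irreps_module.proj G V (MA U) (%g. act g U) i"

definition ho :: "nat => 'y set => nat => 'a => 'v => 'a" where
 "ho i U a s = irreps_module.hom_of G V (MA U) (%g. act g U) i a s"

lemma prj_closed [simp]: "op U ==> s : sects A U ==> prj i U s : sects A U"
 using irreps_module.proj_closed[OF MI, of U s i] by (simp add: prj_def)

lemma prj_add: "op U ==> s : sects A U ==> t : sects A U ==> prj i U (s \<oplus>\<^sub>(sec A U) t) = prj i U s \<oplus>\<^sub>(sec A U) prj i U t"
 using kG_module.ga_add[OF MA_kG, of U s t] by (simp add: prj_def irreps_module.proj_def[OF MI])

lemma prj_hom:
 assumes "op U" "op W" "h : kG_hom G (MA U) (%g. act g U) (MA W) (%g. act g W)" "s : sects A U"
 shows "h (prj i U s) = prj i W (h s)"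
 using kG_hom_ga[OF MA_kG[OF assms(1)] MA_kG[OF assms(2)] assms(3)] assms
 by (simp add: prj_def irreps_module.proj_def[OF MI])

lemma prj_res: "op U ==> op W ==> W \<subseteq> U ==> s : sects A U ==> prj i W (res A U W s) = res A U W (prj i U s)"
 by (rule prj_hom[symmetric]) (simp_all add: res_kG_hom)

lemma prj_mult: "op U ==> b : sects Y U ==> s : sects A U ==>
  prj i U (inc U b \<otimes>\<^sub>(sec A U) s) = inc U b \<otimes>\<^sub>(sec A U) prj i U s"
 by (rule prj_hom[symmetric]) (simp_all add: mult_kG_hom)

lemma prj_act: "op U ==> i \<le> r ==> g : carrier G ==> s : sects A U ==> prj i U (act g U s) = act g U (prj i U s)"
 using irreps_module.proj_act[OF MI, of U i g s] by (simp add: prj_def)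

lemma prj_prj: "op U ==> i \<le> r ==> j \<le> r ==> s : sects A U ==>
  prj i U (prj j U s) = (if i = j then prj i U s else \<zero>\<^sub>(sec A U))"
 using irreps_module.proj_proj[OF MI, of U i j s] by (simp add: prj_def)

lemma prj_fun: "op U ==> i \<le> r ==> f : sects (hom_sheaf (V i)) U ==> v : carrier (V i) ==> prj i U (f v) = f v"
 using irreps_module.proj_hom[OF MI _ hom_kG] by (simp add: prj_def)

lemma ho_mem: "op U ==> i \<le> r ==> a < dm i ==> s : sects A U ==> ho i U a s : sects (hom_sheaf (V i)) U"
 using irreps_module.hom_of_hom[OF MI, of U i a s]
 by (simp add: ho_def hom_sheaf_def irreps_module.hom_of_def[OF MI])

lemma ho_add:
 assumes U: "op U" and i: "i \<le> r" "a < dm i" and s: "s : sects A U" "t : sects A U"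
 shows "ho i U a (s \<oplus>\<^sub>(sec A U) t) = ho i U a s \<oplus>\<^sub>(sec (hom_sheaf (V i)) U) ho i U a t"
proof -
 interpret M: irreps_module G r V "MA U" "%g. act g U" by (rule MI[OF U])
 interpret AU: cring "sec A U" by (rule A_cring[OF U])
 have Ec: "M.E i b a m : sects A U" if "m : sects A U" for b m using M.M.ga_closed[of m] that by simp
 show ?thesis
 proof (rule hom_eqI[OF ho_mem[OF U i] hom_add[OF rep[OF i(1)] U ho_mem[OF U i s(1)] ho_mem[OF U i s(2)]]])
  show "s \<oplus>\<^sub>(sec A U) t : sects A U" using U s by simp
  fix v assume v: "v : carrier (V i)"
  have "ho i U a (s \<oplus>\<^sub>(sec A U) t) v = (\<Oplus>\<^sub>(sec A U)b\<in>{..<dm i}. \<kappa> U (co i v b) \<otimes>\<^sub>(sec A U) M.E i b a (s \<oplus>\<^sub>(sec A U) t))"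
   using v by (simp add: ho_def M.hom_of_def)
  also have "\<dots> = (\<Oplus>\<^sub>(sec A U)b\<in>{..<dm i}. \<kappa> U (co i v b) \<otimes>\<^sub>(sec A U) M.E i b a s \<oplus>\<^sub>(sec A U) \<kappa> U (co i v b) \<otimes>\<^sub>(sec A U) M.E i b a t)"
  proof (rule AU.finsum_cong')
   fix b assume "b : {..<dm i}"
   have "M.E i b a (s \<oplus>\<^sub>(sec A U) t) = M.E i b a s \<oplus>\<^sub>(sec A U) M.E i b a t" using M.M.ga_add[of s t] s by simp
   thus "\<kappa> U (co i v b) \<otimes>\<^sub>(sec A U) M.E i b a (s \<oplus>\<^sub>(sec A U) t) =
     \<kappa> U (co i v b) \<otimes>\<^sub>(sec A U) M.E i b a s \<oplus>\<^sub>(sec A U) \<kappa> U (co i v b) \<otimes>\<^sub>(sec A U) M.E i b a t"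
    using AU.r_distr[OF Ec[OF s(1)] Ec[OF s(2)] \<kappa>_closed[OF U]] by simp
  qed (use Ec s U in auto)
  also have "\<dots> = (\<Oplus>\<^sub>(sec A U)b\<in>{..<dm i}. \<kappa> U (co i v b) \<otimes>\<^sub>(sec A U) M.E i b a s) \<oplus>\<^sub>(sec A U)
    (\<Oplus>\<^sub>(sec A U)b\<in>{..<dm i}. \<kappa> U (co i v b) \<otimes>\<^sub>(sec A U) M.E i b a t)"
   by (rule AU.finsum_addf) (use Ec s U in auto)
  also have "\<dots> = (ho i U a s \<oplus>\<^sub>(sec (hom_sheaf (V i)) U) ho i U a t) v"
   using v by (simp add: ho_def M.hom_of_def)
  finally show "ho i U a (s \<oplus>\<^sub>(sec A U) t) v = (ho i U a s \<oplus>\<^sub>(sec (hom_sheaf (V i)) U) ho i U a t) v" .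
 qed
qed

text \<open>The equivariant maps recovered from an evaluated tensor \<open>b f(v)\<close> are
  multiples of \<open>f\<close> itself, by \<open>b\<close> times the coordinates of
  \<open>v\<close>; this is why \<open>nu\<close> inverts \<open>mu\<close>.\<close>

lemma ho_fun:
 assumes U: "op U" and i: "i \<le> r" "a < dm i" and b: "b : sects Y U" and f: "f : sects (hom_sheaf (V i)) U" and v: "v : carrier (V i)"
 shows "ho i U a (inc U b \<otimes>\<^sub>(sec A U) f v) = (kY U (co i v a) \<otimes>\<^sub>(sec Y U) b) \<odot>\<^sub>(sec (hom_sheaf (V i)) U) f"
proof -
 interpret M: irreps_module G r V "MA U" "%g. act g U" by (rule MI[OF U])
 interpret AU: cring "sec A U" by (rule A_cring[OF U])
 let ?s = "inc U b \<otimes>\<^sub>(sec A U) f v" and ?c = "kY U (co i v a) \<otimes>\<^sub>(sec Y U) b"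
 have fw: "f w : sects A U" if "w : carrier (V i)" for w using hom_memD(2)[OF f that] .
 have s: "?s : sects A U" using U b fw[OF v] by simp
 have c: "?c : sects Y U" using U b Y.sec_closed(2) by simp
 have cf: "?c \<odot>\<^sub>(sec (hom_sheaf (V i)) U) f : sects (hom_sheaf (V i)) U" by (rule hom_smult[OF rep[OF i(1)] U c f])
 have E: "M.E i d a ?s = inc U ?c \<otimes>\<^sub>(sec A U) f (bas i d)" if d: "d < dm i" for d
 proof -
  have "M.E i d a ?s = inc U b \<otimes>\<^sub>(sec A U) M.E i d a (f v)"
   using kG_hom_ga[OF MA_kG[OF U] MA_kG[OF U] mult_kG_hom[OF U b], of "f v" "idem i d a"] fw[OF v] by simp
  also have "M.E i d a (f v) = \<kappa> U (co i v a) \<otimes>\<^sub>(sec A U) f (bas i d)"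
   using M.E_hom_apply[OF i d hom_kG[OF f] v] by simp
  finally show ?thesis
   using U b fw[OF bas_closed[OF i(1) d]] by (simp add: inc_ring \<kappa>_def AU.m_ac)
 qed
 show ?thesis
 proof (rule hom_eqI[OF ho_mem[OF U i s] cf])
  fix w assume w: "w : carrier (V i)"
  have "ho i U a ?s w = (\<Oplus>\<^sub>(MA U)d\<in>{..<dm i}. co i w d \<odot>\<^sub>(MA U) M.E i d a ?s)"
   using w by (simp add: ho_def M.hom_of_def)
  also have "\<dots> = (\<Oplus>\<^sub>(MA U)d\<in>{..<dm i}. co i w d \<odot>\<^sub>(MA U) (?c \<odot>\<^sub>(sec (hom_sheaf (V i)) U) f) (bas i d))"
  proof (rule M.M.finsum_cong')
   fix d assume "d : {..<dm i}"
   thus "co i w d \<odot>\<^sub>(MA U) M.E i d a ?s = co i w d \<odot>\<^sub>(MA U) (?c \<odot>\<^sub>(sec (hom_sheaf (V i)) U) f) (bas i d)"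
    using E[of d] bas_closed[OF i(1), of d] by simp
  next
   show "(%d. co i w d \<odot>\<^sub>(MA U) (?c \<odot>\<^sub>(sec (hom_sheaf (V i)) U) f) (bas i d)) : {..<dm i} \<rightarrow> carrier (MA U)"
   proof
    fix d assume "d : {..<dm i}"
    hence "(?c \<odot>\<^sub>(sec (hom_sheaf (V i)) U) f) (bas i d) : carrier (MA U)"
     using hom_memD(2)[OF cf bas_closed[OF i(1)]] by (simp del: hom_sheaf_simps)
    thus "co i w d \<odot>\<^sub>(MA U) (?c \<odot>\<^sub>(sec (hom_sheaf (V i)) U) f) (bas i d) : carrier (MA U)"
     by (rule M.M.smult_closed')
   qed
  qed simp
  also have "\<dots> = (?c \<odot>\<^sub>(sec (hom_sheaf (V i)) U) f) w" by (rule M.hom_expand[OF i(1) hom_kG[OF cf] w, symmetric])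
  finally show "ho i U a ?s w = (?c \<odot>\<^sub>(sec (hom_sheaf (V i)) U) f) w" .
 qed
qed

lemma prj_eq_sum_ho: "op U ==> i \<le> r ==> s : sects A U ==> prj i U s = (\<Oplus>\<^sub>(sec A U)a\<in>{..<dm i}. ho i U a s (bas i a))"
 using irreps_module.proj_eq_sum_hom_of[OF MI, of U i s] by (simp add: prj_def ho_def)

text \<open>The presheaf whose sheafification is the tensor product in the theorem; by
  \<open>mu_bij\<close> its sections already form the isotypic part.\<close>

definition tpre :: "nat => ('y, 'b, ((('b \<times> 'v) \<Rightarrow>\<^sub>0 int) set \<times> ('v => 'a) \<Rightarrow>\<^sub>0 int) set, 'g) gmod_sheaf" where
 "tpre i = \<lparr>base = base Y,
   sec = (%U. tensor (sec Y U) (sec (rep_sheaf Y (V i)) U) (sec (trivial_gmod (hom_sheaf (V i)) :: ('y, 'b, 'v => 'a, 'g) gmod_sheaf) U)),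
   res = (%U W. tensor_map (sec Y W) (sec (rep_sheaf Y (V i)) W) (sec (trivial_gmod (hom_sheaf (V i)) :: ('y, 'b, 'v => 'a, 'g) gmod_sheaf) W)
    (res (rep_sheaf Y (V i)) U W) (res (trivial_gmod (hom_sheaf (V i)) :: ('y, 'b, 'v => 'a, 'g) gmod_sheaf) U W)),
   gact = (%g U. tensor_map (sec Y U) (sec (rep_sheaf Y (V i)) U) (sec (trivial_gmod (hom_sheaf (V i)) :: ('y, 'b, 'v => 'a, 'g) gmod_sheaf) U)
    (gact (rep_sheaf Y (V i)) g U) (gact (trivial_gmod (hom_sheaf (V i))) g U))\<rparr>"

lemma gmod_tensor_tpre:
 "gmod_tensor Y (rep_sheaf Y (V i)) (trivial_gmod (hom_sheaf (V i))) = gmod_sheafify Y (tpre i)"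
 by (simp add: gmod_tensor_def tpre_def)

text \<open>The isotypic part is cut out as the sections fixed by the projection, which makes the
  sheaf property inherited from \<open>A\<close>.\<close>

definition iso_part :: "nat => ('y, 'b, 'a, 'g) gmod_sheaf" where
 "iso_part i = \<lparr>base = base Y,
   sec = (%U. \<lparr>carrier = {s : sects A U. prj i U s = s}, mult = undefined, one = undefined,
    ring.zero = \<zero>\<^sub>(sec A U), add = add (sec A U), smult = (%b s. inc U b \<otimes>\<^sub>(sec A U) s)\<rparr>),
   res = res A, gact = act\<rparr>"

lemma iso_part_simps [simp]: "base (iso_part i) = base Y" "sects (iso_part i) U = {s : sects A U. prj i U s = s}"
 "add (sec (iso_part i) U) = add (sec A U)" "smult (sec (iso_part i) U) b s = inc U b \<otimes>\<^sub>(sec A U) s"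
 "res (iso_part i) = res A" "gact (iso_part i) = act"
 by (simp_all add: iso_part_def)

lemma iso_part_sheaf: "sheaf (iso_part i)"
proof -
 have pre: "is_presheaf (iso_part i)"
  unfolding is_presheaf_def by (auto simp: prj_res A_res_id A_res_res)
 have "is_sheaf (iso_part i)"
  unfolding is_sheaf_def
 proof (intro conjI allI impI pre)
  fix \<U> s
  assume "(ALL U:\<U>. openin (base (iso_part i)) U & s U : sects (iso_part i) U) &
   (ALL U:\<U>. ALL W:\<U>. res (iso_part i) U (U \<inter> W) (s U) = res (iso_part i) W (U \<inter> W) (s W))"
  hence o: "!!U. U : \<U> ==> op U" and s: "!!U. U : \<U> ==> s U : sects A U" "!!U. U : \<U> ==> prj i U (s U) = s U"
   and cp: "!!U W. U : \<U> ==> W : \<U> ==> res A U (U \<inter> W) (s U) = res A W (U \<inter> W) (s W)"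
   by (simp, simp, simp, simp) blast
  let ?U = "\<Union>\<U>"
  have oU: "op ?U" using o by blast
  have "EX! t. t : sects A ?U & (ALL U:\<U>. res A ?U U t = s U)" by (rule A_glue1) (use o s cp in auto)
  then obtain t where t: "t : sects A ?U" "ALL U:\<U>. res A ?U U t = s U"
   and u: "ALL t'. t' : sects A ?U & (ALL U:\<U>. res A ?U U t' = s U) --> t' = t" by (elim ex1E conjE) (rule that)
  \<comment> \<open>The projection commutes with restriction, so the projected section solves the
    same gluing problem as \<open>t\<close>.\<close>
  have "prj i ?U t = t"
  proof (rule u[rule_format], intro conjI ballI)
   show "prj i ?U t : sects A ?U" using oU t by simp
   fix U assume U: "U : \<U>"
   hence "U \<subseteq> ?U" by blast
   thus "res A ?U U (prj i ?U t) = s U" using prj_res[OF oU o[OF U] _ t(1)] t(2) s(2)[OF U] U by simp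
  qed
  thus "EX! t. t : sects (iso_part i) ?U & (ALL U:\<U>. res (iso_part i) ?U U t = s U)"
  proof (intro ex1I[of _ t] conjI)
   fix t' assume "t' : sects (iso_part i) ?U & (ALL U:\<U>. res (iso_part i) ?U U t' = s U)"
   thus "t' = t" using u[rule_format, of t'] by simp
  qed (use t in simp_all)
 qed
 thus ?thesis by (simp add: sheaf_def presheaf_def sheaf_axioms_def pre)
qed

section \<open>Operations on the iterated tensor product\<close>

context
 fixes i :: nat assumes i: "i \<le> r"
begin

interpretation Vi: Module.module class_ring "V i" by (rule V_mod[OF i])

abbreviation (input) KS where "KS U \<equiv> ksections Y U"
abbreviation (input) T1 where "T1 U \<equiv> tensor class_ring (ksections Y U) (V i)"
abbreviation (input) M1 where "M1 U \<equiv> sec (rep_sheaf Y (V i)) U"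
abbreviation (input) EE where "EE U \<equiv> sec (hom_sheaf (V i)) U"
abbreviation (input) T2 where "T2 U \<equiv> tensor (sec Y U) (sec (rep_sheaf Y (V i)) U) (sec (hom_sheaf (V i)) U)"
abbreviation (input) pure1 where "pure1 U \<equiv> tensor_product.pure class_ring (ksections Y U) (V i)"
abbreviation (input) pure2 where "pure2 U \<equiv> tensor_product.pure (sec Y U) (sec (rep_sheaf Y (V i)) U) (sec (hom_sheaf (V i)) U)"

abbreviation (input) SH where "SH U \<equiv> sects (hom_sheaf (V i)) U"
abbreviation (input) C1 where "C1 U \<equiv> carrier (tensor class_ring (ksections Y U) (V i))"
abbreviation (input) C2 where "C2 U \<equiv> carrier (tensor (sec Y U) (sec (rep_sheaf Y (V i)) U) (sec (hom_sheaf (V i)) U))"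
abbreviation (input) Vc where "Vc \<equiv> carrier (V i)"
abbreviation (input) tm where "tm W \<equiv> tensor_map class_ring (ksections Y W) (V i)"
abbreviation (input) tn where "tn W \<equiv> tensor_map (sec Y W) (sec (rep_sheaf Y (V i)) W) (sec (hom_sheaf (V i)) W)"

text \<open>With \<open>rs\<close> and \<open>gt\<close>, short names for the scalar multiplication,
  restriction and group action of \<open>rep_sheaf Y (V i)\<close>.\<close>

definition sm :: "'y set => 'b => ('b \<times> 'v \<Rightarrow>\<^sub>0 int) set => ('b \<times> 'v \<Rightarrow>\<^sub>0 int) set" where
 "sm U b = tm U (%f. b \<otimes>\<^sub>(sec Y U) f) (%v. v)"
definition rs :: "'y set => 'y set => ('b \<times> 'v \<Rightarrow>\<^sub>0 int) set => ('b \<times> 'v \<Rightarrow>\<^sub>0 int) set" where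
 "rs U W = tm W (res Y U W) (%v. v)"
definition gt :: "'g => 'y set => ('b \<times> 'v \<Rightarrow>\<^sub>0 int) set => ('b \<times> 'v \<Rightarrow>\<^sub>0 int) set" where
 "gt g U = tm U (%f. f) (rho (V i) g)"

lemma KS_simps: "carrier (KS U) = sects Y U" "add (KS U) = add (sec Y U)" "c \<odot>\<^sub>(KS U) b = kY U c \<otimes>\<^sub>(sec Y U) b"
 by (simp_all add: ksections_def kY_def)

lemma M1_simps: "carrier (M1 U) = C1 U" "add (M1 U) = add (T1 U)" "smult (M1 U) = sm U"
 by (simp_all add: rep_sheaf_def sm_def fun_eq_iff)

lemma tpre_simps: "base (tpre i) = base Y" "sec (tpre i) U = T2 U"
 "res (tpre i) U W = tn W (rs U W) (res (hom_sheaf (V i)) U W)"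
 "gact (tpre i) g U = tn U (gt g U) (%f. f)"
 by (simp_all add: tpre_def trivial_gmod_def rs_def gt_def, simp_all add: rep_sheaf_def)

lemma TP1: assumes U: "op U" shows "tensor_product class_ring (KS U) (V i)"
 by unfold_locales (use U Y.sec_closed in \<open>auto simp: KS_simps\<close>)

lemma T1_abelian: "op U ==> abelian_group (T1 U)" by (rule tensor_product.T_abelian[OF TP1])

lemma tm1:
 fixes \<alpha> :: "'b => 'b" and \<beta> :: "'v => 'v"
 assumes U: "op U" "op W"
  and \<alpha>: "!!f. f : sects Y U ==> \<alpha> f : sects Y W"
   "!!f f'. f : sects Y U ==> f' : sects Y U ==> \<alpha> (f \<oplus>\<^sub>(sec Y U) f') = \<alpha> f \<oplus>\<^sub>(sec Y W) \<alpha> f'"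
   "!!c f. f : sects Y U ==> \<alpha> (kY U c \<otimes>\<^sub>(sec Y U) f) = kY W c \<otimes>\<^sub>(sec Y W) \<alpha> f"
  and \<beta>: "!!v. v : Vc ==> \<beta> v : Vc"
   "!!v w. v : Vc ==> w : Vc ==> \<beta> (v \<oplus>\<^sub>(V i) w) = \<beta> v \<oplus>\<^sub>(V i) \<beta> w"
   "!!c v. v : Vc ==> \<beta> (c \<odot>\<^sub>(V i) v) = c \<odot>\<^sub>(V i) \<beta> v"
 shows "x : C1 U ==> tm W \<alpha> \<beta> x : C1 W" (is "PROP ?P1")
  "x : C1 U ==> y : C1 U ==> tm W \<alpha> \<beta> (x \<oplus>\<^sub>(T1 U) y) =
   tm W \<alpha> \<beta> x \<oplus>\<^sub>(T1 W) tm W \<alpha> \<beta> y" (is "PROP ?P2")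
  "f : sects Y U ==> v : Vc ==> tm W \<alpha> \<beta> (pure1 U f v) = pure1 W (\<alpha> f) (\<beta> v)" (is "PROP ?P3")
proof -
 have c: "\<alpha> : carrier (KS U) \<rightarrow> carrier (KS W)" "\<beta> : Vc \<rightarrow> Vc" using \<alpha>(1) \<beta>(1) by (auto simp: KS_simps)
 have a: "\<alpha> (m \<oplus>\<^sub>(KS U) m') = \<alpha> m \<oplus>\<^sub>(KS W) \<alpha> m'" if "m : carrier (KS U)" "m' : carrier (KS U)" for m m'
  using \<alpha>(2) that by (simp add: KS_simps)
 have b: "pure1 W (\<alpha> (c \<odot>\<^sub>(KS U) m)) (\<beta> y) = pure1 W (\<alpha> m) (\<beta> (c \<odot>\<^sub>(V i) y))"
  if "c : carrier class_ring" "m : carrier (KS U)" "y : Vc" for c m y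
  using tensor_product.pure_balanced[OF TP1[OF U(2)], of c "\<alpha> m" "\<beta> y"] \<alpha>(1,3) \<beta>(1,3) that by (simp add: KS_simps)
 note p = tensor_map_props[where \<alpha> = \<alpha> and \<beta> = \<beta> and R = class_ring and R' = class_ring and M = "KS U" and M' = "KS W" and N = "V i" and N' = "V i",
   OF TP1[OF U(1)] TP1[OF U(2)] c a \<beta>(2) b]
 show "PROP ?P1"
  using p(1) by (rule funcset_mem)
 show "PROP ?P2"
  by (rule p(2))
 show "PROP ?P3"
  using p(3)[of f v] by (simp only: KS_simps)
qed

lemma sm_props:
 assumes U: "op U" and b: "b : sects Y U"
 shows "x : C1 U ==> sm U b x : C1 U" (is "PROP ?P1")
  "x : C1 U ==> y : C1 U ==> sm U b (x \<oplus>\<^sub>(T1 U) y) = sm U b x \<oplus>\<^sub>(T1 U) sm U b y" (is "PROP ?P2")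
  "f : sects Y U ==> v : Vc ==> sm U b (pure1 U f v) = pure1 U (b \<otimes>\<^sub>(sec Y U) f) v" (is "PROP ?P3")
proof -
 interpret YU: cring "sec Y U" by (rule Y.sec_cring[OF U])
 note p = tm1[OF U U, of "%f. b \<otimes>\<^sub>(sec Y U) f" "%v. v", folded sm_def]
 show "PROP ?P1"
  by (rule p(1)) (use U b in \<open>simp_all add: YU.r_distr YU.m_lcomm\<close>)
 show "PROP ?P2"
  by (rule p(2)) (use U b in \<open>simp_all add: YU.r_distr YU.m_lcomm\<close>)
 show "PROP ?P3"
  by (rule p(3)) (use U b in \<open>simp_all add: YU.r_distr YU.m_lcomm\<close>)
qed

lemma rs_props:
 assumes U: "op U" "op W" "W \<subseteq> U"
 shows "x : C1 U ==> rs U W x : C1 W" (is "PROP ?P1")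
  "x : C1 U ==> y : C1 U ==> rs U W (x \<oplus>\<^sub>(T1 U) y) = rs U W x \<oplus>\<^sub>(T1 W) rs U W y" (is "PROP ?P2")
  "f : sects Y U ==> v : Vc ==> rs U W (pure1 U f v) = pure1 W (res Y U W f) v" (is "PROP ?P3")
proof -
 note p = tm1[OF U(1,2), of "res Y U W" "%v. v", folded rs_def]
 note s = Y.res_closed[OF U] Y.res_ring[OF U] kY_res[OF U] kY_closed[OF U(1)]
 show "PROP ?P1" by (rule p(1)) (simp_all add: s)
 show "PROP ?P2"
  by (rule p(2)) (simp_all add: s)
 show "PROP ?P3"
  by (rule p(3)) (simp_all add: s)
qed

lemma gt_props:
 assumes U: "op U" and g: "g : carrier G"
 shows "x : C1 U ==> gt g U x : C1 U" (is "PROP ?P1")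
  "x : C1 U ==> y : C1 U ==> gt g U (x \<oplus>\<^sub>(T1 U) y) = gt g U x \<oplus>\<^sub>(T1 U) gt g U y" (is "PROP ?P2")
  "f : sects Y U ==> v : Vc ==> gt g U (pure1 U f v) = pure1 U f (rho (V i) g v)" (is "PROP ?P3")
proof -
 note p = tm1[OF U U, of "%f. f" "rho (V i) g", folded gt_def]
 note s = kG_module.act_closed[OF V_kG[OF i] g] kG_module.act_add[OF V_kG[OF i] g] kG_module.act_smult[OF V_kG[OF i] g]
 show "PROP ?P1" by (rule p(1)) (simp_all add: s)
 show "PROP ?P2"
  by (rule p(2)) (simp_all add: s)
 show "PROP ?P3"
  by (rule p(3)) (simp_all add: s)
qed

lemma T1_ext:
 assumes U: "op U" and B: "abelian_group B"
  and c: "!!x. x : C1 U ==> \<mu> x : carrier B" "!!x. x : C1 U ==> \<nu> x : carrier B"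
  and a: "!!x y. x : C1 U ==> y : C1 U ==> \<mu> (x \<oplus>\<^sub>(T1 U) y) = \<mu> x \<oplus>\<^sub>B \<mu> y"
   "!!x y. x : C1 U ==> y : C1 U ==> \<nu> (x \<oplus>\<^sub>(T1 U) y) = \<nu> x \<oplus>\<^sub>B \<nu> y"
  and p: "!!b v. b : sects Y U ==> v : Vc ==> \<mu> (pure1 U b v) = \<nu> (pure1 U b v)"
  and x: "x : C1 U"
 shows "\<mu> x = \<nu> x"
proof -
 have f: "\<mu> : C1 U \<rightarrow> carrier B" "\<nu> : C1 U \<rightarrow> carrier B" using c by auto
 have p': "\<mu> (pure1 U b v) = \<nu> (pure1 U b v)" if "b : carrier (KS U)" "v : Vc" for b v
  using p that by (simp add: KS_simps)
 show ?thesis by (rule tensor_product.tensor_ext[OF TP1[OF U] B f a p' x])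
qed

lemma pure1_closed: "op U ==> b : sects Y U ==> v : Vc ==> pure1 U b v : C1 U"
 using tensor_product.pure_closed[OF TP1, of U b v] by (simp only: KS_simps)

lemma sm_sm:
 assumes U: "op U" and b: "b : sects Y U" "c : sects Y U" and x: "x : C1 U"
 shows "sm U b (sm U c x) = sm U c (sm U b x)"
proof (rule T1_ext[OF U T1_abelian[OF U] _ _ _ _ _ x, where \<mu> = "%x. sm U b (sm U c x)" and \<nu> = "%x. sm U c (sm U b x)"])
 interpret YU: cring "sec Y U" by (rule Y.sec_cring[OF U])
 fix f v assume "f : sects Y U" "v : Vc"
 thus "sm U b (sm U c (pure1 U f v)) = sm U c (sm U b (pure1 U f v))"
  using b by (simp add: sm_props[OF U] YU.m_lcomm)
qed (use b in \<open>simp_all add: sm_props[OF U]\<close>)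

lemma gt_sm:
 assumes U: "op U" and b: "b : sects Y U" and g: "g : carrier G" and x: "x : C1 U"
 shows "gt g U (sm U b x) = sm U b (gt g U x)"
proof (rule T1_ext[OF U T1_abelian[OF U] _ _ _ _ _ x, where \<mu> = "%x. gt g U (sm U b x)" and \<nu> = "%x. sm U b (gt g U x)"])
 interpret YU: cring "sec Y U" by (rule Y.sec_cring[OF U])
 fix f v assume "f : sects Y U" "v : Vc"
 thus "gt g U (sm U b (pure1 U f v)) = sm U b (gt g U (pure1 U f v))"
  using b g by (simp add: sm_props[OF U] gt_props[OF U g] kG_module.act_closed[OF V_kG[OF i]])
qed (use b in \<open>simp_all add: sm_props[OF U] gt_props[OF U g]\<close>)

lemma rs_sm:
 assumes U: "op U" "op W" "W \<subseteq> U" and b: "b : sects Y U" and x: "x : C1 U"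
 shows "rs U W (sm U b x) = sm W (res Y U W b) (rs U W x)"
proof (rule T1_ext[OF U(1) T1_abelian[OF U(2)] _ _ _ _ _ x, where \<mu> = "%x. rs U W (sm U b x)" and \<nu> = "%x. sm W (res Y U W b) (rs U W x)"])
 interpret YU: cring "sec Y U" by (rule Y.sec_cring[OF U(1)])
 note rb = Y.res_closed[OF U b]
 fix f v assume "f : sects Y U" "v : Vc"
 thus "rs U W (sm U b (pure1 U f v)) = sm W (res Y U W b) (rs U W (pure1 U f v))"
  using b by (simp add: sm_props[OF U(1)] sm_props[OF U(2) rb] rs_props[OF U] Y.res_closed[OF U] Y.res_ring[OF U])
qed (use b in \<open>simp_all add: sm_props[OF U(1)] sm_props[OF U(2) Y.res_closed[OF U b]] rs_props[OF U]\<close>)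

lemma TP2: assumes U: "op U" shows "tensor_product (sec Y U) (M1 U) (EE U)"
proof -
 interpret T: abelian_group "T1 U" by (rule T1_abelian[OF U])
 show ?thesis
  by unfold_locales
   (use U hom_add[OF rep[OF i] U] hom_smult[OF rep[OF i] U] in \<open>simp_all add: M1_simps sm_props del: hom_sheaf_simps\<close>)
qed

lemma T2_abelian: "op U ==> abelian_group (T2 U)" by (rule tensor_product.T_abelian[OF TP2])

lemma pure2_closed: "op U ==> x : C1 U ==> f : SH U ==> pure2 U x f : C2 U"
 by (rule tensor_product.pure_closed[OF TP2]) (simp_all add: M1_simps)

text \<open>The map \<sigma> records how scalars change: it is the identity for operations over one
  open set and the restriction of functions on \<open>Y\<close> for restriction maps.\<close>

lemma tm2:
 fixes \<alpha> :: "('b \<times> 'v \<Rightarrow>\<^sub>0 int) set => ('b \<times> 'v \<Rightarrow>\<^sub>0 int) set" and \<beta> :: "('v => 'a) => 'v => 'a"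
 assumes U: "op U" "op W"
  and \<sigma>: "!!b. b : sects Y U ==> \<sigma> b : sects Y W"
  and \<alpha>: "!!x. x : C1 U ==> \<alpha> x : C1 W"
   "!!x y. x : C1 U ==> y : C1 U ==> \<alpha> (x \<oplus>\<^sub>(T1 U) y) = \<alpha> x \<oplus>\<^sub>(T1 W) \<alpha> y"
   "!!b x. b : sects Y U ==> x : C1 U ==> \<alpha> (sm U b x) = sm W (\<sigma> b) (\<alpha> x)"
  and \<beta>: "!!f. f : SH U ==> \<beta> f : SH W"
   "!!f f'. f : SH U ==> f' : SH U ==> \<beta> (f \<oplus>\<^sub>(EE U) f') = \<beta> f \<oplus>\<^sub>(EE W) \<beta> f'"
   "!!b f. b : sects Y U ==> f : SH U ==> \<beta> (b \<odot>\<^sub>(EE U) f) = \<sigma> b \<odot>\<^sub>(EE W) \<beta> f"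
 shows "z : C2 U ==> tn W \<alpha> \<beta> z : C2 W" (is "PROP ?P1")
  "z : C2 U ==> z' : C2 U ==> tn W \<alpha> \<beta> (z \<oplus>\<^sub>(T2 U) z') =
   tn W \<alpha> \<beta> z \<oplus>\<^sub>(T2 W) tn W \<alpha> \<beta> z'" (is "PROP ?P2")
  "x : C1 U ==> f : SH U ==>
   tn W \<alpha> \<beta> (pure2 U x f) = pure2 W (\<alpha> x) (\<beta> f)" (is "PROP ?P3")
proof -
 have c: "\<alpha> : carrier (M1 U) \<rightarrow> carrier (M1 W)" "\<beta> : SH U \<rightarrow> carrier (EE W)"
  using \<alpha>(1) \<beta>(1) by (auto simp: M1_simps)
 have a: "\<alpha> (m \<oplus>\<^sub>(M1 U) m') = \<alpha> m \<oplus>\<^sub>(M1 W) \<alpha> m'" if "m : carrier (M1 U)" "m' : carrier (M1 U)" for m m'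
  using \<alpha>(2) that by (simp add: M1_simps)
 have b: "pure2 W (\<alpha> (c \<odot>\<^sub>(M1 U) m)) (\<beta> y) = pure2 W (\<alpha> m) (\<beta> (c \<odot>\<^sub>(EE U) y))"
  if h: "c : sects Y U" "m : carrier (M1 U)" "y : SH U" for c m y
 proof -
  have "pure2 W (\<sigma> c \<odot>\<^sub>(M1 W) \<alpha> m) (\<beta> y) = pure2 W (\<alpha> m) (\<sigma> c \<odot>\<^sub>(EE W) \<beta> y)"
   by (rule tensor_product.pure_balanced[OF TP2[OF U(2)]]) (use h \<sigma> \<alpha>(1) \<beta>(1) in \<open>auto simp: M1_simps\<close>)
  thus ?thesis using \<alpha>(3)[of c m] \<beta>(3)[of c y] h by (simp only: M1_simps)
 qed
 note p = tensor_map_props[where \<alpha> = \<alpha> and \<beta> = \<beta> and R = "sec Y U" and R' = "sec Y W" and M = "M1 U" and M' = "M1 W" and N = "EE U" and N' = "EE W",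
   OF TP2[OF U(1)] TP2[OF U(2)] c a \<beta>(2) b]
 show "PROP ?P1"
  using p(1) by (rule funcset_mem)
 show "PROP ?P2"
  by (rule p(2))
 show "PROP ?P3"
  by (rule p(3)) (simp_all add: M1_simps)
qed

lemma T2_smult:
 assumes U: "op U" and b: "b : sects Y U"
 shows "z : C2 U ==> b \<odot>\<^sub>(T2 U) z : C2 U" (is "PROP ?P1")
  "z : C2 U ==> z' : C2 U ==> b \<odot>\<^sub>(T2 U) (z \<oplus>\<^sub>(T2 U) z') = b \<odot>\<^sub>(T2 U) z \<oplus>\<^sub>(T2 U) b \<odot>\<^sub>(T2 U) z'" (is "PROP ?P2")
  "x : C1 U ==> f : SH U ==> b \<odot>\<^sub>(T2 U) pure2 U x f = pure2 U (sm U b x) f" (is "PROP ?P3")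
proof -
 have e: "smult (T2 U) b = tn U (sm U b) (%f. f)"
  by (simp add: tensor_def M1_simps)
 note p = tm2[OF U U, of "%b. b" "sm U b" "%f. f", folded e]
 note s = sm_props[OF U b] sm_sm[OF U b]
 show "PROP ?P1" by (rule p(1)) (simp_all add: s)
 show "PROP ?P2"
  by (rule p(2)) (simp_all add: s)
 show "PROP ?P3"
  by (rule p(3)) (simp_all add: s)
qed

lemma T2_gact:
 assumes U: "op U" and g: "g : carrier G"
 shows "z : C2 U ==> gact (tpre i) g U z : C2 U" (is "PROP ?P1")
  "z : C2 U ==> z' : C2 U ==>
   gact (tpre i) g U (z \<oplus>\<^sub>(T2 U) z') = gact (tpre i) g U z \<oplus>\<^sub>(T2 U) gact (tpre i) g U z'" (is "PROP ?P2")
  "x : C1 U ==> f : SH U ==> gact (tpre i) g U (pure2 U x f) = pure2 U (gt g U x) f" (is "PROP ?P3")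
proof -
 note p = tm2[OF U U, of "%b. b" "gt g U" "%f. f", folded tpre_simps(4)]
 note s = gt_props[OF U g] gt_sm[OF U _ g]
 show "PROP ?P1" by (rule p(1)) (simp_all add: s)
 show "PROP ?P2"
  by (rule p(2)) (simp_all add: s)
 show "PROP ?P3"
  by (rule p(3)) (simp_all add: s)
qed

lemma T2_res:
 assumes U: "op U" "op W" "W \<subseteq> U"
 shows "z : C2 U ==> res (tpre i) U W z : C2 W" (is "PROP ?P1")
  "z : C2 U ==> z' : C2 U ==>
   res (tpre i) U W (z \<oplus>\<^sub>(T2 U) z') = res (tpre i) U W z \<oplus>\<^sub>(T2 W) res (tpre i) U W z'" (is "PROP ?P2")
  "x : C1 U ==> f : SH U ==>
   res (tpre i) U W (pure2 U x f) = pure2 W (rs U W x) (res (hom_sheaf (V i)) U W f)" (is "PROP ?P3")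
proof -
 have mp: "mod_presheaf Y (hom_sheaf (V i))"
 proof (rule O_module_presheaf)
  show "sheaf_of_rings Y" using Y.integral by (simp add: integral_scheme_def scheme_def locally_ringed_space_def)
 qed (rule hom_O_module[OF rep[OF i]])
 note a = mod_presheaf.res_add[OF mp, unfolded hom_sheaf_simps(1), OF U]
  and m = mod_presheaf.res_smult[OF mp, unfolded hom_sheaf_simps(1), OF U]
 note s = rs_props(1,2)[OF U] rs_sm[OF U] hom_res[OF rep[OF i] U] Y.res_closed[OF U] a m
 note p = tm2[OF U(1,2), of "res Y U W" "rs U W" "res (hom_sheaf (V i)) U W", folded tpre_simps(3)]
 show "PROP ?P1"
  by (rule p(1)) (simp_all add: s del: hom_sheaf_simps)
 show "PROP ?P2"
  by (rule p(2)) (simp_all add: s del: hom_sheaf_simps)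
 show "PROP ?P3"
  by (rule p(3)) (simp_all add: s del: hom_sheaf_simps)
qed

lemma T2_ext:
 assumes U: "op U" and B: "abelian_group B"
  and c: "!!x. x : C2 U ==> \<mu> x : carrier B" "!!x. x : C2 U ==> \<nu> x : carrier B"
  and a: "!!x y. x : C2 U ==> y : C2 U ==> \<mu> (x \<oplus>\<^sub>(T2 U) y) = \<mu> x \<oplus>\<^sub>B \<mu> y"
   "!!x y. x : C2 U ==> y : C2 U ==> \<nu> (x \<oplus>\<^sub>(T2 U) y) = \<nu> x \<oplus>\<^sub>B \<nu> y"
  and p: "!!x f. x : C1 U ==> f : SH U ==> \<mu> (pure2 U x f) = \<nu> (pure2 U x f)"
  and x: "x : C2 U"
 shows "\<mu> x = \<nu> x"
proof -
 have f: "\<mu> : C2 U \<rightarrow> carrier B" "\<nu> : C2 U \<rightarrow> carrier B" using c by auto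
 have p': "\<mu> (pure2 U x f) = \<nu> (pure2 U x f)" if "x : carrier (M1 U)" "f : SH U" for x f
  using p that by (simp add: M1_simps)
 show ?thesis by (rule tensor_product.tensor_ext[OF TP2[OF U] B f a p' x])
qed

section \<open>Evaluation and its inverse\<close>

text \<open>The tensor product is iterated, so the universal property is used twice:
  \<open>m1 U f\<close> is the map taking \<open>b \<otimes> v\<close> to \<open>b f(v)\<close> for
  fixed \<open>f\<close>, and \<open>mu\<close> then lets \<open>f\<close> vary.\<close>

definition m1 :: "'y set => ('v => 'a) => ('b \<times> 'v \<Rightarrow>\<^sub>0 int) set => 'a" where
 "m1 U f = (SOME m. m : C1 U \<rightarrow> carrier (sec A U) &
  (ALL x:C1 U. ALL y:C1 U. m (x \<oplus>\<^sub>(T1 U) y) = m x \<oplus>\<^sub>(sec A U) m y) &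
  (ALL b:carrier (KS U). ALL v:Vc. m (pure1 U b v) = inc U b \<otimes>\<^sub>(sec A U) f v))"

definition mu :: "'y set => (('b \<times> 'v \<Rightarrow>\<^sub>0 int) set \<times> ('v => 'a) \<Rightarrow>\<^sub>0 int) set => 'a" where
 "mu U = (SOME m. m : C2 U \<rightarrow> carrier (sec A U) &
  (ALL x:C2 U. ALL y:C2 U. m (x \<oplus>\<^sub>(T2 U) y) = m x \<oplus>\<^sub>(sec A U) m y) &
  (ALL x:carrier (M1 U). ALL f:SH U. m (pure2 U x f) = m1 U f x))"

text \<open>
 The map \<open>mu\<close> is \<open>(b \<otimes> v) \<otimes> f \<mapsto> b f(v)\<close>. Its inverse \<open>nu\<close> comes from the identity \<open>s = \<Sum>\<^sub>a f\<^sub>a(v\<^sub>a)\<close> on the isotypic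
 part, where \<open>v\<^sub>a\<close> runs through a basis and \<open>f\<^sub>a\<close> through the equivariant maps \<open>ho i U a s\<close>.
\<close>
definition nu :: "'y set => 'a => (('b \<times> 'v \<Rightarrow>\<^sub>0 int) set \<times> ('v => 'a) \<Rightarrow>\<^sub>0 int) set" where
 "nu U s = (\<Oplus>\<^sub>(T2 U)a\<in>{..<dm i}. pure2 U (pure1 U \<one>\<^sub>(sec Y U) (bas i a)) (ho i U a s))"

context
 fixes U :: "'y set" assumes U: "op U"
begin

interpretation AU: cring "sec A U" by (rule A_cring[OF U])
interpretation YU: cring "sec Y U" by (rule Y.sec_cring[OF U])

lemma m1_props:
 assumes f: "f : SH U"
 shows "x : C1 U ==> m1 U f x : sects A U" (is "PROP ?P1")
  "x : C1 U ==> y : C1 U ==> m1 U f (x \<oplus>\<^sub>(T1 U) y) = m1 U f x \<oplus>\<^sub>(sec A U) m1 U f y" (is "PROP ?P2")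
  "b : sects Y U ==> v : Vc ==> m1 U f (pure1 U b v) = inc U b \<otimes>\<^sub>(sec A U) f v" (is "PROP ?P3")
proof -
 note d = hom_memD[OF f]
 have "EX m. m : C1 U \<rightarrow> carrier (sec A U) &
  (ALL x:C1 U. ALL y:C1 U. m (x \<oplus>\<^sub>(T1 U) y) = m x \<oplus>\<^sub>(sec A U) m y) &
  (ALL b:carrier (KS U). ALL v:Vc. m (pure1 U b v) = inc U b \<otimes>\<^sub>(sec A U) f v)"
 proof (rule tensor_product.tensor_lift[OF TP1[OF U] AU.abelian_group_axioms])
  fix c :: 'k and b v assume h: "c : carrier class_ring" "b : carrier (KS U)" "v : Vc"
  hence b: "b : sects Y U" by (simp add: KS_simps)
  show "inc U (c \<odot>\<^sub>(KS U) b) \<otimes>\<^sub>(sec A U) f v = inc U b \<otimes>\<^sub>(sec A U) f (c \<odot>\<^sub>(V i) v)"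
   using d(2)[OF h(3)] b U by (simp add: KS_simps d(4)[OF h(3)] inc_ring \<kappa>_def AU.m_ac)
 qed (use U d(2,3) in \<open>simp_all add: KS_simps inc_ring AU.l_distr AU.r_distr\<close>)
 from someI_ex[OF this, folded m1_def]
 have m: "m1 U f : C1 U \<rightarrow> carrier (sec A U)"
  "ALL x:C1 U. ALL y:C1 U. m1 U f (x \<oplus>\<^sub>(T1 U) y) = m1 U f x \<oplus>\<^sub>(sec A U) m1 U f y"
  "ALL b:carrier (KS U). ALL v:Vc. m1 U f (pure1 U b v) = inc U b \<otimes>\<^sub>(sec A U) f v"
  by (rule conjunct1, rule conjunct2[THEN conjunct1], rule conjunct2[THEN conjunct2])
 show "PROP ?P1" using m(1) by (rule funcset_mem)
 show "PROP ?P2"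
  using m(2) by blast
 show "PROP ?P3"
  using m(3) by (simp add: KS_simps)
qed

lemma m1_sm:
 assumes "f : SH U" "b : sects Y U" "x : C1 U"
 shows "m1 U f (sm U b x) = inc U b \<otimes>\<^sub>(sec A U) m1 U f x"
proof (rule T1_ext[OF U AU.abelian_group_axioms _ _ _ _ _ assms(3), where \<mu> = "%x. m1 U f (sm U b x)" and \<nu> = "%x. inc U b \<otimes>\<^sub>(sec A U) m1 U f x"])
 fix c v assume h: "c : sects Y U" "v : Vc"
 show "m1 U f (sm U b (pure1 U c v)) = inc U b \<otimes>\<^sub>(sec A U) m1 U f (pure1 U c v)"
  using assms(2) h U hom_memD(2)[OF assms(1) h(2)] by (simp add: sm_props[OF U] m1_props[OF assms(1)] inc_ring AU.m_assoc)
qed (use assms(2) U in \<open>simp_all add: sm_props[OF U] m1_props[OF assms(1)] AU.r_distr\<close>)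

text \<open>Together with \<open>m1_sm\<close> this is the balancedness over functions on
  \<open>Y\<close> that \<open>mu\<close> needs.\<close>

lemma m1_smult:
 assumes "f : SH U" "b : sects Y U" "x : C1 U"
 shows "m1 U (b \<odot>\<^sub>(EE U) f) x = inc U b \<otimes>\<^sub>(sec A U) m1 U f x"
proof (rule T1_ext[OF U AU.abelian_group_axioms _ _ _ _ _ assms(3), where \<mu> = "m1 U (b \<odot>\<^sub>(EE U) f)" and \<nu> = "%x. inc U b \<otimes>\<^sub>(sec A U) m1 U f x"])
 note bf = hom_smult[OF rep[OF i] U assms(2,1)]
 fix c v assume h: "c : sects Y U" "v : Vc"
 show "m1 U (b \<odot>\<^sub>(EE U) f) (pure1 U c v) = inc U b \<otimes>\<^sub>(sec A U) m1 U f (pure1 U c v)"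
  using assms(2) h U hom_memD(2)[OF assms(1) h(2)] m1_props(3)[OF bf h] by (simp add: m1_props(3)[OF assms(1)] AU.m_ac)
qed (use assms(2) U in \<open>simp_all add: m1_props[OF assms(1)] m1_props[OF hom_smult[OF rep[OF i] U assms(2,1)]] AU.r_distr del: hom_sheaf_simps\<close>)

lemma m1_add:
 assumes "f : SH U" "f' : SH U" "x : C1 U"
 shows "m1 U (f \<oplus>\<^sub>(EE U) f') x = m1 U f x \<oplus>\<^sub>(sec A U) m1 U f' x"
proof (rule T1_ext[OF U AU.abelian_group_axioms _ _ _ _ _ assms(3), where \<mu> = "m1 U (f \<oplus>\<^sub>(EE U) f')" and \<nu> = "%x. m1 U f x \<oplus>\<^sub>(sec A U) m1 U f' x"])
 note bf = hom_add[OF rep[OF i] U assms(1,2)]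
 fix c v assume h: "c : sects Y U" "v : Vc"
 show "m1 U (f \<oplus>\<^sub>(EE U) f') (pure1 U c v) = m1 U f (pure1 U c v) \<oplus>\<^sub>(sec A U) m1 U f' (pure1 U c v)"
  using h U hom_memD(2)[OF assms(1) h(2)] hom_memD(2)[OF assms(2) h(2)] m1_props(3)[OF bf h]
  by (simp add: m1_props(3)[OF assms(1)] m1_props(3)[OF assms(2)] AU.r_distr)
qed (use U in \<open>simp_all add: m1_props[OF assms(1)] m1_props[OF assms(2)] m1_props[OF hom_add[OF rep[OF i] U assms(1,2)]] AU.a_ac del: hom_sheaf_simps\<close>)

lemma m1_gt:
 assumes "f : SH U" and g: "g : carrier G" and x: "x : C1 U"
 shows "m1 U f (gt g U x) = act g U (m1 U f x)"
proof (rule T1_ext[OF U AU.abelian_group_axioms _ _ _ _ _ x, where \<mu> = "%x. m1 U f (gt g U x)" and \<nu> = "%x. act g U (m1 U f x)"])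
 fix c v assume h: "c : sects Y U" "v : Vc"
 show "m1 U f (gt g U (pure1 U c v)) = act g U (m1 U f (pure1 U c v))"
  using h g U hom_memD(2)[OF assms(1) h(2)] hom_memD(5)[OF assms(1) g h(2)] rho_closed[OF i g h(2)]
  by (simp add: gt_props[OF U g] m1_props[OF assms(1)] act_ring inc_inv)
qed (use g U in \<open>simp_all add: gt_props[OF U g] m1_props[OF assms(1)] act_ring\<close>)

lemma m1_prj:
 assumes "f : SH U" and x: "x : C1 U"
 shows "prj i U (m1 U f x) = m1 U f x"
proof (rule T1_ext[OF U AU.abelian_group_axioms _ _ _ _ _ x, where \<mu> = "%x. prj i U (m1 U f x)" and \<nu> = "m1 U f"])
 fix c v assume h: "c : sects Y U" "v : Vc"
 show "prj i U (m1 U f (pure1 U c v)) = m1 U f (pure1 U c v)"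
  using h U hom_memD(2)[OF assms(1) h(2)] by (simp add: m1_props[OF assms(1)] prj_mult prj_fun[OF U i assms(1)])
qed (use U in \<open>simp_all add: m1_props[OF assms(1)] prj_add\<close>)

lemma mu_props:
 shows "z : C2 U ==> mu U z : sects A U" (is "PROP ?P1")
  "z : C2 U ==> z' : C2 U ==> mu U (z \<oplus>\<^sub>(T2 U) z') = mu U z \<oplus>\<^sub>(sec A U) mu U z'" (is "PROP ?P2")
  "x : C1 U ==> f : SH U ==> mu U (pure2 U x f) = m1 U f x" (is "PROP ?P3")
proof -
 have "EX m. m : C2 U \<rightarrow> carrier (sec A U) &
  (ALL x:C2 U. ALL y:C2 U. m (x \<oplus>\<^sub>(T2 U) y) = m x \<oplus>\<^sub>(sec A U) m y) &
  (ALL x:carrier (M1 U). ALL f:SH U. m (pure2 U x f) = m1 U f x)"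
  by (rule tensor_product.tensor_lift[where \<beta> = "%x f. m1 U f x", OF TP2[OF U] AU.abelian_group_axioms])
   (simp_all add: M1_simps m1_props m1_sm m1_smult m1_add del: hom_sheaf_simps)
 from someI_ex[OF this, folded mu_def]
 have m: "mu U : C2 U \<rightarrow> carrier (sec A U)"
  "ALL x:C2 U. ALL y:C2 U. mu U (x \<oplus>\<^sub>(T2 U) y) = mu U x \<oplus>\<^sub>(sec A U) mu U y"
  "ALL x:carrier (M1 U). ALL f:SH U. mu U (pure2 U x f) = m1 U f x"
  by (rule conjunct1, rule conjunct2[THEN conjunct1], rule conjunct2[THEN conjunct2])
 show "PROP ?P1" using m(1) by (rule funcset_mem)
 show "PROP ?P2"
  using m(2) by blast
 show "PROP ?P3"
  using m(3) by (simp add: M1_simps)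
qed

lemma mu_smult:
 assumes b: "b : sects Y U" and z: "z : C2 U"
 shows "mu U (b \<odot>\<^sub>(T2 U) z) = inc U b \<otimes>\<^sub>(sec A U) mu U z"
 by (rule T2_ext[OF U AU.abelian_group_axioms _ _ _ _ _ z, where \<mu> = "%z. mu U (b \<odot>\<^sub>(T2 U) z)" and \<nu> = "%z. inc U b \<otimes>\<^sub>(sec A U) mu U z"])
  (use b U in \<open>simp_all add: T2_smult[OF U b] mu_props m1_sm sm_props[OF U b] AU.r_distr\<close>)

lemma mu_gact:
 assumes g: "g : carrier G" and z: "z : C2 U"
 shows "mu U (gact (tpre i) g U z) = act g U (mu U z)"
 by (rule T2_ext[OF U AU.abelian_group_axioms _ _ _ _ _ z, where \<mu> = "%z. mu U (gact (tpre i) g U z)" and \<nu> = "%z. act g U (mu U z)"])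
  (use g U in \<open>simp_all add: T2_gact[OF U g] mu_props m1_gt gt_props[OF U g] act_ring\<close>)

lemma mu_prj:
 assumes z: "z : C2 U" shows "prj i U (mu U z) = mu U z"
 by (rule T2_ext[OF U AU.abelian_group_axioms _ _ _ _ _ z, where \<mu> = "%z. prj i U (mu U z)" and \<nu> = "mu U"])
  (use U in \<open>simp_all add: mu_props m1_prj prj_add\<close>)

lemma nu_term:
 "a < dm i ==> s : sects A U ==> pure2 U (pure1 U \<one>\<^sub>(sec Y U) (bas i a)) (ho i U a s) : C2 U"
 by (intro pure2_closed[OF U] pure1_closed[OF U] ho_mem[OF U i] YU.one_closed bas_closed[OF i])

lemma nu_closed: assumes "s : sects A U" shows "nu U s : C2 U"
proof -
 interpret T2: abelian_group "T2 U" by (rule T2_abelian[OF U])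
 show ?thesis unfolding nu_def by (rule T2.finsum_closed) (use nu_term assms in auto)
qed

lemma nu_add:
 assumes s: "s : sects A U" "t : sects A U" shows "nu U (s \<oplus>\<^sub>(sec A U) t) = nu U s \<oplus>\<^sub>(T2 U) nu U t"
proof -
 interpret T2: abelian_group "T2 U" by (rule T2_abelian[OF U])
 let ?p = "%a. pure1 U \<one>\<^sub>(sec Y U) (bas i a)"
 have e: "pure2 U (?p a) (ho i U a (s \<oplus>\<^sub>(sec A U) t)) = pure2 U (?p a) (ho i U a s) \<oplus>\<^sub>(T2 U) pure2 U (?p a) (ho i U a t)"
  if a: "a < dm i" for a
  unfolding ho_add[OF U i a s]
  by (rule tensor_product.pure_add_right[OF TP2[OF U] _ ho_mem[OF U i a s(1)] ho_mem[OF U i a s(2)]])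
   (use pure1_closed[OF U YU.one_closed bas_closed[OF i a]] in \<open>simp add: M1_simps\<close>)
 have "nu U (s \<oplus>\<^sub>(sec A U) t) = (\<Oplus>\<^sub>(T2 U)a\<in>{..<dm i}. pure2 U (?p a) (ho i U a s) \<oplus>\<^sub>(T2 U) pure2 U (?p a) (ho i U a t))"
  unfolding nu_def by (rule T2.finsum_cong') (use e nu_term s in auto)
 also have "\<dots> = nu U s \<oplus>\<^sub>(T2 U) nu U t"
  unfolding nu_def by (rule T2.finsum_addf) (use nu_term s in auto)
 finally show ?thesis .
qed

lemma mu_nu:
 assumes s: "s : sects A U" "prj i U s = s" shows "mu U (nu U s) = s"
proof -
 have "mu U (nu U s) = (\<Oplus>\<^sub>(sec A U)a\<in>{..<dm i}. mu U (pure2 U (pure1 U \<one>\<^sub>(sec Y U) (bas i a)) (ho i U a s)))"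
  unfolding nu_def
  by (rule mod_hom_finsum[OF T2_abelian[OF U] AU.abelian_group_axioms]) (use mu_props nu_term s in auto)
 also have "\<dots> = (\<Oplus>\<^sub>(sec A U)a\<in>{..<dm i}. ho i U a s (bas i a))"
 proof (rule AU.finsum_cong')
  have h: "ho i U a s (bas i a) : sects A U" if "a < dm i" for a
   using hom_memD(2)[OF ho_mem[OF U i that s(1)] bas_closed[OF i that]] .
  thus "(%a. ho i U a s (bas i a)) : {..<dm i} \<rightarrow> sects A U" by simp
  fix a assume "a : {..<dm i}"
  hence a: "a < dm i" by simp
  show "mu U (pure2 U (pure1 U \<one>\<^sub>(sec Y U) (bas i a)) (ho i U a s)) = ho i U a s (bas i a)"
   using mu_props(3)[OF pure1_closed[OF U YU.one_closed bas_closed[OF i a]] ho_mem[OF U i a s(1)]]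
    m1_props(3)[OF ho_mem[OF U i a s(1)] YU.one_closed bas_closed[OF i a]] inc_ring(3)[OF U] h[OF a] by simp
 qed simp
 also have "\<dots> = s" using prj_eq_sum_ho[OF U i s(1)] s(2) by simp
 finally show ?thesis .
qed

text \<open>By \<open>ho_fun\<close> the summand at \<open>a\<close> is a multiple of
  \<open>f\<close>. Its scalar moves across the outer tensor product, the constant in it then across
  the inner one, and the sum over \<open>a\<close> reassembles \<open>v\<close> from its
  coordinates.\<close>

lemma nu_mu_pure:
 assumes b: "b : sects Y U" and v: "v : Vc" and f: "f : SH U"
 shows "nu U (inc U b \<otimes>\<^sub>(sec A U) f v) = pure2 U (pure1 U b v) f"
proof -
 interpret T2: abelian_group "T2 U" by (rule T2_abelian[OF U])
 have bc: "bas i a : Vc" if "a < dm i" for a using bas_closed[OF i that] .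
 have cb: "co i v a \<odot>\<^sub>(V i) bas i a : Vc" if "a < dm i" for a using bc[OF that] by simp
 have pc: "pure2 U (pure1 U b w) f : C2 U" if "w : Vc" for w
  by (rule pure2_closed[OF U pure1_closed[OF U b that] f])
 have e: "pure2 U (pure1 U \<one>\<^sub>(sec Y U) (bas i a)) (ho i U a (inc U b \<otimes>\<^sub>(sec A U) f v)) =
   pure2 U (pure1 U b (co i v a \<odot>\<^sub>(V i) bas i a)) f" if a: "a < dm i" for a
 proof -
  let ?c = "kY U (co i v a) \<otimes>\<^sub>(sec Y U) b" and ?x = "pure1 U \<one>\<^sub>(sec Y U) (bas i a)"
  have c: "?c : sects Y U" using b U by simp
  have x: "?x : C1 U" by (rule pure1_closed[OF U YU.one_closed bc[OF a]])
  have "pure2 U ?x (?c \<odot>\<^sub>(EE U) f) = pure2 U (?c \<odot>\<^sub>(M1 U) ?x) f"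
   by (rule tensor_product.pure_balanced[OF TP2[OF U] c _ f, symmetric]) (use x in \<open>simp add: M1_simps\<close>)
  also have "?c \<odot>\<^sub>(M1 U) ?x = pure1 U ?c (bas i a)"
   using sm_props(3)[OF U c YU.one_closed bc[OF a]] c by (simp add: M1_simps)
  also have "\<dots> = pure1 U b (co i v a \<odot>\<^sub>(V i) bas i a)"
   using tensor_product.pure_balanced[OF TP1[OF U], of "co i v a" b "bas i a"] b bc[OF a] by (simp add: KS_simps)
  finally show ?thesis unfolding ho_fun[OF U i a b f v] .
 qed
 have "nu U (inc U b \<otimes>\<^sub>(sec A U) f v) = (\<Oplus>\<^sub>(T2 U)a\<in>{..<dm i}. pure2 U (pure1 U b (co i v a \<odot>\<^sub>(V i) bas i a)) f)"
  unfolding nu_def by (rule T2.finsum_cong') (use e pc[OF cb] in auto)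
 also have "\<dots> = pure2 U (pure1 U b (\<Oplus>\<^sub>(V i)a\<in>{..<dm i}. co i v a \<odot>\<^sub>(V i) bas i a)) f"
 proof (rule mod_hom_finsum[OF Vi.abelian_group_axioms T2.abelian_group_axioms, symmetric, where T = "%w. pure2 U (pure1 U b w) f"])
  fix w w' assume w: "w : Vc" "w' : Vc"
  have "pure1 U b (w \<oplus>\<^sub>(V i) w') = pure1 U b w \<oplus>\<^sub>(T1 U) pure1 U b w'"
   using tensor_product.pure_add_right[OF TP1[OF U], of b w w'] b w by (simp add: KS_simps)
  thus "pure2 U (pure1 U b (w \<oplus>\<^sub>(V i) w')) f = pure2 U (pure1 U b w) f \<oplus>\<^sub>(T2 U) pure2 U (pure1 U b w') f"
   using tensor_product.pure_add_left[OF TP2[OF U], of "pure1 U b w" "pure1 U b w'" f] f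
    pure1_closed[OF U b w(1)] pure1_closed[OF U b w(2)] by (simp add: M1_simps)
 qed (use pc cb in auto)
 also have "(\<Oplus>\<^sub>(V i)a\<in>{..<dm i}. co i v a \<odot>\<^sub>(V i) bas i a) = v" by (rule expand[OF i v, symmetric])
 finally show ?thesis .
qed

lemma nu_mu:
 assumes z: "z : C2 U" shows "nu U (mu U z) = z"
proof (rule T2_ext[OF U T2_abelian[OF U] _ _ _ _ _ z, where \<mu> = "%z. nu U (mu U z)" and \<nu> = "%z. z"])
 fix x f assume x: "x : C1 U" and f: "f : SH U"
 have "nu U (m1 U f x) = pure2 U x f"
 proof (rule T1_ext[OF U T2_abelian[OF U] _ _ _ _ _ x, where \<mu> = "%x. nu U (m1 U f x)" and \<nu> = "%x. pure2 U x f"])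
  fix x y assume "x : C1 U" "y : C1 U"
  thus "pure2 U (x \<oplus>\<^sub>(T1 U) y) f = pure2 U x f \<oplus>\<^sub>(T2 U) pure2 U y f"
   using tensor_product.pure_add_left[OF TP2[OF U], of x y f] f by (simp add: M1_simps)
 qed (use f in \<open>simp_all add: m1_props[OF f] nu_closed nu_add pure2_closed[OF U] nu_mu_pure\<close>)
 thus "nu U (mu U (pure2 U x f)) = pure2 U x f" by (simp add: mu_props(3)[OF x f])
qed (simp_all add: mu_props nu_closed nu_add)

lemma mu_bij: "bij_betw (mu U) (C2 U) {s : sects A U. prj i U s = s}"
proof (rule bij_betwI[where g = "nu U"])
 show "mu U : C2 U \<rightarrow> {s : sects A U. prj i U s = s}" using mu_props(1) mu_prj by blast
 show "nu U : {s : sects A U. prj i U s = s} \<rightarrow> C2 U" using nu_closed by blast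
qed (simp_all add: nu_mu mu_nu)

end

lemma mu_res:
 assumes U: "op U" "op W" "W \<subseteq> U" and z: "z : C2 U"
 shows "mu W (res (tpre i) U W z) = res A U W (mu U z)"
proof (rule T2_ext[OF U(1) ring.is_abelian_group[OF cring.axioms(1)[OF A_cring[OF U(2)]]] _ _ _ _ _ z,
   where \<mu> = "%z. mu W (res (tpre i) U W z)" and \<nu> = "%z. res A U W (mu U z)"])
 fix x f assume x: "x : C1 U" and f: "f : SH U"
 note rf = hom_res[OF rep[OF i] U f]
 have "m1 W (res (hom_sheaf (V i)) U W f) (rs U W x) = res A U W (m1 U f x)"
 proof (rule T1_ext[OF U(1) ring.is_abelian_group[OF cring.axioms(1)[OF A_cring[OF U(2)]]] _ _ _ _ _ x,
   where \<mu> = "%x. m1 W (res (hom_sheaf (V i)) U W f) (rs U W x)" and \<nu> = "%x. res A U W (m1 U f x)"])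
  fix b v assume h: "b : sects Y U" "v : Vc"
  show "m1 W (res (hom_sheaf (V i)) U W f) (rs U W (pure1 U b v)) = res A U W (m1 U f (pure1 U b v))"
   using m1_props(3)[OF U(2) rf Y.res_closed[OF U h(1)] h(2)] m1_props(3)[OF U(1) f h] rs_props(3)[OF U h] U h hom_memD(2)[OF f h(2)]
   by (simp add: A_res_ring inc_res)
 qed (use U in \<open>simp_all add: rs_props[OF U] m1_props[OF U(1) f] m1_props[OF U(2) rf] A_res_ring del: hom_sheaf_simps\<close>)
 thus "mu W (res (tpre i) U W (pure2 U x f)) = res A U W (mu U (pure2 U x f))"
  using T2_res(3)[OF U x f] mu_props(3)[OF U(1) x f] mu_props(3)[OF U(2) rs_props(1)[OF U x] rf] by simp
qed (use U in \<open>simp_all add: T2_res(1,2)[OF U] mu_props[OF U(1)] mu_props[OF U(2)] A_res_ring\<close>)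

lemma iso_part_tensor:
 "gmod_iso G Y (iso_part i) (gmod_tensor Y (rep_sheaf Y (V i)) (trivial_gmod (hom_sheaf (V i))))"
 unfolding gmod_tensor_tpre
proof (rule gmod_sheafify_iso[where \<mu> = mu, OF Y.ring_presheaf_axioms iso_part_sheaf])
 fix U assume U: "op U"
 show "bij_betw (mu U) (sects (tpre i) U) (sects (iso_part i) U)" using mu_bij[OF U] by (simp add: tpre_simps(2))
next
 fix U s t assume "op U" "s : sects (tpre i) U" "t : sects (tpre i) U"
 thus "s \<oplus>\<^sub>(sec (tpre i) U) t : sects (tpre i) U"
  using abelian_monoid.a_closed[OF abelian_group.axioms(1)[OF T2_abelian]] by (simp add: tpre_simps(2))
qed (simp_all add: tpre_simps(1,2) prj_add prj_mult prj_act[OF _ i] T2_smult(1) T2_gact(1) T2_res(1)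
   A_res_ring inc_res act_res mu_props(2) mu_smult mu_gact mu_res)

end

end

section \<open>The isotypic decomposition\<close>

context galois_irreps
begin

lemma prj_zero_act: "op U ==> s : sects A U ==> g : carrier G ==> act g U (prj 0 U s) = prj 0 U s"
 using irreps_module.proj_zero_invariant[OF MI, of U s g] by (simp add: prj_def)

lemma prj_zero_inc: "op U ==> b : sects Y U ==> prj 0 U (inc U b) = inc U b"
 using irreps_module.proj_invariant[OF MI, of U "inc U b"] by (simp add: prj_def inc_inv)

lemma sum_prj: "op U ==> s : sects A U ==> (\<Oplus>\<^sub>(sec A U)i\<in>{..r}. prj i U s) = s"
 using irreps_module.sum_proj[OF MI, of U s] by (simp add: prj_def)

lemma prj_sum:
 assumes U: "op U" and t: "!!i. i \<le> r ==> t i : sects A U" "!!i. i \<le> r ==> prj i U (t i) = t i" and j: "j \<le> r"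
 shows "prj j U (\<Oplus>\<^sub>(sec A U)i\<in>{..r}. t i) = t j"
proof -
 interpret AU: cring "sec A U" by (rule A_cring[OF U])
 have tc: "t : {..r} \<rightarrow> sects A U" using t(1) by simp
 have "prj j U (\<Oplus>\<^sub>(sec A U)i\<in>{..r}. t i) = (\<Oplus>\<^sub>(sec A U)i\<in>{..r}. prj j U (t i))"
  by (rule mod_hom_finsum[OF AU.abelian_group_axioms AU.abelian_group_axioms _ _ tc]) (use U prj_add in auto)
 also have "\<dots> = (\<Oplus>\<^sub>(sec A U)i\<in>{..r}. if j = i then t i else \<zero>\<^sub>(sec A U))"
 proof (rule AU.finsum_cong')
  fix i assume "i : {..r}"
  hence i: "i \<le> r" by simp
  have "prj j U (t i) = prj j U (prj i U (t i))" using t(2)[OF i] by simp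
  also have "\<dots> = (if j = i then t i else \<zero>\<^sub>(sec A U))"
   unfolding prj_prj[OF U j i t(1)[OF i]] using t(2)[OF i] by simp
  finally show "prj j U (t i) = (if j = i then t i else \<zero>\<^sub>(sec A U))" .
 qed (use t(1) in auto)
 also have "\<dots> = t j" by (rule AU.finsum_singleton[OF _ _ tc]) (use j in auto)
 finally show ?thesis .
qed

definition dir :: "('y, 'b, 'a, 'g) gmod_sheaf" where
 "dir = \<lparr>base = base Y, sec = (%U. with_smult (sec A U) (%b s. inc U b \<otimes>\<^sub>(sec A U) s)), res = res A, gact = act\<rparr>"

lemma dir_simps: "base dir = base Y" "sects dir U = sects A U" "add (sec dir U) = add (sec A U)"
 "b \<odot>\<^sub>(sec dir U) s = inc U b \<otimes>\<^sub>(sec A U) s" "res dir = res A" "gact dir = act"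
 by (simp_all add: dir_def)

text \<open>A section is the sum of its projections, and any family of components occurs because
  \<open>prj j\<close> picks the component \<open>j\<close> out of a sum. The \<open>Q i\<close> are
  arbitrary modules isomorphic to the isotypic parts, so tensor products do not enter here.\<close>

theorem isotypic_decomposition:
 fixes Q :: "nat => ('y, 'b, 'q, 'g) gmod_sheaf"
 assumes Q: "!!i. i : {1..r} ==> gmod_iso G Y (iso_part i) (Q i)"
 shows "gmod_iso G Y dir (gmod_sum2 (structure_gmod Y) (gmod_sum Y {1..r} Q))"
proof -
 let ?I = "{1..r}"
 define ISO where "ISO i \<phi> \<longleftrightarrow>
   (ALL U. op U -->
    \<phi> U : module_hom (sec Y U) (sec (iso_part i) U) (sec (Q i) U) & bij_betw (\<phi> U) (sects (iso_part i) U) (sects (Q i) U) &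
    (ALL g:carrier G. ALL s:sects (iso_part i) U. \<phi> U (gact (iso_part i) g U s) = gact (Q i) g U (\<phi> U s))) &
   (ALL U W. op U & op W & W \<subseteq> U -->
    (ALL s:sects (iso_part i) U. \<phi> W (res (iso_part i) U W s) = res (Q i) U W (\<phi> U s)))" for i \<phi>
 have "ALL i. EX \<phi>. i : ?I --> ISO i \<phi>" using Q unfolding gmod_iso_def ISO_def by simp
 from choice[OF this] obtain \<phi> where \<phi>: "ALL i. i : ?I --> ISO i (\<phi> i)" by (rule exE)
 have iso: "ISO i (\<phi> i)" if "i : ?I" for i using \<phi> that by simp
 have hom: "\<phi> i U : module_hom (sec Y U) (sec (iso_part i) U) (sec (Q i) U)"
  and bij: "bij_betw (\<phi> i U) (sects (iso_part i) U) (sects (Q i) U)"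
  and gac: "g : carrier G ==> s : sects (iso_part i) U ==> \<phi> i U (act g U s) = gact (Q i) g U (\<phi> i U s)"
  if "i : ?I" "op U" for i U g s
  using iso[OF that(1), unfolded ISO_def, THEN conjunct1, rule_format, OF that(2)] by simp_all
 have rsc: "\<phi> i W (res A U W s) = res (Q i) U W (\<phi> i U s)"
  if "i : ?I" "op U" "op W" "W \<subseteq> U" "s : sects (iso_part i) U" for i U W s
  using iso[OF that(1), unfolded ISO_def, THEN conjunct2, rule_format, of U W s] that by simp
 have ip: "prj i U s : sects (iso_part i) U" if "i : ?I" "op U" "s : sects A U" for i U s
  using that prj_prj[of U i i s] by simp
 have \<phi>_closed: "\<phi> i U s : sects (Q i) U" if "i : ?I" "op U" "s : sects (iso_part i) U" for i U s
  using bij_betwE[OF bij[OF that(1,2)]] that(3) by blast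
 have \<phi>_add: "\<phi> i U (s \<oplus>\<^sub>(sec A U) t) = \<phi> i U s \<oplus>\<^sub>(sec (Q i) U) \<phi> i U t"
  if "i : ?I" "op U" "s : sects (iso_part i) U" "t : sects (iso_part i) U" for i U s t
  using module_hom_add[OF hom[OF that(1,2)] that(3,4)] by simp
 have \<phi>_smult: "\<phi> i U (inc U b \<otimes>\<^sub>(sec A U) s) = b \<odot>\<^sub>(sec (Q i) U) \<phi> i U s"
  if "i : ?I" "op U" "b : sects Y U" "s : sects (iso_part i) U" for i U b s
  using module_hom_smult[OF hom[OF that(1,2)] that(3,4)] by simp
 \<comment> \<open>Inverse of \<open>inc\<close> on invariants, applied to the image of
   \<open>prj 0\<close> to land in the structure sheaf.\<close>
 define iv where "iv U = the_inv_into (sects Y U) (inc U)" for U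
 have iv_eq: "iv U (inc U b) = b" if "op U" "b : sects Y U" for U b
  unfolding iv_def by (rule the_inv_into_f_f[OF bij_betw_imp_inj_on[OF inc_bij[OF that(1)]] that(2)])
 have iv: "iv U (prj 0 U s) : sects Y U" "inc U (iv U (prj 0 U s)) = prj 0 U s" if U: "op U" and s: "s : sects A U" for U s
 proof -
  obtain b where b: "b : sects Y U" "prj 0 U s = inc U b"
   by (rule inc_surj[OF U prj_closed[OF U s] prj_zero_act[OF U s]])
  thus "iv U (prj 0 U s) : sects Y U" "inc U (iv U (prj 0 U s)) = prj 0 U s" using iv_eq[OF U b(1)] by simp_all
 qed
 have iv_eqI: "iv U s = b" if "op U" "b : sects Y U" "inc U b = s" for U s b
  using iv_eq[OF that(1,2)] that(3) by simp
 define \<Phi> where "\<Phi> U s = (iv U (prj 0 U s), \<lambda>i\<in>?I. \<phi> i U (prj i U s))" for U s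
 let ?N = "gmod_sum2 (structure_gmod Y) (gmod_sum Y ?I Q) :: ('y, 'b, 'b \<times> (nat => 'q), 'g) gmod_sheaf"
 have N: "sects ?N U = sects Y U \<times> (\<Pi>\<^sub>E i\<in>?I. sects (Q i) U)"
  "(b, q) \<oplus>\<^sub>(sec ?N U) (b', q') = (b \<oplus>\<^sub>(sec Y U) b', \<lambda>i\<in>?I. q i \<oplus>\<^sub>(sec (Q i) U) q' i)"
  "c \<odot>\<^sub>(sec ?N U) (b, q) = (c \<otimes>\<^sub>(sec Y U) b, \<lambda>i\<in>?I. c \<odot>\<^sub>(sec (Q i) U) q i)"
  "res ?N U W (b, q) = (res Y U W b, \<lambda>i\<in>?I. res (Q i) U W (q i))"
  "gact ?N g U (b, q) = (b, \<lambda>i\<in>?I. gact (Q i) g U (q i))" for U W b b' c q q' g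
  by (simp_all add: gmod_sum2_def gmod_sum_def structure_gmod_def)
 show ?thesis
  unfolding gmod_iso_def
 proof (intro exI[of _ \<Phi>] conjI allI impI ballI)
  fix U assume U: "op U"
  interpret AU: cring "sec A U" by (rule A_cring[OF U])
  have cl: "\<Phi> U s : sects ?N U" if s: "s : sects A U" for s
   unfolding N \<Phi>_def using iv(1)[OF U s] \<phi>_closed[OF _ U ip[OF _ U s]] by (intro SigmaI restrict_PiE_iff[THEN iffD2]) auto
  show "\<Phi> U : module_hom (sec Y U) (sec dir U) (sec ?N U)"
   unfolding module_hom_def
  proof (intro CollectI conjI allI impI funcsetI)
   fix s assume "s : sects dir U" thus "\<Phi> U s : sects ?N U" using cl by (simp add: dir_simps)
  next
   fix s t assume "s : sects dir U & t : sects dir U"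
   hence st: "s : sects A U" "t : sects A U" by (simp_all add: dir_simps)
   have "iv U (prj 0 U (s \<oplus>\<^sub>(sec A U) t)) = iv U (prj 0 U s) \<oplus>\<^sub>(sec Y U) iv U (prj 0 U t)"
    by (rule iv_eqI[OF U]) (simp_all add: iv[OF U] st U Y.sec_closed inc_ring prj_add)
   moreover have "\<phi> i U (prj i U (s \<oplus>\<^sub>(sec A U) t)) = \<phi> i U (prj i U s) \<oplus>\<^sub>(sec (Q i) U) \<phi> i U (prj i U t)" if "i : ?I" for i
    unfolding prj_add[OF U st] by (rule \<phi>_add[OF that U ip[OF that U st(1)] ip[OF that U st(2)]])
   ultimately show "\<Phi> U (s \<oplus>\<^sub>(sec dir U) t) = \<Phi> U s \<oplus>\<^sub>(sec ?N U) \<Phi> U t"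
    unfolding dir_simps \<Phi>_def N by (intro conjI[THEN prod.inject[THEN iffD2]] restrict_ext) simp_all
  next
   fix b s assume "b : sects Y U & s : sects dir U"
   hence bs: "b : sects Y U" "s : sects A U" by (simp_all add: dir_simps)
   have "iv U (prj 0 U (inc U b \<otimes>\<^sub>(sec A U) s)) = b \<otimes>\<^sub>(sec Y U) iv U (prj 0 U s)"
    by (rule iv_eqI[OF U]) (simp_all add: iv[OF U] bs U Y.sec_closed inc_ring prj_mult)
   moreover have "\<phi> i U (prj i U (inc U b \<otimes>\<^sub>(sec A U) s)) = b \<odot>\<^sub>(sec (Q i) U) \<phi> i U (prj i U s)" if "i : ?I" for i
    unfolding prj_mult[OF U bs] by (rule \<phi>_smult[OF that U bs(1) ip[OF that U bs(2)]])
   ultimately show "\<Phi> U (b \<odot>\<^sub>(sec dir U) s) = b \<odot>\<^sub>(sec ?N U) \<Phi> U s"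
    unfolding dir_simps \<Phi>_def N by (intro conjI[THEN prod.inject[THEN iffD2]] restrict_ext) simp_all
  qed
  have inj: "s = t" if st: "s : sects A U" "t : sects A U" and e: "\<Phi> U s = \<Phi> U t" for s t
  proof -
   have "prj i U s = prj i U t" if i: "i \<le> r" for i
   proof (cases "i = 0")
    case True
    have "iv U (prj 0 U s) = iv U (prj 0 U t)" using e by (simp add: \<Phi>_def)
    hence "inc U (iv U (prj 0 U s)) = inc U (iv U (prj 0 U t))" by simp
    thus ?thesis using True by (simp add: iv[OF U] st)
   next
    case False
    hence I: "i : ?I" using i by simp
    have "(\<lambda>i\<in>?I. \<phi> i U (prj i U s)) i = (\<lambda>i\<in>?I. \<phi> i U (prj i U t)) i" using e by (simp add: \<Phi>_def)
    hence "\<phi> i U (prj i U s) = \<phi> i U (prj i U t)" using I by simp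
    thus ?thesis by (rule inj_onD[OF bij_betw_imp_inj_on[OF bij[OF I U]]]) (rule ip[OF I U st(1)], rule ip[OF I U st(2)])
   qed
   hence "(\<Oplus>\<^sub>(sec A U)i\<in>{..r}. prj i U s) = (\<Oplus>\<^sub>(sec A U)i\<in>{..r}. prj i U t)"
    by (intro AU.finsum_cong') (use U st in auto)
   thus ?thesis by (simp add: sum_prj[OF U] st)
  qed
  have surj: "EX s:sects A U. \<Phi> U s = (b, q)" if b: "b : sects Y U" and q: "q : (\<Pi>\<^sub>E i\<in>?I. sects (Q i) U)" for b q
  proof -
   have "EX x:sects (iso_part i) U. \<phi> i U x = q i" if "i : ?I" for i
   proof -
    have "q i : \<phi> i U ` sects (iso_part i) U" using PiE_mem[OF q that] bij[OF that U] by (simp add: bij_betw_def)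
    thus ?thesis by (elim imageE) (rule bexI, simp_all)
   qed
   hence "ALL i. EX x. i : ?I --> x : sects (iso_part i) U & \<phi> i U x = q i" by blast
   from choice[OF this] obtain u where u: "ALL i. i : ?I --> u i : sects (iso_part i) U & \<phi> i U (u i) = q i" by (rule exE)
   \<comment> \<open>Index 0 carries the component in the structure sheaf; the summands
     \<open>Q i\<close> start at 1.\<close>
   define t where "t i = (if i = 0 then inc U b else u i)" for i
   have ti: "t i : sects A U & prj i U (t i) = t i" if "i \<le> r" for i
    using that b U u[rule_format, of i] prj_zero_inc[OF U b] by (cases "i = 0") (auto simp: t_def)
   define s where "s = (\<Oplus>\<^sub>(sec A U)i\<in>{..r}. t i)"
   have s: "s : sects A U" unfolding s_def by (rule AU.finsum_closed) (use ti in auto)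
   have ps: "prj j U s = t j" if "j \<le> r" for j
    unfolding s_def by (rule prj_sum[OF U _ _ that]) (use ti in auto)
   have "iv U (prj 0 U s) = b" using ps[of 0] iv_eq[OF U b] by (simp add: t_def)
   moreover have "(\<lambda>i\<in>?I. \<phi> i U (prj i U s)) = q"
   proof (rule extensionalityI[of _ ?I])
    fix i assume i: "i : ?I"
    thus "(\<lambda>i\<in>?I. \<phi> i U (prj i U s)) i = q i" using ps[of i] u[rule_format, of i] by (simp add: t_def)
   qed (use q in \<open>simp_all add: PiE_iff\<close>)
   ultimately show ?thesis using s by (intro bexI[of _ s]) (simp_all add: \<Phi>_def)
  qed
  show "bij_betw (\<Phi> U) (sects dir U) (sects ?N U)"
   unfolding bij_betw_def dir_simps
  proof
   show "inj_on (\<Phi> U) (sects A U)" using inj by (intro inj_onI)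
   show "\<Phi> U ` sects A U = sects ?N U"
   proof
    show "\<Phi> U ` sects A U \<subseteq> sects ?N U" using cl by blast
    show "sects ?N U \<subseteq> \<Phi> U ` sects A U"
    proof
     fix y assume "y : sects ?N U"
     then obtain b q where y: "y = (b, q)" "b : sects Y U" "q : (\<Pi>\<^sub>E i\<in>?I. sects (Q i) U)" unfolding N by (elim SigmaE) (rule that)
     from surj[OF y(2,3)] show "y : \<Phi> U ` sects A U" unfolding y(1) by (elim bexE) (rule image_eqI, simp_all)
    qed
   qed
  qed
  fix g s assume g: "g : carrier G" and "s : sects dir U"
  hence s: "s : sects A U" by (simp add: dir_simps)
  have "prj 0 U (act g U s) = prj 0 U s" using prj_act[OF U _ g s, of 0] prj_zero_act[OF U s g] by simp
  moreover have "\<phi> i U (prj i U (act g U s)) = gact (Q i) g U (\<phi> i U (prj i U s))" if "i : ?I" for i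
   using gac[OF that U g ip[OF that U s]] prj_act[OF U _ g s, of i] that by simp
  ultimately show "\<Phi> U (gact dir g U s) = gact ?N g U (\<Phi> U s)"
   unfolding dir_simps \<Phi>_def N by (intro conjI[THEN prod.inject[THEN iffD2]] restrict_ext) simp_all
 next
  fix U W s assume h: "op U & op W & W \<subseteq> U" "s : sects dir U"
  hence U: "op U" "op W" "W \<subseteq> U" and s: "s : sects A U" by (simp_all add: dir_simps)
  have "iv W (prj 0 W (res A U W s)) = res Y U W (iv U (prj 0 U s))"
   by (rule iv_eqI[OF U(2)]) (simp_all add: iv[OF U(1)] s U Y.res_closed[OF U] prj_res inc_res[OF U, symmetric])
  moreover have "\<phi> i W (prj i W (res A U W s)) = res (Q i) U W (\<phi> i U (prj i U s))" if "i : ?I" for i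
   unfolding prj_res[OF U s] by (rule rsc[OF that U ip[OF that U(1) s]])
  ultimately show "\<Phi> W (res dir U W s) = res ?N U W (\<Phi> U s)"
   unfolding dir_simps \<Phi>_def N by (intro conjI[THEN prod.inject[THEN iffD2]] restrict_ext) simp_all
 qed
qed

end

section \<open>Quotients of projective varieties\<close>

text \<open>The substantial axiom is faithfulness: triviality is given only over preimages of open
  sets of \<open>Y\<close>, and it has to be spread to all points and sections of
  \<open>X\<close>.\<close>

lemma quotient_galois_sheaf:
 fixes X :: "('x, 'a, 'k::field) kspace" and Y :: "('y, 'b, 'k) kspace" and G :: "('g, 'h) monoid_scheme" (structure)
  and \<rho> :: "'g => ('x, 'a, 'x, 'a) mor" and p :: "('x, 'a, 'y, 'b) mor"
 assumes PX: "projective_variety X" and G: "group G" "finite (carrier G)" and \<rho>: "faithful_action G X \<rho>"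
  and PY: "projective_variety Y" and quot: "quotient_by G X \<rho> Y p"
 shows "galois_sheaf Y \<lparr>base = base Y, sec = (%V. sec X (preim X p V)), res = (%V W. res X (preim X p V) (preim X p W))\<rparr>
  G (%g V. co (\<rho> (m_inv G g)) (preim X p V)) (co p)"
proof -
 interpret G: group G by fact
 interpret X: integral X by (rule integral_schemeI) (use PX in \<open>simp add: projective_variety_def\<close>)
 interpret Y: integral Y by (rule integral_schemeI) (use PY in \<open>simp add: projective_variety_def\<close>)
 let ?A = "\<lparr>base = base Y, sec = (%V. sec X (preim X p V)), res = (%V W. res X (preim X p V) (preim X p W))\<rparr>"
 let ?pr = "preim X p"
 have pm: "lrs_mor X Y p" and quot_map: "quotient_map (base X) (base Y) (pt p)"
  and orbits: "!!x x'. x : points X ==> x' : points X ==> pt p x = pt p x' \<longleftrightarrow> (EX g:carrier G. x' = pt (\<rho> g) x)"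
  and inv_bij: "!!V. Y.op V ==> bij_betw (co p V) (sects Y V) {s : sects X (?pr V). ALL g:carrier G. co (\<rho> g) (?pr V) s = s}"
  using quot by (simp_all add: quotient_by_def kmor_def)
 have p_inv: "pt p (pt (\<rho> g) x) = pt p x" if "g : carrier G" "x : points X" for g x
  using quot that by (simp add: quotient_by_def mor_eq_def mor_comp_def)
 have \<rho>m: "lrs_mor X X (\<rho> g)" if "g : carrier G" for g
  using \<rho> that by (simp add: faithful_action_def scheme_action_def kmor_def)
 have \<rho>_one: "pt (\<rho> \<one>) x = x" "X.op V ==> s : sects X V ==> co (\<rho> \<one>) V s = s" if "x : points X" for x V s
  using \<rho> that by (simp_all add: faithful_action_def scheme_action_def mor_eq_def mor_id_def)
 have \<rho>_mult_pt: "pt (\<rho> (g \<otimes> h)) x = pt (\<rho> g) (pt (\<rho> h) x)" if "g : carrier G" "h : carrier G" "x : points X" for g h x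
  using \<rho> that by (simp add: faithful_action_def scheme_action_def mor_eq_def mor_comp_def)
 have \<rho>_mult_co: "co (\<rho> (g \<otimes> h)) V s = co (\<rho> h) (preim X (\<rho> g) V) (co (\<rho> g) V s)"
  if "g : carrier G" "h : carrier G" "X.op V" "s : sects X V" for g h V s
  using \<rho> that by (simp add: faithful_action_def scheme_action_def mor_eq_def mor_comp_def)
 obtain x0 where x0: "x0 : points X" using X.gen_point(1) by blast
 have \<rho>_pt: "pt (\<rho> g) x : points X" if "g : carrier G" "x : points X" for g x
  using continuous_map_image_subset_topspace[of "base X" "base X" "pt (\<rho> g)"] \<rho>m[OF that(1)] that(2) by (auto simp: lrs_mor_def)
 have \<rho>_open: "X.op (preim X (\<rho> g) V)" if "g : carrier G" "X.op V" for g V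
  unfolding preim_def by (rule openin_continuous_map_preimage[OF _ that(2)]) (use \<rho>m[OF that(1)] in \<open>simp add: lrs_mor_def\<close>)
 have pr_open: "X.op (?pr V)" if "Y.op V" for V
  unfolding preim_def by (rule openin_continuous_map_preimage[OF _ that]) (use pm in \<open>simp add: lrs_mor_def\<close>)
 have p_surj: "pt p ` points X = points Y" using quot_map by (simp add: quotient_map_def)
 have pr_mono: "V \<subseteq> W ==> ?pr V \<subseteq> ?pr W" for V W by (auto simp: preim_def)
 have pr_ne: "?pr V \<noteq> {}" if V: "Y.op V" "V \<noteq> {}" for V
 proof -
  obtain y where y: "y : V" using V(2) by blast
  hence "y : pt p ` points X" using p_surj Y.op_sub[OF V(1)] by blast
  thus ?thesis using y by (auto simp: preim_def)
 qed
 have pr_Int: "?pr (V \<inter> W) = ?pr V \<inter> ?pr W" for V W by (auto simp: preim_def)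
 have \<rho>_pr: "preim X (\<rho> g) (?pr V) = ?pr V" if "g : carrier G" for g V
  using p_inv[OF that] \<rho>_pt[OF that] by (auto simp: preim_def)
 have co\<rho>: "co (\<rho> g) (?pr V) : ring_hom (sec X (?pr V)) (sec X (?pr V))" if "g : carrier G" "Y.op V" for g V
  using \<rho>m[OF that(1)] pr_open[OF that(2)] \<rho>_pr[OF that(1)] unfolding lrs_mor_def by metis
 have co\<rho>_res: "co (\<rho> g) W (res X V W s) = res X (preim X (\<rho> g) V) (preim X (\<rho> g) W) (co (\<rho> g) V s)"
  if "g : carrier G" "X.op V" "X.op W" "W \<subseteq> V" "s : sects X V" for g V W s
  using \<rho>m[OF that(1)] that by (simp add: lrs_mor_def)
 have presheaf_A: "is_presheaf ?A"
  unfolding is_presheaf_def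
  using X.res_closed[OF pr_open pr_open pr_mono] X.res_id[OF pr_open] X.res_res[OF pr_open pr_open pr_open pr_mono pr_mono] by simp
 have sheaf_A: "is_sheaf ?A"
  unfolding is_sheaf_def
 proof (intro conjI allI impI presheaf_A)
  fix \<U> s
  assume "(ALL U:\<U>. openin (base ?A) U & s U : sects ?A U) &
   (ALL U:\<U>. ALL W:\<U>. res ?A U (U \<inter> W) (s U) = res ?A W (U \<inter> W) (s W))"
  hence o: "!!U. U : \<U> ==> Y.op U" and s: "!!U. U : \<U> ==> s U : sects X (?pr U)"
   and cp: "ALL U:\<U>. ALL W:\<U>. res X (?pr U) (?pr (U \<inter> W)) (s U) = res X (?pr W) (?pr (U \<inter> W)) (s W)"
   by (simp, simp, simp) blast
  have im: "pt p ` ?pr U = U" if "U : \<U>" for U using Y.op_sub[OF o[OF that]] p_surj by (auto simp: preim_def image_iff)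
  \<comment> \<open>Gluing on \<open>X\<close> needs a family indexed by preimages; since
    \<open>p\<close> is surjective, an open set of \<open>Y\<close> is the image of its
    preimage.\<close>
  define s' where "s' D = s (pt p ` D)" for D
  have s': "s' (?pr U) = s U" if "U : \<U>" for U using im[OF that] by (simp add: s'_def)
  have un: "?pr (\<Union>\<U>) = \<Union>(?pr ` \<U>)" by (auto simp: preim_def)
  have "EX! t. t : sects X (\<Union>(?pr ` \<U>)) & (ALL D:?pr ` \<U>. res X (\<Union>(?pr ` \<U>)) D t = s' D)"
  proof (rule X.glue1)
   fix D E assume D: "D : ?pr ` \<U>" and E: "E : ?pr ` \<U>"
   then obtain U W where U: "U : \<U>" "D = ?pr U" "W : \<U>" "E = ?pr W" by blast
   show "res X D (D \<inter> E) (s' D) = res X E (D \<inter> E) (s' E)"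
    using bspec[OF bspec[OF cp U(1)] U(3)] by (simp add: U s' pr_Int)
  next
   fix D assume "D : ?pr ` \<U>"
   then obtain U where U: "U : \<U>" "D = ?pr U" by blast
   thus "X.op D & s' D : sects X D" using s pr_open[OF o] by (simp add: s')
  qed
  thus "EX! t. t : sects ?A (\<Union>\<U>) & (ALL U:\<U>. res ?A (\<Union>\<U>) U t = s U)"
   unfolding un[symmetric] by (simp add: s')
 qed
 have ring_sheaf_A: "ring_sheaf ?A"
  unfolding ring_sheaf_def sheaf_def sheaf_axioms_def ring_presheaf_def presheaf_def ring_presheaf_axioms_def
  using presheaf_A sheaf_A X.sec_cring[OF pr_open] X.res_hom[OF pr_open pr_open pr_mono] by simp
 \<comment> \<open>Intersect all translates of \<open>V\<close>. The result is open as
   \<open>G\<close> is finite, contains the generic point because each translate is nonempty, and is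
   a union of orbits, hence the preimage of an open set of \<open>Y\<close>.\<close>
 have saturated: "EX U. Y.op U & U \<noteq> {} & ?pr U \<subseteq> V" if V: "X.op V" "V \<noteq> {}" for V
 proof -
  define V' where "V' = (\<Inter>g\<in>carrier G. preim X (\<rho> g) V)"
  have V'o: "X.op V'" unfolding V'_def by (rule openin_INT2[OF G(2)]) (use \<rho>_open[OF _ V(1)] in auto)
  have V'p: "V' \<subseteq> points X" using X.op_sub[OF V'o] .
  have "gen_point X : preim X (\<rho> g) V" if g: "g : carrier G" for g
  proof (rule X.gen_point(2)[OF \<rho>_open[OF g V(1)]])
   obtain x where x: "x : V" using V by blast
   hence xp: "x : points X" using X.op_sub[OF V(1)] by blast
   have "pt (\<rho> g) (pt (\<rho> (inv g)) x) = x" using \<rho>_mult_pt[of g "inv g" x] g xp \<rho>_one(1)[OF xp] by simp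
   thus "preim X (\<rho> g) V \<noteq> {}" using x \<rho>_pt[of "inv g" x] g xp by (auto simp: preim_def)
  qed
  hence ne: "gen_point X : V'" by (simp add: V'_def)
  have V'V: "V' \<subseteq> V"
  proof
   fix x assume x: "x : V'"
   hence "pt (\<rho> \<one>) x : V" by (simp add: V'_def preim_def)
   moreover have "x : points X" using x V'p by blast
   ultimately show "x : V" using \<rho>_one(1)[of x] by simp
  qed
  have sat: "?pr (pt p ` V') = V'"
  proof
   show "V' \<subseteq> ?pr (pt p ` V')" using V'p by (auto simp: preim_def)
   show "?pr (pt p ` V') \<subseteq> V'"
   proof
    fix x assume "x : ?pr (pt p ` V')"
    then obtain y where x: "x : points X" and y: "y : V'" "pt p y = pt p x" by (auto simp: preim_def)
    hence yp: "y : points X" using V'p by blast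
    obtain g where g: "g : carrier G" "x = pt (\<rho> g) y" using orbits[OF yp x] y(2) by blast
    have "pt (\<rho> h) x : V" if h: "h : carrier G" for h
    proof -
     have "y : preim X (\<rho> (h \<otimes> g)) V" using y(1) h g(1) by (simp add: V'_def)
     thus ?thesis using \<rho>_mult_pt[OF h g(1) yp] g(2) by (simp add: preim_def)
    qed
    thus "x : V'" using x by (simp add: V'_def preim_def)
   qed
  qed
  have "pt p ` V' \<subseteq> points Y" using V'p p_surj by blast
  hence "Y.op (pt p ` V') \<longleftrightarrow> X.op (?pr (pt p ` V'))" using quot_map by (simp add: quotient_map_def preim_def)
  thus ?thesis using V'o sat V'V ne by (intro exI[of _ "pt p ` V'"]) auto
 qed
 have faith: "h = \<one>" if h: "h : carrier G" and tr: "!!U s. Y.op U ==> s : sects X (?pr U) ==> co (\<rho> h) (?pr U) s = s" for h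
 proof -
  \<comment> \<open>The inverse of \<open>h\<close> acts trivially as well; it gives the second
    inclusion between the homogeneous parts of the ideals of a point and its image.\<close>
  have tr': "co (\<rho> (inv h)) (?pr U) s = s" if U: "Y.op U" "s : sects X (?pr U)" for U s
   using \<rho>_mult_co[of h "inv h" "?pr U" s] h pr_open[OF U(1)] U(2) \<rho>_one(2)[OF x0 pr_open[OF U(1)] U(2)] \<rho>_pr[OF h, of U] tr[OF U]
   by simp
  \<comment> \<open>Every nonempty open set contains a nonempty preimage from \<open>Y\<close>, over
    which \<open>k\<close> is trivial; in this sense \<open>k\<close> fixes all rational functions
    of \<open>X\<close>.\<close>
  have triv: "EX W. X.op W & W \<noteq> {} & W \<subseteq> V \<inter> preim X (\<rho> k) V & res X V W s = res X (preim X (\<rho> k) V) W (co (\<rho> k) V s)"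
   if k: "k : carrier G" and tk: "!!U s. Y.op U ==> s : sects X (?pr U) ==> co (\<rho> k) (?pr U) s = s"
    and V: "X.op V" "V \<noteq> {}" and s: "s : sects X V" for k V s
  proof -
   obtain U where U: "Y.op U" "U \<noteq> {}" "?pr U \<subseteq> V" using saturated[OF V] by blast
   let ?W = "?pr U"
   have W: "X.op ?W" "?W \<noteq> {}" using pr_open[OF U(1)] pr_ne[OF U(1,2)] by auto
   have "?W \<subseteq> preim X (\<rho> k) V" using \<rho>_pr[OF k, of U] U(3) by (auto simp: preim_def)
   moreover have "res X V ?W s = res X (preim X (\<rho> k) V) ?W (co (\<rho> k) V s)"
    using co\<rho>_res[OF k V(1) W(1) U(3) s] tk[OF U(1) X.res_closed[OF V(1) W(1) U(3) s]] \<rho>_pr[OF k, of U] by simp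
   ultimately show ?thesis using W U(3) by blast
  qed
  let ?P = "proj_space :: nat => ('k mpol set, 'k mpol set => ('k mpol \<times> 'k mpol) set, 'k) kspace"
  obtain n f where f: "closed_immersion X (?P n) f" using PX unfolding projective_variety_def by blast
  have fm: "lrs_mor X (?P n) f" and fe: "embedding_map (base X) (base (?P n)) (pt f)"
   using f by (simp_all add: closed_immersion_def)
  have IX: "integral_scheme X" using PX by (simp add: projective_variety_def)
  have f_inj: "inj_on (pt f) (points X)" using fe unfolding embedding_map_def by (rule homeomorphic_imp_injective_map)
  \<comment> \<open>A point of projective space is the ideal generated by its homogeneous elements,
    so these determine it.\<close>
  have f_pt: "pt f x = genideal (poly_ring_in n) (pt f x \<inter> (\<Union>d. homog_part n d))" if x: "x : points X" for x
  proof -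
   have "continuous_map (base X) (base (?P n)) (pt f)" using fm by (simp add: lrs_mor_def)
   hence "pt f x : points (?P n)"
    using x continuous_map_image_subset_topspace by blast
   thus ?thesis unfolding proj_points by blast
  qed
  have mono: "q : pt f (pt (\<rho> k) x)"
   if "k : carrier G" "!!U s. Y.op U ==> s : sects X (?pr U) ==> co (\<rho> k) (?pr U) s = s" "x : points X" "q : pt f x" "q : homog_part n d"
   for k x q d
   by (rule homogeneous_part_mono[OF IX fm \<rho>m[OF that(1)] triv[OF that(1,2)] that(3-5)])
  have pt_id: "pt (\<rho> h) x = x" if x: "x : points X" for x
  proof -
   let ?y = "pt (\<rho> h) x"
   have y: "?y : points X" by (rule \<rho>_pt[OF h x])
   have yx: "pt (\<rho> (inv h)) ?y = x" using \<rho>_mult_pt[of "inv h" h x] h x \<rho>_one(1)[OF x] by simp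
   have "pt f x \<inter> (\<Union>d. homog_part n d) = pt f ?y \<inter> (\<Union>d. homog_part n d)"
   proof
    show "pt f x \<inter> (\<Union>d. homog_part n d) \<subseteq> pt f ?y \<inter> (\<Union>d. homog_part n d)" using mono[OF h tr x] by blast
    show "pt f ?y \<inter> (\<Union>d. homog_part n d) \<subseteq> pt f x \<inter> (\<Union>d. homog_part n d)"
     using mono[OF G.inv_closed[OF h] tr' y] unfolding yx by blast
   qed
   hence "pt f x = pt f ?y" using f_pt[OF x] f_pt[OF y] by simp
   thus ?thesis using inj_onD[OF f_inj _ x y] by simp
  qed
  \<comment> \<open>Once points are fixed, \<open>s\<close> and its pullback live over the same set
    and agree on a nonempty open subset, hence everywhere.\<close>
  have "co (\<rho> h) V s = s" if V: "X.op V" and s: "s : sects X V" for V s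
  proof -
   have pV: "preim X (\<rho> h) V = V" using pt_id X.op_sub[OF V] by (auto simp: preim_def)
   have "co (\<rho> h) V : ring_hom (sec X V) (sec X (preim X (\<rho> h) V))" using \<rho>m[OF h] V by (simp add: lrs_mor_def)
   hence c: "co (\<rho> h) V s : sects X V" using ring_hom_closed[of "co (\<rho> h) V"] s pV by metis
   show ?thesis
   proof (cases "V = {}")
    case True thus ?thesis using X.sec_empty[of "co (\<rho> h) V s" s] c s by simp
   next
    case False
    obtain W where W: "X.op W" "W \<noteq> {}" "W \<subseteq> V" "res X V W s = res X V W (co (\<rho> h) V s)"
     using triv[OF h tr V False s] unfolding pV by blast
    show ?thesis by (rule X.res_inj[OF V c s W(1-3) W(4)[symmetric]])
   qed
  qed
  hence "mor_eq X X (\<rho> h) mor_id" using pt_id by (simp add: mor_eq_def mor_id_def)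
  thus ?thesis using \<rho> h by (simp add: faithful_action_def)
 qed
 show ?thesis
  unfolding galois_sheaf_def galois_sheaf_axioms_def
 proof (intro conjI allI impI ring_sheaf_A Y.integral_axioms G.is_group G(2))
  show "kmap Y : ring_hom class_ring (sec Y (points Y))" using PY by (simp add: projective_variety_def kscheme_def)
 next
  fix g U assume "g : carrier G" "Y.op U"
  thus "co (\<rho> (inv g)) (?pr U) : ring_hom (sec ?A U) (sec ?A U)" using co\<rho>[of "inv g" U] by simp
 next
  fix U s assume "Y.op U" "s : sects ?A U"
  thus "co (\<rho> (inv \<one>)) (?pr U) s = s" using \<rho>_one(2)[OF x0 pr_open] by simp
 next
  fix g h U s assume a: "g : carrier G" "h : carrier G" "Y.op U" "s : sects ?A U"
  show "co (\<rho> (inv (g \<otimes> h))) (?pr U) s = co (\<rho> (inv g)) (?pr U) (co (\<rho> (inv h)) (?pr U) s)"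
   using \<rho>_mult_co[of "inv h" "inv g" "?pr U" s] a pr_open[OF a(3)] \<rho>_pr[of "inv h" U] by (simp add: G.inv_mult_group)
 next
  fix g U W s assume a: "g : carrier G" "Y.op U" "Y.op W" "W \<subseteq> U" "s : sects ?A U"
  show "res ?A U W (co (\<rho> (inv g)) (?pr U) s) = co (\<rho> (inv g)) (?pr W) (res ?A U W s)"
   using co\<rho>_res[of "inv g" "?pr U" "?pr W" s] a pr_open[OF a(2)] pr_open[OF a(3)] pr_mono[OF a(4)]
    \<rho>_pr[of "inv g" U] \<rho>_pr[of "inv g" W] by simp
 next
  fix U assume "Y.op U"
  thus "co p U : ring_hom (sec Y U) (sec ?A U)" using pm by (simp add: lrs_mor_def)
 next
  fix U W b assume "Y.op U" "Y.op W" "W \<subseteq> U" "b : sects Y U"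
  thus "res ?A U W (co p U b) = co p W (res Y U W b)" using pm by (simp add: lrs_mor_def)
 next
  fix U assume U: "Y.op U"
  have "(ALL g:carrier G. co (\<rho> (inv g)) (?pr U) s = s) \<longleftrightarrow> (ALL g:carrier G. co (\<rho> g) (?pr U) s = s)" for s
   using G.inv_closed G.inv_inv by metis
  thus "bij_betw (co p U) (sects Y U) {s : sects ?A U. ALL g:carrier G. co (\<rho> (inv g)) (?pr U) s = s}"
   using inv_bij[OF U] by simp
 next
  fix U assume "Y.op U" "U \<noteq> {}"
  thus "domain (sec ?A U)" using X.dom[OF pr_open pr_ne] by simp
 next
  fix U s t W
  assume "Y.op U" "s : sects ?A U" "t : sects ?A U" "Y.op W" "W \<noteq> {}" "W \<subseteq> U" "res ?A U W s = res ?A U W t"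
  thus "s = t" using X.res_inj[OF pr_open[of U], of s t "?pr W"] pr_open[of W] pr_ne[of W] pr_mono[of W U] by simp
 next
  fix g assume g: "g : carrier G" and a: "ALL U s. Y.op U --> s : sects ?A U --> co (\<rho> (inv g)) (?pr U) s = s"
  have "inv g = \<one>" by (rule faith) (use g a in simp_all)
  thus "g = \<one>" using g by (metis G.inv_inv G.inv_one)
 qed simp
qed

theorem theorem4:
  fixes X :: "('x, 'a, 'k::alg_closed_field) kspace"
    and Y :: "('y, 'b, 'k) kspace"
    and G :: "('g, 'h) monoid_scheme"
    and \<rho> :: "'g \<Rightarrow> ('x, 'a, 'x, 'a) mor"
    and p :: "('x, 'a, 'y, 'b) mor"
    and V :: "nat \<Rightarrow> ('k, 'v, 'g) rep"
    and r :: nat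
  assumes "projective_variety X"
    and "group G" and "finite (carrier G)"
    and "faithful_action G X \<rho>"
    and "\<not> CHAR('k) dvd card (carrier G)"
    and "projective_variety Y"
    and "quotient_by G X \<rho> Y p"
    and "irreducible_reps G r V"
  shows "\<exists>E :: nat \<Rightarrow> ('y, 'b, 'v \<Rightarrow> 'a) mod_sheaf.
    (\<forall>i\<in>{1..r}. O_module Y (E i) \<and> has_rank Y (E i) (vectorspace.dim class_ring (V i))) \<and>
    gmod_iso G Y (direct_image_gmod G X \<rho> Y p)
      (gmod_sum2 (structure_gmod Y)
        (gmod_sum Y {1..r} (\<lambda>i. gmod_tensor Y (rep_sheaf Y (V i)) (trivial_gmod (E i)))))"
proof -
  let ?A = "\<lparr>base = base Y, sec = (\<lambda>U. sec X (preim X p U)), res = (\<lambda>U W. res X (preim X p U) (preim X p W))\<rparr> :: ('y, 'a) ringed_space"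
  let ?act = "\<lambda>g U. co (\<rho> (m_inv G g)) (preim X p U)"
  have sheaf: "galois_sheaf Y ?A G ?act (co p)"
    by (rule quotient_galois_sheaf) (use assms in auto)
  have irr: "irreps G r V"
    unfolding irreps_def irreps_axioms_def using assms by blast
  interpret galois_irreps Y ?A G ?act "co p" r V
    unfolding galois_irreps_def by (intro conjI sheaf irr)
  have dir: "dir = direct_image_gmod G X \<rho> Y p"
    by (simp add: dir_def direct_image_gmod_def)
  have "O_module Y (hom_sheaf (V i)) \<and> has_rank Y (hom_sheaf (V i)) (vectorspace.dim class_ring (V i))" if "i \<in> {1..r}" for i
    using hom_O_module[OF rep] hom_sheaf_rank[OF rep fr] that by (simp add: dm_def)
  moreover have "gmod_iso G Y dir (gmod_sum2 (structure_gmod Y)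
      (gmod_sum Y {1..r} (\<lambda>i. gmod_tensor Y (rep_sheaf Y (V i)) (trivial_gmod (hom_sheaf (V i))))))"
    by (rule isotypic_decomposition) (simp add: iso_part_tensor)
  ultimately show ?thesis
    unfolding dir by (intro exI[of _ "\<lambda>i. hom_sheaf (V i)"] conjI ballI) simp_all
qed

end
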